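(* Let $m \geq 1$. Then: (1) $\mathrm{domdim}(B_{3m+1}) = 0$. (2) $\mathrm{domdim}(B_{3m+2}) = 1$. Consequently, the algebras $A_{3m+1}$ and $A_{3m+2}$ do not have property *.
   Context: Let $K$ be a field. All algebras are finite dimensional $K$-algebras and all modules are finite dimensional right modules. Dominant dimension: let $0 \to M \to I_0 \to I_1 \to \cdots$ be a minimal injective resolution of a module $M$. Then $\mathrm{domdim}(M) = 0$ if $I_0$ is not projective, and otherwise $\mathrm{domdim}(M) = \sup\{ n \mid I_i \text{ is projective for } i = 0,1,\dots,n\} + 1$. The dominant dimension $\mathrm{domdim}(A)$ of an algebra $A$ is the dominant dimension of the regular right module $A$. For a module $M$, $\Omega^{-i}(M)$ denotes the $i$-th cosyzygy of $M$, i.e. the cokernel of $I_{i-2} \to I_{i-1}$ in a minimal injective resolution (with $I_{-1} = M$, $\Omega^0(M)=M$). Property *: an algebra $A$ with finite dominant dimension $n \geq 1$ has property * iff, with $I_0$ the injective hull of the regular module $A$, the algebra $\mathrm{End}_A(I_0 \oplus \Omega^{-n}(A))$ has dominant dimension $n$. The algebras $A_n$: for $n \geq 2$, $A_n$ is the connected Nakayama algebra given by quiver and relations with $n$ simple modules (vertices $0,1,\dots,n-1$) and Kupisch series $[c_0,\dots,c_{n-1}]$ with $c_i = \dim_K e_iA_n$, where $c_i = 3$ for $0 \leq i \leq n-3$, $c_{n-2} = 2$, $c_{n-1} = 1$. Explicitly, $A_n = KQ/J^3$, where $Q$ is the linear quiver $0 \to 1 \to \cdots \to n-1$ and $J$ is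 the ideal generated by all arrows; paths are written from left to right, so $e_iA_n$ is uniserial with composition factors $S_i, S_{i+1}, \dots$ from top to socle. The algebras $B_n$: let $\hat d_n$ be the dominant dimension of $A_n$ and let $eA_n$ ($e$ an idempotent) be the minimal faithful projective-injective $A_n$-module (the direct sum of one copy of each indecomposable projective-injective module). Then $B_n := \mathrm{End}_{A_n}(eA_n \oplus \Omega^{-\hat d_n}(A_n))$, with multiplication given by composition of maps, maps being written on the left of their arguments. *)

theory Defs
  imports
    "HOL-Algebra.Module"
    "HOL-Algebra.QuotRing"
    "HOL-Algebra.Ideal_Product"
    "HOL-Library.Extended_Nat"
    "Graph_Theory.Arc_Walk"
begin

section \<open>Finite dimensional right modules over a K-algebra\<close>

text \<open>
  A \<open>K\<close>-algebra is represented by a \<open>('k, 'a) module\<close> record: a (not necessarily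
  commutative) ring together with a scalar multiplication.  A right module carries its own
  \<open>K\<close>-structure and the action \<open>\<star>\<close> of the algebra; as for the library's \<open>module\<close> records,
  the inherited fields \<open>mult\<close> and \<open>one\<close> of a right module are irrelevant.
\<close>

record ('k, 'a, 'v) rmodule = "('k, 'v) module" +
  ract :: "'v \<Rightarrow> 'a \<Rightarrow> 'v" (infixl "\<star>\<index>" 70)

definition finite_dim :: "('k, 'c) ring_scheme \<Rightarrow> ('k, 'v, 'd) module_scheme \<Rightarrow> bool" where
  "finite_dim K M \<longleftrightarrow> (\<exists>S. finite S \<and> S \<subseteq> carrier M \<and>
     (\<forall>x \<in> carrier M. \<exists>c \<in> S \<rightarrow> carrier K. x = (\<Oplus>\<^bsub>M\<^esub>s\<in>S. c s \<odot>\<^bsub>M\<^esub> s)))"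

definition fd_rmodule ::
  "('k, 'c) ring_scheme \<Rightarrow> ('k, 'a) module \<Rightarrow> ('k, 'a, 'v) rmodule \<Rightarrow> bool" where
  "fd_rmodule K A M \<longleftrightarrow> Module.module K M \<and> finite_dim K M \<and>
     (\<forall>x \<in> carrier M. \<forall>a \<in> carrier A. x \<star>\<^bsub>M\<^esub> a \<in> carrier M) \<and>
     (\<forall>x \<in> carrier M. \<forall>y \<in> carrier M. \<forall>a \<in> carrier A.
        (x \<oplus>\<^bsub>M\<^esub> y) \<star>\<^bsub>M\<^esub> a = x \<star>\<^bsub>M\<^esub> a \<oplus>\<^bsub>M\<^esub> y \<star>\<^bsub>M\<^esub> a) \<and>
     (\<forall>x \<in> carrier M. \<forall>a \<in> carrier A. \<forall>b \<in> carrier A.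
        x \<star>\<^bsub>M\<^esub> (a \<oplus>\<^bsub>A\<^esub> b) = x \<star>\<^bsub>M\<^esub> a \<oplus>\<^bsub>M\<^esub> x \<star>\<^bsub>M\<^esub> b) \<and>
     (\<forall>x \<in> carrier M. \<forall>a \<in> carrier A. \<forall>b \<in> carrier A.
        x \<star>\<^bsub>M\<^esub> (a \<otimes>\<^bsub>A\<^esub> b) = (x \<star>\<^bsub>M\<^esub> a) \<star>\<^bsub>M\<^esub> b) \<and>
     (\<forall>x \<in> carrier M. x \<star>\<^bsub>M\<^esub> \<one>\<^bsub>A\<^esub> = x) \<and>
     (\<forall>x \<in> carrier M. \<forall>a \<in> carrier A. \<forall>k \<in> carrier K.
        x \<star>\<^bsub>M\<^esub> (k \<odot>\<^bsub>A\<^esub> a) = k \<odot>\<^bsub>M\<^esub> (x \<star>\<^bsub>M\<^esub> a))"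

text \<open>\<open>K\<close>-linearity of module homomorphisms is automatic, because
  \<open>k \<odot> x = x \<star> (k \<odot> \<one>)\<close>.\<close>

definition rhom ::
  "('k, 'a) module \<Rightarrow> ('k, 'a, 'v) rmodule \<Rightarrow> ('k, 'a, 'w) rmodule \<Rightarrow> ('v \<Rightarrow> 'w) set" where
  "rhom A M N = {f \<in> carrier M \<rightarrow> carrier N.
     (\<forall>x \<in> carrier M. \<forall>y \<in> carrier M. f (x \<oplus>\<^bsub>M\<^esub> y) = f x \<oplus>\<^bsub>N\<^esub> f y) \<and>
     (\<forall>x \<in> carrier M. \<forall>a \<in> carrier A. f (x \<star>\<^bsub>M\<^esub> a) = f x \<star>\<^bsub>N\<^esub> a)}"

definition rker :: "('k, 'a, 'v) rmodule \<Rightarrow> ('k, 'a, 'w) rmodule \<Rightarrow> ('v \<Rightarrow> 'w) \<Rightarrow> 'v set" where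
  "rker M N f = {x \<in> carrier M. f x = \<zero>\<^bsub>N\<^esub>}"

definition rmod_iso ::
  "('k, 'a) module \<Rightarrow> ('k, 'a, 'v) rmodule \<Rightarrow> ('k, 'a, 'w) rmodule \<Rightarrow> bool" where
  "rmod_iso A M N \<longleftrightarrow> (\<exists>f \<in> rhom A M N. bij_betw f (carrier M) (carrier N))"

definition submod :: "('k, 'a) module \<Rightarrow> ('k, 'a, 'v) rmodule \<Rightarrow> 'v set \<Rightarrow> bool" where
  "submod A M U \<longleftrightarrow> additive_subgroup U M \<and> (\<forall>u \<in> U. \<forall>a \<in> carrier A. u \<star>\<^bsub>M\<^esub> a \<in> U)"

definition essential :: "('k, 'a) module \<Rightarrow> ('k, 'a, 'v) rmodule \<Rightarrow> 'v set \<Rightarrow> bool" where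
  "essential A M U \<longleftrightarrow> submod A M U \<and>
     (\<forall>V. submod A M V \<longrightarrow> U \<inter> V = {\<zero>\<^bsub>M\<^esub>} \<longrightarrow> V = {\<zero>\<^bsub>M\<^esub>})"

definition indecomposable :: "('k, 'a) module \<Rightarrow> ('k, 'a, 'v) rmodule \<Rightarrow> bool" where
  "indecomposable A M \<longleftrightarrow> carrier M \<noteq> {\<zero>\<^bsub>M\<^esub>} \<and>
     (\<forall>U V. submod A M U \<longrightarrow> submod A M V \<longrightarrow> U \<inter> V = {\<zero>\<^bsub>M\<^esub>} \<longrightarrow> U <+>\<^bsub>M\<^esub> V = carrier M \<longrightarrow>
        U = {\<zero>\<^bsub>M\<^esub>} \<or> V = {\<zero>\<^bsub>M\<^esub>})"

definition faithful :: "('k, 'a) module \<Rightarrow> ('k, 'a, 'v) rmodule \<Rightarrow> bool" where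
  "faithful A M \<longleftrightarrow>
     (\<forall>a \<in> carrier A. (\<forall>x \<in> carrier M. x \<star>\<^bsub>M\<^esub> a = \<zero>\<^bsub>M\<^esub>) \<longrightarrow> a = \<zero>\<^bsub>A\<^esub>)"

definition regular_rmod :: "('k, 'a) module \<Rightarrow> ('k, 'a, 'a) rmodule" where
  "regular_rmod A = module.extend A (rmodule.fields (\<otimes>\<^bsub>A\<^esub>))"

definition rmod_sum ::
  "('k, 'a, 'v) rmodule \<Rightarrow> ('k, 'a, 'w) rmodule \<Rightarrow> ('k, 'a, 'v \<times> 'w) rmodule" where
  "rmod_sum M N = \<lparr>carrier = carrier M \<times> carrier N, mult = undefined, one = undefined,
     zero = (\<zero>\<^bsub>M\<^esub>, \<zero>\<^bsub>N\<^esub>),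
     add = (\<lambda>(x, y) (x', y'). (x \<oplus>\<^bsub>M\<^esub> x', y \<oplus>\<^bsub>N\<^esub> y')),
     smult = (\<lambda>k (x, y). (k \<odot>\<^bsub>M\<^esub> x, k \<odot>\<^bsub>N\<^esub> y)),
     ract = (\<lambda>(x, y) a. (x \<star>\<^bsub>M\<^esub> a, y \<star>\<^bsub>N\<^esub> a))\<rparr>"

text \<open>The product \<open>f g\<close> of endomorphisms is \<open>x \<mapsto> f (g x)\<close>.  Maps are set to \<open>undefined\<close>
  outside the carrier, so that equality in the algebra is equality of maps on \<open>M\<close>.\<close>

definition End_alg :: "('k, 'a) module \<Rightarrow> ('k, 'a, 'v) rmodule \<Rightarrow> ('k, 'v \<Rightarrow> 'v) module" where
  "End_alg A M = \<lparr>carrier = rhom A M M \<inter> extensional (carrier M),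
     mult = (\<lambda>f g. compose (carrier M) f g),
     one = (\<lambda>x \<in> carrier M. x),
     zero = (\<lambda>x \<in> carrier M. \<zero>\<^bsub>M\<^esub>),
     add = (\<lambda>f g. \<lambda>x \<in> carrier M. f x \<oplus>\<^bsub>M\<^esub> g x),
     smult = (\<lambda>k f. \<lambda>x \<in> carrier M. k \<odot>\<^bsub>M\<^esub> f x)\<rparr>"


section \<open>Injective resolutions and dominant dimension\<close>

text \<open>
  Statements about all (finite dimensional) modules quantify over modules whose elements have
  type \<open>nat \<Rightarrow> 'k\<close>.  Every \<open>d\<close>-dimensional space is in bijection with \<open>K^d\<close>, which embeds
  into this type, so every finite dimensional module is isomorphic to such a module.
\<close>

definition inj_rmod ::
  "('k, 'c) ring_scheme \<Rightarrow> ('k, 'a) module \<Rightarrow> ('k, 'a, 'v) rmodule \<Rightarrow> bool" where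
  "inj_rmod K A I \<longleftrightarrow> fd_rmodule K A I \<and>
     (\<forall>(X :: ('k, 'a, nat \<Rightarrow> 'k) rmodule) (Y :: ('k, 'a, nat \<Rightarrow> 'k) rmodule) f g.
        fd_rmodule K A X \<longrightarrow> fd_rmodule K A Y \<longrightarrow>
        f \<in> rhom A X Y \<longrightarrow> inj_on f (carrier X) \<longrightarrow> g \<in> rhom A X I \<longrightarrow>
        (\<exists>h \<in> rhom A Y I. \<forall>x \<in> carrier X. h (f x) = g x))"

definition proj_rmod ::
  "('k, 'c) ring_scheme \<Rightarrow> ('k, 'a) module \<Rightarrow> ('k, 'a, 'v) rmodule \<Rightarrow> bool" where
  "proj_rmod K A P \<longleftrightarrow> fd_rmodule K A P \<and>
     (\<forall>(X :: ('k, 'a, nat \<Rightarrow> 'k) rmodule) (Y :: ('k, 'a, nat \<Rightarrow> 'k) rmodule) f g.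
        fd_rmodule K A X \<longrightarrow> fd_rmodule K A Y \<longrightarrow>
        f \<in> rhom A X Y \<longrightarrow> f ` carrier X = carrier Y \<longrightarrow> g \<in> rhom A P Y \<longrightarrow>
        (\<exists>h \<in> rhom A P X. \<forall>x \<in> carrier P. f (h x) = g x))"

definition is_injective_hull ::
  "('k, 'c) ring_scheme \<Rightarrow> ('k, 'a) module \<Rightarrow> ('k, 'a, 'v) rmodule \<Rightarrow>
   ('k, 'a, 'w) rmodule \<Rightarrow> ('v \<Rightarrow> 'w) \<Rightarrow> bool" where
  "is_injective_hull K A M E \<epsilon> \<longleftrightarrow> inj_rmod K A E \<and>
     \<epsilon> \<in> rhom A M E \<and> inj_on \<epsilon> (carrier M) \<and> essential A E (\<epsilon> ` carrier M)"

definition injective_hull ::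
  "('k, 'c) ring_scheme \<Rightarrow> ('k, 'a) module \<Rightarrow> ('k, 'a, 'v) rmodule \<Rightarrow>
   ('k, 'a, nat \<Rightarrow> 'k) rmodule" where
  "injective_hull K A M = (SOME E. \<exists>\<epsilon>. is_injective_hull K A M E \<epsilon>)"

text \<open>The exact sequence \<open>0 \<rightarrow> M \<rightarrow> I 0 \<rightarrow> I 1 \<rightarrow> \<dots>\<close> with maps \<open>\<epsilon>, d 0, d 1, \<dots>\<close>;
  minimality says that \<open>I (i + 1)\<close> is an injective hull of the image of \<open>d i\<close>, that is, of
  the cokernel of the preceding map.\<close>

definition min_inj_resolution ::
  "('k, 'c) ring_scheme \<Rightarrow> ('k, 'a) module \<Rightarrow> ('k, 'a, 'v) rmodule \<Rightarrow>
   (nat \<Rightarrow> ('k, 'a, nat \<Rightarrow> 'k) rmodule) \<Rightarrow> ('v \<Rightarrow> nat \<Rightarrow> 'k) \<Rightarrow>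
   (nat \<Rightarrow> (nat \<Rightarrow> 'k) \<Rightarrow> nat \<Rightarrow> 'k) \<Rightarrow> bool" where
  "min_inj_resolution K A M I \<epsilon> d \<longleftrightarrow>
     is_injective_hull K A M (I 0) \<epsilon> \<and>
     (\<forall>i. inj_rmod K A (I (Suc i)) \<and> d i \<in> rhom A (I i) (I (Suc i)) \<and>
          essential A (I (Suc i)) (d i ` carrier (I i))) \<and>
     rker (I 0) (I 1) (d 0) = \<epsilon> ` carrier M \<and>
     (\<forall>i. rker (I (Suc i)) (I (Suc (Suc i))) (d (Suc i)) = d i ` carrier (I i))"

definition domdim_mod ::
  "('k, 'c) ring_scheme \<Rightarrow> ('k, 'a) module \<Rightarrow> ('k, 'a, 'v) rmodule \<Rightarrow> enat" where
  "domdim_mod K A M =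
     (let I = (SOME I. \<exists>\<epsilon> d. min_inj_resolution K A M I \<epsilon> d) in
      if \<not> proj_rmod K A (I 0) then 0
      else Sup {enat n | n. \<forall>i \<le> n. proj_rmod K A (I i)} + 1)"

definition domdim :: "('k, 'c) ring_scheme \<Rightarrow> ('k, 'a) module \<Rightarrow> enat" where
  "domdim K A = domdim_mod K A (regular_rmod A)"

text \<open>A cokernel of a map is a module \<open>C\<close> with an epimorphism onto it from the codomain whose
  kernel is the image of the map.\<close>

definition is_cosyzygy ::
  "('k, 'c) ring_scheme \<Rightarrow> ('k, 'a) module \<Rightarrow> nat \<Rightarrow> ('k, 'a, 'v) rmodule \<Rightarrow>
   ('k, 'a, nat \<Rightarrow> 'k) rmodule \<Rightarrow> bool" where
  "is_cosyzygy K A i M C \<longleftrightarrow> fd_rmodule K A C \<and>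
     (\<exists>I \<epsilon> d. min_inj_resolution K A M I \<epsilon> d \<and>
        (case i of
           0 \<Rightarrow> rmod_iso A M C
         | Suc 0 \<Rightarrow> (\<exists>p \<in> rhom A (I 0) C. p ` carrier (I 0) = carrier C \<and>
             rker (I 0) C p = \<epsilon> ` carrier M)
         | Suc (Suc j) \<Rightarrow> (\<exists>p \<in> rhom A (I (Suc j)) C. p ` carrier (I (Suc j)) = carrier C \<and>
             rker (I (Suc j)) C p = d j ` carrier (I j))))"

definition cosyzygy ::
  "('k, 'c) ring_scheme \<Rightarrow> ('k, 'a) module \<Rightarrow> nat \<Rightarrow> ('k, 'a, 'v) rmodule \<Rightarrow>
   ('k, 'a, nat \<Rightarrow> 'k) rmodule" where
  "cosyzygy K A i M = (SOME C. is_cosyzygy K A i M C)"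

definition property_star :: "('k, 'c) ring_scheme \<Rightarrow> ('k, 'a) module \<Rightarrow> bool" where
  "property_star K A \<longleftrightarrow> (\<exists>n \<ge> 1. domdim K A = enat n \<and>
     domdim K (End_alg A (rmod_sum (injective_hull K A (regular_rmod A))
                                   (cosyzygy K A n (regular_rmod A)))) = enat n)"


section \<open>The minimal faithful projective-injective module\<close>

text \<open>In the last conjunct, \<open>M\<close> is the internal direct sum of the submodules in \<open>\<U>\<close>.
  Unique existence of \<open>U\<close> says both that every indecomposable projective-injective module
  occurs and that the members of \<open>\<U>\<close> are pairwise non-isomorphic.\<close>

definition minimal_faithful_projinj ::
  "('k, 'c) ring_scheme \<Rightarrow> ('k, 'a) module \<Rightarrow> ('k, 'a, 'v) rmodule \<Rightarrow> bool" where
  "minimal_faithful_projinj K A M \<longleftrightarrow>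
     faithful A M \<and> proj_rmod K A M \<and> inj_rmod K A M \<and>
     (\<exists>\<U>. finite \<U> \<and>
        (\<forall>U \<in> \<U>. submod A M U \<and> indecomposable A (M\<lparr>carrier := U\<rparr>) \<and>
           proj_rmod K A (M\<lparr>carrier := U\<rparr>) \<and> inj_rmod K A (M\<lparr>carrier := U\<rparr>)) \<and>
        (\<forall>X :: ('k, 'a, nat \<Rightarrow> 'k) rmodule.
           indecomposable A X \<longrightarrow> proj_rmod K A X \<longrightarrow> inj_rmod K A X \<longrightarrow>
           (\<exists>!U. U \<in> \<U> \<and> rmod_iso A X (M\<lparr>carrier := U\<rparr>))) \<and>
        (\<forall>x \<in> carrier M. \<exists>!f. f \<in> (\<Pi>\<^sub>E U \<in> \<U>. U) \<and> x = (\<Oplus>\<^bsub>M\<^esub>U\<in>\<U>. f U)))"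

definition idem_rmod :: "('k, 'a) module \<Rightarrow> 'a \<Rightarrow> ('k, 'a, 'a) rmodule" where
  "idem_rmod A e = (regular_rmod A)\<lparr>carrier := {e \<otimes>\<^bsub>A\<^esub> a | a. a \<in> carrier A}\<rparr>"

definition minimal_projinj_idem :: "('k, 'c) ring_scheme \<Rightarrow> ('k, 'a) module \<Rightarrow> 'a" where
  "minimal_projinj_idem K A = (SOME e. e \<in> carrier A \<and> e \<otimes>\<^bsub>A\<^esub> e = e \<and>
     minimal_faithful_projinj K A (idem_rmod A e))"


section \<open>Path algebras and the algebras \<open>A_n\<close> and \<open>B_n\<close>\<close>

text \<open>A path is a start vertex together with a list of arcs, read from left to right.\<close>

definition paths :: "('v, 'e) pre_digraph \<Rightarrow> ('v \<times> 'e list) set" where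
  "paths Q = {(u, p). \<exists>v. pre_digraph.awalk Q u p v}"

text \<open>Elements are the finitely supported families of coefficients on the paths.  In the
  product, a path \<open>(u, p)\<close> is cut in all possible ways into an initial and a final part.\<close>

definition path_algebra ::
  "('k, 'c) ring_scheme \<Rightarrow> ('v, 'e) pre_digraph \<Rightarrow> ('k, 'v \<times> 'e list \<Rightarrow> 'k) module" where
  "path_algebra K Q = \<lparr>
     carrier = {x \<in> UNIV \<rightarrow> carrier K. finite {w. x w \<noteq> \<zero>\<^bsub>K\<^esub>} \<and> {w. x w \<noteq> \<zero>\<^bsub>K\<^esub>} \<subseteq> paths Q},
     mult = (\<lambda>x y (u, p). \<Oplus>\<^bsub>K\<^esub>i\<in>{..length p}.
        x (u, take i p) \<otimes>\<^bsub>K\<^esub> y (pre_digraph.awlast Q u (take i p), drop i p)),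
     one = (\<lambda>(u, p). if u \<in> verts Q \<and> p = [] then \<one>\<^bsub>K\<^esub> else \<zero>\<^bsub>K\<^esub>),
     zero = (\<lambda>w. \<zero>\<^bsub>K\<^esub>),
     add = (\<lambda>x y w. x w \<oplus>\<^bsub>K\<^esub> y w),
     smult = (\<lambda>k x w. k \<otimes>\<^bsub>K\<^esub> x w)\<rparr>"

definition arrow_elem ::
  "('k, 'c) ring_scheme \<Rightarrow> ('v, 'e) pre_digraph \<Rightarrow> 'e \<Rightarrow> 'v \<times> 'e list \<Rightarrow> 'k" where
  "arrow_elem K Q a = (\<lambda>w. if w = (tail Q a, [a]) then \<one>\<^bsub>K\<^esub> else \<zero>\<^bsub>K\<^esub>)"

definition arrow_ideal ::
  "('k, 'c) ring_scheme \<Rightarrow> ('v, 'e) pre_digraph \<Rightarrow> ('v \<times> 'e list \<Rightarrow> 'k) set" where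
  "arrow_ideal K Q = Idl\<^bsub>path_algebra K Q\<^esub> (arrow_elem K Q ` arcs Q)"

definition quot_algebra :: "('k, 'a) module \<Rightarrow> 'a set \<Rightarrow> ('k, 'a set) module" where
  "quot_algebra R I = ring.extend (R Quot I)
     (module.fields (\<lambda>k X. \<Union>x\<in>X. I +>\<^bsub>R\<^esub> (k \<odot>\<^bsub>R\<^esub> x)))"

text \<open>The arrow \<open>i \<rightarrow> i + 1\<close> is named \<open>i\<close>.\<close>

definition linear_quiver :: "nat \<Rightarrow> (nat, nat) pre_digraph" where
  "linear_quiver n = \<lparr>verts = {i. i < n}, arcs = {i. Suc i < n}, tail = (\<lambda>i. i), head = Suc\<rparr>"

definition A_alg ::
  "('k, 'c) ring_scheme \<Rightarrow> nat \<Rightarrow> ('k, (nat \<times> nat list \<Rightarrow> 'k) set) module" where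
  "A_alg K n = (let R = path_algebra K (linear_quiver n); J = arrow_ideal K (linear_quiver n) in
     quot_algebra R (J \<cdot>\<^bsub>R\<^esub> J \<cdot>\<^bsub>R\<^esub> J))"

definition B_alg ::
  "('k, 'c) ring_scheme \<Rightarrow> nat \<Rightarrow>
   ('k, (nat \<times> nat list \<Rightarrow> 'k) set \<times> (nat \<Rightarrow> 'k) \<Rightarrow>
        (nat \<times> nat list \<Rightarrow> 'k) set \<times> (nat \<Rightarrow> 'k)) module" where
  "B_alg K n = (let A = A_alg K n; e = minimal_projinj_idem K A; d = the_enat (domdim K A) in
     End_alg A (rmod_sum (idem_rmod A e) (cosyzygy K A d (regular_rmod A))))"

end

theory Submission
  imports Defs
begin

text \<open>
  A right module over \<open>A = A_n\<close> is pictured by intervals: \<open>[a, b)\<close>, for \<open>b \<le> a + 3\<close> and \<open>b \<le> n\<close>, has one basis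
  vector at each vertex \<open>a \<le> x < b\<close>, and the arrows move these to the right. It is uniserial with top
  \<open>a\<close> and socle \<open>b - 1\<close>. Its injective hull is \<open>[b - 3, b)\<close>, cut off at \<open>0\<close>, with cokernel \<open>[b - 3, a)\<close>,
  and this hull is projective exactly if \<open>b \<ge> 3\<close>. The rows \<open>e_r A = [r, min (r + 3) n)\<close> are injective
  except for the last two, so the minimal injective resolution of \<open>A\<close> is obtained by iterating
  \<open>(a, b) \<mapsto> (b - 3, a)\<close> on two intervals. It meets a hull that is not projective when an end drops below
  \<open>3\<close>. This gives dominant dimension \<open>2m - 1\<close> and cosyzygy \<open>[1, 2) + [1, 3)\<close> for \<open>n = 3m + 1\<close>, and
  dominant dimension \<open>2m\<close> and cosyzygy \<open>[1, 2) + [0, 2)\<close> for \<open>n = 3m + 2\<close> (\<open>domdim_1\<close>, \<open>domdim_2\<close>,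
  \<open>cosyzygy_iso\<close>).

  Let \<open>C\<close> be this cosyzygy and \<open>M = P + C\<close>, where \<open>P\<close> is faithful and embeds into a free module. Both
  \<open>eA\<close> and the injective hull of \<open>A\<close> are such modules, and every such \<open>P\<close> contains all
  \<open>[i, i + 3)\<close> with \<open>i + 2 < n\<close> as summands (\<open>faithful_summand\<close>). In both cases \<open>C\<close> contains the simple
  module at vertex \<open>1\<close>. Let \<open>\<rho>\<close> be the endomorphism of \<open>M\<close> that maps the summand \<open>[1, 4)\<close> of \<open>P\<close> onto it.

  For \<open>n = 3m + 1\<close> let \<open>\<beta>\<close> map \<open>[1, 4)\<close> to the submodule \<open>[1, 3)\<close> of \<open>[0, 3)\<close>. The kernel of \<open>\<beta>\<close> lies in the
  kernel of \<open>\<rho>\<close>, so \<open>\<rho> = y \<beta>\<close> for some \<open>y\<close> in the injective hull of \<open>B = End M\<close>. If this hull were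
  projective, a homomorphism to \<open>B\<close> would turn this into a relation \<open>g \<rho> = y' \<beta>\<close> in \<open>B\<close> with
  \<open>g \<rho> \<noteq> 0\<close>. But then \<open>M\<close> would have an element at vertex \<open>0\<close> that is killed by the path from \<open>0\<close> to
  \<open>2\<close> and not by the arrow from \<open>0\<close> to \<open>1\<close>. There is none in \<open>P\<close>, and \<open>C\<close> vanishes at \<open>0\<close>. Hence the
  dominant dimension of \<open>B\<close> is \<open>0\<close> (\<open>domdim_End_1\<close>). As this is not \<open>2m - 1\<close>, property * fails for \<open>A\<close>.

  For \<open>n = 3m + 2\<close> let \<open>\<mu>\<close> be the map \<open>\<beta>\<close> from above and let \<open>\<nu>\<close> map \<open>[0, 3)\<close> onto the summand \<open>[0, 2)\<close> of
  \<open>C\<close>. As before, \<open>\<rho> = y \<nu> \<mu>\<close> in the injective hull of \<open>B\<close>. The coset of \<open>y \<nu>\<close> is a nonzero element of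
  the cokernel that \<open>\<mu>\<close> annihilates. It would survive under some homomorphism to \<open>B\<close> if the second term
  of the resolution were projective, so there would be \<open>k\<close> with \<open>k \<nu> \<mu> = 0\<close> and
  \<open>k \<nu> \<noteq> 0\<close>. But the arrow from \<open>0\<close> to \<open>1\<close> kills no nonzero
  element of \<open>M\<close> at vertex \<open>0\<close>. Hence the dominant dimension is at most
  \<open>1\<close> (\<open>End_second_term\<close>), whence \<open>A\<close> does not have property *. If \<open>P\<close> is injective, it is \<open>1\<close>: with \<open>f\<close> the sum
  of the idempotents at the vertices \<open>1, \<dots>, n - 3\<close>, the bimodule \<open>Hom_K (M f, M)\<close> is a
  projective-injective \<open>B\<close>-module that contains \<open>B\<close> (\<open>End_first_term\<close>).

  The computations use coordinates: \<open>A\<close> is identified with the upper triangular \<open>n \<times> n\<close> matrices modulo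
  those that vanish on the main diagonal and on the two diagonals above it (\<open>nakayama_A\<close>).
\<close>

text \<open>The subscript that selects a structure may be a single identifier.\<close>

syntax "_index" :: "logic \<Rightarrow> index" ("\<^sub>_" [1000] 1000)

section \<open>Finite dimensional vector spaces\<close>

lemma module_intro:
  fixes K (structure) and M (structure)
  assumes "cring K"
    and "!!x y. x \<in> carrier M ==> y \<in> carrier M ==> x \<oplus>\<^sub>M y \<in> carrier M"
    and "\<zero>\<^sub>M \<in> carrier M"
    and "!!x y z. x \<in> carrier M ==> y \<in> carrier M ==> z \<in> carrier M ==>
           (x \<oplus>\<^sub>M y) \<oplus>\<^sub>M z = x \<oplus>\<^sub>M (y \<oplus>\<^sub>M z)"
    and "!!x y. x \<in> carrier M ==> y \<in> carrier M ==> x \<oplus>\<^sub>M y = y \<oplus>\<^sub>M x"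
    and "!!x. x \<in> carrier M ==> \<zero>\<^sub>M \<oplus>\<^sub>M x = x"
    and "!!a x. a \<in> carrier K ==> x \<in> carrier M ==> a \<odot>\<^sub>M x \<in> carrier M"
    and "!!a b x. a \<in> carrier K ==> b \<in> carrier K ==> x \<in> carrier M ==>
           (a \<oplus> b) \<odot>\<^sub>M x = a \<odot>\<^sub>M x \<oplus>\<^sub>M b \<odot>\<^sub>M x"
    and "!!a x y. a \<in> carrier K ==> x \<in> carrier M ==> y \<in> carrier M ==>
           a \<odot>\<^sub>M (x \<oplus>\<^sub>M y) = a \<odot>\<^sub>M x \<oplus>\<^sub>M a \<odot>\<^sub>M y"
    and "!!a b x. a \<in> carrier K ==> b \<in> carrier K ==> x \<in> carrier M ==>
           (a \<otimes> b) \<odot>\<^sub>M x = a \<odot>\<^sub>M (b \<odot>\<^sub>M x)"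
    and "!!x. x \<in> carrier M ==> \<one> \<odot>\<^sub>M x = x"
    and "!!x. x \<in> carrier M ==> \<zero> \<odot>\<^sub>M x = \<zero>\<^sub>M"
  shows "Module.module K M"
proof -
  interpret cring K by fact
  have inv: "\<exists>y\<in>carrier M. y \<oplus>\<^sub>M x = \<zero>\<^sub>M" if x: "x \<in> carrier M" for x
  proof
    have "(\<ominus> \<one>) \<odot>\<^sub>M x \<oplus>\<^sub>M \<one> \<odot>\<^sub>M x = (\<ominus> \<one> \<oplus> \<one>) \<odot>\<^sub>M x"
      using x assms(8)[of "\<ominus> \<one>" \<one> x] by simp
    thus "(\<ominus> \<one>) \<odot>\<^sub>M x \<oplus>\<^sub>M x = \<zero>\<^sub>M" using x assms(11,12) by (simp add: l_neg)
    show "(\<ominus> \<one>) \<odot>\<^sub>M x \<in> carrier M" using x assms(7) by simp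
  qed
  show ?thesis
    by (rule moduleI) (use assms inv in \<open>auto intro!: abelian_groupI\<close>)
qed

definition ksub :: "('k, 'c) ring_scheme => ('k, 'v, 'd) module_scheme => 'v set => bool" where
  "ksub K M U \<longleftrightarrow> U \<subseteq> carrier M \<and> \<zero>\<^sub>M \<in> U \<and> (\<forall>x \<in> U. \<forall>y \<in> U. x \<oplus>\<^sub>M y \<in> U) \<and>
     (\<forall>k \<in> carrier K. \<forall>x \<in> U. k \<odot>\<^sub>M x \<in> U)"

definition lin :: "('k, 'c) ring_scheme => ('k, 'v, 'd) module_scheme =>
    ('k, 'w, 'e) module_scheme => ('v => 'w) set" where
  "lin K M N = {f \<in> carrier M \<rightarrow> carrier N.
     (\<forall>x \<in> carrier M. \<forall>y \<in> carrier M. f (x \<oplus>\<^sub>M y) = f x \<oplus>\<^sub>N f y) \<and>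
     (\<forall>k \<in> carrier K. \<forall>x \<in> carrier M. f (k \<odot>\<^sub>M x) = k \<odot>\<^sub>N f x)}"

lemma ksubD:
  assumes "ksub K M U"
  shows "U \<subseteq> carrier M" "\<zero>\<^sub>M \<in> U" "!!x y. x \<in> U ==> y \<in> U ==> x \<oplus>\<^sub>M y \<in> U"
    "!!k x. k \<in> carrier K ==> x \<in> U ==> k \<odot>\<^sub>M x \<in> U" "!!x. x \<in> U ==> x \<in> carrier M"
  using assms unfolding ksub_def by auto

lemma linD:
  assumes "f \<in> lin K M N"
  shows "!!x. x \<in> carrier M ==> f x \<in> carrier N"
    "!!x y. x \<in> carrier M ==> y \<in> carrier M ==> f (x \<oplus>\<^sub>M y) = f x \<oplus>\<^sub>N f y"
    "!!k x. k \<in> carrier K ==> x \<in> carrier M ==> f (k \<odot>\<^sub>M x) = k \<odot>\<^sub>N f x"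
  using assms unfolding lin_def by auto

lemma linI:
  assumes "!!x. x \<in> carrier M ==> f x \<in> carrier N"
    "!!x y. x \<in> carrier M ==> y \<in> carrier M ==> f (x \<oplus>\<^sub>M y) = f x \<oplus>\<^sub>N f y"
    "!!k x. k \<in> carrier K ==> x \<in> carrier M ==> f (k \<odot>\<^sub>M x) = k \<odot>\<^sub>N f x"
  shows "f \<in> lin K M N"
  using assms unfolding lin_def by auto

lemma additive_zero:
  assumes "abelian_group M" "abelian_group N" "f \<in> carrier M \<rightarrow> carrier N"
    "\<forall>x \<in> carrier M. \<forall>y \<in> carrier M. f (x \<oplus>\<^sub>M y) = f x \<oplus>\<^sub>N f y"
  shows "f \<zero>\<^sub>M = \<zero>\<^sub>N"
proof -
  interpret M: abelian_group M by fact
  interpret N: abelian_group N by fact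
  have "f \<zero>\<^sub>M \<oplus>\<^sub>N f \<zero>\<^sub>M = f \<zero>\<^sub>M" using assms(4) by (metis M.zero_closed M.l_zero)
  thus ?thesis using assms(3) N.add.l_cancel_one by (metis M.zero_closed Pi_mem)
qed

lemma additive_finsum:
  assumes "abelian_group M" "abelian_group N" "f \<in> carrier M \<rightarrow> carrier N"
    "\<forall>x \<in> carrier M. \<forall>y \<in> carrier M. f (x \<oplus>\<^sub>M y) = f x \<oplus>\<^sub>N f y" "g \<in> A \<rightarrow> carrier M"
  shows "f (\<Oplus>\<^sub>M i\<in>A. g i) = (\<Oplus>\<^sub>N i\<in>A. f (g i))"
proof -
  interpret M: abelian_group M by fact
  interpret N: abelian_group N by fact
  note z = additive_zero[OF assms(1-4)]
  show ?thesis
  proof (cases "finite A")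
    case False
    thus ?thesis using z by (simp add: M.finsum_infinite N.finsum_infinite)
  next
    case True
    thus ?thesis using assms(5)
    proof (induction A)
      case empty
      thus ?case using z by simp
    next
      case (insert i A)
      have 1: "g \<in> A \<rightarrow> carrier M" "g i \<in> carrier M" using insert.prems by auto
      have 2: "(%i. f (g i)) \<in> A \<rightarrow> carrier N" "f (g i) \<in> carrier N" using 1 assms(3) by auto
      show ?case using insert.hyps insert.IH 1 2 assms(4) M.finsum_closed[OF 1(1)]
        by (simp add: M.finsum_insert N.finsum_insert)
    qed
  qed
qed

lemma lin_zero:
  assumes "Module.module K M" "Module.module K N" "f \<in> lin K M N"
  shows "f \<zero>\<^sub>M = \<zero>\<^sub>N"
  using additive_zero[of M N f] assms by (auto simp: lin_def dest: module.axioms)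

lemma lin_finsum:
  assumes "Module.module K M" "Module.module K N" "f \<in> lin K M N" "g \<in> A \<rightarrow> carrier M"
  shows "f (\<Oplus>\<^sub>M i\<in>A. g i) = (\<Oplus>\<^sub>N i\<in>A. f (g i))"
  using additive_finsum[of M N f g A] assms by (auto simp: lin_def dest: module.axioms)

lemma lin_comp:
  assumes "f \<in> lin K L M" "g \<in> lin K M N"
  shows "(%x. g (f x)) \<in> lin K L N"
  using assms unfolding lin_def by (auto simp: Pi_iff)

lemma ksub_finsum:
  assumes "Module.module K M" "ksub K M U" "g \<in> A \<rightarrow> U"
  shows "(\<Oplus>\<^sub>M i\<in>A. g i) \<in> U"
proof -
  interpret M: Module.module K M by fact
  show ?thesis
  proof (cases "finite A")
    case False
    thus ?thesis using ksubD(2)[OF assms(2)] by (simp add: M.finsum_infinite)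
  next
    case True
    thus ?thesis using assms(3)
    proof (induction A)
      case (insert i A)
      have "g \<in> A \<rightarrow> U" "g i \<in> U" using insert.prems by auto
      moreover have "g \<in> A \<rightarrow> carrier M" "g i \<in> carrier M" 
        using insert.prems ksubD(5)[OF assms(2)] by auto
      ultimately show ?case using insert ksubD(3)[OF assms(2)] by (simp add: M.finsum_insert)
    qed (use ksubD(2)[OF assms(2)] in simp)
  qed
qed

lemma ksub_additive_subgroup:
  assumes "Module.module K M" "ksub K M U"
  shows "additive_subgroup U M"
proof -
  interpret M: Module.module K M by fact
  have m: "\<ominus>\<^sub>M x \<in> U" if "x \<in> U" for x
  proof -
    have "(\<ominus>\<^sub>K \<one>\<^sub>K) \<odot>\<^sub>M x \<in> U" using ksubD(4)[OF assms(2)] that by simp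
    thus ?thesis using that ksubD(5)[OF assms(2)] by (simp add: M.smult_l_minus)
  qed
  show ?thesis
    by (rule additive_subgroup.intro, rule M.add.subgroupI)
      (use ksubD[OF assms(2)] m in \<open>auto simp: a_inv_def\<close>)
qed

lemma additive_subgroup_minus:
  assumes "additive_subgroup U M" "abelian_group M" "x \<in> U" "y \<in> U"
  shows "x \<ominus>\<^sub>M y \<in> U"
  using assms by (simp add: a_minus_def additive_subgroup.a_closed additive_subgroup.a_inv_closed)

lemma module_ksub:
  assumes "Module.module K M" "ksub K M U"
  shows "Module.module K (M\<lparr>carrier := U\<rparr>)"
proof -
  interpret M: Module.module K M by fact
  note u = ksubD[OF assms(2)]
  show ?thesis
    by (rule module_intro) (use u M.is_cring in \<open>auto simp: M.a_assoc M.smult_l_distr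
      M.smult_r_distr M.smult_assoc1 intro: M.a_comm\<close>)
qed

lemma finsum_ksub:
  "finsum (M\<lparr>carrier := U\<rparr>) f A = finsum M f A" if "abelian_group M" "additive_subgroup U M" "f \<in> A \<rightarrow> U"
  for M :: "('a, 'b) ring_scheme"
proof -
  interpret M: abelian_group M by fact
  interpret U: additive_subgroup U M by fact
  have ag: "abelian_group (M\<lparr>carrier := U\<rparr>)"
    by (rule abelian_groupI)
      (use U.a_subset in \<open>auto simp: M.a_assoc subset_iff intro: M.a_comm intro!: bexI[OF _ U.a_inv_closed] M.l_neg\<close>)
  show ?thesis
    using additive_finsum[OF ag that(1), of "%x. x" f A] U.a_subset that(3) by auto
qed

text \<open>Generation in terms of subspaces avoids computing with linear combinations.\<close>

lemma finite_dim_iff: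
  assumes "Module.module K M"
  shows "finite_dim K M \<longleftrightarrow>
    (\<exists>S. finite S \<and> S \<subseteq> carrier M \<and> (\<forall>U. ksub K M U --> S \<subseteq> U --> carrier M \<subseteq> U))"
proof -
  interpret M: Module.module K M by fact
  show ?thesis
  proof
    assume "finite_dim K M"
    then obtain S where S: "finite S" "S \<subseteq> carrier M"
      "!!x. x \<in> carrier M ==> \<exists>c \<in> S \<rightarrow> carrier K. x = (\<Oplus>\<^sub>M s\<in>S. c s \<odot>\<^sub>M s)"
      unfolding finite_dim_def by blast
    have "carrier M \<subseteq> U" if "ksub K M U" "S \<subseteq> U" for U
    proof
      fix x assume "x \<in> carrier M"
      then obtain c where "c \<in> S \<rightarrow> carrier K" "x = (\<Oplus>\<^sub>M s\<in>S. c s \<odot>\<^sub>M s)" using S(3) by blast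
      thus "x \<in> U" using that ksubD(4)[OF that(1)]
        by (auto intro!: ksub_finsum[OF assms that(1)])
    qed
    thus "\<exists>S. finite S \<and> S \<subseteq> carrier M \<and> (\<forall>U. ksub K M U --> S \<subseteq> U --> carrier M \<subseteq> U)"
      using S(1,2) by blast
  next
    assume "\<exists>S. finite S \<and> S \<subseteq> carrier M \<and> (\<forall>U. ksub K M U --> S \<subseteq> U --> carrier M \<subseteq> U)"
    then obtain S where S: "finite S" "S \<subseteq> carrier M"
      "!!U. ksub K M U ==> S \<subseteq> U ==> carrier M \<subseteq> U" by blast
    let ?U = "{x. \<exists>c \<in> S \<rightarrow> carrier K. x = (\<Oplus>\<^sub>M s\<in>S. c s \<odot>\<^sub>M s)}"
    have cl: "(%s. c s \<odot>\<^sub>M s) \<in> S \<rightarrow> carrier M" if "c \<in> S \<rightarrow> carrier K" for c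
      using that S(2) by auto
    have k: "ksub K M ?U" unfolding ksub_def
    proof (intro conjI ballI)
      show "?U \<subseteq> carrier M" using cl by auto
      have "\<zero>\<^sub>M = (\<Oplus>\<^sub>M s\<in>S. \<zero>\<^sub>K \<odot>\<^sub>M s)"
        using S(2) by (intro M.add.finprod_one_eqI[symmetric]) auto
      thus "\<zero>\<^sub>M \<in> ?U" by (auto intro!: bexI[of _ "%_. \<zero>\<^sub>K"])
    next
      fix x y assume "x \<in> ?U" "y \<in> ?U"
      then obtain c d where c: "c \<in> S \<rightarrow> carrier K" "x = (\<Oplus>\<^sub>M s\<in>S. c s \<odot>\<^sub>M s)"
        and d: "d \<in> S \<rightarrow> carrier K" "y = (\<Oplus>\<^sub>M s\<in>S. d s \<odot>\<^sub>M s)" by auto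
      have "x \<oplus>\<^sub>M y = (\<Oplus>\<^sub>M s\<in>S. c s \<odot>\<^sub>M s \<oplus>\<^sub>M d s \<odot>\<^sub>M s)"
        using c(2) d(2) M.finsum_addf[OF cl[OF c(1)] cl[OF d(1)]] by simp
      also have "\<dots> = (\<Oplus>\<^sub>M s\<in>S. (c s \<oplus>\<^sub>K d s) \<odot>\<^sub>M s)"
        using c(1) d(1) S(2) by (intro M.finsum_cong') (auto simp: M.smult_l_distr Pi_iff subset_iff)
      finally show "x \<oplus>\<^sub>M y \<in> ?U" using c(1) d(1) by (auto intro!: bexI[of _ "%s. c s \<oplus>\<^sub>K d s"])
    next
      fix k x assume k: "k \<in> carrier K" and "x \<in> ?U"
      then obtain c where c: "c \<in> S \<rightarrow> carrier K" "x = (\<Oplus>\<^sub>M s\<in>S. c s \<odot>\<^sub>M s)" by auto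
      have "k \<odot>\<^sub>M x = (\<Oplus>\<^sub>M s\<in>S. k \<odot>\<^sub>M (c s \<odot>\<^sub>M s))"
        using M.finsum_smult_ldistr[OF S(1) k cl[OF c(1)]] c(2) by simp
      also have "\<dots> = (\<Oplus>\<^sub>M s\<in>S. (k \<otimes>\<^sub>K c s) \<odot>\<^sub>M s)"
        using c(1) k S(2) by (intro M.finsum_cong') (auto simp: M.smult_assoc1 Pi_iff subset_iff)
      finally show "k \<odot>\<^sub>M x \<in> ?U" using c(1) k by (auto intro!: bexI[of _ "%s. k \<otimes>\<^sub>K c s"])
    qed
    moreover have "S \<subseteq> ?U"
    proof
      fix t assume t: "t \<in> S"
      have "t = (\<Oplus>\<^sub>M s\<in>S. if t = s then s else \<zero>\<^sub>M)"
        using t S by (simp add: M.finsum_singleton[OF t S(1), of "%s. s"] subset_iff)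
      also have "\<dots> = (\<Oplus>\<^sub>M s\<in>S. (if t = s then \<one>\<^sub>K else \<zero>\<^sub>K) \<odot>\<^sub>M s)"
        using S(2) by (intro M.finsum_cong') auto
      finally show "t \<in> ?U" by (auto intro!: bexI[of _ "%s. if t = s then \<one>\<^sub>K else \<zero>\<^sub>K"])
    qed
    ultimately have "carrier M \<subseteq> ?U" by (rule S(3))
    thus "finite_dim K M" unfolding finite_dim_def using S(1,2) by blast
  qed
qed

lemma ksub_vimage:
  assumes "Module.module K M" "Module.module K N" "f \<in> lin K M N" "ksub K N U"
  shows "ksub K M {x \<in> carrier M. f x \<in> U}"
proof -
  interpret M: Module.module K M by fact
  show ?thesis using ksubD[OF assms(4)] linD[OF assms(3)] lin_zero[OF assms(1-3)] by (simp add: ksub_def)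
qed

lemma ksub_image:
  assumes "Module.module K M" "Module.module K N" "f \<in> lin K M N"
  shows "ksub K N (f ` carrier M)"
proof -
  interpret M: Module.module K M by fact
  show ?thesis unfolding ksub_def
  proof (intro conjI ballI)
    show "f ` carrier M \<subseteq> carrier N" using linD[OF assms(3)] by auto
    show "\<zero>\<^sub>N \<in> f ` carrier M" using lin_zero[OF assms] by (metis M.zero_closed imageI)
  next
    fix x y assume "x \<in> f ` carrier M" "y \<in> f ` carrier M"
    then obtain a b where "a \<in> carrier M" "b \<in> carrier M" "x = f a" "y = f b" by blast
    thus "x \<oplus>\<^sub>N y \<in> f ` carrier M"
      using linD(2)[OF assms(3)] by (auto intro!: image_eqI[of _ f "a \<oplus>\<^sub>M b"])
  next
    fix k x assume "k \<in> carrier K" "x \<in> f ` carrier M"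
    thus "k \<odot>\<^sub>N x \<in> f ` carrier M" using linD(3)[OF assms(3)] by (auto intro!: image_eqI[of _ f "k \<odot>\<^sub>M b" for b])
  qed
qed

lemma finite_dim_image:
  assumes "Module.module K M" "Module.module K N" "f \<in> lin K M N" "f ` carrier M = carrier N"
    "finite_dim K M"
  shows "finite_dim K N"
proof -
  obtain S where S: "finite S" "S \<subseteq> carrier M" "!!U. ksub K M U ==> S \<subseteq> U ==> carrier M \<subseteq> U"
    using assms(5) finite_dim_iff[OF assms(1)] by blast
  have "carrier N \<subseteq> U" if "ksub K N U" "f ` S \<subseteq> U" for U
    using S(3)[OF ksub_vimage[OF assms(1-3) that(1)]] that(2) S(2) assms(4)[symmetric] by auto
  moreover have "f ` S \<subseteq> carrier N" using S(2) linD(1)[OF assms(3)] by auto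
  ultimately show ?thesis using finite_dim_iff[OF assms(2)] S(1) by (metis finite_imageI)
qed

lemma minus_eq_zeroD:
  fixes Y :: "('a, 'b) ring_scheme"
  assumes "abelian_group Y" "x \<in> carrier Y" "y \<in> carrier Y" "x \<ominus>\<^sub>Y y = \<zero>\<^sub>Y"
  shows "x = y"
proof -
  interpret Y: abelian_group Y by fact
  have "x = (x \<ominus>\<^sub>Y y) \<oplus>\<^sub>Y y" using assms(2,3) by (simp add: a_minus_def Y.a_assoc Y.l_neg)
  thus ?thesis using assms(3,4) by simp
qed

lemma sum_projection:
  fixes Y :: "('a, 'b) ring_scheme"
  assumes "abelian_group Y" "additive_subgroup X Y" "additive_subgroup V Y" "X \<inter> V = {\<zero>\<^sub>Y}"
  shows "\<exists>p. \<forall>x\<in>X. \<forall>v\<in>V. p (x \<oplus>\<^sub>Y v) = x"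
proof -
  interpret Y: abelian_group Y by fact
  interpret X: additive_subgroup X Y by fact
  interpret V: additive_subgroup V Y by fact
  have u: "x = x'" if h: "x \<in> X" "x' \<in> X" "v \<in> V" "v' \<in> V" "x \<oplus>\<^sub>Y v = x' \<oplus>\<^sub>Y v'" for x x' v v'
  proof -
    have c: "x \<in> carrier Y" "x' \<in> carrier Y" "v \<in> carrier Y" "v' \<in> carrier Y"
      using h X.a_subset V.a_subset by auto
    have "v' \<ominus>\<^sub>Y v = \<ominus>\<^sub>Y x' \<oplus>\<^sub>Y (x' \<oplus>\<^sub>Y v') \<ominus>\<^sub>Y v"
      using c by (simp add: Y.r_neg1)
    also have "\<dots> = \<ominus>\<^sub>Y x' \<oplus>\<^sub>Y x"
      unfolding h(5)[symmetric] using c by (simp add: a_minus_def Y.a_assoc Y.r_neg)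
    finally have "x \<ominus>\<^sub>Y x' = v' \<ominus>\<^sub>Y v" using c by (simp add: a_minus_def Y.a_comm)
    hence "x \<ominus>\<^sub>Y x' \<in> X \<inter> V"
      using additive_subgroup_minus[OF X.additive_subgroup_axioms assms(1) h(1,2)]
        additive_subgroup_minus[OF V.additive_subgroup_axioms assms(1) h(4,3)] by simp
    hence "x \<ominus>\<^sub>Y x' = \<zero>\<^sub>Y" using assms(4) by blast
    thus ?thesis by (rule minus_eq_zeroD[OF assms(1) c(1,2)])
  qed
  have "\<forall>x\<in>X. \<forall>v\<in>V. (THE x'. x' \<in> X \<and> (\<exists>v'\<in>V. x \<oplus>\<^sub>Y v = x' \<oplus>\<^sub>Y v')) = x"
    using u by (intro ballI the_equality) blast+
  thus ?thesis by (intro exI[of _ "%y. THE x'. x' \<in> X \<and> (\<exists>v'\<in>V. y = x' \<oplus>\<^sub>Y v')"])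
qed


text \<open>A maximal \<open>V\<close> with \<open>X \<inter> V = 0\<close>, which exists by Zorn's lemma, is a complement, since for
  \<open>y\<close> outside \<open>X + V\<close> the space spanned by \<open>V\<close> and \<open>y\<close> would still meet \<open>X\<close> trivially.\<close>

lemma complement_exists:
  assumes "field K" "Module.module K Y" "ksub K Y X"
  shows "\<exists>V. ksub K Y V \<and> X \<inter> V = {\<zero>\<^sub>Y} \<and> carrier Y \<subseteq> X <+>\<^sub>Y V"
proof -
  interpret K: field K by fact
  interpret Y: Module.module K Y by fact
  note X = ksubD[OF assms(3)]
  let ?S = "{V. ksub K Y V \<and> X \<inter> V = {\<zero>\<^sub>Y}}"
  have "\<exists>V\<in>?S. \<forall>W\<in>?S. V \<subseteq> W --> W = V"
  proof (rule subset_Zorn_nonempty)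
    have "{\<zero>\<^sub>Y} \<in> ?S" using X by (auto simp: ksub_def)
    thus "?S ~= {}" by blast
  next
    fix C assume C: "C ~= {}" "subset.chain ?S C"
    have C1: "!!V. V \<in> C ==> ksub K Y V" "!!V. V \<in> C ==> X \<inter> V = {\<zero>\<^sub>Y}"
      using C(2) by (auto simp: subset.chain_def)
    have ch: "!!V W. V \<in> C ==> W \<in> C ==> V \<subseteq> W \<or> W \<subseteq> V" using C(2) by (auto simp: subset.chain_def)
    have "ksub K Y (\<Union>C)" unfolding ksub_def
    proof (intro conjI ballI)
      show "\<Union>C \<subseteq> carrier Y" using C1(1) ksubD(1) by blast
      show "\<zero>\<^sub>Y \<in> \<Union>C" using C1(1) C(1) ksubD(2) by blast
    next
      fix x y assume "x \<in> \<Union>C" "y \<in> \<Union>C"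
      then obtain V where "V \<in> C" "x \<in> V" "y \<in> V" using ch by blast
      thus "x \<oplus>\<^sub>Y y \<in> \<Union>C" using ksubD(3)[OF C1(1)] by blast
    next
      fix k x assume "k \<in> carrier K" "x \<in> \<Union>C"
      thus "k \<odot>\<^sub>Y x \<in> \<Union>C" using ksubD(4)[OF C1(1)] by blast
    qed
    moreover have "X \<inter> \<Union>C = {\<zero>\<^sub>Y}" using C1(2) C(1) by blast
    ultimately show "\<Union>C \<in> ?S" by simp
  qed
  then obtain V where VS: "V \<in> ?S" and mx: "\<forall>W\<in>?S. V \<subseteq> W --> W = V" by (rule bexE)
  have V: "ksub K Y V" "X \<inter> V = {\<zero>\<^sub>Y}" using VS by simp_all
  have max: "W = V" if "ksub K Y W" "X \<inter> W = {\<zero>\<^sub>Y}" "V \<subseteq> W" for W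
    using mx that by simp
  note v = ksubD[OF V(1)]
  have "y \<in> X <+>\<^sub>Y V" if y: "y \<in> carrier Y" for y
  proof (rule ccontr)
    assume n: "y \<notin> X <+>\<^sub>Y V"
    let ?W = "{v \<oplus>\<^sub>Y k \<odot>\<^sub>Y y | v k. v \<in> V \<and> k \<in> carrier K}"
    have eq0: "v = v \<oplus>\<^sub>Y \<zero>\<^sub>K \<odot>\<^sub>Y y" if "v \<in> V" for v using that v y by simp
    have "ksub K Y ?W" unfolding ksub_def
    proof (intro conjI ballI)
      show "?W \<subseteq> carrier Y" using v y by auto
      show "\<zero>\<^sub>Y \<in> ?W" using eq0[OF v(2)] v(2) by blast
    next
      fix a b assume "a \<in> ?W" "b \<in> ?W"
      then obtain s k t l where s: "s \<in> V" "k \<in> carrier K" "a = s \<oplus>\<^sub>Y k \<odot>\<^sub>Y y"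
        and t: "t \<in> V" "l \<in> carrier K" "b = t \<oplus>\<^sub>Y l \<odot>\<^sub>Y y" by blast
      have "a \<oplus>\<^sub>Y b = (s \<oplus>\<^sub>Y t) \<oplus>\<^sub>Y (k \<oplus>\<^sub>K l) \<odot>\<^sub>Y y"
        using s t y v by (simp add: Y.smult_l_distr Y.a_ac)
      thus "a \<oplus>\<^sub>Y b \<in> ?W" using s t v by blast
    next
      fix k a assume k: "k \<in> carrier K" and "a \<in> ?W"
      then obtain s l where s: "s \<in> V" "l \<in> carrier K" "a = s \<oplus>\<^sub>Y l \<odot>\<^sub>Y y" by blast
      have "k \<odot>\<^sub>Y a = k \<odot>\<^sub>Y s \<oplus>\<^sub>Y (k \<otimes>\<^sub>K l) \<odot>\<^sub>Y y"
        using s k y v by (simp add: Y.smult_r_distr Y.smult_assoc1)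
      thus "k \<odot>\<^sub>Y a \<in> ?W" using s k v by blast
    qed
    moreover have "V \<subseteq> ?W" using eq0 by blast
    moreover have "y \<in> ?W"
    proof -
      have "y = \<zero>\<^sub>Y \<oplus>\<^sub>Y \<one>\<^sub>K \<odot>\<^sub>Y y" using y by simp
      thus ?thesis using v(2) by blast
    qed
    moreover have "y \<notin> V"
    proof
      assume "y \<in> V"
      hence "\<zero>\<^sub>Y \<oplus>\<^sub>Y y \<in> X <+>\<^sub>Y V" using X(2) by (auto simp: set_add_def' )
      thus False using n y by simp
    qed
    ultimately have "X \<inter> ?W ~= {\<zero>\<^sub>Y}" using max[of ?W] by auto
    moreover have "\<zero>\<^sub>Y \<in> X \<inter> ?W" using X(2) v(2) \<open>V \<subseteq> ?W\<close> by auto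
    ultimately have "\<exists>a\<in>X \<inter> ?W. a ~= \<zero>\<^sub>Y" by auto
    then obtain a where a: "a \<in> X" "a \<in> ?W" "a ~= \<zero>\<^sub>Y" by (elim bexE IntE)
    then obtain s k where sk: "a = s \<oplus>\<^sub>Y k \<odot>\<^sub>Y y" "s \<in> V" "k \<in> carrier K" by blast
    hence s: "s \<in> V" "k \<in> carrier K" "s \<oplus>\<^sub>Y k \<odot>\<^sub>Y y \<in> X"
      "s \<oplus>\<^sub>Y k \<odot>\<^sub>Y y ~= \<zero>\<^sub>Y" using a by simp_all
    have "k ~= \<zero>\<^sub>K"
    proof
      assume "k = \<zero>\<^sub>K"
      hence "s \<oplus>\<^sub>Y k \<odot>\<^sub>Y y = s" using eq0[OF s(1)] by simp
      hence "s \<in> X \<inter> V" "s ~= \<zero>\<^sub>Y" using s by simp_all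
      thus False using V(2) by simp
    qed
    then obtain l where l: "l \<in> carrier K" "l \<otimes>\<^sub>K k = \<one>\<^sub>K"
      using s(2) K.field_Units K.Units_l_inv_ex by blast
    let ?x = "l \<odot>\<^sub>Y (s \<oplus>\<^sub>Y k \<odot>\<^sub>Y y)" and ?v = "(\<ominus>\<^sub>K l) \<odot>\<^sub>Y s"
    have xv: "?x \<in> X" "?v \<in> V" using X(4) v(4) s l by auto
    have "?x = l \<odot>\<^sub>Y s \<oplus>\<^sub>Y y"
      using l s y v by (simp add: Y.smult_r_distr Y.smult_assoc1[symmetric])
    hence "?x \<oplus>\<^sub>Y ?v = y"
      using l s y v by (simp add: Y.smult_l_minus Y.a_ac Y.r_neg Y.r_neg1 Y.r_neg2)
    hence "y \<in> X <+>\<^sub>Y V" using xv unfolding set_add_def' by blast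
    thus False using n by simp
  qed
  thus ?thesis using V by blast
qed

text \<open>The projection along a complement. Extension of linear maps and the passage to subspaces and
  quotients rest on it.\<close>

lemma linear_retraction:
  assumes "field K" "Module.module K Y" "ksub K Y X"
  shows "\<exists>r\<in>lin K Y Y. r ` carrier Y \<subseteq> X \<and> (\<forall>x\<in>X. r x = x)"
proof -
  interpret Y: Module.module K Y by fact
  obtain V where V: "ksub K Y V" "X \<inter> V = {\<zero>\<^sub>Y}" "carrier Y \<subseteq> X <+>\<^sub>Y V"
    using complement_exists[OF assms] by blast
  note X = ksubD[OF assms(3)] note v = ksubD[OF V(1)]
  obtain p where p: "!!x v. x \<in> X ==> v \<in> V ==> p (x \<oplus>\<^sub>Y v) = x"
    using sum_projection[OF _ ksub_additive_subgroup[OF assms(2,3)] ksub_additive_subgroup[OF assms(2) V(1)] V(2)]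
      Y.abelian_group_axioms by blast
  have ex: "\<exists>x\<in>X. \<exists>v\<in>V. y = x \<oplus>\<^sub>Y v" if "y \<in> carrier Y" for y
    using V(3) that unfolding set_add_def' by blast
  have "p \<in> lin K Y Y"
  proof (rule linI)
    fix y assume "y \<in> carrier Y"
    thus "p y \<in> carrier Y" using ex p X by metis
  next
    fix y z assume "y \<in> carrier Y" "z \<in> carrier Y"
    then obtain x s x' s' where h: "x \<in> X" "s \<in> V" "y = x \<oplus>\<^sub>Y s" "x' \<in> X" "s' \<in> V" "z = x' \<oplus>\<^sub>Y s'"
      using ex by metis
    have "y \<oplus>\<^sub>Y z = (x \<oplus>\<^sub>Y x') \<oplus>\<^sub>Y (s \<oplus>\<^sub>Y s')"
      using h X(5) v(5) by (simp add: Y.a_ac)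
    thus "p (y \<oplus>\<^sub>Y z) = p y \<oplus>\<^sub>Y p z" using h p X(3) v(3) by simp
  next
    fix k y assume k: "k \<in> carrier K" and "y \<in> carrier Y"
    then obtain x s where h: "x \<in> X" "s \<in> V" "y = x \<oplus>\<^sub>Y s"
      using ex by metis
    have "k \<odot>\<^sub>Y y = k \<odot>\<^sub>Y x \<oplus>\<^sub>Y k \<odot>\<^sub>Y s"
      using h X(5) v(5) k by (simp add: Y.smult_r_distr)
    thus "p (k \<odot>\<^sub>Y y) = k \<odot>\<^sub>Y p y" using h p X(4) v(4) k by simp
  qed
  moreover have "p ` carrier Y \<subseteq> X" using ex p by (metis image_subsetI)
  moreover have "p x = x" if "x \<in> X" for x
    using p[OF that v(2)] that X by simp
  ultimately show ?thesis by blast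
qed

lemma finite_dim_ksub:
  assumes "field K" "Module.module K Y" "ksub K Y X" "finite_dim K Y"
  shows "finite_dim K (Y\<lparr>carrier := X\<rparr>)"
proof -
  obtain r where r: "r \<in> lin K Y Y" "r ` carrier Y \<subseteq> X" "\<forall>x\<in>X. r x = x"
    using linear_retraction[OF assms(1-3)] by blast
  have "X \<subseteq> r ` carrier Y" 
  proof
    fix x assume "x \<in> X"
    hence "x = r x" "x \<in> carrier Y" using r(3) ksubD(5)[OF assms(3)] by auto
    thus "x \<in> r ` carrier Y" by (rule image_eqI)
  qed
  hence 1: "r ` carrier Y = X" using r(2) by blast
  have 2: "r \<in> lin K Y (Y\<lparr>carrier := X\<rparr>)"
    by (rule linI) (use linD[OF r(1)] 1 in auto)
  thus ?thesis using finite_dim_image[OF assms(2) module_ksub[OF assms(2,3)] 2 _ assms(4)] 1 by simp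
qed

lemma lin_extend:
  assumes "field K" "Module.module K X" "Module.module K Y" "Module.module K Z"
    "f \<in> lin K X Y" "inj_on f (carrier X)" "g \<in> lin K X Z"
  shows "\<exists>h\<in>lin K Y Z. \<forall>x\<in>carrier X. h (f x) = g x"
proof -
  interpret X: Module.module K X by fact
  obtain r where r: "r \<in> lin K Y Y" "r ` carrier Y \<subseteq> f ` carrier X" "\<forall>x\<in>f ` carrier X. r x = x"
    using linear_retraction[OF assms(1,3) ksub_image[OF assms(2,3,5)]] by blast
  define q where "q y = inv_into (carrier X) f (r y)" for y
  have q: "q y \<in> carrier X" "f (q y) = r y" if "y \<in> carrier Y" for y
    using that r(2) by (auto simp: q_def image_subset_iff inv_into_into f_inv_into_f)
  have "q \<in> lin K Y X"
  proof (rule linI)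
    interpret Y: Module.module K Y by fact
    fix x y assume h: "x \<in> carrier Y" "y \<in> carrier Y"
    have "f (q (x \<oplus>\<^sub>Y y)) = f (q x \<oplus>\<^sub>X q y)"
      using h q linD[OF r(1)] linD[OF assms(5)] by simp
    thus "q (x \<oplus>\<^sub>Y y) = q x \<oplus>\<^sub>X q y" using inj_onD[OF assms(6)] q h by simp
  next
    interpret Y: Module.module K Y by fact
    fix k x assume h: "k \<in> carrier K" "x \<in> carrier Y"
    have "f (q (k \<odot>\<^sub>Y x)) = f (k \<odot>\<^sub>X q x)"
      using h q linD[OF r(1)] linD[OF assms(5)] by simp
    thus "q (k \<odot>\<^sub>Y x) = k \<odot>\<^sub>X q x" using inj_onD[OF assms(6)] q h by simp
  qed (use q in auto)
  moreover have "q (f x) = x" if "x \<in> carrier X" for x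
  proof -
    have "f (q (f x)) = f x" using q(2) that r(3) linD(1)[OF assms(5)] by simp
    thus ?thesis using inj_onD[OF assms(6)] q(1) that linD(1)[OF assms(5)] by blast
  qed
  ultimately show ?thesis
    by (intro bexI[OF _ lin_comp[OF _ assms(7)]]) auto
qed

lemma field_inverse:
  assumes "field K" "a \<in> carrier K" "a ~= \<zero>\<^sub>K"
  shows "\<exists>l\<in>carrier K. l \<otimes>\<^sub>K a = \<one>\<^sub>K"
proof -
  interpret K: field K by fact
  show ?thesis using assms(2,3) K.field_Units K.Units_l_inv_ex by blast
qed

text \<open>The field as a vector space over itself, so that functionals are linear maps.\<close>

definition kmod :: "('k, 'c) ring_scheme => ('k, 'k) module" where
  "kmod K = \<lparr>carrier = carrier K, mult = mult K, one = one K, zero = zero K, add = add K,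
     smult = mult K\<rparr>"

lemma kmod_simps [simp]:
  "carrier (kmod K) = carrier K" "zero (kmod K) = zero K" "add (kmod K) = add K"
  "smult (kmod K) = mult K"
  by (simp_all add: kmod_def)

lemma module_kmod: "cring K ==> Module.module K (kmod K)"
proof -
  assume "cring K"
  then interpret cring K .
  show ?thesis
    by (rule module_intro) (auto simp: is_cring a_assoc l_distr r_distr m_assoc intro: a_comm)
qed

lemma finsum_kmod [simp]: "finsum (kmod K) f A = finsum K f A"
  by (simp add: finsum_def kmod_def finprod_def)

definition dual_basis ::
  "('k, 'c) ring_scheme => ('k, 'v, 'd) module_scheme => 'v set => ('v => 'v => 'k) => bool" where
  "dual_basis K M S c \<longleftrightarrow> finite S \<and> S \<subseteq> carrier M \<and> (\<forall>s\<in>S. c s \<in> lin K M (kmod K)) \<and>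
     (\<forall>x\<in>carrier M. x = (\<Oplus>\<^sub>M s\<in>S. c s x \<odot>\<^sub>M s))"

text \<open>A minimal generating set is a basis: if the coefficients of the elements were not unique, one
  generator would be a combination of the others.\<close>

lemma dual_basis_exists:
  assumes "field K" "Module.module K M" "finite_dim K M"
  shows "\<exists>S c. dual_basis K M S c"
proof -
  interpret K: field K by fact
  interpret M: Module.module K M by fact
  define gen where "gen S \<longleftrightarrow> finite S \<and> S \<subseteq> carrier M \<and>
    (\<forall>x \<in> carrier M. \<exists>c \<in> S \<rightarrow> carrier K. x = (\<Oplus>\<^sub>M s\<in>S. c s \<odot>\<^sub>M s))" for S
  have "\<exists>S. gen S" using assms(3) by (auto simp: gen_def finite_dim_def)
  then obtain S where S: "gen S" and min: "!!T. gen T ==> card S \<le> card T"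
    using ex_has_least_nat[of gen _ card] by blast
  have fS: "finite S" and Sc: "S \<subseteq> carrier M" and
    ex: "!!x. x \<in> carrier M ==> \<exists>c \<in> S \<rightarrow> carrier K. x = (\<Oplus>\<^sub>M s\<in>S. c s \<odot>\<^sub>M s)"
    using S by (auto simp: gen_def)
  have cl: "(%s. c s \<odot>\<^sub>M s) \<in> T \<rightarrow> carrier M" if "c \<in> T \<rightarrow> carrier K" "T \<subseteq> S" for c T
    using that Sc by auto
  have spl: "(\<Oplus>\<^sub>M s\<in>S. c s \<odot>\<^sub>M s) = c t \<odot>\<^sub>M t \<oplus>\<^sub>M (\<Oplus>\<^sub>M s\<in>S-{t}. c s \<odot>\<^sub>M s)"
    if "c \<in> S \<rightarrow> carrier K" "t \<in> S" for c t
  proof -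
    have "(\<Oplus>\<^sub>M s\<in>insert t (S-{t}). c s \<odot>\<^sub>M s) = c t \<odot>\<^sub>M t \<oplus>\<^sub>M (\<Oplus>\<^sub>M s\<in>S-{t}. c s \<odot>\<^sub>M s)"
      using that fS Sc by (intro M.finsum_insert cl) auto
    thus ?thesis using that by (simp add: insert_absorb)
  qed
  have add: "(\<Oplus>\<^sub>M s\<in>T. c s \<odot>\<^sub>M s) \<oplus>\<^sub>M (\<Oplus>\<^sub>M s\<in>T. d s \<odot>\<^sub>M s) = (\<Oplus>\<^sub>M s\<in>T. (c s \<oplus>\<^sub>K d s) \<odot>\<^sub>M s)"
    if "c \<in> T \<rightarrow> carrier K" "d \<in> T \<rightarrow> carrier K" "T \<subseteq> S" for c d T
  proof -
    have "(\<Oplus>\<^sub>M s\<in>T. c s \<odot>\<^sub>M s) \<oplus>\<^sub>M (\<Oplus>\<^sub>M s\<in>T. d s \<odot>\<^sub>M s) = (\<Oplus>\<^sub>M s\<in>T. c s \<odot>\<^sub>M s \<oplus>\<^sub>M d s \<odot>\<^sub>M s)"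
      using M.finsum_addf[OF cl[OF that(1,3)] cl[OF that(2,3)]] by simp
    also have "\<dots> = (\<Oplus>\<^sub>M s\<in>T. (c s \<oplus>\<^sub>K d s) \<odot>\<^sub>M s)"
      using that Sc by (intro M.finsum_cong') (auto simp: M.smult_l_distr Pi_iff subset_iff)
    finally show ?thesis .
  qed
  have scal: "k \<odot>\<^sub>M (\<Oplus>\<^sub>M s\<in>T. c s \<odot>\<^sub>M s) = (\<Oplus>\<^sub>M s\<in>T. (k \<otimes>\<^sub>K c s) \<odot>\<^sub>M s)"
    if "c \<in> T \<rightarrow> carrier K" "k \<in> carrier K" "T \<subseteq> S" for c k T
  proof -
    have "finite T" using that fS finite_subset by blast
    hence "k \<odot>\<^sub>M (\<Oplus>\<^sub>M s\<in>T. c s \<odot>\<^sub>M s) = (\<Oplus>\<^sub>M s\<in>T. k \<odot>\<^sub>M (c s \<odot>\<^sub>M s))"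
      using M.finsum_smult_ldistr[OF _ that(2) cl[OF that(1,3)]] by simp
    also have "\<dots> = (\<Oplus>\<^sub>M s\<in>T. (k \<otimes>\<^sub>K c s) \<odot>\<^sub>M s)"
      using that Sc by (intro M.finsum_cong') (auto simp: M.smult_assoc1 Pi_iff subset_iff)
    finally show ?thesis .
  qed
  have indep: "c t = \<zero>\<^sub>K" if c: "c \<in> S \<rightarrow> carrier K" "(\<Oplus>\<^sub>M s\<in>S. c s \<odot>\<^sub>M s) = \<zero>\<^sub>M" "t \<in> S" for c t
  proof (rule ccontr)
    assume "c t ~= \<zero>\<^sub>K"
    then obtain l where l: "l \<in> carrier K" "l \<otimes>\<^sub>K c t = \<one>\<^sub>K"
      using field_inverse[OF assms(1), of "c t"] c by blast
    have tc: "t \<in> carrier M" "c t \<in> carrier K" using c Sc by auto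
    let ?T = "S - {t}"
    have c': "c \<in> ?T \<rightarrow> carrier K" using c by auto
    note d1 = M.finsum_closed[OF cl[OF c']]
    have "\<zero>\<^sub>M = l \<odot>\<^sub>M (c t \<odot>\<^sub>M t \<oplus>\<^sub>M (\<Oplus>\<^sub>M s\<in>?T. c s \<odot>\<^sub>M s))"
      using c spl[OF c(1,3)] l by simp
    also have "\<dots> = t \<oplus>\<^sub>M l \<odot>\<^sub>M (\<Oplus>\<^sub>M s\<in>?T. c s \<odot>\<^sub>M s)"
      using tc l d1 by (simp add: M.smult_r_distr M.smult_assoc1[symmetric])
    finally have "t = \<ominus>\<^sub>M (l \<odot>\<^sub>M (\<Oplus>\<^sub>M s\<in>?T. c s \<odot>\<^sub>M s))"
      using tc l d1 by (intro M.minus_equality[symmetric]) auto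
    also have "\<dots> = (\<ominus>\<^sub>K l) \<odot>\<^sub>M (\<Oplus>\<^sub>M s\<in>?T. c s \<odot>\<^sub>M s)"
      using l d1 by (simp add: M.smult_l_minus)
    finally have t: "t = (\<Oplus>\<^sub>M s\<in>?T. ((\<ominus>\<^sub>K l) \<otimes>\<^sub>K c s) \<odot>\<^sub>M s)"
      using scal[OF c'] l by simp
    define e where "e s = (\<ominus>\<^sub>K l) \<otimes>\<^sub>K c s" for s
    have e: "e \<in> ?T \<rightarrow> carrier K" using c' l by (simp add: e_def Pi_iff)
    have "gen ?T" unfolding gen_def
    proof (intro conjI ballI)
      fix x assume "x \<in> carrier M"
      then obtain d where d: "d \<in> S \<rightarrow> carrier K" "x = (\<Oplus>\<^sub>M s\<in>S. d s \<odot>\<^sub>M s)" using ex by blast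
      have dt: "d t \<in> carrier K" "d \<in> ?T \<rightarrow> carrier K" using d c by auto
      have "x = d t \<odot>\<^sub>M t \<oplus>\<^sub>M (\<Oplus>\<^sub>M s\<in>?T. d s \<odot>\<^sub>M s)" using spl[OF d(1) c(3)] d(2) by simp
      also have "d t \<odot>\<^sub>M t = (\<Oplus>\<^sub>M s\<in>?T. (d t \<otimes>\<^sub>K e s) \<odot>\<^sub>M s)"
        using scal[OF e dt(1)] t by (simp add: e_def)
      finally have "x = (\<Oplus>\<^sub>M s\<in>?T. (d t \<otimes>\<^sub>K e s \<oplus>\<^sub>K d s) \<odot>\<^sub>M s)"
        using add[of "%s. d t \<otimes>\<^sub>K e s" ?T d] e dt by auto
      moreover have "(%s. d t \<otimes>\<^sub>K e s \<oplus>\<^sub>K d s) \<in> ?T \<rightarrow> carrier K" using e dt by auto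
      ultimately show "\<exists>c \<in> ?T \<rightarrow> carrier K. x = (\<Oplus>\<^sub>M s\<in>?T. c s \<odot>\<^sub>M s)" 
        by (intro bexI[of _ "%s. d t \<otimes>\<^sub>K e s \<oplus>\<^sub>K d s"])
    qed (use fS Sc in auto)
    from min[OF this] show False using c(3) fS by (metis card_Diff1_less not_le)
  qed
  have uniq: "c t = d t" if cd: "c \<in> S \<rightarrow> carrier K" "d \<in> S \<rightarrow> carrier K"
    "(\<Oplus>\<^sub>M s\<in>S. c s \<odot>\<^sub>M s) = (\<Oplus>\<^sub>M s\<in>S. d s \<odot>\<^sub>M s)" "t \<in> S" for c d t
  proof -
    let ?d = "%s. (\<ominus>\<^sub>K \<one>\<^sub>K) \<otimes>\<^sub>K d s"
    have d': "?d \<in> S \<rightarrow> carrier K" using cd by auto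
    note z = M.finsum_closed[OF cl[OF cd(2) subset_refl]]
    have "(\<Oplus>\<^sub>M s\<in>S. (c s \<oplus>\<^sub>K ?d s) \<odot>\<^sub>M s) = (\<Oplus>\<^sub>M s\<in>S. d s \<odot>\<^sub>M s) \<oplus>\<^sub>M (\<ominus>\<^sub>K \<one>\<^sub>K) \<odot>\<^sub>M (\<Oplus>\<^sub>M s\<in>S. d s \<odot>\<^sub>M s)"
      using add[OF cd(1) d' subset_refl] scal[OF cd(2) _ subset_refl, of "\<ominus>\<^sub>K \<one>\<^sub>K"] cd(3) by simp
    also have "\<dots> = \<zero>\<^sub>M" using z by (simp add: M.smult_l_minus M.r_neg)
    finally have "c t \<oplus>\<^sub>K ?d t = \<zero>\<^sub>K" using indep[of "%s. c s \<oplus>\<^sub>K ?d s" t] cd d' by auto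
    moreover have m: "c t \<in> carrier K" "d t \<in> carrier K" using cd by auto
    ultimately have "c t \<ominus>\<^sub>K d t = \<zero>\<^sub>K" by (simp add: a_minus_def K.l_minus)
    thus ?thesis by (rule minus_eq_zeroD[OF K.abelian_group_axioms m])
  qed
  define D where "D x = (SOME c. c \<in> S \<rightarrow> carrier K \<and> x = (\<Oplus>\<^sub>M s\<in>S. c s \<odot>\<^sub>M s))" for x
  have "D x \<in> S \<rightarrow> carrier K \<and> x = (\<Oplus>\<^sub>M s\<in>S. D x s \<odot>\<^sub>M s)" if "x \<in> carrier M" for x
  proof -
    have "\<exists>c. c \<in> S \<rightarrow> carrier K \<and> x = (\<Oplus>\<^sub>M s\<in>S. c s \<odot>\<^sub>M s)" using ex[OF that] by (simp add: Bex_def)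
    thus ?thesis unfolding D_def by (rule someI_ex)
  qed
  hence D: "!!x. x \<in> carrier M ==> D x \<in> S \<rightarrow> carrier K"
    "!!x. x \<in> carrier M ==> x = (\<Oplus>\<^sub>M s\<in>S. D x s \<odot>\<^sub>M s)" by blast+
  have "(%x. D x s) \<in> lin K M (kmod K)" if s: "s \<in> S" for s
  proof (rule linI)
    fix x assume "x \<in> carrier M"
    thus "D x s \<in> carrier (kmod K)" using D(1) s by auto
  next
    fix x y assume h: "x \<in> carrier M" "y \<in> carrier M"
    have "D (x \<oplus>\<^sub>M y) s = D x s \<oplus>\<^sub>K D y s"
    proof (rule uniq[OF _ _ _ s])
      show "(\<Oplus>\<^sub>M s\<in>S. D (x \<oplus>\<^sub>M y) s \<odot>\<^sub>M s) = (\<Oplus>\<^sub>M s\<in>S. (D x s \<oplus>\<^sub>K D y s) \<odot>\<^sub>M s)"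
        using D(2)[symmetric] h add[OF D(1) D(1) subset_refl, OF h, symmetric] by simp
      show "D (x \<oplus>\<^sub>M y) \<in> S \<rightarrow> carrier K" using D h by blast
      show "(%s. D x s \<oplus>\<^sub>K D y s) \<in> S \<rightarrow> carrier K" using D(1)[OF h(1)] D(1)[OF h(2)] by auto
    qed
    thus "D (x \<oplus>\<^sub>M y) s = D x s \<oplus>\<^bsub>kmod K\<^esub> D y s" by simp
  next
    fix k x assume h: "k \<in> carrier K" "x \<in> carrier M"
    have "D (k \<odot>\<^sub>M x) s = k \<otimes>\<^sub>K D x s"
    proof (rule uniq[OF _ _ _ s])
      show "(\<Oplus>\<^sub>M s\<in>S. D (k \<odot>\<^sub>M x) s \<odot>\<^sub>M s) = (\<Oplus>\<^sub>M s\<in>S. (k \<otimes>\<^sub>K D x s) \<odot>\<^sub>M s)"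
        using D(2)[symmetric] h scal[OF D(1) _ subset_refl, OF h(2,1), symmetric] by simp
      show "D (k \<odot>\<^sub>M x) \<in> S \<rightarrow> carrier K" using D h by blast
      show "(%s. k \<otimes>\<^sub>K D x s) \<in> S \<rightarrow> carrier K" using D(1)[OF h(2)] h(1) by auto
    qed
    thus "D (k \<odot>\<^sub>M x) s = k \<odot>\<^bsub>kmod K\<^esub> D x s" by simp
  qed
  thus ?thesis using D fS Sc unfolding dual_basis_def
    by (intro exI[of _ S] exI[of _ "%s x. D x s"]) auto
qed

lemma dual_basisD:
  assumes "dual_basis K M S c"
  shows "finite S" "S \<subseteq> carrier M" "!!s. s \<in> S ==> c s \<in> lin K M (kmod K)"
    "!!x. x \<in> carrier M ==> (\<Oplus>\<^sub>M s\<in>S. c s x \<odot>\<^sub>M s) = x"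
    "!!s. s \<in> S ==> s \<in> carrier M" "!!s x. s \<in> S ==> x \<in> carrier M ==> c s x \<in> carrier K"
  using assms unfolding dual_basis_def by (auto simp: lin_def)

lemma functional_exists:
  assumes "field K" "Module.module K M" "finite_dim K M" "x \<in> carrier M" "x ~= \<zero>\<^sub>M"
  shows "\<exists>f\<in>lin K M (kmod K). f x = \<one>\<^sub>K"
proof -
  interpret K: field K by fact
  interpret M: Module.module K M by fact
  obtain S c where "dual_basis K M S c" using dual_basis_exists[OF assms(1-3)] by blast
  note d = dual_basisD[OF this]
  have "\<exists>s\<in>S. c s x ~= \<zero>\<^sub>K"
  proof (rule ccontr)
    assume "\<not> ?thesis"
    hence "(\<Oplus>\<^sub>M s\<in>S. c s x \<odot>\<^sub>M s) = \<zero>\<^sub>M" using d(5) by (intro M.add.finprod_one_eqI) auto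
    thus False using d(4) assms by simp
  qed
  then obtain s where s: "s \<in> S" "c s x ~= \<zero>\<^sub>K" by blast
  then obtain l where l: "l \<in> carrier K" "l \<otimes>\<^sub>K c s x = \<one>\<^sub>K"
    using field_inverse[OF assms(1) d(6)[OF s(1) assms(4)] s(2)] by blast
  note L = linD[OF d(3)[OF s(1)], simplified]
  have "(%y. l \<otimes>\<^sub>K c s y) \<in> lin K M (kmod K)"
    by (rule linI) (simp_all add: L l(1) K.r_distr K.m_lcomm)
  thus ?thesis by (rule bexI[rotated]) (simp add: l(2))
qed

lemma in_ksub_if_dual_basis:
  assumes "Module.module K M" "dual_basis K M S c" "ksub K M U" "S \<subseteq> U"
  shows "carrier M \<subseteq> U"
proof
  fix x assume x: "x \<in> carrier M"
  have "(\<Oplus>\<^sub>M s\<in>S. c s x \<odot>\<^sub>M s) \<in> U"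
    using dual_basisD(6)[OF assms(2) _ x] assms(4) ksubD(4)[OF assms(3)]
    by (intro ksub_finsum[OF assms(1,3)]) (simp add: Pi_iff subset_iff)
  thus "x \<in> U" using dual_basisD(4)[OF assms(2) x] by simp
qed

definition fun_space :: "('k, 'c) ring_scheme => 'i set => ('k, 'i => 'k) module" where
  "fun_space K D = \<lparr>carrier = {f. (\<forall>d. f d \<in> carrier K) \<and> (\<forall>d. d \<notin> D --> f d = \<zero>\<^sub>K)},
     mult = undefined, one = undefined, zero = (%d. \<zero>\<^sub>K),
     add = (%f g d. f d \<oplus>\<^sub>K g d), smult = (%k f d. k \<otimes>\<^sub>K f d)\<rparr>"

definition delta :: "('k, 'c) ring_scheme => 'i => 'i => 'k" where
  "delta K i = (%j. if j = i then \<one>\<^sub>K else \<zero>\<^sub>K)"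

lemma module_fun_space:
  assumes "cring K"
  shows "Module.module K (fun_space K D)"
proof -
  interpret cring K by fact
  show ?thesis
    by (rule module_intro)
      (simp_all add: fun_space_def is_cring a_ac l_distr r_distr m_assoc fun_eq_iff)
qed

text \<open>Induction over the support.\<close>

lemma fun_space_sub:
  assumes "cring K" "finite D" "ksub K (fun_space K D) U" "!!d. d \<in> D ==> delta K d \<in> U"
  shows "carrier (fun_space K D) \<subseteq> U"
proof -
  interpret cring K by fact
  have "\<forall>f\<in>carrier (fun_space K D). (\<forall>d. d \<notin> F --> f d = \<zero>\<^sub>K) --> f \<in> U" if "finite F" "F \<subseteq> D" for F
    using that
  proof (induction F)
    case empty
    show ?case
    proof (intro ballI impI)
      fix f assume "f \<in> carrier (fun_space K D)" "\<forall>d. d \<notin> {} --> f d = \<zero>\<^sub>K"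
      hence "f = \<zero>\<^bsub>fun_space K D\<^esub>" by (simp add: fun_space_def fun_eq_iff)
      thus "f \<in> U" using ksubD(2)[OF assms(3)] by simp
    qed
  next
    case (insert d F)
    show ?case
    proof (intro ballI impI)
      fix f assume f: "f \<in> carrier (fun_space K D)" and z: "\<forall>e. e \<notin> insert d F --> f e = \<zero>\<^sub>K"
      let ?g = "f(d := \<zero>\<^sub>K)"
      have "?g \<in> carrier (fun_space K D)" using f by (simp add: fun_space_def)
      hence "?g \<in> U" using insert z by simp
      moreover have "f d \<odot>\<^bsub>fun_space K D\<^esub> delta K d \<in> U"
        using insert.prems assms(4) f by (intro ksubD(4)[OF assms(3)]) (simp_all add: fun_space_def)
      ultimately have "?g \<oplus>\<^bsub>fun_space K D\<^esub> (f d \<odot>\<^bsub>fun_space K D\<^esub> delta K d) \<in> U"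
        by (rule ksubD(3)[OF assms(3)])
      moreover have "?g \<oplus>\<^bsub>fun_space K D\<^esub> (f d \<odot>\<^bsub>fun_space K D\<^esub> delta K d) = f"
        using f by (simp add: fun_space_def delta_def fun_eq_iff)
      ultimately show "f \<in> U" by simp
    qed
  qed
  from this[OF assms(2) subset_refl] show ?thesis by (auto simp: fun_space_def)
qed

lemma delta_in_fun_space: "cring K ==> d \<in> D ==> delta K d \<in> carrier (fun_space K D)"
  by (auto simp: fun_space_def delta_def cring.cring_simprules)

lemma finite_dim_fun_space:
  assumes "cring K" "finite D"
  shows "finite_dim K (fun_space K D)"
proof -
  have 1: "delta K ` D \<subseteq> carrier (fun_space K D)"
    by (intro image_subsetI delta_in_fun_space assms(1))
  have 2: "\<forall>U. ksub K (fun_space K D) U --> delta K ` D \<subseteq> U --> carrier (fun_space K D) \<subseteq> U"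
  proof (intro allI impI)
    fix U assume U: "ksub K (fun_space K D) U" "delta K ` D \<subseteq> U"
    show "carrier (fun_space K D) \<subseteq> U"
      by (rule fun_space_sub[OF assms U(1)]) (use U(2) in blast)
  qed
  have "finite (delta K ` D)" using assms(2) by (rule finite_imageI)
  with 1 2 show ?thesis
    unfolding finite_dim_iff[OF module_fun_space[OF assms(1)]] by iprover
qed

lemma module_cong:
  fixes M :: "('k, 'v, 'd) module_scheme" and N :: "('k, 'v, 'e) module_scheme"
  assumes "Module.module K M" "carrier N = carrier M" "zero N = zero M"
    "!!x y. x \<in> carrier M ==> y \<in> carrier M ==> x \<oplus>\<^sub>N y = x \<oplus>\<^sub>M y"
    "!!k x. k \<in> carrier K ==> x \<in> carrier M ==> k \<odot>\<^sub>N x = k \<odot>\<^sub>M x"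
  shows "Module.module K N"
proof -
  interpret M: Module.module K M by fact
  show ?thesis
    by (rule module_intro)
      (simp_all add: assms(2-5) M.is_cring M.a_ac M.smult_l_distr M.smult_r_distr M.smult_assoc1)
qed

lemma finite_dim_cong:
  fixes M :: "('k, 'v, 'd) module_scheme" and N :: "('k, 'v, 'e) module_scheme"
  assumes "Module.module K M" "finite_dim K M" "carrier N = carrier M" "zero N = zero M"
    "!!x y. x \<in> carrier M ==> y \<in> carrier M ==> x \<oplus>\<^sub>N y = x \<oplus>\<^sub>M y"
    "!!k x. k \<in> carrier K ==> x \<in> carrier M ==> k \<odot>\<^sub>N x = k \<odot>\<^sub>M x"
  shows "finite_dim K N"
proof (rule finite_dim_image[OF assms(1) _ _ _ assms(2)])
  show "Module.module K N" by (rule module_cong[OF assms(1,3-6)])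
  show "(%x. x) \<in> lin K M N" by (rule linI) (simp_all add: assms)
  show "(%x. x) ` carrier M = carrier N" by (simp add: assms)
qed

definition hom_space :: "('k, 'c) ring_scheme => ('k, 'w, 'd) module_scheme =>
    ('k, 'v, 'e) module_scheme => ('k, 'w => 'v) module" where
  "hom_space K W V = \<lparr>carrier = lin K W V \<inter> extensional (carrier W),
     mult = undefined, one = undefined, zero = (\<lambda>x\<in>carrier W. \<zero>\<^sub>V),
     add = (%f g. \<lambda>x\<in>carrier W. f x \<oplus>\<^sub>V g x),
     smult = (%k f. \<lambda>x\<in>carrier W. k \<odot>\<^sub>V f x)\<rparr>"

lemma hom_space_simps:
  "carrier (hom_space K W V) = lin K W V \<inter> extensional (carrier W)"
  "zero (hom_space K W V) = (\<lambda>x\<in>carrier W. \<zero>\<^sub>V)"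
  "add (hom_space K W V) f g = (\<lambda>x\<in>carrier W. f x \<oplus>\<^sub>V g x)"
  "smult (hom_space K W V) k f = (\<lambda>x\<in>carrier W. k \<odot>\<^sub>V f x)"
  by (simp_all add: hom_space_def)

lemma module_hom_space:
  fixes W :: "('k, 'w, 'd) module_scheme" and V :: "('k, 'v, 'e) module_scheme"
  assumes "Module.module K W" "Module.module K V"
  shows "Module.module K (hom_space K W V)"
proof -
  interpret K: cring K by (rule module.axioms[OF assms(1)])
  interpret W: Module.module K W by fact
  interpret V: Module.module K V by fact
  have e: "f = g" if "f \<in> extensional (carrier W)" "g \<in> extensional (carrier W)"
    "!!x. x \<in> carrier W ==> f x = g x" for f g :: "'w => 'v"
    using that by (intro extensionalityI) auto
  show ?thesis
  proof (rule module_intro)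
    fix f g assume "f \<in> carrier (hom_space K W V)" "g \<in> carrier (hom_space K W V)"
    hence f: "f \<in> lin K W V" and g: "g \<in> lin K W V" by (simp_all add: hom_space_simps)
    have "f \<oplus>\<^bsub>hom_space K W V\<^esub> g \<in> lin K W V"
      by (rule linI) (simp_all add: hom_space_simps linD[OF f] linD[OF g] V.a_ac V.smult_r_distr)
    thus "f \<oplus>\<^bsub>hom_space K W V\<^esub> g \<in> carrier (hom_space K W V)" by (simp add: hom_space_simps)
  next
    have "\<zero>\<^bsub>hom_space K W V\<^esub> \<in> lin K W V"
      by (rule linI) (simp_all add: hom_space_simps)
    thus "\<zero>\<^bsub>hom_space K W V\<^esub> \<in> carrier (hom_space K W V)" by (simp add: hom_space_simps)
  next
    fix k f assume k: "k \<in> carrier K" and "f \<in> carrier (hom_space K W V)"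
    hence f: "f \<in> lin K W V" by (simp add: hom_space_simps)
    have "k \<odot>\<^bsub>hom_space K W V\<^esub> f \<in> lin K W V"
      by (rule linI) (simp_all add: hom_space_simps linD[OF f] k V.smult_r_distr K.m_comm flip: V.smult_assoc1)
    thus "k \<odot>\<^bsub>hom_space K W V\<^esub> f \<in> carrier (hom_space K W V)" by (simp add: hom_space_simps)
  next
    fix f assume "f \<in> carrier (hom_space K W V)"
    hence f: "f \<in> lin K W V" "f \<in> extensional (carrier W)" by (simp_all add: hom_space_simps)
    note L = linD[OF f(1)]
    show "\<zero>\<^bsub>hom_space K W V\<^esub> \<oplus>\<^bsub>hom_space K W V\<^esub> f = f"
      by (rule e) (simp_all add: hom_space_simps f L)
    show "\<one>\<^sub>K \<odot>\<^bsub>hom_space K W V\<^esub> f = f"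
      by (rule e) (simp_all add: hom_space_simps f L)
    show "\<zero>\<^sub>K \<odot>\<^bsub>hom_space K W V\<^esub> f = \<zero>\<^bsub>hom_space K W V\<^esub>"
      by (rule e) (simp_all add: hom_space_simps f L)
  next
    fix f g h assume a: "f \<in> carrier (hom_space K W V)" "g \<in> carrier (hom_space K W V)" "h \<in> carrier (hom_space K W V)"
    hence f: "f \<in> lin K W V" and g: "g \<in> lin K W V" and h: "h \<in> lin K W V" by (simp_all add: hom_space_simps)
    show "f \<oplus>\<^bsub>hom_space K W V\<^esub> g \<oplus>\<^bsub>hom_space K W V\<^esub> h = f \<oplus>\<^bsub>hom_space K W V\<^esub> (g \<oplus>\<^bsub>hom_space K W V\<^esub> h)"
      by (rule e) (simp_all add: hom_space_simps linD[OF f] linD[OF g] linD[OF h] V.a_assoc)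
  next
    fix f g assume a: "f \<in> carrier (hom_space K W V)" "g \<in> carrier (hom_space K W V)"
    hence f: "f \<in> lin K W V" and g: "g \<in> lin K W V" by (simp_all add: hom_space_simps)
    show "f \<oplus>\<^bsub>hom_space K W V\<^esub> g = g \<oplus>\<^bsub>hom_space K W V\<^esub> f"
      by (rule e) (simp_all add: hom_space_simps linD[OF f] linD[OF g] V.a_comm)
    fix k assume k: "k \<in> carrier K"
    show "k \<odot>\<^bsub>hom_space K W V\<^esub> (f \<oplus>\<^bsub>hom_space K W V\<^esub> g) = k \<odot>\<^bsub>hom_space K W V\<^esub> f \<oplus>\<^bsub>hom_space K W V\<^esub> k \<odot>\<^bsub>hom_space K W V\<^esub> g"
      by (rule e) (simp_all add: hom_space_simps linD[OF f] linD[OF g] k V.smult_r_distr)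
  next
    fix a b f assume ab: "a \<in> carrier K" "b \<in> carrier K" and "f \<in> carrier (hom_space K W V)"
    hence f: "f \<in> lin K W V" by (simp_all add: hom_space_simps)
    show "(a \<oplus>\<^sub>K b) \<odot>\<^bsub>hom_space K W V\<^esub> f = a \<odot>\<^bsub>hom_space K W V\<^esub> f \<oplus>\<^bsub>hom_space K W V\<^esub> b \<odot>\<^bsub>hom_space K W V\<^esub> f"
      by (rule e) (simp_all add: hom_space_simps linD[OF f] ab V.smult_l_distr)
    show "(a \<otimes>\<^sub>K b) \<odot>\<^bsub>hom_space K W V\<^esub> f = a \<odot>\<^bsub>hom_space K W V\<^esub> (b \<odot>\<^bsub>hom_space K W V\<^esub> f)"
      by (rule e) (simp_all add: hom_space_simps linD[OF f] ab V.smult_assoc1)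
  qed (rule K.is_cring)
qed

lemma finsum_hom_space:
  assumes "Module.module K W" "Module.module K V" "q \<in> S \<rightarrow> carrier (hom_space K W V)" "x \<in> carrier W"
  shows "(\<Oplus>\<^bsub>hom_space K W V\<^esub>s\<in>S. q s) x = (\<Oplus>\<^sub>V s\<in>S. q s x)"
proof -
  interpret H: Module.module K "hom_space K W V" by (rule module_hom_space[OF assms(1,2)])
  interpret V: Module.module K V by fact
  show ?thesis
    using additive_finsum[OF H.abelian_group_axioms V.abelian_group_axioms _ _ assms(3), of "%f. f x"] assms(4)
    by (simp add: hom_space_simps lin_def Pi_iff)
qed

text \<open>The maps \<open>x \<mapsto> c s x \<odot> t\<close>, for two dual bases, generate.\<close>

lemma finite_dim_hom_space:
  assumes "field K" "Module.module K W" "Module.module K V" "finite_dim K W" "finite_dim K V"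
  shows "finite_dim K (hom_space K W V)"
proof -
  interpret K: field K by fact
  interpret W: Module.module K W by fact
  interpret V: Module.module K V by fact
  let ?H = "hom_space K W V"
  note mH = module_hom_space[OF assms(2,3)]
  interpret H: Module.module K ?H by (rule mH)
  obtain S c where S: "dual_basis K W S c" using dual_basis_exists[OF assms(1,2,4)] by blast
  obtain T d where T: "dual_basis K V T d" using dual_basis_exists[OF assms(1,3,5)] by blast
  define E where "E s t = (\<lambda>x\<in>carrier W. c s x \<odot>\<^sub>V t)" for s t
  have EH: "E s v \<in> carrier ?H" if "s \<in> S" "v \<in> carrier V" for s v
  proof -
    note L = linD[OF dual_basisD(3)[OF S that(1)], simplified]
    have "E s v \<in> lin K W V"
      by (rule linI) (simp_all add: E_def L that V.smult_l_distr V.smult_assoc1)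
    thus ?thesis by (simp add: hom_space_simps E_def)
  qed
  let ?B = "(%(s,t). E s t) ` (S \<times> T)"
  have "finite ?B" using dual_basisD(1)[OF S] dual_basisD(1)[OF T] by simp
  moreover have "?B \<subseteq> carrier ?H" using EH dual_basisD(5)[OF T] by auto
  moreover have "carrier ?H \<subseteq> U" if U: "ksub K ?H U" "?B \<subseteq> U" for U
  proof
    fix q assume q: "q \<in> carrier ?H"
    hence ql: "q \<in> lin K W V" and qe: "q \<in> extensional (carrier W)" by (simp_all add: hom_space_simps)
    note L = linD[OF ql]
    have 1: "E s v \<in> U" if s: "s \<in> S" and v: "v \<in> carrier V" for s v
    proof -
      have "E s \<in> lin K V ?H"
      proof (rule linI)
        fix x assume "x \<in> carrier V"
        thus "E s x \<in> carrier ?H" by (rule EH[OF s])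
      next
        fix x y assume "x \<in> carrier V" "y \<in> carrier V"
        thus "E s (x \<oplus>\<^sub>V y) = E s x \<oplus>\<^sub>?H E s y"
          by (simp add: E_def hom_space_simps fun_eq_iff restrict_def V.smult_r_distr dual_basisD(6)[OF S s])
      next
        fix k x assume "k \<in> carrier K" "x \<in> carrier V"
        thus "E s (k \<odot>\<^sub>V x) = k \<odot>\<^sub>?H E s x"
          by (simp add: E_def hom_space_simps fun_eq_iff restrict_def dual_basisD(6)[OF S s] K.m_comm flip: V.smult_assoc1)
      qed
      note k = ksub_vimage[OF assms(3) mH this U(1)]
      have "T \<subseteq> {x \<in> carrier V. E s x \<in> U}" using U(2) s dual_basisD(5)[OF T] by auto
      from in_ksub_if_dual_basis[OF assms(3) T k this] v show ?thesis by auto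
    qed
    have "q = (\<Oplus>\<^sub>?H s\<in>S. E s (q s))"
    proof (rule extensionalityI[OF qe])
      have eh: "(%s. E s (q s)) \<in> S \<rightarrow> carrier ?H" using EH L(1) dual_basisD(5)[OF S] by auto
      hence "(\<Oplus>\<^sub>?H s\<in>S. E s (q s)) \<in> carrier ?H" by (rule H.finsum_closed)
      thus "(\<Oplus>\<^sub>?H s\<in>S. E s (q s)) \<in> extensional (carrier W)" by (simp add: hom_space_simps)
      fix x assume x: "x \<in> carrier W"
      have "q x = q (\<Oplus>\<^sub>W s\<in>S. c s x \<odot>\<^sub>W s)" using dual_basisD(4)[OF S x] by simp
      also have "\<dots> = (\<Oplus>\<^sub>V s\<in>S. q (c s x \<odot>\<^sub>W s))"
        by (rule lin_finsum[OF assms(2,3) ql]) (simp add: Pi_iff dual_basisD(5,6)[OF S] x)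
      also have "\<dots> = (\<Oplus>\<^sub>V s\<in>S. E s (q s) x)"
        by (rule V.finsum_cong') (simp_all add: Pi_iff E_def x L dual_basisD(5,6)[OF S])
      also have "\<dots> = (\<Oplus>\<^sub>?H s\<in>S. E s (q s)) x"
        by (rule finsum_hom_space[OF assms(2,3) eh x, symmetric])
      finally show "q x = (\<Oplus>\<^sub>?H s\<in>S. E s (q s)) x" .
    qed
    also have "\<dots> \<in> U"
      by (rule ksub_finsum[OF mH U(1)]) (simp add: Pi_iff 1 L(1) dual_basisD(5)[OF S])
    finally show "q \<in> U" .
  qed
  ultimately show ?thesis unfolding finite_dim_iff[OF mH] by blast
qed

section \<open>Modules over a finite dimensional algebra\<close>

lemma fdD:
  assumes "fd_rmodule K A M"
  shows "Module.module K M" "finite_dim K M"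
    "!!x a. x \<in> carrier M ==> a \<in> carrier A ==> x \<star>\<^sub>M a \<in> carrier M"
    "!!x y a. x \<in> carrier M ==> y \<in> carrier M ==> a \<in> carrier A ==>
        (x \<oplus>\<^sub>M y) \<star>\<^sub>M a = x \<star>\<^sub>M a \<oplus>\<^sub>M y \<star>\<^sub>M a"
    "!!x a b. x \<in> carrier M ==> a \<in> carrier A ==> b \<in> carrier A ==>
        x \<star>\<^sub>M (a \<oplus>\<^sub>A b) = x \<star>\<^sub>M a \<oplus>\<^sub>M x \<star>\<^sub>M b"
    "!!x a b. x \<in> carrier M ==> a \<in> carrier A ==> b \<in> carrier A ==>
        x \<star>\<^sub>M (a \<otimes>\<^sub>A b) = (x \<star>\<^sub>M a) \<star>\<^sub>M b"
    "!!x. x \<in> carrier M ==> x \<star>\<^sub>M \<one>\<^sub>A = x"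
    "!!x a k. x \<in> carrier M ==> a \<in> carrier A ==> k \<in> carrier K ==>
        x \<star>\<^sub>M (k \<odot>\<^sub>A a) = k \<odot>\<^sub>M (x \<star>\<^sub>M a)"
    "abelian_group M"
  using assms unfolding fd_rmodule_def by (auto dest: module.axioms)

lemma fdI:
  assumes "Module.module K M" "finite_dim K M"
    "!!x a. x \<in> carrier M ==> a \<in> carrier A ==> x \<star>\<^sub>M a \<in> carrier M"
    "!!x y a. x \<in> carrier M ==> y \<in> carrier M ==> a \<in> carrier A ==>
        (x \<oplus>\<^sub>M y) \<star>\<^sub>M a = x \<star>\<^sub>M a \<oplus>\<^sub>M y \<star>\<^sub>M a"
    "!!x a b. x \<in> carrier M ==> a \<in> carrier A ==> b \<in> carrier A ==>
        x \<star>\<^sub>M (a \<oplus>\<^sub>A b) = x \<star>\<^sub>M a \<oplus>\<^sub>M x \<star>\<^sub>M b"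
    "!!x a b. x \<in> carrier M ==> a \<in> carrier A ==> b \<in> carrier A ==>
        x \<star>\<^sub>M (a \<otimes>\<^sub>A b) = (x \<star>\<^sub>M a) \<star>\<^sub>M b"
    "!!x. x \<in> carrier M ==> x \<star>\<^sub>M \<one>\<^sub>A = x"
    "!!x a k. x \<in> carrier M ==> a \<in> carrier A ==> k \<in> carrier K ==>
        x \<star>\<^sub>M (k \<odot>\<^sub>A a) = k \<odot>\<^sub>M (x \<star>\<^sub>M a)"
  shows "fd_rmodule K A M"
  unfolding fd_rmodule_def using assms by blast

lemma rhomD:
  assumes "f \<in> rhom A M N"
  shows "!!x. x \<in> carrier M ==> f x \<in> carrier N"
    "!!x y. x \<in> carrier M ==> y \<in> carrier M ==> f (x \<oplus>\<^sub>M y) = f x \<oplus>\<^sub>N f y"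
    "!!a x. x \<in> carrier M ==> a \<in> carrier A ==> f (x \<star>\<^sub>M a) = f x \<star>\<^sub>N a"
  using assms unfolding rhom_def by auto

lemma rhomI:
  assumes "!!x. x \<in> carrier M ==> f x \<in> carrier N"
    "!!x y. x \<in> carrier M ==> y \<in> carrier M ==> f (x \<oplus>\<^sub>M y) = f x \<oplus>\<^sub>N f y"
    "!!a x. x \<in> carrier M ==> a \<in> carrier A ==> f (x \<star>\<^sub>M a) = f x \<star>\<^sub>N a"
  shows "f \<in> rhom A M N"
  using assms unfolding rhom_def by auto

lemma rhom_comp: "f \<in> rhom A L M ==> g \<in> rhom A M N ==> (%x. g (f x)) \<in> rhom A L N"
  by (rule rhomI) (simp_all add: rhomD)

lemma rhom_id: "(%x. x) \<in> rhom A M M"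
  by (rule rhomI) simp_all

lemma rhom_zero_map:
  assumes "fd_rmodule K A M" "fd_rmodule K A N"
  shows "f \<in> rhom A M N ==> f \<zero>\<^sub>M = \<zero>\<^sub>N"
  using additive_zero[of M N f] fdD(9)[OF assms(1)] fdD(9)[OF assms(2)] by (simp add: rhom_def)

lemma rhom_finsum:
  assumes "fd_rmodule K A M" "fd_rmodule K A N" "f \<in> rhom A M N" "g \<in> S \<rightarrow> carrier M"
  shows "f (\<Oplus>\<^sub>M i\<in>S. g i) = (\<Oplus>\<^sub>N i\<in>S. f (g i))"
  using additive_finsum[of M N f g S] fdD(9)[OF assms(1)] fdD(9)[OF assms(2)] assms(3,4)
  by (simp add: rhom_def)

lemma rhom_inj_iff:
  assumes "fd_rmodule K A M" "fd_rmodule K A N" "f \<in> rhom A M N"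
  shows "inj_on f (carrier M) \<longleftrightarrow> (\<forall>x\<in>carrier M. f x = \<zero>\<^sub>N --> x = \<zero>\<^sub>M)"
proof -
  interpret M: Module.module K M by (rule fdD[OF assms(1)])
  interpret N: Module.module K N by (rule fdD[OF assms(2)])
  note L = rhomD[OF assms(3)] and z = rhom_zero_map[OF assms]
  show ?thesis
  proof (intro iffI ballI impI)
    fix x assume "inj_on f (carrier M)" "x \<in> carrier M" "f x = \<zero>\<^sub>N"
    thus "x = \<zero>\<^sub>M" using z by (metis M.zero_closed inj_onD)
  next
    assume r: "\<forall>x\<in>carrier M. f x = \<zero>\<^sub>N --> x = \<zero>\<^sub>M"
    show "inj_on f (carrier M)"
    proof (rule inj_onI)
      fix x y assume h: "x \<in> carrier M" "y \<in> carrier M" "f x = f y"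
      have "f (x \<ominus>\<^sub>M y) \<oplus>\<^sub>N f y = f x"
        using h L(2)[of "x \<ominus>\<^sub>M y" y] by (simp add: a_minus_def M.a_assoc M.l_neg)
      hence "f (x \<ominus>\<^sub>M y) = \<zero>\<^sub>N" using h L(1) by simp
      hence "x \<ominus>\<^sub>M y = \<zero>\<^sub>M" using r h by simp
      thus "x = y" using minus_eq_zeroD[OF M.abelian_group_axioms] h by blast
    qed
  qed
qed

lemma rhom_inverse:
  assumes "fd_rmodule K A M" "f \<in> rhom A M N" "bij_betw f (carrier M) (carrier N)"
  shows "inv_into (carrier M) f \<in> rhom A N M"
proof -
  interpret M: Module.module K M by (rule fdD[OF assms(1)])
  note L = rhomD[OF assms(2)]
  let ?g = "inv_into (carrier M) f"
  have g: "?g y \<in> carrier M" "f (?g y) = y" if "y \<in> carrier N" for y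
    using that assms(3) bij_betw_inv_into_right[OF assms(3)] bij_betwE[OF bij_betw_inv_into[OF assms(3)]] by auto
  have f: "?g (f x) = x" if "x \<in> carrier M" for x
    using bij_betw_inv_into_left[OF assms(3) that] .
  show ?thesis
  proof (rule rhomI)
    fix x y assume h: "x \<in> carrier N" "y \<in> carrier N"
    have "?g (f (?g x \<oplus>\<^sub>M ?g y)) = ?g x \<oplus>\<^sub>M ?g y" using g(1) h by (intro f) simp
    thus "?g (x \<oplus>\<^sub>N y) = ?g x \<oplus>\<^sub>M ?g y" using h g L(2) by simp
  next
    fix a x assume h: "x \<in> carrier N" "a \<in> carrier A"
    have "?g (f (?g x \<star>\<^sub>M a)) = ?g x \<star>\<^sub>M a" using g(1) h by (intro f) (simp add: fdD(3)[OF assms(1)])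
    thus "?g (x \<star>\<^sub>N a) = ?g x \<star>\<^sub>M a" using h g L(3) by simp
  qed (rule g)
qed

text \<open>The ring axioms and the vector space axioms share their additive group, so an algebra is a ring, a
  module over \<open>K\<close>, and the two compatibilities of the scalar multiplication.\<close>

locale fd_algebra =
  fixes K :: "('k, 'c) ring_scheme" (structure) and A :: "('k, 'a) module"
  assumes fieldK: "field K" and ringA: "ring A" and moduleA: "Module.module K A"
    and fdA: "finite_dim K A"
    and smult_mult_l: "k \<in> carrier K ==> a \<in> carrier A ==> b \<in> carrier A ==>
       (k \<odot>\<^sub>A a) \<otimes>\<^sub>A b = k \<odot>\<^sub>A (a \<otimes>\<^sub>A b)"
    and smult_mult_r: "k \<in> carrier K ==> a \<in> carrier A ==> b \<in> carrier A ==>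
       a \<otimes>\<^sub>A (k \<odot>\<^sub>A b) = k \<odot>\<^sub>A (a \<otimes>\<^sub>A b)"
begin

abbreviation "AA \<equiv> regular_rmod A"
abbreviation "fdm \<equiv> fd_rmodule K A"
abbreviation "projm \<equiv> proj_rmod K A"
abbreviation "injm \<equiv> inj_rmod K A"

sublocale K: field K by (rule fieldK)
sublocale A: ring A by (rule ringA)
sublocale KA: Module.module K A by (rule moduleA)

lemma regular_simps [simp]:
  "carrier AA = carrier A" "zero AA = zero A"
  "add AA = add A" "smult AA = smult A"
  "ract AA = mult A"
  by (simp_all add: regular_rmod_def module.defs rmodule.defs)

lemma fd_regular: "fdm AA"
proof (rule fdI)
  show "Module.module K AA" by (rule module_cong[OF moduleA]) simp_all
  show "finite_dim K AA" by (rule finite_dim_cong[OF moduleA fdA]) simp_all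
qed (simp_all add: A.l_distr A.r_distr A.m_assoc smult_mult_r)

context
  fixes M :: "('k, 'a, 'v) rmodule"
  assumes M: "fdm M"
begin

interpretation M: Module.module K M by (rule fdD(1)[OF M])

text \<open>Scalars act through the algebra, so additive maps that commute with the action are linear, and
  submodules are subspaces.\<close>

lemma smult_conv_ract: "k \<in> carrier K ==> x \<in> carrier M ==> k \<odot>\<^sub>M x = x \<star>\<^sub>M (k \<odot>\<^sub>A \<one>\<^sub>A)"
  by (simp add: fdD(7,8)[OF M])

lemma smult_ract:
  "k \<in> carrier K ==> x \<in> carrier M ==> a \<in> carrier A ==> (k \<odot>\<^sub>M x) \<star>\<^sub>M a = k \<odot>\<^sub>M (x \<star>\<^sub>M a)"
  by (simp add: smult_conv_ract[of k x] smult_mult_l flip: fdD(6,8)[OF M])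

lemma zero_ract: "a \<in> carrier A ==> \<zero>\<^sub>M \<star>\<^sub>M a = \<zero>\<^sub>M"
  using additive_zero[OF fdD(9)[OF M] fdD(9)[OF M], of "%x. x \<star>\<^sub>M a"]
  by (simp add: fdD[OF M])

lemma ract_zero: "x \<in> carrier M ==> x \<star>\<^sub>M \<zero>\<^sub>A = \<zero>\<^sub>M"
  using additive_zero[OF A.abelian_group_axioms fdD(9)[OF M], of "%a. x \<star>\<^sub>M a"]
  by (simp add: fdD[OF M])

lemma finsum_ract:
  "f \<in> S \<rightarrow> carrier M ==> a \<in> carrier A ==> (\<Oplus>\<^sub>M i\<in>S. f i) \<star>\<^sub>M a = (\<Oplus>\<^sub>M i\<in>S. f i \<star>\<^sub>M a)"
  using additive_finsum[OF fdD(9)[OF M] fdD(9)[OF M], of "%x. x \<star>\<^sub>M a" f S]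
  by (simp add: fdD[OF M])

lemma ract_finsum:
  "f \<in> S \<rightarrow> carrier A ==> x \<in> carrier M ==> x \<star>\<^sub>M (\<Oplus>\<^sub>A i\<in>S. f i) = (\<Oplus>\<^sub>M i\<in>S. x \<star>\<^sub>M f i)"
  using additive_finsum[OF A.abelian_group_axioms fdD(9)[OF M], of "%a. x \<star>\<^sub>M a" f S]
  by (simp add: fdD[OF M])

lemma ract_lin: "a \<in> carrier A ==> (%x. x \<star>\<^sub>M a) \<in> lin K M M"
  by (rule linI) (simp_all add: fdD(3,4)[OF M] smult_ract)

lemma lin_ract: "x \<in> carrier M ==> (%a. x \<star>\<^sub>M a) \<in> lin K A M"
  by (rule linI) (simp_all add: fdD[OF M])

lemma submod_iff:
  "submod A M U \<longleftrightarrow> ksub K M U \<and> (\<forall>u\<in>U. \<forall>a\<in>carrier A. u \<star>\<^sub>M a \<in> U)"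
proof
  assume u: "submod A M U"
  hence ag: "additive_subgroup U M" and cl: "!!u a. u \<in> U ==> a \<in> carrier A ==> u \<star>\<^sub>M a \<in> U"
    by (simp_all add: submod_def)
  interpret U: additive_subgroup U M by fact
  have "k \<odot>\<^sub>M x \<in> U" if "k \<in> carrier K" "x \<in> U" for k x
    using cl[OF that(2), of "k \<odot>\<^sub>A \<one>\<^sub>A"] that U.a_Hcarr by (simp add: smult_conv_ract)
  hence "ksub K M U" using U.a_subset by (simp add: ksub_def)
  thus "ksub K M U \<and> (\<forall>u\<in>U. \<forall>a\<in>carrier A. u \<star>\<^sub>M a \<in> U)" using cl by blast
qed (simp add: submod_def ksub_additive_subgroup[OF fdD(1)[OF M]])

lemma fd_submod:
  assumes "submod A M U"
  shows "fdm (M\<lparr>carrier := U\<rparr>)"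
proof (rule fdI)
  have k: "ksub K M U" and cl: "!!u a. u \<in> U ==> a \<in> carrier A ==> u \<star>\<^sub>M a \<in> U"
    using assms by (simp_all add: submod_iff)
  note u = ksubD(5)[OF k]
  show "Module.module K (M\<lparr>carrier := U\<rparr>)" by (rule module_ksub[OF fdD(1)[OF M] k])
  show "finite_dim K (M\<lparr>carrier := U\<rparr>)" by (rule finite_dim_ksub[OF fieldK fdD(1)[OF M] k fdD(2)[OF M]])
qed (use assms in \<open>simp_all add: submod_iff fdD(4-8)[OF M] ksubD(5)[of K M U]\<close>)

text \<open>A linear retraction \<open>r\<close> onto \<open>U\<close> identifies the quotient with the image of \<open>x \<mapsto> x - r x\<close>. In this way
  the quotient lives on the same type as the module.\<close>

lemma quotient_exists:
  assumes "submod A M U"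
  shows "\<exists>(Q :: ('k, 'a, 'v) rmodule) p. fdm Q \<and> p \<in> rhom A M Q \<and>
     p ` carrier M = carrier Q \<and> rker M Q p = U"
proof -
  have k: "ksub K M U" and cl: "!!u a. u \<in> U ==> a \<in> carrier A ==> u \<star>\<^sub>M a \<in> U"
    using assms by (simp_all add: submod_iff)
  note u = ksubD(5)[OF k] note mM = fdD(1)[OF M]
  obtain r where r: "r \<in> lin K M M" "r ` carrier M \<subseteq> U" "\<forall>x\<in>U. r x = x"
    using linear_retraction[OF fieldK mM k] by blast
  note R = linD[OF r(1)]
  define p where "p x = x \<ominus>\<^sub>M r x" for x
  have rU: "r x \<in> U" if "x \<in> carrier M" for x using r(2) that by blast
  have pc: "p x \<in> carrier M" if "x \<in> carrier M" for x using that R by (simp add: p_def)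
  have padd: "p (x \<oplus>\<^sub>M y) = p x \<oplus>\<^sub>M p y" if "x \<in> carrier M" "y \<in> carrier M" for x y
    using that R by (simp add: p_def a_minus_def M.minus_add M.a_ac)
  have psm: "p (c \<odot>\<^sub>M x) = c \<odot>\<^sub>M p x" if "x \<in> carrier M" "c \<in> carrier K" for x c
    using that R by (simp add: p_def a_minus_def M.smult_r_distr M.smult_r_minus)
  have pU: "p x = \<zero>\<^sub>M" if "x \<in> U" for x using that r(3) u by (simp add: p_def a_minus_def M.r_neg)
  have dec: "x = p x \<oplus>\<^sub>M r x" if "x \<in> carrier M" for x
    using that R by (simp add: p_def a_minus_def M.a_assoc M.l_neg)
  have pU2: "x \<in> U" if "x \<in> carrier M" "p x = \<zero>\<^sub>M" for x
    using dec[OF that(1)] that R(1) rU by (metis M.l_zero)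
  have pp: "p (p x) = p x" if x: "x \<in> carrier M" for x
  proof -
    have "p x = p (p x \<oplus>\<^sub>M r x)" using dec[OF x] by simp
    also have "\<dots> = p (p x)" using x pc padd pU rU R by simp
    finally show ?thesis by simp
  qed
  have pact: "p (p x \<star>\<^sub>M a) = p (x \<star>\<^sub>M a)" if "x \<in> carrier M" "a \<in> carrier A" for x a
  proof -
    have "p (x \<star>\<^sub>M a) = p (p x \<star>\<^sub>M a \<oplus>\<^sub>M r x \<star>\<^sub>M a)"
      using dec[OF that(1)] that pc R by (metis fdD(4)[OF M])
    also have "\<dots> = p (p x \<star>\<^sub>M a)" using that pc R padd pU cl rU by (simp add: fdD(3)[OF M])
    finally show ?thesis by simp
  qed
  let ?C = "p ` carrier M"
  have kC: "ksub K M ?C"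
    by (rule ksub_image[OF mM mM]) (rule linI, simp_all add: pc padd psm)
  define Q where "Q = M\<lparr>carrier := ?C, ract := (%x a. p (x \<star>\<^sub>M a))\<rparr>"
  have Qs: "carrier Q = ?C" "zero Q = zero M" "add Q = add M" "smult Q = smult M"
    "ract Q = (%x a. p (x \<star>\<^sub>M a))" by (simp_all add: Q_def)
  have cC: "x \<in> carrier M" "p x = x" if "x \<in> ?C" for x using that pc pp by auto
  have "fdm Q"
  proof (rule fdI)
    show "Module.module K Q" by (rule module_cong[OF module_ksub[OF mM kC]]) (simp_all add: Qs)
    show "finite_dim K Q"
      by (rule finite_dim_cong[OF module_ksub[OF mM kC] finite_dim_ksub[OF fieldK mM kC fdD(2)[OF M]]])
        (simp_all add: Qs)
  next
    fix x a assume "x \<in> carrier Q" and a: "a \<in> carrier A"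
    hence x: "x \<in> carrier M" "p x = x" using cC unfolding Qs by blast+
    show "x \<star>\<^sub>Q a \<in> carrier Q" unfolding Qs by (intro imageI fdD(3)[OF M] x a)
    show "x \<star>\<^sub>Q (a \<oplus>\<^sub>A b) = x \<star>\<^sub>Q a \<oplus>\<^sub>Q x \<star>\<^sub>Q b" if b: "b \<in> carrier A" for b
      unfolding Qs using x a b by (simp add: fdD(3,5)[OF M] padd)
    show "x \<star>\<^sub>Q (a \<otimes>\<^sub>A b) = x \<star>\<^sub>Q a \<star>\<^sub>Q b" if b: "b \<in> carrier A" for b
      unfolding Qs using x a b by (simp add: fdD(3,6)[OF M] pact)
    show "x \<star>\<^sub>Q (c \<odot>\<^sub>A a) = c \<odot>\<^sub>Q (x \<star>\<^sub>Q a)" if c: "c \<in> carrier K" for c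
      unfolding Qs using x a c by (simp add: fdD(3,8)[OF M] psm)
  next
    fix x y a assume "x \<in> carrier Q" "y \<in> carrier Q" and a: "a \<in> carrier A"
    hence x: "x \<in> carrier M" and y: "y \<in> carrier M" using cC unfolding Qs by blast+
    show "(x \<oplus>\<^sub>Q y) \<star>\<^sub>Q a = x \<star>\<^sub>Q a \<oplus>\<^sub>Q y \<star>\<^sub>Q a"
      unfolding Qs using x y a by (simp add: fdD(3,4)[OF M] padd)
  next
    fix x assume "x \<in> carrier Q"
    hence x: "x \<in> carrier M" "p x = x" using cC unfolding Qs by blast+
    show "x \<star>\<^sub>Q \<one>\<^sub>A = x" unfolding Qs using x by (simp add: fdD(7)[OF M])
  qed
  moreover have "p \<in> rhom A M Q"
    by (rule rhomI) (simp_all add: Qs padd pact)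
  moreover have "rker M Q p = U" using pU pU2 u by (auto simp: rker_def Qs)
  ultimately show ?thesis using Qs(1) by blast
qed

text \<open>Injectivity, projectivity and resolutions only speak about modules with elements of type
  \<open>nat \<Rightarrow> 'k\<close>. The coordinates in a finite basis transport any module there.\<close>

lemma nat_copy_exists:
  "\<exists>(N :: ('k, 'a, nat => 'k) rmodule) c. fdm N \<and> c \<in> rhom A M N \<and>
     bij_betw c (carrier M) (carrier N)"
proof -
  note mM = fdD(1)[OF M]
  obtain S c where S: "dual_basis K M S c" using dual_basis_exists[OF fieldK mM fdD(2)[OF M]] by blast
  note D = dual_basisD[OF S]
  obtain e where e: "S = e ` {i::nat. i < card S}" using finite_imp_nat_seg_image_inj_on[OF D(1)]
    by (metis card_Collect_less_nat card_image)
  define t where "t x = (%i. if i < card S then c (e i) x else \<zero>)" for x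
  have inj: "inj_on t (carrier M)"
  proof (rule inj_onI)
    fix x y assume h: "x \<in> carrier M" "y \<in> carrier M" "t x = t y"
    have ti: "c (e i) x = c (e i) y" if "i < card S" for i
      using fun_cong[OF h(3), of i] that by (simp add: t_def)
    have "c s x = c s y" if "s \<in> S" for s
    proof -
      from that e have "s \<in> e ` {i. i < card S}" by metis
      then obtain i where "i < card S" "s = e i" by blast
      thus ?thesis using ti by simp
    qed
    hence "(\<Oplus>\<^sub>M s\<in>S. c s x \<odot>\<^sub>M s) = (\<Oplus>\<^sub>M s\<in>S. c s y \<odot>\<^sub>M s)"
      using D h by (intro M.finsum_cong') (simp_all add: Pi_iff)
    thus "x = y" using D(4) h by simp
  qed
  define v where "v = inv_into (carrier M) t"
  have vt: "v (t x) = x" if "x \<in> carrier M" for x using inj that by (simp add: v_def)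
  define N :: "('k, 'a, nat => 'k) rmodule" where
    "N = \<lparr>carrier = t ` carrier M, mult = undefined, one = undefined, zero = t \<zero>\<^sub>M,
       add = (%x y. t (v x \<oplus>\<^sub>M v y)), smult = (%k x. t (k \<odot>\<^sub>M v x)),
       ract = (%x a. t (v x \<star>\<^sub>M a))\<rparr>"
  have Ns: "carrier N = t ` carrier M" "zero N = t \<zero>\<^sub>M" "x \<oplus>\<^sub>N y = t (v x \<oplus>\<^sub>M v y)"
    "k \<odot>\<^sub>N x = t (k \<odot>\<^sub>M v x)" "x \<star>\<^sub>N a = t (v x \<star>\<^sub>M a)" for x y k a
    by (simp_all add: N_def)
  have mN: "Module.module K N"
    by (rule module_intro) (auto simp: Ns vt K.is_cring M.a_ac M.smult_l_distr
      M.smult_r_distr M.smult_assoc1)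
  have tl: "t \<in> lin K M N" by (rule linI) (simp_all add: Ns vt)
  have "fdm N"
  proof (rule fdI[OF mN])
    show "finite_dim K N"
      by (rule finite_dim_image[OF mM mN tl _ fdD(2)[OF M]]) (simp add: Ns)
  qed (auto simp: Ns vt fdD(3-8)[OF M])
  moreover have "t \<in> rhom A M N" by (rule rhomI) (simp_all add: Ns vt)
  moreover have "bij_betw t (carrier M) (carrier N)" using inj by (simp add: bij_betw_def Ns)
  ultimately show ?thesis by blast
qed

end

lemma rhom_lin:
  assumes "fdm M" "fdm N" "f \<in> rhom A M N"
  shows "f \<in> lin K M N"
proof -
  have "k \<odot>\<^sub>A \<one>\<^sub>A \<in> carrier A" if "k \<in> carrier K" for k using that by simp
  thus ?thesis
    by (intro linI) (simp_all add: rhomD[OF assms(3)] smult_conv_ract[OF assms(1)] smult_conv_ract[OF assms(2)])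
qed

lemma submod_image:
  assumes "fdm M" "fdm N" "f \<in> rhom A M N"
  shows "submod A N (f ` carrier M)"
proof -
  have "f x \<star>\<^sub>N a \<in> f ` carrier M" if "x \<in> carrier M" "a \<in> carrier A" for x a
    using rhomD(3)[OF assms(3) that] fdD(3)[OF assms(1) that] by (metis imageI)
  thus ?thesis
    unfolding submod_iff[OF assms(2)]
    using ksub_image[OF fdD(1)[OF assms(1)] fdD(1)[OF assms(2)] rhom_lin[OF assms]] by blast
qed

lemma submod_vimage:
  assumes "fdm M" "fdm N" "f \<in> rhom A M N" "submod A N U"
  shows "submod A M {x \<in> carrier M. f x \<in> U}"
  unfolding submod_iff[OF assms(1)]
  using ksub_vimage[OF fdD(1)[OF assms(1)] fdD(1)[OF assms(2)] rhom_lin[OF assms(1-3)], of U]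
    assms(4)[unfolded submod_iff[OF assms(2)]]
  by (simp add: fdD(3)[OF assms(1)] rhomD[OF assms(3)])

lemma submod_zero: "fdm M ==> submod A M {\<zero>\<^sub>M}"
proof -
  assume M: "fdm M"
  interpret M: Module.module K M by (rule fdD(1)[OF M])
  show ?thesis by (simp add: submod_iff[OF M] ksub_def zero_ract[OF M])
qed

lemma submod_carrier: "fdm M ==> submod A M (carrier M)"
  using submod_image[OF _ _ rhom_id] by fastforce

lemma submod_rker:
  assumes "fdm M" "fdm N" "f \<in> rhom A M N"
  shows "submod A M (rker M N f)"
  using submod_vimage[OF assms submod_zero[OF assms(2)]] by (simp add: rker_def)

lemma submodD:
  assumes "fdm M" "submod A M U"
  shows "!!x. x \<in> U ==> x \<in> carrier M" "\<zero>\<^sub>M \<in> U" "!!x y. x \<in> U ==> y \<in> U ==> x \<oplus>\<^sub>M y \<in> U"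
    "!!k x. k \<in> carrier K ==> x \<in> U ==> k \<odot>\<^sub>M x \<in> U" "!!a x. a \<in> carrier A ==> x \<in> U ==> x \<star>\<^sub>M a \<in> U"
  using assms(2) unfolding submod_iff[OF assms(1)] ksub_def by auto

lemma submodI:
  assumes "fdm M" "U \<subseteq> carrier M" "\<zero>\<^sub>M \<in> U" "!!x y. x \<in> U ==> y \<in> U ==> x \<oplus>\<^sub>M y \<in> U"
    "!!a x. a \<in> carrier A ==> x \<in> U ==> x \<star>\<^sub>M a \<in> U"
  shows "submod A M U"
proof -
  have "k \<odot>\<^sub>M x \<in> U" if "k \<in> carrier K" "x \<in> U" for k x
    using assms(5)[of "k \<odot>\<^sub>A \<one>\<^sub>A" x] that assms(2) smult_conv_ract[OF assms(1), of k x] by auto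
  thus ?thesis using assms(2-5) by (simp add: submod_iff[OF assms(1)] ksub_def)
qed

lemma fd_rmod_sum:
  assumes M: "fdm M" and N: "fdm N"
  shows "fdm (rmod_sum M N)"
proof -
  interpret M: Module.module K M by (rule fdD(1)[OF M])
  interpret N: Module.module K N by (rule fdD(1)[OF N])
  have m: "Module.module K (rmod_sum M N)"
    by (rule module_intro) (auto simp: rmod_sum_def K.is_cring M.a_ac N.a_ac M.smult_l_distr
       N.smult_l_distr M.smult_r_distr N.smult_r_distr M.smult_assoc1 N.smult_assoc1)
  obtain S where S: "finite S" "S \<subseteq> carrier M" "!!U. ksub K M U ==> S \<subseteq> U ==> carrier M \<subseteq> U"
    using fdD(2)[OF M] finite_dim_iff[OF fdD(1)[OF M]] by blast
  obtain T where T: "finite T" "T \<subseteq> carrier N" "!!U. ksub K N U ==> T \<subseteq> U ==> carrier N \<subseteq> U"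
    using fdD(2)[OF N] finite_dim_iff[OF fdD(1)[OF N]] by blast
  let ?B = "(%x. (x, \<zero>\<^sub>N)) ` S \<union> (%y. (\<zero>\<^sub>M, y)) ` T"
  have i1: "(%x. (x, \<zero>\<^sub>N)) \<in> lin K M (rmod_sum M N)" by (rule linI) (simp_all add: rmod_sum_def)
  have i2: "(%y. (\<zero>\<^sub>M, y)) \<in> lin K N (rmod_sum M N)" by (rule linI) (simp_all add: rmod_sum_def)
  have "carrier (rmod_sum M N) \<subseteq> U" if U: "ksub K (rmod_sum M N) U" "?B \<subseteq> U" for U
  proof
    fix z assume "z \<in> carrier (rmod_sum M N)"
    then obtain x y where z: "z = (x, y)" "x \<in> carrier M" "y \<in> carrier N" by (auto simp: rmod_sum_def)
    have "S \<subseteq> {x \<in> carrier M. (x, \<zero>\<^sub>N) \<in> U}" using U(2) S(2) by blast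
    from S(3)[OF ksub_vimage[OF fdD(1)[OF M] m i1 U(1)] this] z
    have "(x, \<zero>\<^sub>N) \<in> U" by blast
    moreover have "T \<subseteq> {y \<in> carrier N. (\<zero>\<^sub>M, y) \<in> U}" using U(2) T(2) by blast
    from T(3)[OF ksub_vimage[OF fdD(1)[OF N] m i2 U(1)] this] z
    have "(\<zero>\<^sub>M, y) \<in> U" by blast
    ultimately have "(x, \<zero>\<^sub>N) \<oplus>\<^bsub>rmod_sum M N\<^esub> (\<zero>\<^sub>M, y) \<in> U" by (rule ksubD(3)[OF U(1)])
    thus "z \<in> U" using z by (simp add: rmod_sum_def)
  qed
  moreover have "finite ?B" "?B \<subseteq> carrier (rmod_sum M N)" using S(1,2) T(1,2) by (auto simp: rmod_sum_def)
  ultimately have "finite_dim K (rmod_sum M N)" unfolding finite_dim_iff[OF m] by blast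
  with m show ?thesis
    by (rule fdI) (auto simp: rmod_sum_def fdD(3-8)[OF M] fdD(3-8)[OF N])
qed

end

section \<open>Injective and projective modules\<close>

text \<open>Modules that embed into a product of copies of the algebra. To show that a module is not projective, it
  suffices to show that it is not torsionless.\<close>

definition torsionless :: "('k, 'a) module => ('k, 'a, 'v) rmodule => bool" where
  "torsionless A E \<longleftrightarrow> (\<forall>x\<in>carrier E. x ~= \<zero>\<^sub>E --> (\<exists>\<phi>\<in>rhom A E (regular_rmod A). \<phi> x ~= \<zero>\<^sub>A))"

context fd_algebra
begin

lemma inj_fd: "injm I ==> fdm I"
  by (simp add: inj_rmod_def)

lemma proj_fd: "projm I ==> fdm I"
  by (simp add: proj_rmod_def)

text \<open>The extension property for modules on arbitrary types, by transport to \<open>nat \<Rightarrow> 'k\<close>.\<close>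

lemma inj_extend:
  fixes X :: "('k, 'a, 'x) rmodule" and Y :: "('k, 'a, 'y) rmodule"
  assumes I: "injm I" and X: "fdm X" and Y: "fdm Y"
    and f: "f \<in> rhom A X Y" "inj_on f (carrier X)" and g: "g \<in> rhom A X I"
  shows "\<exists>h\<in>rhom A Y I. \<forall>x\<in>carrier X. h (f x) = g x"
proof -
  obtain X' :: "('k, 'a, nat => 'k) rmodule" and c where
    X': "fdm X'" "c \<in> rhom A X X'" "bij_betw c (carrier X) (carrier X')"
    using nat_copy_exists[OF X] by blast
  obtain Y' :: "('k, 'a, nat => 'k) rmodule" and e where
    Y': "fdm Y'" "e \<in> rhom A Y Y'" "bij_betw e (carrier Y) (carrier Y')"
    using nat_copy_exists[OF Y] by blast
  let ?c = "inv_into (carrier X) c"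
  have ci: "?c \<in> rhom A X' X" by (rule rhom_inverse[OF X X'(2,3)])
  have cb: "bij_betw ?c (carrier X') (carrier X)" by (rule bij_betw_inv_into[OF X'(3)])
  have f': "(%x. e (f (?c x))) \<in> rhom A X' Y'"
    by (intro rhom_comp[OF _ Y'(2)] rhom_comp[OF ci f(1)])
  have i': "inj_on (%x. e (f (?c x))) (carrier X')"
  proof (rule inj_onI)
    fix x y assume h: "x \<in> carrier X'" "y \<in> carrier X'" "e (f (?c x)) = e (f (?c y))"
    have cc: "?c x \<in> carrier X" "?c y \<in> carrier X" using rhomD(1)[OF ci] h by blast+
    have "f (?c x) = f (?c y)"
      using inj_onD[OF bij_betw_imp_inj_on[OF Y'(3)] h(3)] rhomD(1)[OF f(1)] cc by blast
    hence "?c x = ?c y" using inj_onD[OF f(2)] cc by blast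
    thus "x = y" using inj_onD[OF bij_betw_imp_inj_on[OF cb]] h by blast
  qed
  have g': "(%x. g (?c x)) \<in> rhom A X' I" by (rule rhom_comp[OF ci g])
  obtain h where h: "h \<in> rhom A Y' I" "\<forall>x\<in>carrier X'. h (e (f (?c x))) = g (?c x)"
    using I X'(1) Y'(1) f' i' g' unfolding inj_rmod_def by meson
  have "h (e (f x)) = g x" if "x \<in> carrier X" for x
    using h(2) rhomD(1)[OF X'(2) that] bij_betw_inv_into_left[OF X'(3) that] by force
  thus ?thesis by (intro bexI[OF _ rhom_comp[OF Y'(2) h(1)]]) simp
qed

lemma proj_lift:
  fixes X :: "('k, 'a, 'x) rmodule" and Y :: "('k, 'a, 'y) rmodule"
  assumes P: "projm P" and X: "fdm X" and Y: "fdm Y"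
    and f: "f \<in> rhom A X Y" "f ` carrier X = carrier Y" and g: "g \<in> rhom A P Y"
  shows "\<exists>h\<in>rhom A P X. \<forall>x\<in>carrier P. f (h x) = g x"
proof -
  obtain X' :: "('k, 'a, nat => 'k) rmodule" and c where
    X': "fdm X'" "c \<in> rhom A X X'" "bij_betw c (carrier X) (carrier X')"
    using nat_copy_exists[OF X] by blast
  obtain Y' :: "('k, 'a, nat => 'k) rmodule" and e where
    Y': "fdm Y'" "e \<in> rhom A Y Y'" "bij_betw e (carrier Y) (carrier Y')"
    using nat_copy_exists[OF Y] by blast
  let ?c = "inv_into (carrier X) c"
  have ci: "?c \<in> rhom A X' X" by (rule rhom_inverse[OF X X'(2,3)])
  have cb: "bij_betw ?c (carrier X') (carrier X)" by (rule bij_betw_inv_into[OF X'(3)])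
  have f': "(%x. e (f (?c x))) \<in> rhom A X' Y'"
    by (intro rhom_comp[OF _ Y'(2)] rhom_comp[OF ci f(1)])
  have "(%x. e (f (?c x))) ` carrier X' = e ` f ` ?c ` carrier X'" by (simp add: image_image)
  also have "\<dots> = carrier Y'"
    using bij_betw_imp_surj_on[OF cb] f(2) bij_betw_imp_surj_on[OF Y'(3)] by simp
  finally have s': "(%x. e (f (?c x))) ` carrier X' = carrier Y'" .
  have g': "(%x. e (g x)) \<in> rhom A P Y'" by (rule rhom_comp[OF g Y'(2)])
  obtain h where h: "h \<in> rhom A P X'" "\<forall>x\<in>carrier P. e (f (?c (h x))) = e (g x)"
    using P X'(1) Y'(1) f' s' g' unfolding proj_rmod_def by meson
  have "f (?c (h x)) = g x" if x: "x \<in> carrier P" for x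
  proof (rule inj_onD[OF bij_betw_imp_inj_on[OF Y'(3)]])
    show "e (f (?c (h x))) = e (g x)" using h(2) x by blast
    show "f (?c (h x)) \<in> carrier Y" by (intro rhomD(1)[OF f(1)] rhomD(1)[OF ci] rhomD(1)[OF h(1)] x)
    show "g x \<in> carrier Y" by (rule rhomD(1)[OF g x])
  qed
  thus ?thesis by (intro bexI[OF _ rhom_comp[OF h(1) ci]]) simp
qed

lemma inj_retract:
  assumes "injm I" "fdm J" "i \<in> rhom A J I" "r \<in> rhom A I J"
    "!!x. x \<in> carrier J ==> r (i x) = x"
  shows "injm J"
  unfolding inj_rmod_def
proof (intro conjI allI impI)
  fix X Y :: "('k, 'a, nat => 'k) rmodule" and f g
  assume h: "fdm X" "fdm Y" "f \<in> rhom A X Y" "inj_on f (carrier X)" "g \<in> rhom A X J"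
  obtain q where q: "q \<in> rhom A Y I" "\<forall>x\<in>carrier X. q (f x) = i (g x)"
    using inj_extend[OF assms(1) h(1-4) rhom_comp[OF h(5) assms(3)]] by blast
  have "r (q (f x)) = g x" if "x \<in> carrier X" for x
    using q(2) that assms(5)[OF rhomD(1)[OF h(5) that]] by simp
  thus "\<exists>h\<in>rhom A Y J. \<forall>x\<in>carrier X. h (f x) = g x"
    by (intro bexI[OF _ rhom_comp[OF q(1) assms(4)]]) simp
qed (rule assms(2))

lemma proj_retract:
  assumes "projm I" "fdm J" "i \<in> rhom A J I" "r \<in> rhom A I J"
    "!!x. x \<in> carrier J ==> r (i x) = x"
  shows "projm J"
  unfolding proj_rmod_def
proof (intro conjI allI impI)
  fix X Y :: "('k, 'a, nat => 'k) rmodule" and f g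
  assume h: "fdm X" "fdm Y" "f \<in> rhom A X Y" "f ` carrier X = carrier Y" "g \<in> rhom A J Y"
  obtain q where q: "q \<in> rhom A I X" "\<forall>x\<in>carrier I. f (q x) = g (r x)"
    using proj_lift[OF assms(1) h(1-4) rhom_comp[OF assms(4) h(5)]] by blast
  have "f (q (i x)) = g x" if "x \<in> carrier J" for x
    using q(2) rhomD(1)[OF assms(3) that] assms(5)[OF that] by simp
  thus "\<exists>h\<in>rhom A J X. \<forall>x\<in>carrier J. f (h x) = g x"
    by (intro bexI[OF _ rhom_comp[OF assms(3) q(1)]]) simp
qed (rule assms(2))

lemma inj_iso:
  assumes "injm I" "fdm J" "f \<in> rhom A I J" "bij_betw f (carrier I) (carrier J)"
  shows "injm J"
  by (rule inj_retract[OF assms(1,2) rhom_inverse[OF inj_fd[OF assms(1)] assms(3,4)] assms(3)])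
    (rule bij_betw_inv_into_right[OF assms(4)])

lemma proj_iso:
  assumes "projm I" "fdm J" "f \<in> rhom A I J" "bij_betw f (carrier I) (carrier J)"
  shows "projm J"
  by (rule proj_retract[OF assms(1,2) rhom_inverse[OF proj_fd[OF assms(1)] assms(3,4)] assms(3)])
    (rule bij_betw_inv_into_right[OF assms(4)])

lemma generator_hom:
  assumes "fdm X" "x \<in> carrier X" "\<phi> \<in> rhom A E AA"
  shows "(%y. x \<star>\<^sub>X \<phi> y) \<in> rhom A E X"
  using rhomD[OF assms(3), simplified]
  by (intro rhomI) (simp_all add: fdD[OF assms(1)] assms(2))

lemma rhom_sum:
  assumes "fdm X" "finite T" "!!t. t \<in> T ==> f t \<in> rhom A E X"
  shows "(%y. \<Oplus>\<^sub>X t\<in>T. f t y) \<in> rhom A E X"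
proof -
  interpret X: Module.module K X by (rule fdD(1)[OF assms(1)])
  note R = rhomD[OF assms(3)]
  show ?thesis
  proof (rule rhomI)
    fix y assume "y \<in> carrier E"
    thus "(\<Oplus>\<^sub>X t\<in>T. f t y) \<in> carrier X" using R(1) by (intro X.finsum_closed) simp
  next
    fix y z assume yz: "y \<in> carrier E" "z \<in> carrier E"
    have "(\<Oplus>\<^sub>X t\<in>T. f t (y \<oplus>\<^sub>E z)) = (\<Oplus>\<^sub>X t\<in>T. f t y \<oplus>\<^sub>X f t z)"
      using R yz by (intro X.finsum_cong') simp_all
    thus "(\<Oplus>\<^sub>X t\<in>T. f t (y \<oplus>\<^sub>E z)) = (\<Oplus>\<^sub>X t\<in>T. f t y) \<oplus>\<^sub>X (\<Oplus>\<^sub>X t\<in>T. f t z)"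
      using X.finsum_addf[of "%t. f t y" T "%t. f t z"] R(1) yz by simp
  next
    fix a y assume ay: "y \<in> carrier E" "a \<in> carrier A"
    have "(\<Oplus>\<^sub>X t\<in>T. f t (y \<star>\<^sub>E a)) = (\<Oplus>\<^sub>X t\<in>T. f t y \<star>\<^sub>X a)"
      using R ay by (intro X.finsum_cong') (simp_all add: fdD[OF assms(1)])
    thus "(\<Oplus>\<^sub>X t\<in>T. f t (y \<star>\<^sub>E a)) = (\<Oplus>\<^sub>X t\<in>T. f t y) \<star>\<^sub>X a"
      using finsum_ract[OF assms(1), of "%t. f t y" T a] R(1) ay by simp
  qed
qed

text \<open>The dual basis lemma: a system of generators with coordinate homomorphisms splits
  every epimorphism.\<close>

lemma proj_if_dual_basis:
  assumes E: "fdm E" and T: "finite T" "!!t. t \<in> T ==> x t \<in> carrier E"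
    "!!t. t \<in> T ==> \<phi> t \<in> rhom A E AA"
    "!!y. y \<in> carrier E ==> y = (\<Oplus>\<^sub>E t\<in>T. x t \<star>\<^sub>E \<phi> t y)"
  shows "projm E"
  unfolding proj_rmod_def
proof (intro conjI allI impI)
  fix X Y :: "('k, 'a, nat => 'k) rmodule" and f g
  assume X: "fdm X" and Y: "fdm Y" and f: "f \<in> rhom A X Y"
    and s: "f ` carrier X = carrier Y" and g: "g \<in> rhom A E Y"
  interpret Y: Module.module K Y by (rule fdD(1)[OF Y])
  have "\<exists>w. w \<in> carrier X \<and> f w = g (x t)" if "t \<in> T" for t
  proof -
    have "g (x t) \<in> f ` carrier X" using rhomD(1)[OF g T(2)[OF that]] s by simp
    then obtain w where "g (x t) = f w" "w \<in> carrier X" by (rule imageE)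
    thus ?thesis by (intro exI[of _ w]) simp
  qed
  hence "\<forall>t. \<exists>w. t \<in> T --> w \<in> carrier X \<and> f w = g (x t)" by blast
  from choice[OF this] obtain w where w: "!!t. t \<in> T ==> w t \<in> carrier X" "!!t. t \<in> T ==> f (w t) = g (x t)" by blast
  define h where "h y = (\<Oplus>\<^sub>X t\<in>T. w t \<star>\<^sub>X \<phi> t y)" for y
  have "h \<in> rhom A E X" unfolding h_def
    by (intro rhom_sum[OF X T(1)] generator_hom[OF X] w(1) T(3))
  moreover have "f (h y) = g y" if y: "y \<in> carrier E" for y
  proof -
    have p: "\<phi> t y \<in> carrier A" if "t \<in> T" for t using rhomD(1)[OF T(3)[OF that] y] by simp
    have "f (h y) = (\<Oplus>\<^sub>Y t\<in>T. f (w t \<star>\<^sub>X \<phi> t y))" unfolding h_def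
      by (rule rhom_finsum[OF X Y f]) (simp add: w p fdD(3)[OF X])
    also have "\<dots> = (\<Oplus>\<^sub>Y t\<in>T. g (x t \<star>\<^sub>E \<phi> t y))"
      by (rule Y.finsum_cong')
        (simp_all add: w p T(2) rhomD(3)[OF f] rhomD(3)[OF g] rhomD(1)[OF g] fdD(3)[OF Y])
    also have "\<dots> = g (\<Oplus>\<^sub>E t\<in>T. x t \<star>\<^sub>E \<phi> t y)"
      by (rule rhom_finsum[OF E Y g, symmetric]) (simp add: T(2) p fdD(3)[OF E])
    finally show ?thesis using T(4)[OF y] by simp
  qed
  ultimately show "\<exists>h\<in>rhom A E X. \<forall>x\<in>carrier E. f (h x) = g x" by blast
qed (rule E)

lemma torsionless_regular: "torsionless A AA"
  unfolding torsionless_def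
proof (intro ballI impI)
  fix x assume "x \<in> carrier AA" "x ~= \<zero>\<^bsub>AA\<^esub>"
  thus "\<exists>\<phi>\<in>rhom A AA AA. \<phi> x ~= \<zero>\<^sub>A"
    by (intro bexI[of _ "%x. x"] rhom_id) simp
qed

lemma torsionless_inj:
  assumes "torsionless A F" "f \<in> rhom A E F" "!!x. x \<in> carrier E ==> x ~= \<zero>\<^sub>E ==> f x ~= \<zero>\<^sub>F"
  shows "torsionless A E"
  unfolding torsionless_def
proof (intro ballI impI)
  fix x assume x: "x \<in> carrier E" "x ~= \<zero>\<^sub>E"
  then obtain \<phi> where p: "\<phi> \<in> rhom A F AA" "\<phi> (f x) ~= \<zero>\<^sub>A"
    using assms(1,3) rhomD(1)[OF assms(2) x(1)] unfolding torsionless_def by meson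
  thus "\<exists>\<phi>\<in>rhom A E AA. \<phi> x ~= \<zero>\<^sub>A"
    by (intro bexI[OF _ rhom_comp[OF assms(2) p(1)]])
qed

lemma rmod_sum_simps [simp]:
  "carrier (rmod_sum M N) = carrier M \<times> carrier N" "zero (rmod_sum M N) = (\<zero>\<^sub>M, \<zero>\<^sub>N)"
  "(x, y) \<oplus>\<^bsub>rmod_sum M N\<^esub> (x', y') = (x \<oplus>\<^sub>M x', y \<oplus>\<^sub>N y')"
  "k \<odot>\<^bsub>rmod_sum M N\<^esub> (x, y) = (k \<odot>\<^sub>M x, k \<odot>\<^sub>N y)"
  "(x, y) \<star>\<^bsub>rmod_sum M N\<^esub> a = (x \<star>\<^sub>M a, y \<star>\<^sub>N a)"
  by (simp_all add: rmod_sum_def)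

lemma fst_rhom: "fst \<in> rhom A (rmod_sum M N) M"
  by (rule rhomI) auto

lemma snd_rhom: "snd \<in> rhom A (rmod_sum M N) N"
  by (rule rhomI) auto

lemma torsionless_sum:
  assumes "torsionless A M" "torsionless A N"
  shows "torsionless A (rmod_sum M N)"
  unfolding torsionless_def
proof (intro ballI impI)
  fix z assume z: "z \<in> carrier (rmod_sum M N)" "z ~= \<zero>\<^bsub>rmod_sum M N\<^esub>"
  then obtain x y where xy: "z = (x, y)" "x \<in> carrier M" "y \<in> carrier N" by auto
  show "\<exists>\<phi>\<in>rhom A (rmod_sum M N) AA. \<phi> z ~= \<zero>\<^sub>A"
  proof (cases "x = \<zero>\<^sub>M")
    case False
    then obtain \<phi> where p: "\<phi> \<in> rhom A M AA" "\<phi> x ~= \<zero>\<^sub>A"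
      using assms(1) xy(2) unfolding torsionless_def by meson
    thus ?thesis using xy by (intro bexI[OF _ rhom_comp[OF fst_rhom p(1)]]) simp
  next
    case True
    hence "y ~= \<zero>\<^sub>N" using z xy by simp
    then obtain \<phi> where p: "\<phi> \<in> rhom A N AA" "\<phi> y ~= \<zero>\<^sub>A"
      using assms(2) xy(3) unfolding torsionless_def by meson
    thus ?thesis using xy by (intro bexI[OF _ rhom_comp[OF snd_rhom p(1)]]) simp
  qed
qed

text \<open>A free module maps onto a projective one, which therefore embeds into it.\<close>

lemma torsionless_cover:
  assumes E: "fdm E" and "finite S" "S \<subseteq> carrier E"
  shows "\<exists>(F :: ('k, 'a, nat => 'k) rmodule) f. fdm F \<and> torsionless A F \<and>
    f \<in> rhom A F E \<and> S \<subseteq> f ` carrier F"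
  using assms(2,3)
proof (induction S)
  case empty
  interpret E: Module.module K E by (rule fdD(1)[OF E])
  obtain F :: "('k, 'a, nat => 'k) rmodule" and c where
    F: "fdm F" "c \<in> rhom A AA F" "bij_betw c (carrier AA) (carrier F)"
    using nat_copy_exists[OF fd_regular] by blast
  note ci = rhom_inverse[OF fd_regular F(2,3)]
  have "inv_into (carrier AA) c x ~= \<zero>\<^bsub>AA\<^esub>" if "x \<in> carrier F" "x ~= \<zero>\<^sub>F" for x
  proof
    assume "inv_into (carrier AA) c x = \<zero>\<^bsub>AA\<^esub>"
    hence "x = c \<zero>\<^bsub>AA\<^esub>" using bij_betw_inv_into_right[OF F(3) that(1)] by simp
    thus False using rhom_zero_map[OF fd_regular F(1,2)] that(2) by simp
  qed
  hence "torsionless A F" by (rule torsionless_inj[OF torsionless_regular ci])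
  moreover have "(%x. \<zero>\<^sub>E) \<in> rhom A F E" by (rule rhomI) (simp_all add: zero_ract[OF E])
  ultimately show ?case using F(1) by (intro exI[of _ F] exI[of _ "%x. \<zero>\<^sub>E"]) simp
next
  case (insert s S)
  interpret E: Module.module K E by (rule fdD(1)[OF E])
  from insert obtain F :: "('k, 'a, nat => 'k) rmodule" and f where
    F: "fdm F" "torsionless A F" "f \<in> rhom A F E" "S \<subseteq> f ` carrier F" by auto
  interpret F: Module.module K F by (rule fdD(1)[OF F(1)])
  have s: "s \<in> carrier E" using insert by simp
  note G = fd_rmod_sum[OF F(1) fd_regular]
  obtain H :: "('k, 'a, nat => 'k) rmodule" and c where
    H: "fdm H" "c \<in> rhom A (rmod_sum F AA) H"
      "bij_betw c (carrier (rmod_sum F AA)) (carrier H)"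
    using nat_copy_exists[OF G] by blast
  let ?c = "inv_into (carrier (rmod_sum F AA)) c"
  note ci = rhom_inverse[OF G H(2,3)]
  have "?c x ~= \<zero>\<^bsub>rmod_sum F AA\<^esub>" if "x \<in> carrier H" "x ~= \<zero>\<^sub>H" for x
  proof
    assume "?c x = \<zero>\<^bsub>rmod_sum F AA\<^esub>"
    hence "x = c \<zero>\<^bsub>rmod_sum F AA\<^esub>" using bij_betw_inv_into_right[OF H(3) that(1)] by simp
    thus False using rhom_zero_map[OF G H(1,2)] that(2) by simp
  qed
  hence t: "torsionless A H" by (rule torsionless_inj[OF torsionless_sum[OF F(2) torsionless_regular] ci])
  define g where "g = (%(x, a). f x \<oplus>\<^sub>E s \<star>\<^sub>E a)"
  have gr: "g \<in> rhom A (rmod_sum F AA) E"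
    by (rule rhomI) (auto simp: g_def rhomD[OF F(3)] fdD[OF E] s E.a_ac)
  have surj: "?c ` carrier H = carrier F \<times> carrier A"
    using bij_betw_imp_surj_on[OF bij_betw_inv_into[OF H(3)]] by simp
  have "y \<in> (%x. g (?c x)) ` carrier H" if "y \<in> g ` (carrier F \<times> carrier A)" for y
    using that unfolding surj[symmetric] by (simp add: image_image)
  moreover have "s \<in> g ` (carrier F \<times> carrier A)"
  proof -
    have "s = g (\<zero>\<^sub>F, \<one>\<^sub>A)" using s by (simp add: g_def fdD(7)[OF E] rhom_zero_map[OF F(1) E F(3)])
    thus ?thesis by (rule image_eqI) simp
  qed
  moreover have "t \<in> g ` (carrier F \<times> carrier A)" if t: "t \<in> S" for t
  proof -
    obtain x where x: "x \<in> carrier F" "t = f x" using F(4) t by blast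
    have "t = g (x, \<zero>\<^sub>A)" using s x by (simp add: g_def ract_zero[OF E] rhomD(1)[OF F(3)])
    thus ?thesis by (rule image_eqI) (simp add: x)
  qed
  ultimately have "insert s S \<subseteq> (%x. g (?c x)) ` carrier H" by blast
  thus ?case using H(1) t rhom_comp[OF ci gr] by blast
qed

lemma proj_torsionless:
  assumes "projm E"
  shows "torsionless A E"
proof -
  note E = proj_fd[OF assms]
  obtain S where S: "finite S" "S \<subseteq> carrier E" "!!U. ksub K E U ==> S \<subseteq> U ==> carrier E \<subseteq> U"
    using fdD(2)[OF E] finite_dim_iff[OF fdD(1)[OF E]] by blast
  obtain F :: "('k, 'a, nat => 'k) rmodule" and f where
    F: "fdm F" "torsionless A F" "f \<in> rhom A F E" "S \<subseteq> f ` carrier F"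
    using torsionless_cover[OF E S(1,2)] by blast
  have "f ` carrier F = carrier E"
    using S(3)[OF ksub_image[OF fdD(1)[OF F(1)] fdD(1)[OF E] rhom_lin[OF F(1) E F(3)]] F(4)]
      rhomD(1)[OF F(3)] by blast
  from proj_lift[OF assms F(1) E F(3) this rhom_id] obtain h where
    h: "h \<in> rhom A E F" "!!x. x \<in> carrier E ==> f (h x) = x" by blast
  have "h x ~= \<zero>\<^sub>F" if "x \<in> carrier E" "x ~= \<zero>\<^sub>E" for x
    using h(2)[OF that(1)] rhom_zero_map[OF F(1) E F(3)] that(2) by auto
  thus ?thesis by (rule torsionless_inj[OF F(2) h(1)])
qed

text \<open>The part of Baer's criterion for principal right ideals.\<close>

lemma inj_divide:
  assumes I: "injm I" and b: "b \<in> carrier A" and x: "x \<in> carrier I"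
    and ann: "!!c. c \<in> carrier A ==> b \<otimes>\<^sub>A c = \<zero>\<^sub>A ==> x \<star>\<^sub>I c = \<zero>\<^sub>I"
  shows "\<exists>y\<in>carrier I. x = y \<star>\<^sub>I b"
proof -
  note F = inj_fd[OF I]
  interpret I: Module.module K I by (rule fdD(1)[OF F])
  let ?U = "(%c. b \<otimes>\<^sub>A c) ` carrier A"
  have "(%c. b \<otimes>\<^sub>A c) \<in> rhom A AA AA"
    by (rule rhomI) (simp_all add: b A.r_distr A.m_assoc)
  from submod_image[OF fd_regular fd_regular this] have U: "submod A AA ?U" by simp
  define g where "g u = x \<star>\<^sub>I (SOME c. c \<in> carrier A \<and> u = b \<otimes>\<^sub>A c)" for u
  have g: "g (b \<otimes>\<^sub>A c) = x \<star>\<^sub>I c" if c: "c \<in> carrier A" for c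
  proof -
    let ?c = "SOME c'. c' \<in> carrier A \<and> b \<otimes>\<^sub>A c = b \<otimes>\<^sub>A c'"
    have s: "?c \<in> carrier A \<and> b \<otimes>\<^sub>A c = b \<otimes>\<^sub>A ?c" by (rule someI[of _ c]) (simp add: c)
    hence "b \<otimes>\<^sub>A (c \<ominus>\<^sub>A ?c) = \<zero>\<^sub>A"
      using c b by (simp add: a_minus_def A.r_distr A.r_minus A.r_neg)
    hence "x \<star>\<^sub>I (c \<ominus>\<^sub>A ?c) = \<zero>\<^sub>I" using ann s c by simp
    moreover have "c = (c \<ominus>\<^sub>A ?c) \<oplus>\<^sub>A ?c" using s c by (simp add: a_minus_def A.a_assoc A.l_neg)
    hence "x \<star>\<^sub>I c = x \<star>\<^sub>I (c \<ominus>\<^sub>A ?c) \<oplus>\<^sub>I x \<star>\<^sub>I ?c"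
      using fdD(5)[OF F x, of "c \<ominus>\<^sub>A ?c" ?c] s c by simp
    ultimately show ?thesis using s x by (simp add: g_def fdD(3)[OF F])
  qed
  have gr: "g \<in> rhom A (AA\<lparr>carrier := ?U\<rparr>) I"
  proof (rule rhomI)
    fix u assume "u \<in> carrier (AA\<lparr>carrier := ?U\<rparr>)"
    thus "g u \<in> carrier I" using g x by (auto simp: fdD(3)[OF F])
  next
    fix u v assume "u \<in> carrier (AA\<lparr>carrier := ?U\<rparr>)" "v \<in> carrier (AA\<lparr>carrier := ?U\<rparr>)"
    then obtain c d where "c \<in> carrier A" "u = b \<otimes>\<^sub>A c" "d \<in> carrier A" "v = b \<otimes>\<^sub>A d" by auto
    moreover from this have "g (b \<otimes>\<^sub>A (c \<oplus>\<^sub>A d)) = g (b \<otimes>\<^sub>A c) \<oplus>\<^sub>I g (b \<otimes>\<^sub>A d)"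
      by (simp only: g A.a_closed fdD(5)[OF F x])
    ultimately show "g (u \<oplus>\<^bsub>AA\<lparr>carrier := ?U\<rparr>\<^esub> v) = g u \<oplus>\<^sub>I g v"
      using b by (simp add: A.r_distr)
  next
    fix a u assume "u \<in> carrier (AA\<lparr>carrier := ?U\<rparr>)" and a: "a \<in> carrier A"
    then obtain c where "c \<in> carrier A" "u = b \<otimes>\<^sub>A c" by auto
    moreover from this a have "g (b \<otimes>\<^sub>A (c \<otimes>\<^sub>A a)) = g (b \<otimes>\<^sub>A c) \<star>\<^sub>I a"
      by (simp only: g A.m_closed fdD(6)[OF F x])
    ultimately show "g (u \<star>\<^bsub>AA\<lparr>carrier := ?U\<rparr>\<^esub> a) = g u \<star>\<^sub>I a"
      using b a by (simp add: A.m_assoc)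
  qed
  have inc: "(%u. u) \<in> rhom A (AA\<lparr>carrier := ?U\<rparr>) AA"
    by (rule rhomI) (use b in auto)
  obtain h where h: "h \<in> rhom A AA I" "!!u. u \<in> ?U ==> h u = g u"
    using inj_extend[OF I fd_submod[OF fd_regular U] fd_regular inc _ gr] by auto
  have "x = h (b \<otimes>\<^sub>A \<one>\<^sub>A)" using h(2)[of "b \<otimes>\<^sub>A \<one>\<^sub>A"] g[of "\<one>\<^sub>A"] x by (simp add: fdD(7)[OF F])
  also have "\<dots> = h \<one>\<^sub>A \<star>\<^sub>I b" using rhomD(3)[OF h(1), of "\<one>\<^sub>A" b] b by simp
  finally show ?thesis using rhomD(1)[OF h(1), of "\<one>\<^sub>A"] by auto
qed

end

context fd_algebra
begin

text \<open>The coinduced module \<open>Hom_K (W, V)\<close> of a left module \<open>W\<close>, whose action is \<open>L\<close>. It is used twice: with \<open>W\<close> the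
  algebra to show that there are enough injectives, and with \<open>W = M f\<close> for the algebra \<open>End M\<close>.\<close>

definition coind ::
  "('k, 'w, 'd) module_scheme => ('k, 'v, 'e) module_scheme => ('a => 'w => 'w) =>
   ('k, 'a, 'w => 'v) rmodule" where
  "coind W V L = module.extend (hom_space K W V) (rmodule.fields (%q a. \<lambda>w\<in>carrier W. q (L a w)))"

lemma coind_simps:
  "carrier (coind W V L) = lin K W V \<inter> extensional (carrier W)"
  "zero (coind W V L) = (\<lambda>x\<in>carrier W. \<zero>\<^sub>V)"
  "add (coind W V L) f g = (\<lambda>x\<in>carrier W. f x \<oplus>\<^sub>V g x)"
  "smult (coind W V L) k f = (\<lambda>x\<in>carrier W. k \<odot>\<^sub>V f x)"
  "ract (coind W V L) f a = (\<lambda>w\<in>carrier W. f (L a w))"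
  by (simp_all add: coind_def module.defs rmodule.defs hom_space_def)

lemma coind_carrierI:
  assumes "Module.module K W" "q \<in> lin K W V"
  shows "(\<lambda>w\<in>carrier W. q w) \<in> carrier (coind W V L)"
proof -
  interpret W: Module.module K W by fact
  show ?thesis unfolding coind_simps by (intro IntI linI) (simp_all add: linD[OF assms(2)])
qed

lemma coind_eqI:
  assumes "f \<in> carrier (coind W V L)" "g \<in> carrier (coind W V L)" "!!w. w \<in> carrier W ==> f w = g w"
  shows "f = g"
  using assms by (intro extensionalityI[of f "carrier W" g]) (simp_all add: coind_simps)

context
  fixes W :: "('k, 'w, 'd) module_scheme" and V :: "('k, 'v, 'e) module_scheme"
    and L :: "'a => 'w => 'w"
  assumes W: "Module.module K W" "finite_dim K W" and V: "Module.module K V" "finite_dim K V"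
    and L: "!!a. a \<in> carrier A ==> L a \<in> lin K W W"
    and L_add: "!!a b w. a \<in> carrier A ==> b \<in> carrier A ==> w \<in> carrier W ==>
       L (a \<oplus>\<^sub>A b) w = L a w \<oplus>\<^sub>W L b w"
    and L_mult: "!!a b w. a \<in> carrier A ==> b \<in> carrier A ==> w \<in> carrier W ==>
       L (a \<otimes>\<^sub>A b) w = L a (L b w)"
    and L_one: "!!w. w \<in> carrier W ==> L \<one>\<^sub>A w = w"
    and L_smult: "!!k a w. k \<in> carrier K ==> a \<in> carrier A ==> w \<in> carrier W ==>
       L (k \<odot>\<^sub>A a) w = k \<odot>\<^sub>W L a w"
begin

interpretation W: Module.module K W by (rule W)
interpretation V: Module.module K V by (rule V)

lemma fd_coind: "fdm (coind W V L)"
proof (rule fdI)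
  have 1: "carrier (coind W V L) = carrier (hom_space K W V)" "zero (coind W V L) = zero (hom_space K W V)"
    "add (coind W V L) = add (hom_space K W V)" "smult (coind W V L) = smult (hom_space K W V)"
    by (simp_all add: coind_def module.defs rmodule.defs)
  show "Module.module K (coind W V L)"
    by (rule module_cong[OF module_hom_space[OF W(1) V(1)]]) (simp_all add: 1)
  show "finite_dim K (coind W V L)"
    by (rule finite_dim_cong[OF module_hom_space[OF W(1) V(1)]
          finite_dim_hom_space[OF fieldK W(1) V(1) W(2) V(2)]]) (simp_all add: 1)
  note LD = linD[OF L]
  fix f assume "f \<in> carrier (coind W V L)"
  hence f: "f \<in> lin K W V" "f \<in> extensional (carrier W)" by (simp_all add: coind_simps)
  note F = linD[OF f(1)]
  show "f \<star>\<^bsub>coind W V L\<^esub> \<one>\<^sub>A = f"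
    by (rule extensionalityI[of _ "carrier W"]) (simp_all add: coind_simps f L_one)
  fix a assume a: "a \<in> carrier A"
  have "(%w. f (L a w)) \<in> lin K W V" by (rule lin_comp[OF L[OF a] f(1)])
  thus "f \<star>\<^bsub>coind W V L\<^esub> a \<in> carrier (coind W V L)"
    unfolding coind_simps(5) by (rule coind_carrierI[OF W(1)])
  show "f \<star>\<^bsub>coind W V L\<^esub> (k \<odot>\<^sub>A a) = k \<odot>\<^bsub>coind W V L\<^esub> (f \<star>\<^bsub>coind W V L\<^esub> a)" if k: "k \<in> carrier K" for k
    unfolding coind_simps(4,5) by (rule restrict_ext) (simp add: L_smult k a F LD)
  fix b assume b: "b \<in> carrier A"
  show "f \<star>\<^bsub>coind W V L\<^esub> (a \<oplus>\<^sub>A b) = f \<star>\<^bsub>coind W V L\<^esub> a \<oplus>\<^bsub>coind W V L\<^esub> f \<star>\<^bsub>coind W V L\<^esub> b"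
    unfolding coind_simps(3,5) by (rule restrict_ext) (simp add: L_add a b F LD)
  show "f \<star>\<^bsub>coind W V L\<^esub> (a \<otimes>\<^sub>A b) = f \<star>\<^bsub>coind W V L\<^esub> a \<star>\<^bsub>coind W V L\<^esub> b"
    unfolding coind_simps(5) by (rule restrict_ext) (simp add: L_mult a b F LD)
next
  fix f g a assume "f \<in> carrier (coind W V L)" "g \<in> carrier (coind W V L)" and a: "a \<in> carrier A"
  show "(f \<oplus>\<^bsub>coind W V L\<^esub> g) \<star>\<^bsub>coind W V L\<^esub> a = f \<star>\<^bsub>coind W V L\<^esub> a \<oplus>\<^bsub>coind W V L\<^esub> g \<star>\<^bsub>coind W V L\<^esub> a"
    unfolding coind_simps(3,5) by (rule restrict_ext) (simp add: a linD[OF L])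
qed

text \<open>If \<open>W\<close> is a projective left module, with dual basis \<open>z\<close>, \<open>\<beta>\<close>, then homomorphisms into the
  coinduced module correspond to families of linear maps, and those can be extended.\<close>

lemma inj_coind:
  assumes J: "finite J" and z: "!!j. j \<in> J ==> z j \<in> carrier W"
    and \<beta>: "!!j. j \<in> J ==> \<beta> j \<in> lin K W A"
    and \<beta>L: "!!j a w. j \<in> J ==> a \<in> carrier A ==> w \<in> carrier W ==> \<beta> j (L a w) = a \<otimes>\<^sub>A \<beta> j w"
    and dec: "!!w. w \<in> carrier W ==> w = (\<Oplus>\<^sub>W j\<in>J. L (\<beta> j w) (z j))"
  shows "injm (coind W V L)"
  unfolding inj_rmod_def
proof (intro conjI allI impI)
  fix X Y :: "('k, 'a, nat => 'k) rmodule" and f g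
  assume X: "fdm X" and Y: "fdm Y" and f: "f \<in> rhom A X Y" and i: "inj_on f (carrier X)"
    and g: "g \<in> rhom A X (coind W V L)"
  interpret Y: Module.module K Y by (rule fdD(1)[OF Y])
  note G = rhomD[OF g] note B = linD[OF \<beta>]
  have gl: "g x \<in> lin K W V" if "x \<in> carrier X" for x using G(1)[OF that] by (simp add: coind_simps)
  have "\<exists>p\<in>lin K Y V. \<forall>x\<in>carrier X. p (f x) = g x (z j)" if j: "j \<in> J" for j
  proof (rule lin_extend[OF fieldK fdD(1)[OF X] fdD(1)[OF Y] V(1) rhom_lin[OF X Y f] i])
    show "(%x. g x (z j)) \<in> lin K X V"
    proof (rule linI)
      fix x assume x: "x \<in> carrier X"
      show "g x (z j) \<in> carrier V" by (rule linD(1)[OF gl[OF x] z[OF j]])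
      show "g (k \<odot>\<^sub>X x) (z j) = k \<odot>\<^sub>V g x (z j)" if k: "k \<in> carrier K" for k
        using linD(3)[OF rhom_lin[OF X fd_coind g] k x] z[OF j] by (simp add: coind_simps)
    next
      fix x y assume "x \<in> carrier X" "y \<in> carrier X"
      thus "g (x \<oplus>\<^sub>X y) (z j) = g x (z j) \<oplus>\<^sub>V g y (z j)" using G(2) z[OF j] by (simp add: coind_simps)
    qed
  qed
  hence "\<forall>j. \<exists>p. j \<in> J --> p \<in> lin K Y V \<and> (\<forall>x\<in>carrier X. p (f x) = g x (z j))" by blast
  from choice[OF this] obtain p where p: "!!j. j \<in> J ==> p j \<in> lin K Y V"
    "!!j x. j \<in> J ==> x \<in> carrier X ==> p j (f x) = g x (z j)" by blast
  note P = linD[OF p(1)]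
  define h where "h y = (\<lambda>w\<in>carrier W. \<Oplus>\<^sub>V j\<in>J. p j (y \<star>\<^sub>Y \<beta> j w))" for y
  note Yc = fdD(3)[OF Y]
  have "h \<in> rhom A Y (coind W V L)"
  proof (rule rhomI)
    fix y assume y: "y \<in> carrier Y"
    have "(%w. \<Oplus>\<^sub>V j\<in>J. p j (y \<star>\<^sub>Y \<beta> j w)) \<in> lin K W V"
    proof (rule linI)
      fix w assume w: "w \<in> carrier W"
      show "(\<Oplus>\<^sub>V j\<in>J. p j (y \<star>\<^sub>Y \<beta> j w)) \<in> carrier V"
        by (rule V.finsum_closed) (simp add: P B Yc y w)
      fix k assume k: "k \<in> carrier K"
      have "k \<odot>\<^sub>V (\<Oplus>\<^sub>V j\<in>J. p j (y \<star>\<^sub>Y \<beta> j w)) = (\<Oplus>\<^sub>V j\<in>J. k \<odot>\<^sub>V p j (y \<star>\<^sub>Y \<beta> j w))"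
        by (rule V.finsum_smult_ldistr[OF J k]) (simp add: P B Yc y w)
      also have "\<dots> = (\<Oplus>\<^sub>V j\<in>J. p j (y \<star>\<^sub>Y \<beta> j (k \<odot>\<^sub>W w)))"
        by (rule V.finsum_cong') (simp_all add: P B Yc y w k fdD(8)[OF Y])
      finally show "(\<Oplus>\<^sub>V j\<in>J. p j (y \<star>\<^sub>Y \<beta> j (k \<odot>\<^sub>W w))) = k \<odot>\<^sub>V (\<Oplus>\<^sub>V j\<in>J. p j (y \<star>\<^sub>Y \<beta> j w))" by simp
    next
      fix v w assume vw: "v \<in> carrier W" "w \<in> carrier W"
      have "(\<Oplus>\<^sub>V j\<in>J. p j (y \<star>\<^sub>Y \<beta> j (v \<oplus>\<^sub>W w))) = (\<Oplus>\<^sub>V j\<in>J. p j (y \<star>\<^sub>Y \<beta> j v) \<oplus>\<^sub>V p j (y \<star>\<^sub>Y \<beta> j w))"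
        by (rule V.finsum_cong') (simp_all add: P B Yc y vw fdD(5)[OF Y])
      thus "(\<Oplus>\<^sub>V j\<in>J. p j (y \<star>\<^sub>Y \<beta> j (v \<oplus>\<^sub>W w))) =
         (\<Oplus>\<^sub>V j\<in>J. p j (y \<star>\<^sub>Y \<beta> j v)) \<oplus>\<^sub>V (\<Oplus>\<^sub>V j\<in>J. p j (y \<star>\<^sub>Y \<beta> j w))"
        using V.finsum_addf[of "%j. p j (y \<star>\<^sub>Y \<beta> j v)" J "%j. p j (y \<star>\<^sub>Y \<beta> j w)"]
        by (simp add: P B Yc y vw)
    qed
    thus "h y \<in> carrier (coind W V L)" unfolding h_def by (rule coind_carrierI[OF W(1)])
    fix a assume a: "a \<in> carrier A"
    show "h (y \<star>\<^sub>Y a) = h y \<star>\<^bsub>coind W V L\<^esub> a" unfolding coind_simps h_def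
    proof (rule restrict_ext)
      fix w assume w: "w \<in> carrier W"
      have Lw: "L a w \<in> carrier W" by (rule linD(1)[OF L[OF a] w])
      have "(\<Oplus>\<^sub>V j\<in>J. p j (y \<star>\<^sub>Y a \<star>\<^sub>Y \<beta> j w)) = (\<Oplus>\<^sub>V j\<in>J. p j (y \<star>\<^sub>Y \<beta> j (L a w)))"
        by (rule V.finsum_cong') (simp_all add: P B Yc y w a Lw \<beta>L fdD(6)[OF Y])
      thus "(\<Oplus>\<^sub>V j\<in>J. p j (y \<star>\<^sub>Y a \<star>\<^sub>Y \<beta> j w)) =
        (\<lambda>w\<in>carrier W. \<Oplus>\<^sub>V j\<in>J. p j (y \<star>\<^sub>Y \<beta> j w)) (L a w)" using Lw by simp
    qed
  next
    fix x y assume xy: "x \<in> carrier Y" "y \<in> carrier Y"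
    show "h (x \<oplus>\<^sub>Y y) = h x \<oplus>\<^bsub>coind W V L\<^esub> h y" unfolding coind_simps h_def
    proof (rule restrict_ext)
      fix w assume w: "w \<in> carrier W"
      have "(\<Oplus>\<^sub>V j\<in>J. p j ((x \<oplus>\<^sub>Y y) \<star>\<^sub>Y \<beta> j w)) = (\<Oplus>\<^sub>V j\<in>J. p j (x \<star>\<^sub>Y \<beta> j w) \<oplus>\<^sub>V p j (y \<star>\<^sub>Y \<beta> j w))"
        by (rule V.finsum_cong') (simp_all add: P B Yc xy w fdD(4)[OF Y])
      also have "\<dots> = (\<Oplus>\<^sub>V j\<in>J. p j (x \<star>\<^sub>Y \<beta> j w)) \<oplus>\<^sub>V (\<Oplus>\<^sub>V j\<in>J. p j (y \<star>\<^sub>Y \<beta> j w))"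
        by (rule V.finsum_addf) (simp_all add: P B Yc xy w)
      finally show "(\<Oplus>\<^sub>V j\<in>J. p j ((x \<oplus>\<^sub>Y y) \<star>\<^sub>Y \<beta> j w)) =
        (\<lambda>w\<in>carrier W. \<Oplus>\<^sub>V j\<in>J. p j (x \<star>\<^sub>Y \<beta> j w)) w \<oplus>\<^sub>V (\<lambda>w\<in>carrier W. \<Oplus>\<^sub>V j\<in>J. p j (y \<star>\<^sub>Y \<beta> j w)) w"
        using w by simp
    qed
  qed
  moreover have "h (f x) = g x" if x: "x \<in> carrier X" for x
  proof (rule coind_eqI)
    show "h (f x) \<in> carrier (coind W V L)" by (rule rhomD(1)[OF calculation rhomD(1)[OF f x]])
    show "g x \<in> carrier (coind W V L)" by (rule G(1)[OF x])
    fix w assume w: "w \<in> carrier W"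
    have Lz: "L (\<beta> j w) (z j) \<in> carrier W" if "j \<in> J" for j
      by (rule linD(1)[OF L[OF B(1)[OF that w]] z[OF that]])
    have "h (f x) w = (\<Oplus>\<^sub>V j\<in>J. p j (f x \<star>\<^sub>Y \<beta> j w))" using w by (simp add: h_def)
    also have "\<dots> = (\<Oplus>\<^sub>V j\<in>J. g x (L (\<beta> j w) (z j)))"
    proof (rule V.finsum_cong')
      show "(%j. g x (L (\<beta> j w) (z j))) \<in> J \<rightarrow> carrier V" using linD(1)[OF gl[OF x] Lz] by simp
      fix j assume j: "j \<in> J"
      have "p j (f x \<star>\<^sub>Y \<beta> j w) = p j (f (x \<star>\<^sub>X \<beta> j w))" by (simp add: rhomD(3)[OF f x] B j w)
      also have "\<dots> = g (x \<star>\<^sub>X \<beta> j w) (z j)" by (rule p(2)[OF j]) (simp add: fdD(3)[OF X] x B j w)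
      also have "\<dots> = (g x \<star>\<^bsub>coind W V L\<^esub> \<beta> j w) (z j)" by (simp add: G(3) x B j w)
      finally show "p j (f x \<star>\<^sub>Y \<beta> j w) = g x (L (\<beta> j w) (z j))" by (simp add: coind_simps z j)
    qed simp
    also have "\<dots> = g x (\<Oplus>\<^sub>W j\<in>J. L (\<beta> j w) (z j))"
      by (rule lin_finsum[OF W(1) V(1) gl[OF x], symmetric]) (simp add: Lz)
    finally show "h (f x) w = g x w" using dec[OF w] by simp
  qed
  ultimately show "\<exists>h\<in>rhom A Y (coind W V L). \<forall>x\<in>carrier X. h (f x) = g x" by blast
qed (rule fd_coind)

end

text \<open>\<open>x \<mapsto> (a \<mapsto> x a)\<close> embeds \<open>M\<close> into \<open>Hom_K (A, M)\<close>.\<close>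

lemma enough_injectives:
  fixes M :: "('k, 'a, 'v) rmodule"
  assumes M: "fdm M"
  shows "\<exists>(E :: ('k, 'a, 'a => 'v) rmodule) \<epsilon>. injm E \<and> \<epsilon> \<in> rhom A M E \<and> inj_on \<epsilon> (carrier M)"
proof -
  interpret M: Module.module K M by (rule fdD(1)[OF M])
  let ?E = "coind A M (mult A)"
  have l: "(\<otimes>\<^sub>A) a \<in> lin K A A" if "a \<in> carrier A" for a
    by (rule linI) (simp_all add: that A.r_distr smult_mult_r)
  have fd: "fdm ?E"
    by (rule fd_coind[OF moduleA fdA fdD(1,2)[OF M] l])
      (simp_all add: A.l_distr A.m_assoc smult_mult_l)
  have inj: "injm ?E"
  proof (rule inj_coind[where J = "{()}" and z = "%u. \<one>\<^sub>A" and \<beta> = "%u a. a",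
        OF moduleA fdA fdD(1,2)[OF M] l])
    show "(%a. a) \<in> lin K A A" by (rule linI) simp_all
    fix w assume "w \<in> carrier A"
    thus "w = (\<Oplus>\<^sub>A j\<in>{()}. w \<otimes>\<^sub>A \<one>\<^sub>A)" by simp
  qed (simp_all add: A.l_distr A.m_assoc smult_mult_l)
  define \<epsilon> where "\<epsilon> x = (\<lambda>a\<in>carrier A. x \<star>\<^sub>M a)" for x
  have "\<epsilon> \<in> rhom A M ?E"
  proof (rule rhomI)
    fix x assume x: "x \<in> carrier M"
    have "\<epsilon> x \<in> lin K A M"
      by (rule linI) (simp_all add: \<epsilon>_def x fdD(3,5,8)[OF M])
    thus "\<epsilon> x \<in> carrier ?E" by (simp add: coind_simps \<epsilon>_def)
    fix a assume "a \<in> carrier A"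
    thus "\<epsilon> (x \<star>\<^sub>M a) = \<epsilon> x \<star>\<^sub>?E a" unfolding coind_simps \<epsilon>_def
      by (intro restrict_ext) (simp add: x fdD(6)[OF M])
  next
    fix x y assume "x \<in> carrier M" "y \<in> carrier M"
    thus "\<epsilon> (x \<oplus>\<^sub>M y) = \<epsilon> x \<oplus>\<^sub>?E \<epsilon> y" unfolding coind_simps \<epsilon>_def
      by (intro restrict_ext) (simp add: fdD(4)[OF M])
  qed
  moreover have "inj_on \<epsilon> (carrier M)"
  proof (rule inj_onI)
    fix x y assume h: "x \<in> carrier M" "y \<in> carrier M" "\<epsilon> x = \<epsilon> y"
    have "\<epsilon> x \<one>\<^sub>A = \<epsilon> y \<one>\<^sub>A" by (simp only: h(3))
    thus "x = y" by (simp add: \<epsilon>_def fdD(7)[OF M] h(1,2))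
  qed
  ultimately show ?thesis using inj by blast
qed

subsection \<open>Injective hulls\<close>

text \<open>Zorn's lemma for submodules with a property that passes to unions of chains.\<close>

lemma maximal_submod:
  assumes M: "fdm M" and U: "submod A M U" "P U"
    and ch: "!!C. C ~= {} ==> (!!V. V \<in> C ==> submod A M V \<and> P V) ==>
       (!!V W. V \<in> C ==> W \<in> C ==> V \<subseteq> W \<or> W \<subseteq> V) ==> submod A M (\<Union>C) ==> P (\<Union>C)"
  shows "\<exists>V. submod A M V \<and> P V \<and> (\<forall>W. submod A M W --> P W --> V \<subseteq> W --> W = V)"
proof -
  let ?S = "{V. submod A M V \<and> P V}"
  have "\<exists>V\<in>?S. \<forall>W\<in>?S. V \<subseteq> W --> W = V"
  proof (rule subset_Zorn_nonempty)
    show "?S ~= {}" using U by blast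
  next
    fix C assume C: "C ~= {}" "subset.chain ?S C"
    have C1: "!!V. V \<in> C ==> submod A M V \<and> P V" using C(2) by (auto simp: subset.chain_def)
    have C2: "!!V W. V \<in> C ==> W \<in> C ==> V \<subseteq> W \<or> W \<subseteq> V" using C(2) by (auto simp: subset.chain_def)
    have "submod A M (\<Union>C)"
    proof (rule submodI[OF M])
      show "\<Union>C \<subseteq> carrier M" using C1 submodD(1)[OF M] by (meson Sup_least subsetI)
      obtain V where "V \<in> C" using C(1) by blast
      thus "\<zero>\<^sub>M \<in> \<Union>C" using C1 submodD(2)[OF M] by (meson UnionI)
    next
      fix x y assume "x \<in> \<Union>C" "y \<in> \<Union>C"
      then obtain V W where "V \<in> C" "x \<in> V" "W \<in> C" "y \<in> W" by blast
      then obtain Z where "Z \<in> C" "x \<in> Z" "y \<in> Z" using C2[of V W] by (meson subsetD)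
      thus "x \<oplus>\<^sub>M y \<in> \<Union>C" using C1 submodD(3)[OF M] by (meson UnionI)
    next
      fix a x assume "a \<in> carrier A" "x \<in> \<Union>C"
      thus "x \<star>\<^sub>M a \<in> \<Union>C" using C1 submodD(5)[OF M] by (meson UnionE UnionI)
    qed
    moreover from this have "P (\<Union>C)" using ch[OF C(1) C1 C2] by blast
    ultimately show "\<Union>C \<in> ?S" by simp
  qed
  then obtain V where V: "V \<in> ?S" and mx: "\<forall>W\<in>?S. V \<subseteq> W --> W = V" by (rule bexE)
  show ?thesis
  proof (rule exI[of _ V], intro conjI allI impI)
    show "submod A M V" "P V" using V by simp_all
    fix W assume "submod A M W" "P W" "V \<subseteq> W"
    thus "W = V" using mx by simp
  qed
qed

lemma submod_Int: "fdm M ==> submod A M U ==> submod A M V ==> submod A M (U \<inter> V)"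
  by (intro submodI) (auto dest: submodD)

lemma submod_sum:
  assumes M: "fdm M" and U: "submod A M U" and V: "submod A M V"
  shows "submod A M (U <+>\<^sub>M V)" "U \<subseteq> U <+>\<^sub>M V" "V \<subseteq> U <+>\<^sub>M V"
proof -
  interpret M: Module.module K M by (rule fdD(1)[OF M])
  note u = submodD[OF M U] and v = submodD[OF M V]
  show "submod A M (U <+>\<^sub>M V)"
  proof (rule submodI[OF M])
    show "U <+>\<^sub>M V \<subseteq> carrier M" using u(1) v(1) by (auto simp: set_add_def')
    have "\<zero>\<^sub>M = \<zero>\<^sub>M \<oplus>\<^sub>M \<zero>\<^sub>M" by simp
    thus "\<zero>\<^sub>M \<in> U <+>\<^sub>M V" using u(2) v(2) unfolding set_add_def' by blast
  next
    fix x y assume "x \<in> U <+>\<^sub>M V" "y \<in> U <+>\<^sub>M V"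
    then obtain a b c d where h: "a \<in> U" "b \<in> V" "x = a \<oplus>\<^sub>M b" "c \<in> U" "d \<in> V" "y = c \<oplus>\<^sub>M d"
      unfolding set_add_def' by blast
    hence "x \<oplus>\<^sub>M y = (a \<oplus>\<^sub>M c) \<oplus>\<^sub>M (b \<oplus>\<^sub>M d)" using u(1) v(1) by (simp add: M.a_ac)
    moreover have "a \<oplus>\<^sub>M c \<in> U" "b \<oplus>\<^sub>M d \<in> V" using h u(3) v(3) by simp_all
    ultimately show "x \<oplus>\<^sub>M y \<in> U <+>\<^sub>M V" unfolding set_add_def' by blast
  next
    fix a x assume a: "a \<in> carrier A" and "x \<in> U <+>\<^sub>M V"
    then obtain c d where h: "c \<in> U" "d \<in> V" "x = c \<oplus>\<^sub>M d" unfolding set_add_def' by blast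
    hence "x \<star>\<^sub>M a = c \<star>\<^sub>M a \<oplus>\<^sub>M d \<star>\<^sub>M a" using u(1) v(1) a by (simp add: fdD(4)[OF M])
    moreover have "c \<star>\<^sub>M a \<in> U" "d \<star>\<^sub>M a \<in> V" using h u(5) v(5) a by simp_all
    ultimately show "x \<star>\<^sub>M a \<in> U <+>\<^sub>M V" unfolding set_add_def' by blast
  qed
  show "U \<subseteq> U <+>\<^sub>M V"
  proof
    fix x assume x: "x \<in> U"
    hence "x = x \<oplus>\<^sub>M \<zero>\<^sub>M" using u(1) by simp
    thus "x \<in> U <+>\<^sub>M V" using x v(2) unfolding set_add_def' by blast
  qed
  show "V \<subseteq> U <+>\<^sub>M V"
  proof
    fix x assume x: "x \<in> V"
    hence "x = \<zero>\<^sub>M \<oplus>\<^sub>M x" using v(1) by simp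
    thus "x \<in> U <+>\<^sub>M V" using x u(2) unfolding set_add_def' by blast
  qed
qed

lemma submod_sub:
  assumes M: "fdm M" and E: "submod A M E"
  shows "submod A (M\<lparr>carrier := E\<rparr>) U \<longleftrightarrow> submod A M U \<and> U \<subseteq> E"
proof -
  note e = submodD[OF M E]
  show ?thesis
  proof
    assume "submod A (M\<lparr>carrier := E\<rparr>) U"
    note u = submodD[OF fd_submod[OF M E] this, simplified]
    have "submod A M U" by (rule submodI[OF M]) (use u e(1) in auto)
    thus "submod A M U \<and> U \<subseteq> E" using u(1) by blast
  next
    assume h: "submod A M U \<and> U \<subseteq> E"
    note u = submodD[OF M conjunct1[OF h]]
    show "submod A (M\<lparr>carrier := E\<rparr>) U"
      by (rule submodI[OF fd_submod[OF M E]]) (use u h in auto)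
  qed
qed

lemma essential_iso:
  assumes M: "fdm M" and N: "fdm N" and f: "f \<in> rhom A M N"
    "bij_betw f (carrier M) (carrier N)" and U: "essential A M U"
  shows "essential A N (f ` U)"
  unfolding essential_def
proof (intro conjI allI impI)
  have sU: "submod A M U" using U by (simp add: essential_def)
  have "f \<in> rhom A (M\<lparr>carrier := U\<rparr>) N"
    by (rule rhomI) (use rhomD[OF f(1)] submodD(1)[OF M sU] in auto)
  from submod_image[OF fd_submod[OF M sU] N this] show "submod A N (f ` U)" by simp
  fix V assume V: "submod A N V" "f ` U \<inter> V = {\<zero>\<^sub>N}"
  let ?W = "{x \<in> carrier M. f x \<in> V}"
  have W: "submod A M ?W" by (rule submod_vimage[OF M N f(1) V(1)])
  have inj: "!!x. x \<in> carrier M ==> f x = \<zero>\<^sub>N ==> x = \<zero>\<^sub>M"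
    using rhom_inj_iff[OF M N f(1)] bij_betw_imp_inj_on[OF f(2)] by blast
  have "U \<inter> ?W = {\<zero>\<^sub>M}"
  proof
    show "U \<inter> ?W \<subseteq> {\<zero>\<^sub>M}"
    proof
      fix x assume x: "x \<in> U \<inter> ?W"
      hence "f x \<in> f ` U \<inter> V" by simp
      hence "f x = \<zero>\<^sub>N" using V(2) by blast
      thus "x \<in> {\<zero>\<^sub>M}" using inj x by simp
    qed
    show "{\<zero>\<^sub>M} \<subseteq> U \<inter> ?W" using submodD(2)[OF M sU] submodD(2)[OF M W] by simp
  qed
  hence W0: "?W = {\<zero>\<^sub>M}" using U W by (simp add: essential_def)
  show "V = {\<zero>\<^sub>N}"
  proof
    show "{\<zero>\<^sub>N} \<subseteq> V" using submodD(2)[OF N V(1)] by simp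
    show "V \<subseteq> {\<zero>\<^sub>N}"
    proof
      fix y assume y: "y \<in> V"
      hence "y \<in> f ` carrier M" using submodD(1)[OF N V(1)] bij_betw_imp_surj_on[OF f(2)] by simp
      then obtain x where x: "x \<in> carrier M" "y = f x" by blast
      hence "x \<in> ?W" using y by simp
      hence "x = \<zero>\<^sub>M" using W0 by blast
      thus "y \<in> {\<zero>\<^sub>N}" using x rhom_zero_map[OF M N f(1)] by simp
    qed
  qed
qed

text \<open>Inside an injective module, a maximal essential extension \<open>E\<close> of \<open>U\<close> is a retract: a
  homomorphism that is the identity on \<open>E\<close> and kills a maximal complement \<open>V\<close> of \<open>E\<close> has image
  an essential extension of \<open>U\<close>, hence image \<open>E\<close>.\<close>

lemma essential_extension_inj:
  assumes I: "injm I" and U: "submod A I U"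
  shows "\<exists>E. submod A I E \<and> U \<subseteq> E \<and> injm (I\<lparr>carrier := E\<rparr>) \<and> essential A (I\<lparr>carrier := E\<rparr>) U"
proof -
  note M = inj_fd[OF I]
  interpret I: Module.module K I by (rule fdD(1)[OF M])
  define P where "P E \<longleftrightarrow> U \<subseteq> E \<and> (\<forall>V. submod A I V --> V \<subseteq> E --> U \<inter> V = {\<zero>\<^sub>I} --> V = {\<zero>\<^sub>I})" for E
  have "\<exists>E. submod A I E \<and> P E \<and> (\<forall>W. submod A I W --> P W --> E \<subseteq> W --> W = E)"
  proof (rule maximal_submod[OF M U])
    have "V = {\<zero>\<^sub>I}" if "V \<subseteq> U" "U \<inter> V = {\<zero>\<^sub>I}" for V using that by blast
    thus "P U" unfolding P_def by blast
  next
    fix C assume C: "C ~= {}" "!!V. V \<in> C ==> submod A I V \<and> P V"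
    show "P (\<Union>C)" unfolding P_def
    proof (intro conjI allI impI)
      show "U \<subseteq> \<Union>C" using C unfolding P_def by (meson Union_upper equals0I subset_trans)
      fix V assume V: "submod A I V" "V \<subseteq> \<Union>C" "U \<inter> V = {\<zero>\<^sub>I}"
      have "v = \<zero>\<^sub>I" if v: "v \<in> V" for v
      proof -
        obtain E where E: "E \<in> C" "v \<in> E" using V(2) v by (meson UnionE subsetD)
        have s: "submod A I E" "P E" using C(2)[OF E(1)] by blast+
        have "U \<inter> (V \<inter> E) = {\<zero>\<^sub>I}" using V(3) submodD(2)[OF M s(1)] by blast
        moreover have "submod A I (V \<inter> E)" by (rule submod_Int[OF M V(1) s(1)])
        ultimately have "V \<inter> E = {\<zero>\<^sub>I}" using s(2) unfolding P_def by (meson Int_lower2)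
        thus ?thesis using v E(2) by blast
      qed
      thus "V = {\<zero>\<^sub>I}" using submodD(2)[OF M V(1)] by blast
    qed
  qed
  then obtain E where E: "submod A I E" "P E" and Emax: "!!W. submod A I W ==> P W ==> E \<subseteq> W ==> W = E" by blast
  note e = submodD[OF M E(1)]
  have "\<exists>V. submod A I V \<and> E \<inter> V = {\<zero>\<^sub>I} \<and> (\<forall>W. submod A I W --> E \<inter> W = {\<zero>\<^sub>I} --> V \<subseteq> W --> W = V)"
  proof (rule maximal_submod[OF M submod_zero[OF M]])
    show "E \<inter> {\<zero>\<^sub>I} = {\<zero>\<^sub>I}" using e(2) by blast
    fix C assume "C ~= {}" "!!V. V \<in> C ==> submod A I V \<and> E \<inter> V = {\<zero>\<^sub>I}"
    thus "E \<inter> \<Union>C = {\<zero>\<^sub>I}" by blast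
  qed
  then obtain V where V: "submod A I V" "E \<inter> V = {\<zero>\<^sub>I}"
    and Vmax: "!!W. submod A I W ==> E \<inter> W = {\<zero>\<^sub>I} ==> V \<subseteq> W ==> W = V" by blast
  note v = submodD[OF M V(1)]
  obtain p where p: "!!x y. x \<in> E ==> y \<in> V ==> p (x \<oplus>\<^sub>I y) = x"
    using sum_projection[OF fdD(9)[OF M] _ _ V(2)] E(1) V(1) unfolding submod_def by blast
  let ?X = "E <+>\<^sub>I V"
  have dX: "\<exists>x y. x \<in> E \<and> y \<in> V \<and> s = x \<oplus>\<^sub>I y" if "s \<in> ?X" for s using that unfolding set_add_def' by blast
  have pr: "p \<in> rhom A (I\<lparr>carrier := ?X\<rparr>) I"
  proof (rule rhomI)
    fix s assume "s \<in> carrier (I\<lparr>carrier := ?X\<rparr>)"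
    hence "s \<in> ?X" by simp
    from dX[OF this] obtain x y where h: "x \<in> E" "y \<in> V" "s = x \<oplus>\<^sub>I y" by blast
    show "p s \<in> carrier I" using h p e(1) by simp
    fix a assume a: "a \<in> carrier A"
    have "s \<star>\<^sub>I a = x \<star>\<^sub>I a \<oplus>\<^sub>I y \<star>\<^sub>I a" using h a e(1) v(1) by (simp add: fdD(4)[OF M])
    thus "p (s \<star>\<^bsub>I\<lparr>carrier := ?X\<rparr>\<^esub> a) = p s \<star>\<^sub>I a" using p h e(5) v(5) a by simp
  next
    fix s t assume "s \<in> carrier (I\<lparr>carrier := ?X\<rparr>)" "t \<in> carrier (I\<lparr>carrier := ?X\<rparr>)"
    hence "s \<in> ?X" "t \<in> ?X" by simp_all
    from dX[OF this(1)] dX[OF this(2)] obtain x y x' y' where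
      h: "x \<in> E" "y \<in> V" "s = x \<oplus>\<^sub>I y" "x' \<in> E" "y' \<in> V" "t = x' \<oplus>\<^sub>I y'" by blast
    hence "s \<oplus>\<^sub>I t = (x \<oplus>\<^sub>I x') \<oplus>\<^sub>I (y \<oplus>\<^sub>I y')" using e(1) v(1) by (simp add: I.a_ac)
    thus "p (s \<oplus>\<^bsub>I\<lparr>carrier := ?X\<rparr>\<^esub> t) = p s \<oplus>\<^sub>I p t" using p h e(3) v(3) by simp
  qed
  note X = submod_sum[OF M E(1) V(1)]
  have inc: "(%x. x) \<in> rhom A (I\<lparr>carrier := ?X\<rparr>) I"
    by (rule rhomI) (use submodD(1)[OF M X(1)] in auto)
  obtain h where h: "h \<in> rhom A I I" "!!x. x \<in> ?X ==> h x = p x"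
    using inj_extend[OF I fd_submod[OF M X(1)] M inc _ pr] by auto
  have hE: "h x = x" if "x \<in> E" for x using h(2)[of x] p[OF that v(2)] X(2) that e(1) by auto
  have hV: "h x = \<zero>\<^sub>I" if "x \<in> V" for x using h(2)[of x] p[OF e(2) that] X(3) that v(1) by auto
  note H = rhomD[OF h(1)]
  have sI: "submod A I (h ` carrier I)" by (rule submod_image[OF M M h(1)])
  have EI: "E \<subseteq> h ` carrier I"
  proof
    fix x assume "x \<in> E"
    thus "x \<in> h ` carrier I" using hE e(1) by (intro image_eqI[of x h x]) simp_all
  qed
  have "P (h ` carrier I)" unfolding P_def
  proof (intro conjI allI impI)
    show "U \<subseteq> h ` carrier I" using E(2) EI unfolding P_def by blast
    fix Z assume Z: "submod A I Z" "Z \<subseteq> h ` carrier I" "U \<inter> Z = {\<zero>\<^sub>I}"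
    note z = submodD[OF M Z(1)]
    have "U \<inter> (E \<inter> Z) = {\<zero>\<^sub>I}" using Z(3) e(2) by blast
    hence EZ: "E \<inter> Z = {\<zero>\<^sub>I}" using E(2) submod_Int[OF M E(1) Z(1)] unfolding P_def by blast
    let ?W = "{x \<in> carrier I. h x \<in> Z}"
    have W: "submod A I ?W" by (rule submod_vimage[OF M M h(1) Z(1)])
    have "E \<inter> ?W = {\<zero>\<^sub>I}"
    proof
      show "E \<inter> ?W \<subseteq> {\<zero>\<^sub>I}"
      proof
        fix x assume "x \<in> E \<inter> ?W"
        hence "x \<in> E" "h x \<in> Z" by simp_all
        hence "x \<in> E \<inter> Z" using hE[of x] by simp
        thus "x \<in> {\<zero>\<^sub>I}" using EZ by simp
      qed
      show "{\<zero>\<^sub>I} \<subseteq> E \<inter> ?W" using e(2) submodD(2)[OF M W] by simp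
    qed
    moreover have "V \<subseteq> ?W" using hV v(1) z(2) by auto
    ultimately have WV: "?W = V" by (intro Vmax[OF W])
    have "u = \<zero>\<^sub>I" if u: "u \<in> Z" for u
    proof -
      obtain x where x: "x \<in> carrier I" "u = h x" using Z(2) u by blast
      hence "x \<in> V" using u WV by blast
      thus ?thesis using hV x by simp
    qed
    thus "Z = {\<zero>\<^sub>I}" using z(2) by blast
  qed
  from Emax[OF sI this EI] have hI: "h ` carrier I = E" .
  have "injm (I\<lparr>carrier := E\<rparr>)"
  proof (rule inj_retract[OF I fd_submod[OF M E(1)]])
    show "(%x. x) \<in> rhom A (I\<lparr>carrier := E\<rparr>) I" by (rule rhomI) (use e(1) in auto)
    show "h \<in> rhom A I (I\<lparr>carrier := E\<rparr>)" by (rule rhomI) (use H hI in auto)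
  qed (use hE in auto)
  moreover have UE: "U \<subseteq> E" using E(2) by (simp add: P_def)
  moreover have "essential A (I\<lparr>carrier := E\<rparr>) U"
    unfolding essential_def submod_sub[OF M E(1)] using U E(2) by (simp add: P_def)
  ultimately show ?thesis using E(1) by blast
qed

lemma injective_hull_exists:
  fixes M :: "('k, 'a, 'v) rmodule"
  assumes M: "fdm M"
  shows "\<exists>(E :: ('k, 'a, nat => 'k) rmodule) \<epsilon>. is_injective_hull K A M E \<epsilon>"
proof -
  obtain I :: "('k, 'a, 'a => 'v) rmodule" and \<epsilon> where I: "injm I" "\<epsilon> \<in> rhom A M I" "inj_on \<epsilon> (carrier M)"
    using enough_injectives[OF M] by blast
  note fI = inj_fd[OF I(1)]
  obtain E where E: "submod A I E" "\<epsilon> ` carrier M \<subseteq> E" "injm (I\<lparr>carrier := E\<rparr>)"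
    "essential A (I\<lparr>carrier := E\<rparr>) (\<epsilon> ` carrier M)"
    using essential_extension_inj[OF I(1) submod_image[OF M fI I(2)]] by blast
  have \<epsilon>: "\<epsilon> \<in> rhom A M (I\<lparr>carrier := E\<rparr>)" by (rule rhomI) (use rhomD[OF I(2)] E(2) in auto)
  obtain N :: "('k, 'a, nat => 'k) rmodule" and c where
    N: "fdm N" "c \<in> rhom A (I\<lparr>carrier := E\<rparr>) N" "bij_betw c (carrier (I\<lparr>carrier := E\<rparr>)) (carrier N)"
    using nat_copy_exists[OF inj_fd[OF E(3)]] by blast
  have "is_injective_hull K A M N (%x. c (\<epsilon> x))" unfolding is_injective_hull_def
  proof (intro conjI)
    show "injm N" by (rule inj_iso[OF E(3) N])
    show "(%x. c (\<epsilon> x)) \<in> rhom A M N" by (rule rhom_comp[OF \<epsilon> N(2)])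
    show "inj_on (%x. c (\<epsilon> x)) (carrier M)"
      using comp_inj_on[OF I(3), of c] inj_on_subset[OF bij_betw_imp_inj_on[OF N(3)], of "\<epsilon> ` carrier M"] E(2)
      by (simp add: comp_def)
    show "essential A N ((%x. c (\<epsilon> x)) ` carrier M)"
      using essential_iso[OF inj_fd[OF E(3)] N E(4)] by (simp add: image_image)
  qed
  thus ?thesis by blast
qed

text \<open>Any homomorphism can be continued by one with exact kernel into an injective module that is a hull
  of the new cokernel. Iterating this gives a minimal resolution.\<close>

lemma hull_step:
  fixes E :: "('k, 'a, 'v) rmodule"
  assumes E: "fdm E" and U: "submod A E U"
  shows "\<exists>(E' :: ('k, 'a, nat => 'k) rmodule) d. injm E' \<and> d \<in> rhom A E E' \<and>
     essential A E' (d ` carrier E) \<and> rker E E' d = U"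
proof -
  obtain Q :: "('k, 'a, 'v) rmodule" and p where Q: "fdm Q" "p \<in> rhom A E Q" "p ` carrier E = carrier Q" "rker E Q p = U"
    using quotient_exists[OF E U] by blast
  obtain E' :: "('k, 'a, nat => 'k) rmodule" and \<epsilon> where E': "is_injective_hull K A Q E' \<epsilon>"
    using injective_hull_exists[OF Q(1)] by blast
  have e: "injm E'" "\<epsilon> \<in> rhom A Q E'" "inj_on \<epsilon> (carrier Q)" "essential A E' (\<epsilon> ` carrier Q)"
    using E' by (simp_all add: is_injective_hull_def)
  have inj: "\<epsilon> y = \<zero>\<^bsub>E'\<^esub> \<longleftrightarrow> y = \<zero>\<^sub>Q" if "y \<in> carrier Q" for y
    using rhom_inj_iff[OF Q(1) inj_fd[OF e(1)] e(2)] e(3) that rhom_zero_map[OF Q(1) inj_fd[OF e(1)] e(2)] by auto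
  have "rker E E' (%x. \<epsilon> (p x)) = U"
    unfolding Q(4)[symmetric] rker_def using inj rhomD(1)[OF Q(2)] by auto
  moreover have "(%x. \<epsilon> (p x)) ` carrier E = \<epsilon> ` carrier Q" using Q(3) by (metis image_image)
  ultimately show ?thesis using e rhom_comp[OF Q(2) e(2)] by (intro exI[of _ E'] exI[of _ "%x. \<epsilon> (p x)"]) simp
qed

lemma min_inj_resolution_exists:
  assumes M: "fdm M"
  shows "\<exists>I \<epsilon> d. min_inj_resolution K A M I \<epsilon> d"
proof -
  obtain I0 :: "('k, 'a, nat => 'k) rmodule" and \<epsilon> where h: "is_injective_hull K A M I0 \<epsilon>"
    using injective_hull_exists[OF M] by blast
  hence I0: "injm I0" "\<epsilon> \<in> rhom A M I0" by (simp_all add: is_injective_hull_def)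
  let ?P = "%(n::nat) (E :: ('k, 'a, nat => 'k) rmodule, U).
     injm E \<and> submod A E U \<and> (n = 0 --> (E, U) = (I0, \<epsilon> ` carrier M))"
  let ?Q = "%(n::nat) (E :: ('k, 'a, nat => 'k) rmodule, U) (E' :: ('k, 'a, nat => 'k) rmodule, U').
     \<exists>d. d \<in> rhom A E E' \<and> essential A E' (d ` carrier E) \<and> rker E E' d = U \<and> U' = d ` carrier E"
  have "\<exists>s. \<forall>n. ?P n (s n) \<and> ?Q n (s n) (s (Suc n))"
  proof (rule dependent_nat_choice)
    show "\<exists>x. ?P 0 x" using I0 submod_image[OF M inj_fd[OF I0(1)] I0(2)]
      by (intro exI[of _ "(I0, \<epsilon> ` carrier M)"]) simp
  next
    fix x n assume "?P n x"
    then obtain E U where x: "x = (E, U)" "injm E" "submod A E U" by (cases x) auto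
    obtain E' :: "('k, 'a, nat => 'k) rmodule" and d where E': "injm E'" "d \<in> rhom A E E'"
      "essential A E' (d ` carrier E)" "rker E E' d = U" using hull_step[OF inj_fd[OF x(2)] x(3)] by blast
    hence "submod A E' (d ` carrier E)" by (simp add: essential_def)
    thus "\<exists>y. ?P (Suc n) y \<and> ?Q n x y" using E' x(1)
      by (intro exI[of _ "(E', d ` carrier E)"]) auto
  qed
  then obtain s where s0: "\<forall>n. ?P n (s n) \<and> ?Q n (s n) (s (Suc n))" by (rule exE)
  have s: "?P n (s n)" "?Q n (s n) (s (Suc n))" for n
    by (rule spec[OF s0, THEN conjunct1], rule spec[OF s0, THEN conjunct2])
  define I where "I n = fst (s n)" for n
  define U where "U n = snd (s n)" for n
  have sn: "s n = (I n, U n)" for n by (simp add: I_def U_def)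
  have P: "injm (I n)" for n using s(1)[of n] by (simp add: sn)
  have P0: "I 0 = I0" "U 0 = \<epsilon> ` carrier M" using s(1)[of 0] by (simp_all add: sn)
  have "\<forall>n. \<exists>d. d \<in> rhom A (I n) (I (Suc n)) \<and> essential A (I (Suc n)) (d ` carrier (I n)) \<and>
     rker (I n) (I (Suc n)) d = U n \<and> U (Suc n) = d ` carrier (I n)"
    using s(2) by (simp add: sn)
  from choice[OF this] obtain d where d: "!!n. d n \<in> rhom A (I n) (I (Suc n))"
    "!!n. essential A (I (Suc n)) (d n ` carrier (I n))" "!!n. rker (I n) (I (Suc n)) (d n) = U n"
    "!!n. U (Suc n) = d n ` carrier (I n)" by blast
  have "min_inj_resolution K A M I \<epsilon> d" unfolding min_inj_resolution_def
    using h P d(1-4) d(3)[of 0] P0 by simp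
  thus ?thesis by blast
qed

text \<open>This replaces the hulls in an arbitrary resolution by explicit interval modules.\<close>

lemma hull_iso:
  assumes E: "injm E" and U: "essential A E U" and F: "injm F" and N: "essential A F N"
    and \<kappa>: "\<kappa> \<in> rhom A (E\<lparr>carrier := U\<rparr>) (F\<lparr>carrier := N\<rparr>)" "bij_betw \<kappa> U N"
  shows "\<exists>h\<in>rhom A E F. bij_betw h (carrier E) (carrier F) \<and> (\<forall>u\<in>U. h u = \<kappa> u)"
proof -
  note fE = inj_fd[OF E] and fF = inj_fd[OF F]
  have sU: "submod A E U" and sN: "submod A F N" using U N by (simp_all add: essential_def)
  note u = submodD[OF fE sU] and n = submodD[OF fF sN]
  have inc: "(%x. x) \<in> rhom A (E\<lparr>carrier := U\<rparr>) E" by (rule rhomI) (use u(1) in auto)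
  have \<kappa>': "\<kappa> \<in> rhom A (E\<lparr>carrier := U\<rparr>) F" by (rule rhomI) (use rhomD[OF \<kappa>(1)] n(1) in auto)
  obtain h where h: "h \<in> rhom A E F" "!!x. x \<in> U ==> h x = \<kappa> x"
    using inj_extend[OF F fd_submod[OF fE sU] fE inc _ \<kappa>'] by auto
  have z: "h \<zero>\<^sub>E = \<zero>\<^sub>F" by (rule rhom_zero_map[OF fE fF h(1)])
  have "U \<inter> rker E F h = {\<zero>\<^sub>E}"
  proof
    show "U \<inter> rker E F h \<subseteq> {\<zero>\<^sub>E}"
    proof
      fix x assume x: "x \<in> U \<inter> rker E F h"
      hence "\<kappa> x = \<kappa> \<zero>\<^sub>E" using h(2)[of x] h(2)[OF u(2)] z by (simp add: rker_def)
      thus "x \<in> {\<zero>\<^sub>E}" using inj_onD[OF bij_betw_imp_inj_on[OF \<kappa>(2)]] x u(2) by simp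
    qed
  qed (use u(2) z submodD(2)[OF fE submod_rker[OF fE fF h(1)]] in auto)
  hence "rker E F h = {\<zero>\<^sub>E}" using U submod_rker[OF fE fF h(1)] by (simp add: essential_def)
  hence hi: "inj_on h (carrier E)" unfolding rhom_inj_iff[OF fE fF h(1)] rker_def by blast
  obtain r where r: "r \<in> rhom A F E" "!!x. x \<in> carrier E ==> r (h x) = x"
    using inj_extend[OF E fE fF h(1) hi rhom_id] by auto
  have "N \<inter> rker F E r = {\<zero>\<^sub>F}"
  proof
    show "N \<inter> rker F E r \<subseteq> {\<zero>\<^sub>F}"
    proof
      fix y assume y: "y \<in> N \<inter> rker F E r"
      then obtain x where x: "x \<in> U" "y = \<kappa> x" using bij_betw_imp_surj_on[OF \<kappa>(2)] by blast
      hence "r y = x" using h(2) r(2) u(1) by metis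
      thus "y \<in> {\<zero>\<^sub>F}" using x y h(2) z by (simp add: rker_def)
    qed
  qed (use n(2) submodD(2)[OF fF submod_rker[OF fF fE r(1)]] in auto)
  hence "rker F E r = {\<zero>\<^sub>F}" using N submod_rker[OF fF fE r(1)] by (simp add: essential_def)
  hence ri: "inj_on r (carrier F)" unfolding rhom_inj_iff[OF fF fE r(1)] rker_def by blast
  have "h (r y) = y" if y: "y \<in> carrier F" for y
    using inj_onD[OF ri, of "h (r y)" y] r(2)[of "r y"] rhomD(1)[OF r(1) y] rhomD(1)[OF h(1)] y by simp
  hence "bij_betw h (carrier E) (carrier F)"
    using r(2) rhomD(1)[OF h(1)] rhomD(1)[OF r(1)] by (intro bij_betw_byWitness[of _ r]) auto
  thus ?thesis using h by blast
qed

end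

section \<open>Dominant dimension and endomorphism algebras\<close>

lemma finsum_product:
  assumes "abelian_monoid M" "finite J" "finite S" "!!j s. j \<in> J ==> s \<in> S ==> f j s \<in> carrier M"
  shows "(\<Oplus>\<^sub>M t\<in>J \<times> S. f (fst t) (snd t)) = (\<Oplus>\<^sub>M s\<in>S. \<Oplus>\<^sub>M j\<in>J. f j s)"
  using assms(3,4)
proof (induction S)
  case empty
  interpret abelian_monoid M by fact
  show ?case by simp
next
  case (insert s S)
  interpret abelian_monoid M by fact
  have 1: "J \<times> insert s S = (%j. (j, s)) ` J \<union> J \<times> S" by auto
  have inj: "inj_on (%j. (j, s)) J" by (rule inj_onI) simp
  have "(\<Oplus>\<^sub>M t\<in>J \<times> insert s S. f (fst t) (snd t)) =
     (\<Oplus>\<^sub>M t\<in>(%j. (j, s)) ` J. f (fst t) (snd t)) \<oplus>\<^sub>M (\<Oplus>\<^sub>M t\<in>J \<times> S. f (fst t) (snd t))"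
    unfolding 1 using insert assms(2) by (intro finsum_Un_disjoint) auto
  also have "(\<Oplus>\<^sub>M t\<in>(%j. (j, s)) ` J. f (fst t) (snd t)) = (\<Oplus>\<^sub>M j\<in>J. f j s)"
    using insert.prems inj by (subst finsum_reindex) auto
  also have "(\<Oplus>\<^sub>M t\<in>J \<times> S. f (fst t) (snd t)) = (\<Oplus>\<^sub>M s\<in>S. \<Oplus>\<^sub>M j\<in>J. f j s)"
    using insert by simp
  finally show ?case using insert by (subst finsum_insert) (auto intro!: finsum_closed)
qed

context fd_algebra
begin

text \<open>The dominant dimension is defined by a choice of resolution. To avoid the uniqueness of minimal
  resolutions, the terms of all of them are considered.\<close>

lemma domdim_mod_eq:
  fixes M :: "('k, 'a, 'v) rmodule"
  assumes M: "fdm M"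
    and D: "!!I \<epsilon> d. min_inj_resolution K A M I \<epsilon> d ==> (\<forall>i<D. projm (I i)) \<and> \<not> projm (I D)"
  shows "domdim_mod K A M = enat D"
proof -
  define I where "I = (SOME I. \<exists>\<epsilon> d. min_inj_resolution K A M I \<epsilon> d)"
  have "\<exists>\<epsilon> d. min_inj_resolution K A M I \<epsilon> d" unfolding I_def
    by (rule someI_ex[OF min_inj_resolution_exists[OF M]])
  hence I: "\<forall>i<D. projm (I i)" "\<not> projm (I D)" using D by blast+
  have dm: "domdim_mod K A M = (if \<not> projm (I 0) then 0
      else Sup {enat n | n. \<forall>i \<le> n. projm (I i)} + 1)"
    unfolding domdim_mod_def I_def by (simp add: Let_def)
  show ?thesis
  proof (cases D)
    case 0
    thus ?thesis using dm I(2) by (simp add: zero_enat_def)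
  next
    case (Suc j)
    have "{enat n | n. \<forall>i \<le> n. projm (I i)} = {enat n | n. n \<le> j}"
    proof (intro Collect_cong iffI; elim exE conjE)
      fix x n assume n: "x = enat n" "\<forall>i\<le>n. projm (I i)"
      hence "n \<le> j" using I(2) Suc by (metis not_less_eq_eq)
      thus "\<exists>n. x = enat n \<and> n \<le> j" using n by blast
    next
      fix x n assume n: "x = enat n" "n \<le> j"
      hence "\<forall>i\<le>n. projm (I i)" using I(1) Suc by simp
      thus "\<exists>n. x = enat n \<and> (\<forall>i \<le> n. projm (I i))" using n by blast
    qed
    moreover have "Sup {enat n | n. n \<le> j} = enat j"
      by (intro antisym Sup_least Sup_upper) auto
    ultimately show ?thesis using dm I(1) Suc by (simp add: one_enat_def)
  qed
qed

lemma domdim_mod_le_1: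
  fixes M :: "('k, 'a, 'v) rmodule"
  assumes M: "fdm M"
    and D: "!!I \<epsilon> d. min_inj_resolution K A M I \<epsilon> d ==> \<not> projm (I 1)"
  shows "domdim_mod K A M \<le> 1"
proof -
  define I where "I = (SOME I. \<exists>\<epsilon> d. min_inj_resolution K A M I \<epsilon> d)"
  have "\<exists>\<epsilon> d. min_inj_resolution K A M I \<epsilon> d" unfolding I_def
    by (rule someI_ex[OF min_inj_resolution_exists[OF M]])
  hence I: "\<not> projm (I 1)" using D by blast
  have dm: "domdim_mod K A M = (if \<not> projm (I 0) then 0
      else Sup {enat n | n. \<forall>i \<le> n. projm (I i)} + 1)"
    unfolding domdim_mod_def I_def by (simp add: Let_def)
  have "Sup {enat n | n. \<forall>i \<le> n. projm (I i)} \<le> 0"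
  proof (rule Sup_least)
    fix x assume "x \<in> {enat n | n. \<forall>i \<le> n. projm (I i)}"
    then obtain n where n: "x = enat n" "\<forall>i \<le> n. projm (I i)" by blast
    have "n = 0" using n(2) I by (metis One_nat_def Suc_leI neq0_conv)
    thus "x \<le> 0" using n(1) by (simp add: zero_enat_def)
  qed
  thus ?thesis using dm by simp
qed

text \<open>Since \<open>\<rho>\<close> is killed by the right annihilator of \<open>\<beta>\<close>, it becomes a left multiple \<open>y \<beta>\<close> in the injective
  hull. A homomorphism from a projective hull to \<open>A\<close> that does not vanish at \<open>\<rho>\<close> makes this a nonzero element
  of \<open>A \<rho> \<inter> A \<beta>\<close>.\<close>

lemma hull_not_proj:
  assumes E: "is_injective_hull K A AA E \<epsilon>"
    and b: "\<beta> \<in> carrier A" "\<rho> \<in> carrier A" "\<rho> ~= \<zero>\<^sub>A"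
    and ann: "!!c. c \<in> carrier A ==> \<beta> \<otimes>\<^sub>A c = \<zero>\<^sub>A ==> \<rho> \<otimes>\<^sub>A c = \<zero>\<^sub>A"
    and no: "!!g y. g \<in> carrier A ==> y \<in> carrier A ==> g \<otimes>\<^sub>A \<rho> = y \<otimes>\<^sub>A \<beta> ==> g \<otimes>\<^sub>A \<rho> = \<zero>\<^sub>A"
  shows "\<not> projm E"
proof
  assume P: "projm E"
  have e: "injm E" "\<epsilon> \<in> rhom A AA E" "inj_on \<epsilon> (carrier A)"
    using E by (simp_all add: is_injective_hull_def)
  note fE = inj_fd[OF e(1)]
  note \<epsilon> = rhomD[OF e(2), simplified]
  have e0: "\<epsilon> c = \<zero>\<^sub>E \<longleftrightarrow> c = \<zero>\<^sub>A" if "c \<in> carrier A" for c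
    using rhom_inj_iff[OF fd_regular fE e(2)] e(3) that rhom_zero_map[OF fd_regular fE e(2)] by auto
  have "\<exists>y\<in>carrier E. \<epsilon> \<rho> = y \<star>\<^sub>E \<beta>"
  proof (rule inj_divide[OF e(1) b(1) \<epsilon>(1)[OF b(2)]])
    fix c assume c: "c \<in> carrier A" "\<beta> \<otimes>\<^sub>A c = \<zero>\<^sub>A"
    have "\<epsilon> \<rho> \<star>\<^sub>E c = \<epsilon> (\<rho> \<otimes>\<^sub>A c)" by (simp add: \<epsilon>(3) b(2) c(1))
    thus "\<epsilon> \<rho> \<star>\<^sub>E c = \<zero>\<^sub>E" using ann[OF c] e0[of "\<zero>\<^sub>A"] by simp
  qed
  then obtain y where y: "y \<in> carrier E" "\<epsilon> \<rho> = y \<star>\<^sub>E \<beta>" by blast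
  have "\<epsilon> \<rho> ~= \<zero>\<^sub>E" using e0[OF b(2)] b(3) by simp
  then obtain \<phi> where p: "\<phi> \<in> rhom A E AA" "\<phi> (\<epsilon> \<rho>) ~= \<zero>\<^sub>A"
    using proj_torsionless[OF P] \<epsilon>(1)[OF b(2)] unfolding torsionless_def by meson
  note \<phi> = rhomD[OF p(1), simplified]
  have "\<epsilon> \<rho> = \<epsilon> \<one>\<^sub>A \<star>\<^sub>E \<rho>" using \<epsilon>(3)[of "\<one>\<^sub>A" \<rho>] b(2) by simp
  hence 1: "\<phi> (\<epsilon> \<rho>) = \<phi> (\<epsilon> \<one>\<^sub>A) \<otimes>\<^sub>A \<rho>" using \<phi>(3)[of "\<epsilon> \<one>\<^sub>A" \<rho>] \<epsilon>(1) b(2) by simp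
  have 2: "\<phi> (\<epsilon> \<rho>) = \<phi> y \<otimes>\<^sub>A \<beta>" using y \<phi>(3) b(1) by simp
  have "\<phi> (\<epsilon> \<one>\<^sub>A) \<otimes>\<^sub>A \<rho> = \<zero>\<^sub>A"
    by (rule no[of _ "\<phi> y"]) (use 1 2 y(1) \<phi>(1) \<epsilon>(1) in simp_all)
  thus False using 1 p(2) by simp
qed

text \<open>In the injective hull, \<open>\<rho> = y \<nu> \<mu>\<close>. The element \<open>y \<nu>\<close> is not in \<open>A\<close>, as \<open>\<rho>\<close> is not in \<open>A \<mu>\<close>, and its
  image in the next term is killed by \<open>\<mu>\<close>. A homomorphism from a projective term to \<open>A\<close> maps the image of
  \<open>y\<close> to some \<open>k\<close> with \<open>k \<nu> \<mu> = 0\<close> and \<open>k \<nu> \<noteq> 0\<close>.\<close>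

lemma second_term_not_proj:
  assumes R: "min_inj_resolution K A AA I \<epsilon> d"
    and b: "\<nu> \<in> carrier A" "\<mu> \<in> carrier A" "\<rho> \<in> carrier A"
    and ann: "!!c. c \<in> carrier A ==> \<nu> \<otimes>\<^sub>A \<mu> \<otimes>\<^sub>A c = \<zero>\<^sub>A ==> \<rho> \<otimes>\<^sub>A c = \<zero>\<^sub>A"
    and no: "!!h. h \<in> carrier A ==> h \<otimes>\<^sub>A \<mu> ~= \<rho>"
    and k: "!!k. k \<in> carrier A ==> k \<otimes>\<^sub>A \<nu> \<otimes>\<^sub>A \<mu> = \<zero>\<^sub>A ==> k \<otimes>\<^sub>A \<nu> = \<zero>\<^sub>A"
  shows "\<not> projm (I 1)"
proof
  assume P: "projm (I 1)"
  have e: "injm (I 0)" "\<epsilon> \<in> rhom A AA (I 0)" "inj_on \<epsilon> (carrier A)"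
    and d: "d 0 \<in> rhom A (I 0) (I 1)" "rker (I 0) (I 1) (d 0) = \<epsilon> ` carrier A"
    using R by (simp_all add: min_inj_resolution_def is_injective_hull_def)
  note fE = inj_fd[OF e(1)] and fF = proj_fd[OF P]
  note \<epsilon> = rhomD[OF e(2), simplified] and D = rhomD[OF d(1)]
  have "\<exists>y\<in>carrier (I 0). \<epsilon> \<rho> = y \<star>\<^bsub>I 0\<^esub> (\<nu> \<otimes>\<^sub>A \<mu>)"
  proof (rule inj_divide[OF e(1) _ \<epsilon>(1)[OF b(3)]])
    fix c assume c: "c \<in> carrier A" "\<nu> \<otimes>\<^sub>A \<mu> \<otimes>\<^sub>A c = \<zero>\<^sub>A"
    have "\<epsilon> \<rho> \<star>\<^bsub>I 0\<^esub> c = \<epsilon> (\<rho> \<otimes>\<^sub>A c)" by (simp add: \<epsilon>(3) b(3) c(1))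
    thus "\<epsilon> \<rho> \<star>\<^bsub>I 0\<^esub> c = \<zero>\<^bsub>I 0\<^esub>" using ann[OF c] rhom_zero_map[OF fd_regular fE e(2)] by simp
  qed (use b in simp)
  then obtain y where y: "y \<in> carrier (I 0)" "\<epsilon> \<rho> = y \<star>\<^bsub>I 0\<^esub> \<nu> \<star>\<^bsub>I 0\<^esub> \<mu>" using b by (auto simp: fdD(6)[OF fE])
  have yn: "y \<star>\<^bsub>I 0\<^esub> \<nu> \<in> carrier (I 0)" using y b by (simp add: fdD(3)[OF fE])
  have "\<epsilon> \<rho> \<in> rker (I 0) (I 1) (d 0)" unfolding d(2) using b by simp
  hence dm: "d 0 (y \<star>\<^bsub>I 0\<^esub> \<nu>) \<star>\<^bsub>I 1\<^esub> \<mu> = \<zero>\<^bsub>I 1\<^esub>"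
    using y(2) D(3)[OF yn b(2)] by (simp add: rker_def)
  have dn: "d 0 (y \<star>\<^bsub>I 0\<^esub> \<nu>) ~= \<zero>\<^bsub>I 1\<^esub>"
  proof
    assume "d 0 (y \<star>\<^bsub>I 0\<^esub> \<nu>) = \<zero>\<^bsub>I 1\<^esub>"
    hence "y \<star>\<^bsub>I 0\<^esub> \<nu> \<in> \<epsilon> ` carrier A" using yn unfolding d(2)[symmetric] by (simp add: rker_def)
    then obtain h where h: "y \<star>\<^bsub>I 0\<^esub> \<nu> = \<epsilon> h" "h \<in> carrier A" by (rule imageE)
    hence "\<epsilon> (h \<otimes>\<^sub>A \<mu>) = \<epsilon> \<rho>" using y(2) \<epsilon>(3) b by simp
    hence "h \<otimes>\<^sub>A \<mu> = \<rho>" using inj_onD[OF e(3)] h(2) b by simp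
    thus False using no[OF h(2)] by simp
  qed
  obtain \<phi> where p: "\<phi> \<in> rhom A (I 1) AA" "\<phi> (d 0 (y \<star>\<^bsub>I 0\<^esub> \<nu>)) ~= \<zero>\<^sub>A"
    using proj_torsionless[OF P] D(1)[OF yn] dn unfolding torsionless_def by meson
  note \<phi> = rhomD[OF p(1), unfolded regular_simps]
  let ?k = "\<phi> (d 0 y)"
  have kc: "?k \<in> carrier A" by (intro \<phi>(1) D(1) y(1))
  have 1: "\<phi> (d 0 (y \<star>\<^bsub>I 0\<^esub> \<nu>)) = ?k \<otimes>\<^sub>A \<nu>"
    using D(3)[OF y(1) b(1)] \<phi>(3)[OF D(1)[OF y(1)] b(1)] by simp
  have "?k \<otimes>\<^sub>A \<nu> \<otimes>\<^sub>A \<mu> = \<phi> (d 0 (y \<star>\<^bsub>I 0\<^esub> \<nu>) \<star>\<^bsub>I 1\<^esub> \<mu>)"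
    unfolding 1[symmetric] by (rule \<phi>(3)[OF D(1)[OF yn] b(2), symmetric])
  also have "\<dots> = \<zero>\<^sub>A" using dm rhom_zero_map[OF fF fd_regular p(1)] by simp
  finally have "?k \<otimes>\<^sub>A \<nu> = \<zero>\<^sub>A" by (rule k[OF kc])
  thus False using 1 p(2) by simp
qed

text \<open>The hull of a submodule of an injective module \<open>Q\<close> is a summand of \<open>Q\<close>.\<close>

lemma hull_proj:
  fixes M :: "('k, 'a, 'v) rmodule" and Q :: "('k, 'a, 'w) rmodule"
  assumes M: "fdm M" and E: "is_injective_hull K A M E \<epsilon>"
    and Q: "injm Q" "projm Q" and i: "i \<in> rhom A M Q" "inj_on i (carrier M)"
  shows "projm E"
proof -
  have e: "injm E" "\<epsilon> \<in> rhom A M E" "inj_on \<epsilon> (carrier M)" "essential A E (\<epsilon> ` carrier M)"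
    using E by (simp_all add: is_injective_hull_def)
  note fE = inj_fd[OF e(1)] and fQ = proj_fd[OF Q(2)]
  obtain h where h: "h \<in> rhom A E Q" "!!x. x \<in> carrier M ==> h (\<epsilon> x) = i x"
    using inj_extend[OF Q(1) M fE e(2,3) i(1)] by blast
  have "\<epsilon> ` carrier M \<inter> rker E Q h = {\<zero>\<^sub>E}"
  proof
    show "\<epsilon> ` carrier M \<inter> rker E Q h \<subseteq> {\<zero>\<^sub>E}"
    proof
      fix z assume "z \<in> \<epsilon> ` carrier M \<inter> rker E Q h"
      then obtain x where x: "x \<in> carrier M" "z = \<epsilon> x" "h z = \<zero>\<^sub>Q" by (auto simp: rker_def)
      hence "i x = \<zero>\<^sub>Q" using h(2) by simp
      hence "x = \<zero>\<^sub>M" using i(2) x(1) unfolding rhom_inj_iff[OF M fQ i(1)] by blast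
      thus "z \<in> {\<zero>\<^sub>E}" using x rhom_zero_map[OF M fE e(2)] by simp
    qed
    have "submod A E (\<epsilon> ` carrier M)" by (rule submod_image[OF M fE e(2)])
    thus "{\<zero>\<^sub>E} \<subseteq> \<epsilon> ` carrier M \<inter> rker E Q h"
      using submodD(2)[OF fE] submod_rker[OF fE fQ h(1)] by blast
  qed
  hence "rker E Q h = {\<zero>\<^sub>E}" using e(4) submod_rker[OF fE fQ h(1)] by (simp add: essential_def)
  hence hi: "inj_on h (carrier E)" unfolding rhom_inj_iff[OF fE fQ h(1)] rker_def by blast
  obtain r where r: "r \<in> rhom A Q E" "!!x. x \<in> carrier E ==> r (h x) = x"
    using inj_extend[OF e(1) fE fQ h(1) hi rhom_id] by auto
  show ?thesis by (rule proj_retract[OF Q(2) fE h(1) r(1)]) (rule r(2))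
qed

subsection \<open>Endomorphism algebras\<close>

lemma End_simps:
  "carrier (End_alg A M) = rhom A M M \<inter> extensional (carrier M)"
  "f \<otimes>\<^bsub>End_alg A M\<^esub> g = compose (carrier M) f g" "\<one>\<^bsub>End_alg A M\<^esub> = (\<lambda>x \<in> carrier M. x)"
  "\<zero>\<^bsub>End_alg A M\<^esub> = (\<lambda>x \<in> carrier M. \<zero>\<^sub>M)"
  "f \<oplus>\<^bsub>End_alg A M\<^esub> g = (\<lambda>x \<in> carrier M. f x \<oplus>\<^sub>M g x)"
  "k \<odot>\<^bsub>End_alg A M\<^esub> f = (\<lambda>x \<in> carrier M. k \<odot>\<^sub>M f x)"
  by (simp_all add: End_alg_def)

context
  fixes M :: "('k, 'a, 'v) rmodule"
  assumes M: "fdm M"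
begin

interpretation M: Module.module K M by (rule fdD(1)[OF M])

lemma restrict_rhom: "f \<in> rhom A M M ==> restrict f (carrier M) \<in> carrier (End_alg A M)"
  unfolding End_simps by (intro IntI rhomI) (simp_all add: rhomD[of f A M M] fdD(3)[OF M])

lemma End_eqI:
  "f \<in> carrier (End_alg A M) ==> g \<in> carrier (End_alg A M) ==> (!!x. x \<in> carrier M ==> f x = g x) ==> f = g"
  by (rule extensionalityI[of f "carrier M" g]) (simp_all add: End_simps)

lemma End_rhom: "f \<in> carrier (End_alg A M) ==> f \<in> rhom A M M"
  by (simp add: End_simps)

lemma smult_rhom:
  assumes "k \<in> carrier K" "f \<in> rhom A M M"
  shows "(%x. k \<odot>\<^sub>M f x) \<in> rhom A M M"
  by (rule rhomI) (simp_all add: rhomD[OF assms(2)] assms(1) M.smult_r_distr smult_ract[OF M])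

lemma add_rhom:
  assumes "f \<in> rhom A M M" "g \<in> rhom A M M"
  shows "(%x. f x \<oplus>\<^sub>M g x) \<in> rhom A M M"
  by (rule rhomI) (simp_all add: rhomD[OF assms(1)] rhomD[OF assms(2)] M.a_ac fdD(3,4)[OF M])

lemma zero_rhom: "(%x. \<zero>\<^sub>M) \<in> rhom A M M"
  by (rule rhomI) (simp_all add: zero_ract[OF M])

lemma End_fd_algebra: "fd_algebra K (End_alg A M)"
proof -
  let ?B = "End_alg A M" and ?H = "hom_space K M M"
  note mM = fdD(1)[OF M]
  note mH = module_hom_space[OF mM mM]
  have k: "ksub K ?H (carrier ?B)" unfolding ksub_def
  proof (intro conjI ballI)
    show "carrier ?B \<subseteq> carrier ?H" using rhom_lin[OF M M] by (auto simp: End_simps hom_space_simps)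
    show "\<zero>\<^sub>?H \<in> carrier ?B" using restrict_rhom[OF zero_rhom] by (simp add: hom_space_simps)
  next
    fix f g assume "f \<in> carrier ?B" "g \<in> carrier ?B"
    from restrict_rhom[OF add_rhom[OF this[THEN End_rhom]]]
    show "f \<oplus>\<^sub>?H g \<in> carrier ?B" by (simp add: hom_space_simps)
  next
    fix k f assume "k \<in> carrier K" "f \<in> carrier ?B"
    from restrict_rhom[OF smult_rhom[OF this(1) this(2)[THEN End_rhom]]]
    show "k \<odot>\<^sub>?H f \<in> carrier ?B" by (simp add: hom_space_simps)
  qed
  have mB: "Module.module K ?B"
    by (rule module_cong[OF module_ksub[OF mH k]]) (simp_all add: End_simps hom_space_simps)
  have fB: "finite_dim K ?B"
    by (rule finite_dim_cong[OF module_ksub[OF mH k] finite_dim_ksub[OF fieldK mH k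
          finite_dim_hom_space[OF fieldK mM mM fdD(2)[OF M] fdD(2)[OF M]]]])
      (simp_all add: End_simps hom_space_simps)
  interpret B: Module.module K ?B by (rule mB)
  have mc: "f \<otimes>\<^sub>?B g \<in> carrier ?B" if "f \<in> carrier ?B" "g \<in> carrier ?B" for f g
    using restrict_rhom[OF rhom_comp[OF that(2,1)[THEN End_rhom]]] by (simp add: End_simps compose_def)
  have ev: "(f \<otimes>\<^sub>?B g) x = f (g x)" "(f \<oplus>\<^sub>?B g) x = f x \<oplus>\<^sub>M g x" "(c \<odot>\<^sub>?B f) x = c \<odot>\<^sub>M f x"
    "\<one>\<^sub>?B x = x" if "x \<in> carrier M" for f g c x
    using that by (simp_all add: End_simps compose_def)
  have fc: "f x \<in> carrier M" if "f \<in> carrier ?B" "x \<in> carrier M" for f x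
    by (rule rhomD(1)[OF End_rhom[OF that(1)] that(2)])
  have oc: "\<one>\<^sub>?B \<in> carrier ?B" using restrict_rhom[OF rhom_id] by (simp add: End_simps)
  have r: "ring ?B"
  proof (rule ringI)
    show "abelian_group ?B" by (rule B.abelian_group_axioms)
    show "monoid ?B"
    proof (rule monoidI)
      fix f g h assume h: "f \<in> carrier ?B" "g \<in> carrier ?B" "h \<in> carrier ?B"
      show "f \<otimes>\<^sub>?B g \<otimes>\<^sub>?B h = f \<otimes>\<^sub>?B (g \<otimes>\<^sub>?B h)"
        by (rule End_eqI) (simp_all add: mc h ev fc)
    next
      fix f assume h: "f \<in> carrier ?B"
      show "\<one>\<^sub>?B \<otimes>\<^sub>?B f = f" by (rule End_eqI) (simp_all add: mc h ev fc oc)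
      show "f \<otimes>\<^sub>?B \<one>\<^sub>?B = f" by (rule End_eqI) (simp_all add: mc h ev fc oc)
    qed (simp_all add: mc oc)
  next
    fix f g h assume h: "f \<in> carrier ?B" "g \<in> carrier ?B" "h \<in> carrier ?B"
    show "(f \<oplus>\<^sub>?B g) \<otimes>\<^sub>?B h = f \<otimes>\<^sub>?B h \<oplus>\<^sub>?B g \<otimes>\<^sub>?B h"
      by (rule End_eqI) (simp_all add: mc h ev fc)
    show "h \<otimes>\<^sub>?B (f \<oplus>\<^sub>?B g) = h \<otimes>\<^sub>?B f \<oplus>\<^sub>?B h \<otimes>\<^sub>?B g"
      by (rule End_eqI) (simp_all add: mc h ev fc rhomD(2)[OF End_rhom[OF h(3)]])
  qed
  have s: "(c \<odot>\<^sub>?B f) \<otimes>\<^sub>?B g = c \<odot>\<^sub>?B (f \<otimes>\<^sub>?B g)" "f \<otimes>\<^sub>?B (c \<odot>\<^sub>?B g) = c \<odot>\<^sub>?B (f \<otimes>\<^sub>?B g)"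
    if h: "c \<in> carrier K" "f \<in> carrier ?B" "g \<in> carrier ?B" for c f g
  proof -
    show "(c \<odot>\<^sub>?B f) \<otimes>\<^sub>?B g = c \<odot>\<^sub>?B (f \<otimes>\<^sub>?B g)"
      by (rule End_eqI) (simp_all add: mc h ev fc)
    show "f \<otimes>\<^sub>?B (c \<odot>\<^sub>?B g) = c \<odot>\<^sub>?B (f \<otimes>\<^sub>?B g)"
      by (rule End_eqI) (simp_all add: mc h ev fc linD(3)[OF rhom_lin[OF M M End_rhom[OF h(2)]]])
  qed
  show ?thesis by (rule fd_algebra.intro[OF fieldK r mB fB s])
qed

interpretation B: fd_algebra K "End_alg A M" by (rule End_fd_algebra)

lemma End_eval:
  assumes "x \<in> carrier M"
  shows "(f \<otimes>\<^bsub>End_alg A M\<^esub> g) x = f (g x)" "\<zero>\<^bsub>End_alg A M\<^esub> x = \<zero>\<^sub>M"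
    "(f \<oplus>\<^bsub>End_alg A M\<^esub> g) x = f x \<oplus>\<^sub>M g x" "(k \<odot>\<^bsub>End_alg A M\<^esub> f) x = k \<odot>\<^sub>M f x"
  using assms by (simp_all add: End_simps compose_def)

lemma End_zero_iff:
  "f \<in> carrier (End_alg A M) ==> f = \<zero>\<^bsub>End_alg A M\<^esub> \<longleftrightarrow> (\<forall>x\<in>carrier M. f x = \<zero>\<^sub>M)"
  using End_eqI[of f "\<zero>\<^bsub>End_alg A M\<^esub>"] by (auto simp: End_eval)

text \<open>\<open>hull_not_proj\<close> for endomorphism algebras, where annihilators become kernels.\<close>

lemma domdim_End_0:
  assumes b: "\<beta> \<in> rhom A M M" "\<rho> \<in> rhom A M M" and w: "w \<in> carrier M" "\<rho> w ~= \<zero>\<^sub>M"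
    and ker: "!!x. x \<in> carrier M ==> \<beta> x = \<zero>\<^sub>M ==> \<rho> x = \<zero>\<^sub>M"
    and no: "!!g y. g \<in> rhom A M M ==> y \<in> rhom A M M ==> (!!x. x \<in> carrier M ==> g (\<rho> x) = y (\<beta> x)) ==>
       (\<forall>x\<in>carrier M. g (\<rho> x) = \<zero>\<^sub>M)"
  shows "domdim K (End_alg A M) = 0"
  unfolding domdim_def zero_enat_def
proof (rule B.domdim_mod_eq[OF B.fd_regular])
  fix I \<epsilon> d assume R: "min_inj_resolution K (End_alg A M) (regular_rmod (End_alg A M)) I \<epsilon> d"
  let ?b = "restrict \<beta> (carrier M)" and ?r = "restrict \<rho> (carrier M)" and ?B = "End_alg A M"
  note bc = restrict_rhom[OF b(1)] and rc = restrict_rhom[OF b(2)]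
  have "\<not> proj_rmod K ?B (I 0)"
  proof (rule B.hull_not_proj[OF _ bc rc])
    show "is_injective_hull K ?B (regular_rmod ?B) (I 0) \<epsilon>" using R by (simp add: min_inj_resolution_def)
    show "?r ~= \<zero>\<^sub>?B" using w by (simp add: End_zero_iff[OF rc]) blast
  next
    fix c assume c: "c \<in> carrier ?B" "?b \<otimes>\<^sub>?B c = \<zero>\<^sub>?B"
    note C = rhomD(1)[OF End_rhom[OF c(1)]]
    have "\<rho> (c x) = \<zero>\<^sub>M" if x: "x \<in> carrier M" for x
    proof (rule ker[OF C[OF x]])
      have "(?b \<otimes>\<^sub>?B c) x = \<zero>\<^sub>M" unfolding c(2) by (rule End_eval(2)[OF x])
      thus "\<beta> (c x) = \<zero>\<^sub>M" using C[OF x] by (simp add: End_eval(1)[OF x])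
    qed
    thus "?r \<otimes>\<^sub>?B c = \<zero>\<^sub>?B" using rc c(1) C by (simp add: End_zero_iff End_eval)
  next
    fix g y assume g: "g \<in> carrier ?B" and y: "y \<in> carrier ?B" and eq: "g \<otimes>\<^sub>?B ?r = y \<otimes>\<^sub>?B ?b"
    have "\<forall>x\<in>carrier M. g (\<rho> x) = \<zero>\<^sub>M"
    proof (rule no[OF End_rhom[OF g] End_rhom[OF y]])
      fix x assume x: "x \<in> carrier M"
      have "(g \<otimes>\<^sub>?B ?r) x = (y \<otimes>\<^sub>?B ?b) x" by (simp only: eq)
      thus "g (\<rho> x) = y (\<beta> x)" using x by (simp add: End_eval)
    qed
    thus "g \<otimes>\<^sub>?B ?r = \<zero>\<^sub>?B" using g rc by (simp add: End_zero_iff End_eval)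
  qed
  thus "(\<forall>i<0. proj_rmod K ?B (I i)) \<and> \<not> proj_rmod K ?B (I 0)" by simp
qed

lemma End_second_term_not_proj:
  assumes R: "min_inj_resolution K (End_alg A M) (regular_rmod (End_alg A M)) I \<epsilon> d"
    and b: "\<nu> \<in> rhom A M M" "\<mu> \<in> rhom A M M" "\<rho> \<in> rhom A M M"
    and ker: "!!x. x \<in> carrier M ==> \<nu> (\<mu> x) = \<zero>\<^sub>M ==> \<rho> x = \<zero>\<^sub>M"
    and no: "!!h. h \<in> rhom A M M ==> \<exists>x\<in>carrier M. h (\<mu> x) ~= \<rho> x"
    and k: "!!k. k \<in> rhom A M M ==> (!!x. x \<in> carrier M ==> k (\<nu> (\<mu> x)) = \<zero>\<^sub>M) ==>
       (\<forall>x\<in>carrier M. k (\<nu> x) = \<zero>\<^sub>M)"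
  shows "\<not> proj_rmod K (End_alg A M) (I 1)"
proof (rule B.second_term_not_proj[OF R restrict_rhom[OF b(1)] restrict_rhom[OF b(2)] restrict_rhom[OF b(3)]])
  let ?n = "restrict \<nu> (carrier M)" and ?m = "restrict \<mu> (carrier M)" and ?r = "restrict \<rho> (carrier M)"
    and ?B = "End_alg A M"
  note c' = restrict_rhom[OF b(1)] restrict_rhom[OF b(2)] restrict_rhom[OF b(3)]
  note Mu = rhomD(1)[OF b(2)]
  {
    fix c assume c: "c \<in> carrier ?B" "?n \<otimes>\<^sub>?B ?m \<otimes>\<^sub>?B c = \<zero>\<^sub>?B"
    note C = rhomD(1)[OF End_rhom[OF c(1)]]
    have "\<rho> (c x) = \<zero>\<^sub>M" if x: "x \<in> carrier M" for x
    proof (rule ker[OF C[OF x]])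
      have "(?n \<otimes>\<^sub>?B ?m \<otimes>\<^sub>?B c) x = \<zero>\<^sub>M" unfolding c(2) by (rule End_eval(2)[OF x])
      thus "\<nu> (\<mu> (c x)) = \<zero>\<^sub>M" using C[OF x] Mu x by (simp add: End_eval)
    qed
    thus "?r \<otimes>\<^sub>?B c = \<zero>\<^sub>?B" using c'(3) c(1) C by (simp add: End_zero_iff End_eval)
  next
    fix h assume h: "h \<in> carrier ?B"
    show "h \<otimes>\<^sub>?B ?m ~= ?r"
    proof
      assume e: "h \<otimes>\<^sub>?B ?m = ?r"
      obtain x where x: "x \<in> carrier M" "h (\<mu> x) ~= \<rho> x" using no[OF End_rhom[OF h]] by blast
      have "(h \<otimes>\<^sub>?B ?m) x = ?r x" by (simp only: e)
      thus False using x by (simp add: End_eval)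
    qed
  next
    fix q assume q: "q \<in> carrier ?B" "q \<otimes>\<^sub>?B ?n \<otimes>\<^sub>?B ?m = \<zero>\<^sub>?B"
    have "\<forall>x\<in>carrier M. q (\<nu> x) = \<zero>\<^sub>M"
    proof (rule k[OF End_rhom[OF q(1)]])
      fix x assume x: "x \<in> carrier M"
      have "(q \<otimes>\<^sub>?B ?n \<otimes>\<^sub>?B ?m) x = \<zero>\<^sub>M" unfolding q(2) by (rule End_eval(2)[OF x])
      thus "q (\<nu> (\<mu> x)) = \<zero>\<^sub>M" using x Mu by (simp add: End_eval)
    qed
    thus "q \<otimes>\<^sub>?B ?n = \<zero>\<^sub>?B" using q(1) c' by (simp add: End_zero_iff End_eval)
  }
qed

text \<open>Let \<open>f\<close> be an idempotent such that endomorphisms of \<open>M\<close> are determined on \<open>M f\<close>. Then \<open>End M\<close> embeds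
  into the coinduced module \<open>Hom_K (M f, M)\<close>. The family \<open>z\<close>, \<open>p\<close> is a dual basis of the left \<open>End M\<close>-module
  \<open>M f\<close>, hence the coinduced module is injective. The family \<open>\<theta>\<close>, \<open>\<kappa>\<close> is a dual basis of its dual
  \<open>Hom_K (M f, K)\<close>; as the coinduced module is a sum of copies of this dual, it is projective.\<close>

lemma End_hull_proj:
  assumes f: "f \<in> carrier A" "f \<otimes>\<^sub>A f = f" and J: "finite J"
    and z: "!!j. j \<in> J ==> z j \<in> carrier M" "!!j. j \<in> J ==> z j \<star>\<^sub>M f = z j"
    and p: "!!j. j \<in> J ==> p j \<in> rhom A M AA"
    and dec: "!!m. m \<in> carrier M ==> m \<star>\<^sub>M f = m ==> m = (\<Oplus>\<^sub>M j\<in>J. m \<star>\<^sub>M p j (z j))"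
    and faithful: "!!b. b \<in> rhom A M M ==> (!!m. m \<in> carrier M ==> m \<star>\<^sub>M f = m ==> b m = \<zero>\<^sub>M) ==>
       \<forall>m\<in>carrier M. b m = \<zero>\<^sub>M"
    and \<theta>: "!!j. j \<in> J ==> \<theta> j \<in> lin K M (kmod K)"
    and \<kappa>: "!!j \<psi>. j \<in> J ==> \<psi> \<in> lin K (M\<lparr>carrier := {m \<in> carrier M. m \<star>\<^sub>M f = m}\<rparr>) (kmod K) ==> \<kappa> j \<psi> \<in> rhom A M M"
    and \<kappa>_add: "!!j \<psi> \<psi>' x. j \<in> J ==> \<psi> \<in> lin K (M\<lparr>carrier := {m \<in> carrier M. m \<star>\<^sub>M f = m}\<rparr>) (kmod K) ==>
       \<psi>' \<in> lin K (M\<lparr>carrier := {m \<in> carrier M. m \<star>\<^sub>M f = m}\<rparr>) (kmod K) ==> x \<in> carrier M ==>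
       \<kappa> j (%w. \<psi> w \<oplus> \<psi>' w) x = \<kappa> j \<psi> x \<oplus>\<^sub>M \<kappa> j \<psi>' x"
    and \<kappa>_comp: "!!j \<psi> b x. j \<in> J ==> \<psi> \<in> lin K (M\<lparr>carrier := {m \<in> carrier M. m \<star>\<^sub>M f = m}\<rparr>) (kmod K) ==>
       b \<in> rhom A M M ==> x \<in> carrier M ==> \<kappa> j (%w. \<psi> (b w)) x = \<kappa> j \<psi> (b x)"
    and \<kappa>_cong: "!!j \<psi> \<psi>' x. j \<in> J ==> x \<in> carrier M ==>
       (!!w. w \<in> carrier M ==> w \<star>\<^sub>M f = w ==> \<psi> w = \<psi>' w) ==> \<kappa> j \<psi> x = \<kappa> j \<psi>' x"
    and \<theta>\<kappa>: "!!\<psi> w. \<psi> \<in> lin K (M\<lparr>carrier := {m \<in> carrier M. m \<star>\<^sub>M f = m}\<rparr>) (kmod K) ==> w \<in> carrier M ==>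
       w \<star>\<^sub>M f = w ==> (\<Oplus>j\<in>J. \<theta> j (\<kappa> j \<psi> w)) = \<psi> w"
    and E: "is_injective_hull K (End_alg A M) (regular_rmod (End_alg A M)) E \<epsilon>"
  shows "proj_rmod K (End_alg A M) E"
proof -
  let ?B = "End_alg A M"
  define W where "W = M\<lparr>carrier := {m \<in> carrier M. m \<star>\<^sub>M f = m}\<rparr>"
  have Wc: "x \<in> carrier W \<longleftrightarrow> x \<in> carrier M \<and> x \<star>\<^sub>M f = x" for x by (simp add: W_def)
  have Ws: "add W = add M" "smult W = smult M" "zero W = zero M" by (simp_all add: W_def)
  note mM = fdD(1)[OF M]
  have kW: "ksub K M {m \<in> carrier M. m \<star>\<^sub>M f = m}" unfolding ksub_def
    using f(1) by (auto simp: fdD(4)[OF M] zero_ract[OF M] smult_ract[OF M])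
  have mW: "Module.module K W" unfolding W_def by (rule module_ksub[OF mM kW])
  have fW: "finite_dim K W" unfolding W_def by (rule finite_dim_ksub[OF fieldK mM kW fdD(2)[OF M]])
  interpret W: Module.module K W by (rule mW)
  have bW: "b w \<in> carrier W" if "b \<in> rhom A M M" "w \<in> carrier W" for b w
    using that rhomD(1)[OF that(1)] rhomD(3)[OF that(1) _ f(1)] by (simp add: Wc) metis
  have blin: "b \<in> lin K W W" if b: "b \<in> rhom A M M" for b
    by (rule linI) (use bW[OF b] linD(2,3)[OF rhom_lin[OF M M b]] in \<open>simp_all add: Ws Wc\<close>)
  let ?L = "%(b :: 'v => 'v) w. b w"
  have Lf: "?L b \<in> lin K W W" if "b \<in> carrier ?B" for b using blin[OF End_rhom[OF that]] .
  let ?Q = "B.coind W M ?L"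
  have ev: "(b \<otimes>\<^sub>?B c) w = b (c w)" "(b \<oplus>\<^sub>?B c) w = b w \<oplus>\<^sub>W c w" "(k \<odot>\<^sub>?B b) w = k \<odot>\<^sub>W b w"
    "\<one>\<^sub>?B w = w" if "w \<in> carrier W" for b c k w
    using that by (simp_all add: End_eval Wc Ws) (simp add: End_simps)
  have fQ: "fd_rmodule K ?B ?Q"
    by (rule B.fd_coind[OF mW fW mM fdD(2)[OF M] Lf]) (simp_all add: ev)
  define \<beta> where "\<beta> j m = restrict (%x. m \<star>\<^sub>M p j x) (carrier M)" for j m
  have \<beta>c: "\<beta> j m \<in> carrier ?B" if "j \<in> J" "m \<in> carrier M" for j m
    unfolding \<beta>_def by (rule restrict_rhom[OF generator_hom[OF M that(2) p[OF that(1)]]])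
  note P = rhomD[OF p, unfolded regular_simps]
  have iQ: "inj_rmod K ?B ?Q"
  proof (rule B.inj_coind[where J = J and z = z and \<beta> = \<beta>, OF mW fW mM fdD(2)[OF M] Lf])
    fix j assume j: "j \<in> J"
    show "z j \<in> carrier W" using z[OF j] by (simp add: Wc)
    show "\<beta> j \<in> lin K W ?B"
    proof (rule linI)
      fix m assume m: "m \<in> carrier W"
      thus "\<beta> j m \<in> carrier ?B" using \<beta>c[OF j] by (simp add: Wc)
      fix k assume k: "k \<in> carrier K"
      have m': "m \<in> carrier M" "k \<odot>\<^sub>M m \<in> carrier M" using m k by (simp_all add: Wc)
      show "\<beta> j (k \<odot>\<^sub>W m) = k \<odot>\<^sub>?B \<beta> j m"
      proof (rule End_eqI)
        show "k \<odot>\<^sub>?B \<beta> j m \<in> carrier ?B" using \<beta>c[OF j m'(1)] k by simp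
        show "\<beta> j (k \<odot>\<^sub>W m) \<in> carrier ?B" unfolding Ws by (rule \<beta>c[OF j m'(2)])
        fix x assume x: "x \<in> carrier M"
        show "\<beta> j (k \<odot>\<^sub>W m) x = (k \<odot>\<^sub>?B \<beta> j m) x"
          using x m' by (simp add: \<beta>_def Ws End_eval smult_ract[OF M k] P[OF j])
      qed
    next
      fix m n assume m: "m \<in> carrier W" and n: "n \<in> carrier W"
      have m': "m \<in> carrier M" "n \<in> carrier M" "m \<oplus>\<^sub>M n \<in> carrier M" using m n by (simp_all add: Wc)
      show "\<beta> j (m \<oplus>\<^sub>W n) = \<beta> j m \<oplus>\<^sub>?B \<beta> j n"
      proof (rule End_eqI)
        show "\<beta> j m \<oplus>\<^sub>?B \<beta> j n \<in> carrier ?B" using \<beta>c[OF j m'(1)] \<beta>c[OF j m'(2)] by simp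
        show "\<beta> j (m \<oplus>\<^sub>W n) \<in> carrier ?B" unfolding Ws by (rule \<beta>c[OF j m'(3)])
        fix x assume x: "x \<in> carrier M"
        show "\<beta> j (m \<oplus>\<^sub>W n) x = (\<beta> j m \<oplus>\<^sub>?B \<beta> j n) x"
          using x m' by (simp add: \<beta>_def Ws End_eval fdD(4)[OF M] P[OF j])
      qed
    qed
    fix a w assume a: "a \<in> carrier ?B" and w: "w \<in> carrier W"
    have w': "w \<in> carrier M" using w by (simp add: Wc)
    note Ar = rhomD[OF End_rhom[OF a]]
    show "\<beta> j (a w) = a \<otimes>\<^sub>?B \<beta> j w"
    proof (rule End_eqI)
      show "\<beta> j (a w) \<in> carrier ?B" by (rule \<beta>c[OF j Ar(1)[OF w']])
      show "a \<otimes>\<^sub>?B \<beta> j w \<in> carrier ?B" using a \<beta>c[OF j w'] by simp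
      fix x assume x: "x \<in> carrier M"
      show "\<beta> j (a w) x = (a \<otimes>\<^sub>?B \<beta> j w) x"
        using x w' by (simp add: \<beta>_def End_eval Ar P[OF j])
    qed
  next
    fix w assume w: "w \<in> carrier W"
    hence w': "w \<in> carrier M" "w \<star>\<^sub>M f = w" by (simp_all add: Wc)
    have c: "w \<star>\<^sub>M p j (z j) \<in> carrier W" if j: "j \<in> J" for j
    proof -
      have "w \<star>\<^sub>M p j (z j) \<star>\<^sub>M f = w \<star>\<^sub>M p j (z j \<star>\<^sub>M f)"
        using w' f(1) by (simp add: P(3)[OF j z(1)[OF j]] P(1)[OF j z(1)[OF j]] fdD(6)[OF M])
      thus ?thesis using w' P(1)[OF j z(1)[OF j]] by (simp add: Wc z(2)[OF j] fdD(3)[OF M])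
    qed
    have "w = (\<Oplus>\<^sub>M j\<in>J. w \<star>\<^sub>M p j (z j))" by (rule dec[OF w'])
    also have "\<dots> = (\<Oplus>\<^sub>W j\<in>J. w \<star>\<^sub>M p j (z j))"
      using finsum_ksub[OF M.abelian_group_axioms ksub_additive_subgroup[OF mM kW], of "%j. w \<star>\<^sub>M p j (z j)" J] c
      by (simp add: W_def)
    also have "\<dots> = (\<Oplus>\<^sub>W j\<in>J. \<beta> j w (z j))"
      by (rule W.finsum_cong') (simp_all add: \<beta>_def z c)
    finally show "w = (\<Oplus>\<^sub>W j\<in>J. \<beta> j w (z j))" .
  qed (simp_all add: ev J)
  obtain S c where S: "dual_basis K M S c" using dual_basis_exists[OF fieldK mM fdD(2)[OF M]] by blast
  note D = dual_basisD[OF S]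
  have Wf: "carrier (M\<lparr>carrier := {m \<in> carrier M. m \<star>\<^sub>M f = m}\<rparr>) = carrier W" by (simp add: W_def)
  have cq: "(%w. c s (q w)) \<in> lin K W (kmod K)" if "s \<in> S" "q \<in> carrier ?Q" for s q
  proof -
    have "q \<in> lin K W M" using that(2) by (simp add: B.coind_simps)
    from lin_comp[OF this D(3)[OF that(1)]] show ?thesis .
  qed
  define \<phi> where "\<phi> t q = restrict (\<kappa> (fst t) (%w. c (snd t) (q w))) (carrier M)" for t q
  define x where "x t = (\<lambda>w\<in>carrier W. \<theta> (fst t) w \<odot>\<^sub>M snd t)" for t
  note \<kappa>' = \<kappa>[folded W_def] and \<kappa>_add' = \<kappa>_add[folded W_def] and \<kappa>_comp' = \<kappa>_comp[folded W_def]
    and \<theta>\<kappa>' = \<theta>\<kappa>[folded W_def]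
  have \<phi>c: "\<phi> t q \<in> carrier ?B" if "t \<in> J \<times> S" "q \<in> carrier ?Q" for t q
  proof -
    have t: "fst t \<in> J" "snd t \<in> S" using that(1) by auto
    show ?thesis unfolding \<phi>_def by (rule restrict_rhom[OF \<kappa>'[OF t(1) cq[OF t(2) that(2)]]])
  qed
  have pQ: "proj_rmod K ?B ?Q"
  proof (rule B.proj_if_dual_basis[where x = x and \<phi> = \<phi>, OF fQ finite_cartesian_product[OF J D(1)]])
    fix t assume t: "t \<in> J \<times> S"
    hence t1: "fst t \<in> J" "snd t \<in> S" by auto
    have sM: "snd t \<in> carrier M" by (rule D(5)[OF t1(2)])
    note T = linD[OF \<theta>[OF t1(1)], simplified]
    have "(%w. \<theta> (fst t) w \<odot>\<^sub>M snd t) \<in> lin K W M"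
      by (rule linI) (simp_all add: Wc Ws T sM M.smult_l_distr M.smult_assoc1)
    thus "x t \<in> carrier ?Q" unfolding x_def by (rule B.coind_carrierI[OF mW])
    show "\<phi> t \<in> rhom ?B ?Q (regular_rmod ?B)"
    proof (rule rhomI, unfold B.regular_simps)
      fix q assume q: "q \<in> carrier ?Q"
      show "\<phi> t q \<in> carrier ?B" by (rule \<phi>c[OF t q])
      fix b assume b: "b \<in> carrier ?B"
      note b' = End_rhom[OF b]
      show "\<phi> t (q \<star>\<^sub>?Q b) = \<phi> t q \<otimes>\<^sub>?B b"
      proof (rule End_eqI)
        show "\<phi> t (q \<star>\<^sub>?Q b) \<in> carrier ?B" by (rule \<phi>c[OF t fdD(3)[OF fQ q b]])
        show "\<phi> t q \<otimes>\<^sub>?B b \<in> carrier ?B" by (rule B.A.m_closed[OF \<phi>c[OF t q] b])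
        fix y assume y: "y \<in> carrier M"
        have "\<kappa> (fst t) (%w. c (snd t) ((q \<star>\<^sub>?Q b) w)) y = \<kappa> (fst t) (%w. c (snd t) (q (b w))) y"
          by (rule \<kappa>_cong[OF t1(1) y]) (simp add: B.coind_simps Wc)
        also have "\<dots> = \<kappa> (fst t) (%w. c (snd t) (q w)) (b y)"
          by (rule \<kappa>_comp'[OF t1(1) cq[OF t1(2) q] b' y])
        finally show "\<phi> t (q \<star>\<^sub>?Q b) y = (\<phi> t q \<otimes>\<^sub>?B b) y"
          using y rhomD(1)[OF b' y] by (simp add: \<phi>_def End_eval)
      qed
    next
      fix q q' assume q: "q \<in> carrier ?Q" and q': "q' \<in> carrier ?Q"
      have ql: "q \<in> lin K W M" "q' \<in> lin K W M" using q q' by (simp_all add: B.coind_simps)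
      interpret Q: Module.module K ?Q by (rule fdD(1)[OF fQ])
      show "\<phi> t (q \<oplus>\<^sub>?Q q') = \<phi> t q \<oplus>\<^sub>?B \<phi> t q'"
      proof (rule End_eqI)
        show "\<phi> t (q \<oplus>\<^sub>?Q q') \<in> carrier ?B" by (rule \<phi>c[OF t Q.a_closed[OF q q']])
        show "\<phi> t q \<oplus>\<^sub>?B \<phi> t q' \<in> carrier ?B" by (rule B.A.a_closed[OF \<phi>c[OF t q] \<phi>c[OF t q']])
        fix y assume y: "y \<in> carrier M"
        have "\<kappa> (fst t) (%w. c (snd t) ((q \<oplus>\<^sub>?Q q') w)) y =
           \<kappa> (fst t) (%w. c (snd t) (q w) \<oplus> c (snd t) (q' w)) y"
          by (rule \<kappa>_cong[OF t1(1) y])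
            (simp add: B.coind_simps Wc linD(1)[OF ql(1)] linD(1)[OF ql(2)] linD(2)[OF D(3)[OF t1(2)]])
        also have "\<dots> = \<kappa> (fst t) (%w. c (snd t) (q w)) y \<oplus>\<^sub>M \<kappa> (fst t) (%w. c (snd t) (q' w)) y"
          by (rule \<kappa>_add'[OF t1(1) cq[OF t1(2) q] cq[OF t1(2) q'] y])
        finally show "\<phi> t (q \<oplus>\<^sub>?Q q') y = (\<phi> t q \<oplus>\<^sub>?B \<phi> t q') y"
          using y by (simp add: \<phi>_def End_eval)
      qed
    qed
  next
    fix q assume q: "q \<in> carrier ?Q"
    have ql: "q \<in> lin K W M" using q by (simp add: B.coind_simps)
    interpret Q: Module.module K ?Q by (rule fdD(1)[OF fQ])
    have xc: "x t \<in> carrier ?Q" if t: "t \<in> J \<times> S" for t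
    proof -
      have t1: "fst t \<in> J" "snd t \<in> S" using t by auto
      have sM: "snd t \<in> carrier M" by (rule D(5)[OF t1(2)])
      note T = linD[OF \<theta>[OF t1(1)], simplified]
      have "(%w. \<theta> (fst t) w \<odot>\<^sub>M snd t) \<in> lin K W M"
        by (rule linI) (simp_all add: Wc Ws T sM M.smult_l_distr M.smult_assoc1)
      thus ?thesis unfolding x_def by (rule B.coind_carrierI[OF mW])
    qed
    have tc: "x t \<star>\<^sub>?Q \<phi> t q \<in> carrier ?Q" if "t \<in> J \<times> S" for t
      by (rule fdD(3)[OF fQ xc[OF that] \<phi>c[OF that q]])
    show "q = (\<Oplus>\<^sub>?Q t\<in>J \<times> S. x t \<star>\<^sub>?Q \<phi> t q)"
    proof (rule B.coind_eqI[OF q])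
      show "(\<Oplus>\<^sub>?Q t\<in>J \<times> S. x t \<star>\<^sub>?Q \<phi> t q) \<in> carrier ?Q" using tc by (intro Q.finsum_closed) simp
      fix w assume w: "w \<in> carrier W"
      hence w': "w \<in> carrier M" "w \<star>\<^sub>M f = w" by (simp_all add: Wc)
      have fs: "\<theta> j (\<kappa> j (%w. c s (q w)) w) \<odot>\<^sub>M s \<in> carrier M" if j: "j \<in> J" and s: "s \<in> S" for j s
        by (intro M.smult_closed D(5)[OF s] linD(1)[OF \<theta>[OF j], simplified] rhomD(1)[OF \<kappa>'[OF j cq[OF s q]] w'(1)])
      have "(\<Oplus>\<^sub>?Q t\<in>J \<times> S. x t \<star>\<^sub>?Q \<phi> t q) w = (\<Oplus>\<^sub>M t\<in>J \<times> S. (x t \<star>\<^sub>?Q \<phi> t q) w)"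
        using additive_finsum[OF Q.abelian_group_axioms M.abelian_group_axioms, of "%q. q w" "%t. x t \<star>\<^sub>?Q \<phi> t q" "J \<times> S"] tc w
        by (simp add: B.coind_simps lin_def Pi_iff)
      also have "\<dots> = (\<Oplus>\<^sub>M t\<in>J \<times> S. \<theta> (fst t) (\<kappa> (fst t) (%w. c (snd t) (q w)) w) \<odot>\<^sub>M snd t)"
      proof (rule M.finsum_cong')
        have kc: "\<kappa> (fst t) (%w. c (snd t) (q w)) \<in> rhom A M M" if "t \<in> J \<times> S" for t
          using that by (intro \<kappa>' cq q) auto
        fix t assume t: "t \<in> J \<times> S"
        have "\<kappa> (fst t) (%w. c (snd t) (q w)) w \<in> carrier W" by (rule bW[OF kc[OF t] w])
        thus "(x t \<star>\<^sub>?Q \<phi> t q) w = \<theta> (fst t) (\<kappa> (fst t) (%w. c (snd t) (q w)) w) \<odot>\<^sub>M snd t"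
          using w w' by (simp add: B.coind_simps x_def \<phi>_def)
      next
        show "(%t. \<theta> (fst t) (\<kappa> (fst t) (%w. c (snd t) (q w)) w) \<odot>\<^sub>M snd t) \<in> J \<times> S \<rightarrow> carrier M"
          by (intro funcsetI fs) auto
      qed simp
      also have "\<dots> = (\<Oplus>\<^sub>M s\<in>S. \<Oplus>\<^sub>M j\<in>J. \<theta> j (\<kappa> j (%w. c s (q w)) w) \<odot>\<^sub>M s)"
        using fs by (intro finsum_product[OF M.abelian_monoid_axioms J D(1)])
      also have "\<dots> = (\<Oplus>\<^sub>M s\<in>S. c s (q w) \<odot>\<^sub>M s)"
      proof (rule M.finsum_cong')
        show "(%s. c s (q w) \<odot>\<^sub>M s) \<in> S \<rightarrow> carrier M" using D(5,6) linD(1)[OF ql w] by simp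
        fix s assume s: "s \<in> S"
        have tk: "\<theta> j (\<kappa> j (%w. c s (q w)) w) \<in> carrier K" if j: "j \<in> J" for j
          by (intro linD(1)[OF \<theta>[OF j], simplified] rhomD(1)[OF \<kappa>'[OF j cq[OF s q]] w'(1)])
        have "(%k. k \<odot>\<^sub>M s) (\<Oplus>j\<in>J. \<theta> j (\<kappa> j (%w. c s (q w)) w)) =
            (\<Oplus>\<^sub>M j\<in>J. \<theta> j (\<kappa> j (%w. c s (q w)) w) \<odot>\<^sub>M s)"
          using additive_finsum[OF K.abelian_group_axioms M.abelian_group_axioms,
              of "%k. k \<odot>\<^sub>M s" "%j. \<theta> j (\<kappa> j (%w. c s (q w)) w)" J]
          by (simp add: tk D(5)[OF s] M.smult_l_distr)
        thus "(\<Oplus>\<^sub>M j\<in>J. \<theta> j (\<kappa> j (%w. c s (q w)) w) \<odot>\<^sub>M s) = c s (q w) \<odot>\<^sub>M s"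
          using \<theta>\<kappa>'[OF cq[OF s q] w'] by simp
      qed simp
      also have "\<dots> = q w" by (rule D(4)[OF linD(1)[OF ql w]])
      finally show "q w = (\<Oplus>\<^sub>?Q t\<in>J \<times> S. x t \<star>\<^sub>?Q \<phi> t q) w" by simp
    qed
  qed
  define \<iota> where "\<iota> b = restrict b (carrier W)" for b :: "'v => 'v"
  have WM: "w \<in> carrier M" if "w \<in> carrier W" for w using that by (simp add: Wc)
  have blM: "b \<in> lin K W M" if "b \<in> carrier ?B" for b
    by (rule linI) (simp_all add: Wc Ws rhomD(1,2)[OF End_rhom[OF that]] linD(3)[OF rhom_lin[OF M M End_rhom[OF that]]])
  have \<iota>r: "\<iota> \<in> rhom ?B (regular_rmod ?B) ?Q"
  proof (rule rhomI, unfold B.regular_simps)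
    fix b assume b: "b \<in> carrier ?B"
    show "\<iota> b \<in> carrier ?Q" unfolding \<iota>_def by (rule B.coind_carrierI[OF mW blM[OF b]])
    fix a assume a: "a \<in> carrier ?B"
    show "\<iota> (b \<otimes>\<^sub>?B a) = \<iota> b \<star>\<^sub>?Q a" unfolding B.coind_simps \<iota>_def
      by (rule restrict_ext) (simp add: ev linD(1)[OF Lf[OF a]])
  next
    fix b a assume "b \<in> carrier ?B" "a \<in> carrier ?B"
    show "\<iota> (b \<oplus>\<^sub>?B a) = \<iota> b \<oplus>\<^sub>?Q \<iota> a" unfolding B.coind_simps \<iota>_def
      by (rule restrict_ext) (simp add: ev Ws)
  qed
  have "inj_on \<iota> (carrier (regular_rmod ?B))" unfolding rhom_inj_iff[OF B.fd_regular fQ \<iota>r]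
  proof (intro ballI impI, unfold B.regular_simps)
    fix b assume b: "b \<in> carrier ?B" "\<iota> b = \<zero>\<^sub>?Q"
    have "b w = \<zero>\<^sub>M" if "w \<in> carrier M" "w \<star>\<^sub>M f = w" for w
      using fun_cong[OF b(2), of w] that by (simp add: \<iota>_def B.coind_simps Wc)
    from faithful[OF End_rhom[OF b(1)] this] show "b = \<zero>\<^sub>?B" using End_zero_iff[OF b(1)] by blast
  qed
  from B.hull_proj[OF B.fd_regular E iQ pQ \<iota>r this] show ?thesis .
qed

end

end

section \<open>Interval modules over the Nakayama algebra\<close>

text \<open>The pairs \<open>(i, j)\<close> for which there is a path from \<open>i\<close> to \<open>j\<close> that is nonzero in \<open>A_n\<close>.\<close>

definition pv :: "nat => nat => nat => bool" where
  "pv n i j \<longleftrightarrow> i \<le> j \<and> j \<le> i + 2 \<and> j < n"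

lemma finsum_swap:
  assumes "abelian_monoid M" "finite J" "finite S" "!!j s. j \<in> J ==> s \<in> S ==> f j s \<in> carrier M"
  shows "(\<Oplus>\<^sub>M s\<in>S. \<Oplus>\<^sub>M j\<in>J. f j s) = (\<Oplus>\<^sub>M j\<in>J. \<Oplus>\<^sub>M s\<in>S. f j s)"
  using assms(3,4)
proof (induction S)
  case empty
  interpret abelian_monoid M by fact
  show ?case by simp
next
  case (insert s S)
  interpret abelian_monoid M by fact
  have c: "!!j t. j \<in> J ==> t \<in> S ==> f j t \<in> carrier M" "!!j. j \<in> J ==> f j s \<in> carrier M"
    using insert.prems by simp_all
  have "(\<Oplus>\<^sub>M t\<in>insert s S. \<Oplus>\<^sub>M j\<in>J. f j t) = (\<Oplus>\<^sub>M j\<in>J. f j s) \<oplus>\<^sub>M (\<Oplus>\<^sub>M j\<in>J. \<Oplus>\<^sub>M t\<in>S. f j t)"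
    using insert.hyps insert.IH[OF c(1)] c by (simp add: Pi_iff)
  also have "\<dots> = (\<Oplus>\<^sub>M j\<in>J. f j s \<oplus>\<^sub>M (\<Oplus>\<^sub>M t\<in>S. f j t))"
    using c by (intro finsum_addf[symmetric]) (simp_all add: Pi_iff)
  also have "\<dots> = (\<Oplus>\<^sub>M j\<in>J. \<Oplus>\<^sub>M t\<in>insert s S. f j t)"
    using insert.hyps c by (intro finsum_cong') (simp_all add: Pi_iff)
  finally show ?case .
qed

lemma finsum_single:
  assumes "abelian_monoid M" "finite S" "j \<in> S" "f j \<in> carrier M" "!!l. l \<in> S ==> l ~= j ==> f l = \<zero>\<^sub>M"
  shows "(\<Oplus>\<^sub>M l\<in>S. f l) = f j"
proof -
  interpret abelian_monoid M by fact
  have fl: "f l \<in> carrier M" if "l \<in> S" for l using assms(4) assms(5)[of l] that by (cases "l = j") simp_all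
  have "(\<Oplus>\<^sub>M l\<in>S. f l) = (\<Oplus>\<^sub>M l\<in>S. if j = l then f l else \<zero>\<^sub>M)"
    using fl assms(5) by (intro finsum_cong') (simp_all add: Pi_iff)
  also have "\<dots> = f j" using fl by (intro finsum_singleton assms(2,3)) simp
  finally show ?thesis .
qed

definition coords :: "('k, 'c) ring_scheme => nat => (nat => nat => 'k) set" where
  "coords K n = {f. \<forall>i j. f i j \<in> carrier K \<and> (\<not> pv n i j --> f i j = \<zero>\<^sub>K)}"

text \<open>\<open>A_n\<close> in coordinates: \<open>co a i j\<close> is the coefficient of \<open>a\<close> at the path from \<open>i\<close> to \<open>j\<close>.\<close>

locale nakayama = fd_algebra K A
  for K :: "('k, 'c) ring_scheme" (structure) and A :: "('k, 'a) module" +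
  fixes n :: nat and co :: "'a => nat => nat => 'k"
  assumes co_bij: "bij_betw co (carrier A) (coords K n)"
    and co_add: "a \<in> carrier A ==> c \<in> carrier A ==> co (a \<oplus>\<^sub>A c) i j = co a i j \<oplus> co c i j"
    and co_smult: "k \<in> carrier K ==> a \<in> carrier A ==> co (k \<odot>\<^sub>A a) i j = k \<otimes> co a i j"
    and co_mult: "a \<in> carrier A ==> c \<in> carrier A ==> pv n i j ==>
      co (a \<otimes>\<^sub>A c) i j = (\<Oplus>l\<in>{..<n}. co a i l \<otimes> co c l j)"
    and co_one: "co \<one>\<^sub>A i j = (if i = j \<and> i < n then \<one> else \<zero>)"
begin

definition el :: "(nat => nat => 'k) => 'a" where
  "el f = inv_into (carrier A) co f"

text \<open>The path from \<open>i\<close> to \<open>j\<close>. With value \<open>0\<close> for the other pairs, products need no side conditions.\<close>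

definition b :: "nat => nat => 'a" where
  "b i j = el (%i' j'. if i' = i \<and> j' = j \<and> pv n i j then \<one> else \<zero>)"

text \<open>The element of \<open>e_l A\<close> with coefficients \<open>g\<close>.\<close>

definition row :: "nat => (nat => 'k) => 'a" where
  "row l g = el (%i j. if i = l \<and> pv n l j then g j else \<zero>)"

lemma co_closed [simp, intro]: "a \<in> carrier A ==> co a i j \<in> carrier K"
  using bij_betwE[OF co_bij] by (auto simp: coords_def)

lemma co_zero: "a \<in> carrier A ==> \<not> pv n i j ==> co a i j = \<zero>"
  using bij_betwE[OF co_bij] by (auto simp: coords_def)

lemma co_eqI:
  assumes "a \<in> carrier A" "c \<in> carrier A" "!!i j. pv n i j ==> co a i j = co c i j"
  shows "a = c"
proof (rule inj_onD[OF bij_betw_imp_inj_on[OF co_bij] _ assms(1,2)], intro ext)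
  fix i j show "co a i j = co c i j" using assms co_zero by (cases "pv n i j") simp_all
qed

lemma el_closed: "f \<in> coords K n ==> el f \<in> carrier A"
  and co_el: "f \<in> coords K n ==> co (el f) = f"
  unfolding el_def using bij_betw_inv_into_right[OF co_bij] bij_betwE[OF bij_betw_inv_into[OF co_bij]] by auto

lemma b_closed [simp, intro]: "b i j \<in> carrier A"
  unfolding b_def by (rule el_closed) (simp add: coords_def)

lemma co_b: "co (b i j) i' j' = (if i' = i \<and> j' = j \<and> pv n i j then \<one> else \<zero>)"
  unfolding b_def by (subst co_el) (auto simp: coords_def)

lemma row_closed: "(!!j. g j \<in> carrier K) ==> row l g \<in> carrier A"
  unfolding row_def by (rule el_closed) (simp add: coords_def)

lemma co_row: "(!!j. g j \<in> carrier K) ==> co (row l g) i j = (if i = l \<and> pv n l j then g j else \<zero>)"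
  unfolding row_def by (subst co_el) (auto simp: coords_def)

lemma co_zero_elem: "co \<zero>\<^sub>A i j = \<zero>"
  using co_smult[of "\<zero>" "\<zero>\<^sub>A" i j] by simp

lemma b_zero: "\<not> pv n i j ==> b i j = \<zero>\<^sub>A"
  by (rule co_eqI) (simp_all add: co_b co_zero_elem)

lemma co_b_mult:
  assumes "c \<in> carrier A"
  shows "co (b i j \<otimes>\<^sub>A c) i' j' = (if i' = i \<and> pv n i j \<and> pv n i j' then co c j j' else \<zero>)"
proof (cases "pv n i' j'")
  case False
  thus ?thesis using assms by (auto simp: co_zero)
next
  case True
  have "(\<Oplus>l\<in>{..<n}. co (b i j) i' l \<otimes> co c l j') = (if i' = i \<and> pv n i j then co c j j' else \<zero>)"
  proof (cases "i' = i \<and> pv n i j")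
    case h: True
    have "(\<Oplus>l\<in>{..<n}. co (b i j) i' l \<otimes> co c l j') = co (b i j) i' j \<otimes> co c j j'"
      by (rule finsum_single[OF K.abelian_monoid_axioms]) (use h assms in \<open>simp_all add: co_b pv_def\<close>)
    thus ?thesis using h assms by (simp add: co_b)
  next
    case h: False
    have "(\<Oplus>l\<in>{..<n}. co (b i j) i' l \<otimes> co c l j') = \<zero>"
      by (rule K.add.finprod_one_eqI) (use h assms in \<open>auto simp: co_b\<close>)
    thus ?thesis using h by auto
  qed
  thus ?thesis using True assms by (auto simp: co_mult)
qed

lemma co_mult_b:
  assumes "c \<in> carrier A"
  shows "co (c \<otimes>\<^sub>A b i j) i' j' = (if j' = j \<and> pv n i j \<and> pv n i' j then co c i' i else \<zero>)"
proof (cases "pv n i' j'")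
  case False
  thus ?thesis using assms by (auto simp: co_zero)
next
  case True
  have "(\<Oplus>l\<in>{..<n}. co c i' l \<otimes> co (b i j) l j') = (if j' = j \<and> pv n i j then co c i' i else \<zero>)"
  proof (cases "j' = j \<and> pv n i j")
    case h: True
    have "(\<Oplus>l\<in>{..<n}. co c i' l \<otimes> co (b i j) l j') = co c i' i \<otimes> co (b i j) i j'"
      by (rule finsum_single[OF K.abelian_monoid_axioms]) (use h assms in \<open>auto simp: co_b pv_def\<close>)
    thus ?thesis using h assms by (simp add: co_b)
  next
    case h: False
    have "(\<Oplus>l\<in>{..<n}. co c i' l \<otimes> co (b i j) l j') = \<zero>"
      by (rule K.add.finprod_one_eqI) (use h assms in \<open>auto simp: co_b\<close>)
    thus ?thesis using h by auto
  qed
  thus ?thesis using True assms by (auto simp: co_mult)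
qed

lemma b_b: "b i j \<otimes>\<^sub>A b k l = (if j = k \<and> pv n i j \<and> pv n j l then b i l else \<zero>\<^sub>A)"
  by (rule co_eqI) (auto simp: co_b_mult co_b co_zero_elem)

lemma row_b:
  assumes "!!j. g j \<in> carrier K"
  shows "row l g \<otimes>\<^sub>A b v w = row l (%j. if j = w \<and> pv n v w \<and> pv n l v then g v else \<zero>)"
  by (rule co_eqI) (auto simp: co_mult_b co_row assms row_closed)

abbreviation "vp \<equiv> {(i, j). pv n i j}"

lemma finite_vp: "finite vp"
  by (rule finite_subset[of _ "{..<n} \<times> {..<n}"]) (auto simp: pv_def)

lemma dec: assumes "a \<in> carrier A" shows "a = (\<Oplus>\<^sub>A t\<in>vp. co a (fst t) (snd t) \<odot>\<^sub>A b (fst t) (snd t))"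
proof (rule co_eqI[OF assms])
  let ?f = "%t. co a (fst t) (snd t) \<odot>\<^sub>A b (fst t) (snd t)"
  have fc: "?f \<in> vp \<rightarrow> carrier A" using assms by auto
  thus "(\<Oplus>\<^sub>A t\<in>vp. ?f t) \<in> carrier A" by (rule A.finsum_closed)
  fix i j assume ij: "pv n i j"
  have "co (\<Oplus>\<^sub>A t\<in>vp. ?f t) i j = (\<Oplus>t\<in>vp. co (?f t) i j)"
    using additive_finsum[OF A.abelian_group_axioms K.abelian_group_axioms, of "%a. co a i j" ?f vp] fc
    by (simp add: co_add)
  also have "\<dots> = co (?f (i, j)) i j"
    by (rule finsum_single[OF K.abelian_monoid_axioms finite_vp])
      (use ij assms in \<open>auto simp: co_smult co_b\<close>)
  also have "\<dots> = co a i j" using ij assms by (simp add: co_smult co_b)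
  finally show "co a i j = co (\<Oplus>\<^sub>A t\<in>vp. ?f t) i j" by simp
qed

text \<open>For a linear map it suffices to commute with the paths, as these span the algebra.\<close>

lemma rhom_basisI:
  assumes M: "fdm M" and N: "fdm N" and h: "h \<in> lin K M N"
    and hb: "!!x i j. x \<in> carrier M ==> pv n i j ==> h (x \<star>\<^sub>M b i j) = h x \<star>\<^sub>N b i j"
  shows "h \<in> rhom A M N"
proof (rule rhomI)
  interpret N: Module.module K N by (rule fdD(1)[OF N])
  fix a x assume x: "x \<in> carrier M" and a: "a \<in> carrier A"
  note H = linD[OF h]
  have "h (x \<star>\<^sub>M a) = h (x \<star>\<^sub>M (\<Oplus>\<^sub>A t\<in>vp. co a (fst t) (snd t) \<odot>\<^sub>A b (fst t) (snd t)))"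
    using dec[OF a] by simp
  also have "\<dots> = (\<Oplus>\<^sub>N t\<in>vp. h (x \<star>\<^sub>M (co a (fst t) (snd t) \<odot>\<^sub>A b (fst t) (snd t))))"
    by (rule lin_finsum[OF moduleA fdD(1)[OF N] lin_comp[OF lin_ract[OF M x] h]]) (use a in auto)
  also have "\<dots> = (\<Oplus>\<^sub>N t\<in>vp. h x \<star>\<^sub>N (co a (fst t) (snd t) \<odot>\<^sub>A b (fst t) (snd t)))"
    by (rule N.finsum_cong')
      (use a x in \<open>auto simp: fdD(8)[OF M] fdD(8)[OF N] fdD(3)[OF M] fdD(3)[OF N] H hb\<close>)
  also have "\<dots> = h x \<star>\<^sub>N (\<Oplus>\<^sub>A t\<in>vp. co a (fst t) (snd t) \<odot>\<^sub>A b (fst t) (snd t))"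
    by (rule ract_finsum[OF N _ H(1)[OF x], symmetric]) (use a in auto)
  also have "\<dots> = h x \<star>\<^sub>N a" using dec[OF a] by simp
  finally show "h (x \<star>\<^sub>M a) = h x \<star>\<^sub>N a" .
qed (use linD[OF h] in blast)+

lemma fd_bb:
  assumes "fdm M" "x \<in> carrier M"
  shows "x \<star>\<^sub>M b i j \<star>\<^sub>M b k l = (if j = k \<and> pv n i j \<and> pv n j l then x \<star>\<^sub>M b i l else \<zero>\<^sub>M)"
  by (auto simp: fdD(6)[OF assms(1,2), symmetric] b_b ract_zero[OF assms])

subsection \<open>Interval modules\<close>

text \<open>A family of intervals \<open>[\<alpha> r, \<beta> r)\<close>, one for each row \<open>r\<close>, is encoded by the set of its points. Keeping
  all rows in one module makes the cosyzygies of \<open>A\<close> members of a single family.\<close>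

definition ivd :: "nat set => (nat => nat) => (nat => nat) => (nat \<times> nat) set" where
  "ivd I \<alpha> \<beta> = {(r, x). r \<in> I \<and> \<alpha> r \<le> x \<and> x < \<beta> r}"

definition ivm :: "nat set => (nat => nat) => (nat => nat) => ('k, 'a, nat \<times> nat => 'k) rmodule" where
  "ivm I \<alpha> \<beta> = module.extend (fun_space K (ivd I \<alpha> \<beta>)) (rmodule.fields
     (%v c. %(r, y). if (r, y) \<in> ivd I \<alpha> \<beta> then (\<Oplus>x\<in>{..<n}. v (r, x) \<otimes> co c x y) else \<zero>))"

lemma ivm_simps:
  "carrier (ivm I \<alpha> \<beta>) = {v. (\<forall>d. v d \<in> carrier K) \<and> (\<forall>d. d \<notin> ivd I \<alpha> \<beta> --> v d = \<zero>)}"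
  "zero (ivm I \<alpha> \<beta>) = (%d. \<zero>)" "add (ivm I \<alpha> \<beta>) = (%f g d. f d \<oplus> g d)"
  "smult (ivm I \<alpha> \<beta>) = (%k f d. k \<otimes> f d)"
  by (simp_all add: ivm_def module.defs rmodule.defs fun_space_def)

lemma ivm_act: "(v \<star>\<^bsub>ivm I \<alpha> \<beta>\<^esub> c) (r, y) =
   (if (r, y) \<in> ivd I \<alpha> \<beta> then (\<Oplus>x\<in>{..<n}. v (r, x) \<otimes> co c x y) else \<zero>)"
  by (simp add: ivm_def module.defs rmodule.defs)

definition ivok :: "nat set => (nat => nat) => (nat => nat) => bool" where
  "ivok I \<alpha> \<beta> \<longleftrightarrow> finite I \<and> (\<forall>r\<in>I. \<alpha> r \<le> \<beta> r \<and> \<beta> r \<le> \<alpha> r + 3 \<and> \<beta> r \<le> n)"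

lemma ivd_pv: "ivok I \<alpha> \<beta> ==> (r, x) \<in> ivd I \<alpha> \<beta> ==> (r, y) \<in> ivd I \<alpha> \<beta> ==> x \<le> y ==> pv n x y"
  by (auto simp: ivok_def ivd_def pv_def)

lemma ivm_D: "v \<in> carrier (ivm I \<alpha> \<beta>) ==> v d \<in> carrier K"
  "v \<in> carrier (ivm I \<alpha> \<beta>) ==> d \<notin> ivd I \<alpha> \<beta> ==> v d = \<zero>"
  unfolding ivm_simps by blast+

lemma ivm_act_b:
  assumes "v \<in> carrier (ivm I \<alpha> \<beta>)"
  shows "(v \<star>\<^bsub>ivm I \<alpha> \<beta>\<^esub> b i j) (r, y) = (if (r, y) \<in> ivd I \<alpha> \<beta> \<and> y = j \<and> pv n i j then v (r, i) else \<zero>)"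
proof (cases "y = j \<and> pv n i j")
  case True
  have "(\<Oplus>x\<in>{..<n}. v (r, x) \<otimes> co (b i j) x y) = v (r, i) \<otimes> co (b i j) i y"
    by (rule finsum_single[OF K.abelian_monoid_axioms])
      (use True ivm_D(1)[OF assms] in \<open>auto simp: co_b pv_def\<close>)
  thus ?thesis using True ivm_D(1)[OF assms] by (simp add: ivm_act co_b)
next
  case False
  have "(\<Oplus>x\<in>{..<n}. v (r, x) \<otimes> co (b i j) x y) = \<zero>"
    by (rule K.add.finprod_one_eqI) (use False ivm_D(1)[OF assms] in \<open>auto simp: co_b\<close>)
  thus ?thesis using False by (auto simp: ivm_act)
qed

lemma fd_ivm:
  assumes ok: "ivok I \<alpha> \<beta>"
  shows "fdm (ivm I \<alpha> \<beta>)"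
proof (rule fdI)
  let ?D = "ivd I \<alpha> \<beta>"
  have 1: "carrier (ivm I \<alpha> \<beta>) = carrier (fun_space K ?D)" "zero (ivm I \<alpha> \<beta>) = zero (fun_space K ?D)"
    "add (ivm I \<alpha> \<beta>) = add (fun_space K ?D)" "smult (ivm I \<alpha> \<beta>) = smult (fun_space K ?D)"
    by (simp_all add: ivm_def module.defs rmodule.defs)
  have fin: "finite ?D"
    by (rule finite_subset[of _ "I \<times> {..<n}"]) (use ok in \<open>auto simp: ivd_def ivok_def\<close>)
  note mF = module_fun_space[OF K.is_cring, of ?D]
  show "Module.module K (ivm I \<alpha> \<beta>)" by (rule module_cong[OF mF]) (simp_all add: 1)
  show "finite_dim K (ivm I \<alpha> \<beta>)"
    by (rule finite_dim_cong[OF mF finite_dim_fun_space[OF K.is_cring fin]]) (simp_all add: 1)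
  have sumc: "(\<Oplus>x\<in>{..<n}. v (r, x) \<otimes> co c x y) \<in> carrier K"
    if "v \<in> carrier (ivm I \<alpha> \<beta>)" "c \<in> carrier A" for v c r y
    using ivm_D(1)[OF that(1)] that(2) by (intro K.finsum_closed) simp
  fix v c assume v: "v \<in> carrier (ivm I \<alpha> \<beta>)" and c: "c \<in> carrier A"
  note V = ivm_D[OF v]
  show "v \<star>\<^bsub>ivm I \<alpha> \<beta>\<^esub> c \<in> carrier (ivm I \<alpha> \<beta>)"
    unfolding ivm_simps(1)
  proof (intro CollectI conjI allI impI)
    fix d show "(v \<star>\<^bsub>ivm I \<alpha> \<beta>\<^esub> c) d \<in> carrier K" using sumc[OF v c] by (cases d) (simp add: ivm_act)
  next
    fix d assume "d \<notin> ?D" thus "(v \<star>\<^bsub>ivm I \<alpha> \<beta>\<^esub> c) d = \<zero>" by (cases d) (simp add: ivm_act)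
  qed
  show "(v \<oplus>\<^bsub>ivm I \<alpha> \<beta>\<^esub> w) \<star>\<^bsub>ivm I \<alpha> \<beta>\<^esub> c = v \<star>\<^bsub>ivm I \<alpha> \<beta>\<^esub> c \<oplus>\<^bsub>ivm I \<alpha> \<beta>\<^esub> w \<star>\<^bsub>ivm I \<alpha> \<beta>\<^esub> c"
    if w: "w \<in> carrier (ivm I \<alpha> \<beta>)" for w
  proof
    fix d :: "nat \<times> nat" obtain r y where d: "d = (r, y)" by (cases d)
    have "(\<Oplus>x\<in>{..<n}. (v (r, x) \<oplus> w (r, x)) \<otimes> co c x y) =
      (\<Oplus>x\<in>{..<n}. v (r, x) \<otimes> co c x y \<oplus> w (r, x) \<otimes> co c x y)"
      using V(1) ivm_D(1)[OF w] c by (intro K.finsum_cong') (simp_all add: K.l_distr)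
    also have "\<dots> = (\<Oplus>x\<in>{..<n}. v (r, x) \<otimes> co c x y) \<oplus> (\<Oplus>x\<in>{..<n}. w (r, x) \<otimes> co c x y)"
      using V(1) ivm_D(1)[OF w] c by (intro K.finsum_addf) simp_all
    finally show "((v \<oplus>\<^bsub>ivm I \<alpha> \<beta>\<^esub> w) \<star>\<^bsub>ivm I \<alpha> \<beta>\<^esub> c) d = (v \<star>\<^bsub>ivm I \<alpha> \<beta>\<^esub> c \<oplus>\<^bsub>ivm I \<alpha> \<beta>\<^esub> w \<star>\<^bsub>ivm I \<alpha> \<beta>\<^esub> c) d"
      by (simp add: d ivm_act ivm_simps)
  qed
  show "v \<star>\<^bsub>ivm I \<alpha> \<beta>\<^esub> (k \<odot>\<^sub>A c) = k \<odot>\<^bsub>ivm I \<alpha> \<beta>\<^esub> (v \<star>\<^bsub>ivm I \<alpha> \<beta>\<^esub> c)" if k: "k \<in> carrier K" for k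
  proof
    fix d :: "nat \<times> nat" obtain r y where d: "d = (r, y)" by (cases d)
    have "(\<Oplus>x\<in>{..<n}. v (r, x) \<otimes> co (k \<odot>\<^sub>A c) x y) = (\<Oplus>x\<in>{..<n}. k \<otimes> (v (r, x) \<otimes> co c x y))"
      using V(1) c k by (intro K.finsum_cong') (simp_all add: co_smult K.m_lcomm)
    also have "\<dots> = k \<otimes> (\<Oplus>x\<in>{..<n}. v (r, x) \<otimes> co c x y)"
      using V(1) c k by (intro K.finsum_rdistr[symmetric]) simp_all
    finally show "(v \<star>\<^bsub>ivm I \<alpha> \<beta>\<^esub> (k \<odot>\<^sub>A c)) d = (k \<odot>\<^bsub>ivm I \<alpha> \<beta>\<^esub> (v \<star>\<^bsub>ivm I \<alpha> \<beta>\<^esub> c)) d"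
      using k by (simp add: d ivm_act ivm_simps)
  qed
  fix e assume e: "e \<in> carrier A"
  show "v \<star>\<^bsub>ivm I \<alpha> \<beta>\<^esub> (c \<oplus>\<^sub>A e) = v \<star>\<^bsub>ivm I \<alpha> \<beta>\<^esub> c \<oplus>\<^bsub>ivm I \<alpha> \<beta>\<^esub> v \<star>\<^bsub>ivm I \<alpha> \<beta>\<^esub> e"
  proof
    fix d :: "nat \<times> nat" obtain r y where d: "d = (r, y)" by (cases d)
    have "(\<Oplus>x\<in>{..<n}. v (r, x) \<otimes> co (c \<oplus>\<^sub>A e) x y) =
      (\<Oplus>x\<in>{..<n}. v (r, x) \<otimes> co c x y \<oplus> v (r, x) \<otimes> co e x y)"
      using V(1) e c by (intro K.finsum_cong') (simp_all add: K.r_distr co_add)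
    also have "\<dots> = (\<Oplus>x\<in>{..<n}. v (r, x) \<otimes> co c x y) \<oplus> (\<Oplus>x\<in>{..<n}. v (r, x) \<otimes> co e x y)"
      using V(1) e c by (intro K.finsum_addf) simp_all
    finally show "(v \<star>\<^bsub>ivm I \<alpha> \<beta>\<^esub> (c \<oplus>\<^sub>A e)) d = (v \<star>\<^bsub>ivm I \<alpha> \<beta>\<^esub> c \<oplus>\<^bsub>ivm I \<alpha> \<beta>\<^esub> v \<star>\<^bsub>ivm I \<alpha> \<beta>\<^esub> e) d"
      by (simp add: d ivm_act ivm_simps)
  qed
  show "v \<star>\<^bsub>ivm I \<alpha> \<beta>\<^esub> (c \<otimes>\<^sub>A e) = v \<star>\<^bsub>ivm I \<alpha> \<beta>\<^esub> c \<star>\<^bsub>ivm I \<alpha> \<beta>\<^esub> e"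
  proof
    fix d :: "nat \<times> nat" obtain r y where d: "d = (r, y)" by (cases d)
    show "(v \<star>\<^bsub>ivm I \<alpha> \<beta>\<^esub> (c \<otimes>\<^sub>A e)) d = (v \<star>\<^bsub>ivm I \<alpha> \<beta>\<^esub> c \<star>\<^bsub>ivm I \<alpha> \<beta>\<^esub> e) d"
    proof (cases "(r, y) \<in> ?D")
      case False thus ?thesis by (simp add: d ivm_act)
    next
      case y: True
      let ?s = "%l x. v (r, x) \<otimes> (co c x l \<otimes> co e l y)"
      have sc: "?s l x \<in> carrier K" for l x using V(1) c e by simp
      have "(\<Oplus>x\<in>{..<n}. v (r, x) \<otimes> co (c \<otimes>\<^sub>A e) x y) = (\<Oplus>x\<in>{..<n}. \<Oplus>l\<in>{..<n}. ?s l x)"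
      proof (rule K.finsum_cong')
        fix x assume x: "x \<in> {..<n}"
        show "v (r, x) \<otimes> co (c \<otimes>\<^sub>A e) x y = (\<Oplus>l\<in>{..<n}. ?s l x)"
        proof (cases "pv n x y")
          case True
          thus ?thesis using c e V(1) by (simp add: co_mult K.finsum_rdistr)
        next
          case False
          hence "(r, x) \<notin> ?D \<or> y < x" using ivd_pv[OF ok _ y] by fastforce
          hence "?s l x = \<zero>" for l
          proof
            assume "(r, x) \<notin> ?D" thus ?thesis using V(2) c e by simp
          next
            assume "y < x"
            hence "\<not> pv n x l \<or> \<not> pv n l y" by (auto simp: pv_def)
            thus ?thesis using V(1) c e by (auto simp: co_zero)
          qed
          hence "(\<Oplus>l\<in>{..<n}. ?s l x) = \<zero>" by (intro K.add.finprod_one_eqI)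
          thus ?thesis using False c e V(1) by (simp add: co_zero)
        qed
      qed (use sc in \<open>auto intro!: K.finsum_closed\<close>)
      also have "\<dots> = (\<Oplus>l\<in>{..<n}. \<Oplus>x\<in>{..<n}. ?s l x)"
        by (rule finsum_swap[OF K.abelian_monoid_axioms]) (simp_all add: sc)
      also have "\<dots> = (\<Oplus>l\<in>{..<n}. (v \<star>\<^bsub>ivm I \<alpha> \<beta>\<^esub> c) (r, l) \<otimes> co e l y)"
      proof (rule K.finsum_cong')
        show "(%l. (v \<star>\<^bsub>ivm I \<alpha> \<beta>\<^esub> c) (r, l) \<otimes> co e l y) \<in> {..<n} \<rightarrow> carrier K"
          using sumc[OF v c] e by (simp add: ivm_act)
        fix l assume l: "l \<in> {..<n}"
        show "(\<Oplus>x\<in>{..<n}. ?s l x) = (v \<star>\<^bsub>ivm I \<alpha> \<beta>\<^esub> c) (r, l) \<otimes> co e l y"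
        proof (cases "(r, l) \<in> ?D")
          case True
          have "(v \<star>\<^bsub>ivm I \<alpha> \<beta>\<^esub> c) (r, l) \<otimes> co e l y = (\<Oplus>x\<in>{..<n}. (v (r, x) \<otimes> co c x l) \<otimes> co e l y)"
            using True V(1) c e by (simp add: ivm_act K.finsum_ldistr)
          also have "\<dots> = (\<Oplus>x\<in>{..<n}. ?s l x)"
            using V(1) c e by (intro K.finsum_cong') (simp_all add: K.m_assoc)
          finally show ?thesis by simp
        next
          case False
          have "?s l x = \<zero>" for x
          proof (cases "(r, x) \<in> ?D \<and> pv n x l \<and> pv n l y")
            case True
            hence False using y False by (auto simp: ivd_def pv_def)
            thus ?thesis ..
          next
            case h: False
            show ?thesis using h V c e by (auto simp: co_zero)
          qed
          hence "(\<Oplus>x\<in>{..<n}. ?s l x) = \<zero>" by (intro K.add.finprod_one_eqI)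
          thus ?thesis using False e by (simp add: ivm_act)
        qed
      qed simp
      finally show ?thesis using y by (simp add: d ivm_act)
    qed
  qed
next
  fix v assume v: "v \<in> carrier (ivm I \<alpha> \<beta>)"
  note V = ivm_D[OF v]
  show "v \<star>\<^bsub>ivm I \<alpha> \<beta>\<^esub> \<one>\<^sub>A = v"
  proof
    fix d :: "nat \<times> nat" obtain r y where d: "d = (r, y)" by (cases d)
    show "(v \<star>\<^bsub>ivm I \<alpha> \<beta>\<^esub> \<one>\<^sub>A) d = v d"
    proof (cases "(r, y) \<in> ivd I \<alpha> \<beta>")
      case True
      hence "y < n" using ok by (auto simp: ivd_def ivok_def)
      have "(\<Oplus>x\<in>{..<n}. v (r, x) \<otimes> co \<one>\<^sub>A x y) = v (r, y) \<otimes> co \<one>\<^sub>A y y"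
        by (rule finsum_single[OF K.abelian_monoid_axioms]) (use \<open>y < n\<close> V(1) in \<open>auto simp: co_one\<close>)
      thus ?thesis using True \<open>y < n\<close> V(1) by (simp add: d ivm_act co_one)
    qed (use V(2) in \<open>simp add: d ivm_act\<close>)
  qed
qed

lemma ivm_carrierI:
  "(!!r x. v (r, x) \<in> carrier K) ==> (!!r x. (r, x) \<notin> ivd I \<alpha> \<beta> ==> v (r, x) = \<zero>) ==> v \<in> carrier (ivm I \<alpha> \<beta>)"
  unfolding ivm_simps by auto

lemma ivm_coord_lin: "(%v. v d) \<in> lin K (ivm I \<alpha> \<beta>) (kmod K)"
  by (rule linI) (simp_all add: ivm_simps(3,4) ivm_D)

text \<open>Rows that are empty or of the form \<open>[\<beta> - 3, \<beta>)\<close> are injective: a homomorphism into them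
  is given by one functional for each row, its coordinate at the socle \<open>\<beta> - 1\<close>.\<close>

definition ivinj :: "nat set => (nat => nat) => (nat => nat) => bool" where
  "ivinj I \<alpha> \<beta> \<longleftrightarrow> ivok I \<alpha> \<beta> \<and> (\<forall>r\<in>I. \<alpha> r < \<beta> r --> \<alpha> r = \<beta> r - 3)"

lemma ivm_functional_rhom:
  assumes iv: "ivinj I \<alpha> \<beta>" and Y: "fdm Y" and \<psi>: "!!r. r \<in> I ==> \<psi> r \<in> lin K Y (kmod K)"
  shows "(%y (r, x). if (r, x) \<in> ivd I \<alpha> \<beta> then \<psi> r (y \<star>\<^sub>Y b x (\<beta> r - 1)) else \<zero>) \<in> rhom A Y (ivm I \<alpha> \<beta>)"
    (is "?h \<in> _")
proof -
  have ok: "ivok I \<alpha> \<beta>" using iv by (simp add: ivinj_def)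
  interpret Y: Module.module K Y by (rule fdD(1)[OF Y])
  have P: "\<psi> r y \<in> carrier K" "\<psi> r (y \<oplus>\<^sub>Y z) = \<psi> r y \<oplus> \<psi> r z" "k \<in> carrier K ==> \<psi> r (k \<odot>\<^sub>Y y) = k \<otimes> \<psi> r y"
    if "(r, x) \<in> ivd I \<alpha> \<beta>" "y \<in> carrier Y" "z \<in> carrier Y" for r x y z k
    using linD[OF \<psi>[of r]] that by (simp_all add: ivd_def)
  have z: "\<psi> r \<zero>\<^sub>Y = \<zero>" if "(r, x) \<in> ivd I \<alpha> \<beta>" for r x
    using lin_zero[OF fdD(1)[OF Y] module_kmod[OF K.is_cring] \<psi>[of r]] that by (simp add: ivd_def)
  note Yc = fdD(3)[OF Y _ b_closed]
  have cl: "?h y \<in> carrier (ivm I \<alpha> \<beta>)" if "y \<in> carrier Y" for y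
    by (rule ivm_carrierI) (use P(1)[OF _ Yc[OF that] Yc[OF that]] in auto)
  show ?thesis
  proof (rule rhom_basisI[OF Y fd_ivm[OF ok]])
    show "?h \<in> lin K Y (ivm I \<alpha> \<beta>)"
    proof (rule linI)
      fix y z assume "y \<in> carrier Y" "z \<in> carrier Y"
      thus "?h (y \<oplus>\<^sub>Y z) = ?h y \<oplus>\<^bsub>ivm I \<alpha> \<beta>\<^esub> ?h z"
        by (auto simp: ivm_simps fdD(4)[OF Y] P(2) Yc)
    next
      fix k y assume "k \<in> carrier K" "y \<in> carrier Y"
      thus "?h (k \<odot>\<^sub>Y y) = k \<odot>\<^bsub>ivm I \<alpha> \<beta>\<^esub> ?h y"
        by (auto simp: ivm_simps smult_ract[OF Y] P(3)[OF _ Yc Yc] Yc)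
    qed (rule cl)
  next
    fix y i j assume y: "y \<in> carrier Y" and ij: "pv n i j"
    show "?h (y \<star>\<^sub>Y b i j) = ?h y \<star>\<^bsub>ivm I \<alpha> \<beta>\<^esub> b i j"
    proof
      fix d :: "nat \<times> nat" obtain r x where d: "d = (r, x)" by (cases d)
      show "?h (y \<star>\<^sub>Y b i j) d = (?h y \<star>\<^bsub>ivm I \<alpha> \<beta>\<^esub> b i j) d"
      proof (cases "(r, x) \<in> ivd I \<alpha> \<beta> \<and> x = j")
        case False
        thus ?thesis using y z by (auto simp: d ivm_act_b[OF cl[OF y]] fd_bb[OF Y y])
      next
        case True
        hence T: "(r, j) \<in> ivd I \<alpha> \<beta>" "x = j" by auto
        hence t: "pv n j (\<beta> r - 1)" using ok by (auto simp: ivd_def ivok_def pv_def)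
        have 1: "?h (y \<star>\<^sub>Y b i j) d = \<psi> r (y \<star>\<^sub>Y b i (\<beta> r - 1))"
          using T t ij by (simp add: d fd_bb[OF Y y])
        have 2: "(?h y \<star>\<^bsub>ivm I \<alpha> \<beta>\<^esub> b i j) d = ?h y (r, i)" using T ij by (simp add: d ivm_act_b[OF cl[OF y]])
        show ?thesis
        proof (cases "(r, i) \<in> ivd I \<alpha> \<beta>")
          case h: True
          thus ?thesis unfolding 1 2 by simp
        next
          case h: False
          have "\<not> pv n i (\<beta> r - 1)" using h True iv ij by (auto simp: ivd_def ivinj_def pv_def)
          thus ?thesis unfolding 1 2 using h z[OF T(1)] y by (simp add: b_zero ract_zero[OF Y])
        qed
      qed
    qed
  qed
qed

lemma inj_ivm:
  assumes iv: "ivinj I \<alpha> \<beta>"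
  shows "injm (ivm I \<alpha> \<beta>)"
  unfolding inj_rmod_def
proof (intro conjI allI impI)
  have ok: "ivok I \<alpha> \<beta>" using iv by (simp add: ivinj_def)
  show "fdm (ivm I \<alpha> \<beta>)" by (rule fd_ivm[OF ok])
  fix X Y :: "('k, 'a, nat => 'k) rmodule" and f g
  assume X: "fdm X" and Y: "fdm Y" and f: "f \<in> rhom A X Y" and i: "inj_on f (carrier X)"
    and g: "g \<in> rhom A X (ivm I \<alpha> \<beta>)"
  note G = rhomD[OF g]
  have "\<exists>p\<in>lin K Y (kmod K). \<forall>x\<in>carrier X. p (f x) = g x (r, \<beta> r - 1)" for r
    by (rule lin_extend[OF fieldK fdD(1)[OF X] fdD(1)[OF Y] module_kmod[OF K.is_cring] rhom_lin[OF X Y f] i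
          lin_comp[OF rhom_lin[OF X fd_ivm[OF ok] g] ivm_coord_lin]])
  hence "\<forall>r. \<exists>p. p \<in> lin K Y (kmod K) \<and> (\<forall>x\<in>carrier X. p (f x) = g x (r, \<beta> r - 1))" by blast
  from choice[OF this] obtain p where p: "!!r. p r \<in> lin K Y (kmod K)"
    "!!r x. x \<in> carrier X ==> p r (f x) = g x (r, \<beta> r - 1)" by blast
  let ?h = "%y (r, x). if (r, x) \<in> ivd I \<alpha> \<beta> then p r (y \<star>\<^sub>Y b x (\<beta> r - 1)) else \<zero>"
  have "?h (f x) = g x" if x: "x \<in> carrier X" for x
  proof
    fix d :: "nat \<times> nat" obtain r y where d: "d = (r, y)" by (cases d)
    show "?h (f x) d = g x d"
    proof (cases "(r, y) \<in> ivd I \<alpha> \<beta>")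
      case False
      thus ?thesis using ivm_D(2)[OF G(1)[OF x]] by (simp add: d)
    next
      case True
      hence t: "pv n y (\<beta> r - 1)" "(r, \<beta> r - 1) \<in> ivd I \<alpha> \<beta>" using ok by (auto simp: ivd_def ivok_def pv_def)
      have "?h (f x) d = p r (f (x \<star>\<^sub>X b y (\<beta> r - 1)))" using True by (simp add: d rhomD(3)[OF f x])
      also have "\<dots> = (g x \<star>\<^bsub>ivm I \<alpha> \<beta>\<^esub> b y (\<beta> r - 1)) (r, \<beta> r - 1)"
        using p(2)[OF fdD(3)[OF X x b_closed]] G(3)[OF x] by simp
      also have "\<dots> = g x (r, y)" using t by (simp add: ivm_act_b[OF G(1)[OF x]])
      finally show ?thesis by (simp add: d)
    qed
  qed
  thus "\<exists>h\<in>rhom A Y (ivm I \<alpha> \<beta>). \<forall>x\<in>carrier X. h (f x) = g x"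
    by (intro bexI[of _ ?h] ballI ivm_functional_rhom[OF iv Y p(1)])
qed

text \<open>The generators at the tops and the coordinates along the rows form a dual basis.\<close>

lemma proj_ivm:
  assumes ok: "ivok I \<alpha> \<beta>" and l: "!!r. r \<in> I ==> \<alpha> r < \<beta> r ==> \<beta> r = \<alpha> r + 3"
  shows "projm (ivm I \<alpha> \<beta>)"
proof (rule proj_if_dual_basis[where T = "{r \<in> I. \<alpha> r < \<beta> r}" and x = "%r. delta K (r, \<alpha> r)"
      and \<phi> = "%r v. row (\<alpha> r) (%j. v (r, j))", OF fd_ivm[OF ok]])
  let ?M = "ivm I \<alpha> \<beta>"
  note mM = fdD(1)[OF fd_ivm[OF ok]]
  interpret M: Module.module K ?M by (rule mM)
  show "finite {r \<in> I. \<alpha> r < \<beta> r}" using ok by (simp add: ivok_def)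
  have dc: "delta K (r, \<alpha> r) \<in> carrier ?M" if "r \<in> {r \<in> I. \<alpha> r < \<beta> r}" for r
    using that by (intro ivm_carrierI) (auto simp: delta_def ivd_def)
  have pvd: "pv n (\<alpha> r) j \<longleftrightarrow> (r, j) \<in> ivd I \<alpha> \<beta>" if "r \<in> {r \<in> I. \<alpha> r < \<beta> r}" for r j
    using that l[of r] ok by (auto simp: pv_def ivd_def ivok_def)
  fix r assume r: "r \<in> {r \<in> I. \<alpha> r < \<beta> r}"
  show "delta K (r, \<alpha> r) \<in> carrier ?M" by (rule dc[OF r])
  show "(%v. row (\<alpha> r) (%j. v (r, j))) \<in> rhom A ?M AA"
  proof (rule rhomI, unfold regular_simps)
    fix v assume v: "v \<in> carrier ?M"
    note V = ivm_D[OF v]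
    show rc: "row (\<alpha> r) (%j. v (r, j)) \<in> carrier A" by (rule row_closed[OF V(1)])
    fix a assume a: "a \<in> carrier A"
    have va: "v \<star>\<^sub>?M a \<in> carrier ?M" by (rule fdD(3)[OF fd_ivm[OF ok] v a])
    show "row (\<alpha> r) (%j. (v \<star>\<^sub>?M a) (r, j)) = row (\<alpha> r) (%j. v (r, j)) \<otimes>\<^sub>A a"
    proof (rule co_eqI)
      fix i j assume ij: "pv n i j"
      show "co (row (\<alpha> r) (%j. (v \<star>\<^sub>?M a) (r, j))) i j = co (row (\<alpha> r) (%j. v (r, j)) \<otimes>\<^sub>A a) i j"
      proof (cases "i = \<alpha> r")
        case False
        have "(\<Oplus>l\<in>{..<n}. co (row (\<alpha> r) (%j. v (r, j))) i l \<otimes> co a l j) = \<zero>"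
          by (rule K.add.finprod_one_eqI) (use False a in \<open>simp add: co_row V(1)\<close>)
        thus ?thesis using False ij a rc by (simp add: co_mult co_row ivm_D(1)[OF va])
      next
        case True
        have "(\<Oplus>l\<in>{..<n}. co (row (\<alpha> r) (%j. v (r, j))) i l \<otimes> co a l j) =
           (\<Oplus>l\<in>{..<n}. v (r, l) \<otimes> co a l j)"
          by (rule K.finsum_cong') (use True V a pvd[OF r] in \<open>auto simp: co_row V(1)\<close>)
        moreover have "co (row (\<alpha> r) (%j. (v \<star>\<^sub>?M a) (r, j))) i j = (v \<star>\<^sub>?M a) (r, j)"
          using True ij by (subst co_row) (simp_all add: ivm_D(1)[OF va])
        ultimately show ?thesis using True ij a rc pvd[OF r, of j] by (simp add: co_mult ivm_act)
      qed
    qed (use rc a row_closed[OF ivm_D(1)[OF va]] in simp_all)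
  next
    fix v w assume v: "v \<in> carrier ?M" and w: "w \<in> carrier ?M"
    show "row (\<alpha> r) (%j. (v \<oplus>\<^sub>?M w) (r, j)) = row (\<alpha> r) (%j. v (r, j)) \<oplus>\<^sub>A row (\<alpha> r) (%j. w (r, j))"
      by (rule co_eqI) (simp_all add: row_closed co_row co_add ivm_D(1)[OF v] ivm_D(1)[OF w] ivm_simps(3))
  qed
next
  let ?M = "ivm I \<alpha> \<beta>" and ?T = "{r \<in> I. \<alpha> r < \<beta> r}"
  note mM = fdD(1)[OF fd_ivm[OF ok]]
  interpret M: Module.module K ?M by (rule mM)
  fix v assume v: "v \<in> carrier ?M"
  note V = ivm_D[OF v]
  let ?t = "%r. delta K (r, \<alpha> r) \<star>\<^sub>?M row (\<alpha> r) (%j. v (r, j))"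
  have dc: "delta K (r, \<alpha> r) \<in> carrier ?M" if "r \<in> ?T" for r
    using that by (intro ivm_carrierI) (auto simp: delta_def ivd_def)
  have tc: "?t r \<in> carrier ?M" if "r \<in> ?T" for r
    by (rule fdD(3)[OF fd_ivm[OF ok] dc[OF that] row_closed[OF V(1)]])
  have pvd: "pv n (\<alpha> r) j \<longleftrightarrow> (r, j) \<in> ivd I \<alpha> \<beta>" if "r \<in> ?T" for r j
    using that l[of r] ok by (auto simp: pv_def ivd_def ivok_def)
  have te: "?t r (r', y) = (if r' = r then v (r, y) else \<zero>)" if r: "r \<in> ?T" and y: "(r', y) \<in> ivd I \<alpha> \<beta>" for r r' y
  proof (cases "r' = r")
    case False
    have "(\<Oplus>x\<in>{..<n}. delta K (r, \<alpha> r) (r', x) \<otimes> co (row (\<alpha> r) (%j. v (r, j))) x y) = \<zero>"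
      by (rule K.add.finprod_one_eqI) (use False in \<open>simp add: delta_def row_closed V(1)\<close>)
    thus ?thesis using False by (simp add: ivm_act)
  next
    case True
    have "(\<Oplus>x\<in>{..<n}. delta K (r, \<alpha> r) (r', x) \<otimes> co (row (\<alpha> r) (%j. v (r, j))) x y) =
       delta K (r, \<alpha> r) (r', \<alpha> r) \<otimes> co (row (\<alpha> r) (%j. v (r, j))) (\<alpha> r) y"
      by (rule finsum_single[OF K.abelian_monoid_axioms])
        (use r ok in \<open>auto simp: delta_def row_closed V(1) ivok_def\<close>)
    thus ?thesis using True y pvd[OF r, of y] by (simp add: ivm_act delta_def row_closed V(1) co_row)
  qed
  have sc: "(\<Oplus>\<^sub>?M r\<in>?T. ?t r) \<in> carrier ?M" using tc by (intro M.finsum_closed) blast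
  show "v = (\<Oplus>\<^sub>?M r\<in>?T. ?t r)"
  proof
    fix d :: "nat \<times> nat" obtain r y where d: "d = (r, y)" by (cases d)
    show "v d = (\<Oplus>\<^sub>?M r\<in>?T. ?t r) d"
    proof (cases "(r, y) \<in> ivd I \<alpha> \<beta>")
      case False
      thus ?thesis using V(2) ivm_D(2)[OF sc] by (simp add: d)
    next
      case True
      hence rT: "r \<in> ?T" by (auto simp: ivd_def)
      have "(\<Oplus>\<^sub>?M r\<in>?T. ?t r) d = (\<Oplus>\<^bsub>kmod K\<^esub>r\<in>?T. ?t r d)"
        by (rule lin_finsum[OF mM module_kmod[OF K.is_cring] ivm_coord_lin]) (use tc in blast)
      also have "\<dots> = ?t r d"
        unfolding finsum_kmod using ok rT te[OF _ True] V(1)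
        by (intro finsum_single[OF K.abelian_monoid_axioms]) (auto simp: d ivok_def)
      also have "\<dots> = v d" using te[OF rT True] by (simp add: d)
      finally show ?thesis by simp
    qed
  qed
qed

lemma ivm_inclusion:
  assumes ok: "ivok I \<alpha> \<beta>" "ivok I \<alpha>' \<beta>" and le: "!!r. r \<in> I ==> \<alpha>' r \<le> \<alpha> r"
  shows "(%v. v) \<in> rhom A (ivm I \<alpha> \<beta>) (ivm I \<alpha>' \<beta>)"
proof (rule rhom_basisI[OF fd_ivm[OF ok(1)] fd_ivm[OF ok(2)]])
  have sub: "ivd I \<alpha> \<beta> \<subseteq> ivd I \<alpha>' \<beta>" using le by (fastforce simp: ivd_def)
  have cl: "v \<in> carrier (ivm I \<alpha>' \<beta>)" if "v \<in> carrier (ivm I \<alpha> \<beta>)" for v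
    by (rule ivm_carrierI) (use ivm_D[OF that] sub in blast)+
  show "(%v. v) \<in> lin K (ivm I \<alpha> \<beta>) (ivm I \<alpha>' \<beta>)"
    by (rule linI) (use cl in \<open>auto simp: ivm_simps(3,4)\<close>)
  fix v i j assume v: "v \<in> carrier (ivm I \<alpha> \<beta>)" and ij: "pv n i j"
  show "v \<star>\<^bsub>ivm I \<alpha> \<beta>\<^esub> b i j = v \<star>\<^bsub>ivm I \<alpha>' \<beta>\<^esub> b i j"
  proof
    fix d :: "nat \<times> nat" obtain r y where d: "d = (r, y)" by (cases d)
    have "v (r, i) = \<zero>" if "(r, j) \<notin> ivd I \<alpha> \<beta>" "(r, j) \<in> ivd I \<alpha>' \<beta>"
      by (rule ivm_D(2)[OF v]) (use that ij in \<open>auto simp: ivd_def pv_def\<close>)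
    thus "(v \<star>\<^bsub>ivm I \<alpha> \<beta>\<^esub> b i j) d = (v \<star>\<^bsub>ivm I \<alpha>' \<beta>\<^esub> b i j) d"
      using sub by (auto simp: d ivm_act_b[OF v] ivm_act_b[OF cl[OF v]])
  qed
qed

lemma ivm_quotient:
  assumes ok: "ivok I \<alpha>' \<beta>" "ivok I \<alpha>' \<alpha>" and le: "!!r. r \<in> I ==> \<alpha> r \<le> \<beta> r"
  shows "\<exists>q\<in>rhom A (ivm I \<alpha>' \<beta>) (ivm I \<alpha>' \<alpha>). q ` carrier (ivm I \<alpha>' \<beta>) = carrier (ivm I \<alpha>' \<alpha>) \<and>
    (\<forall>v\<in>carrier (ivm I \<alpha>' \<beta>). q v = \<zero>\<^bsub>ivm I \<alpha>' \<alpha>\<^esub> \<longleftrightarrow> v \<in> carrier (ivm I \<alpha> \<beta>))"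
proof -
  define q where "q = (%v d. if d \<in> ivd I \<alpha>' \<alpha> then v d else \<zero>)"
  have sub: "ivd I \<alpha>' \<alpha> \<subseteq> ivd I \<alpha>' \<beta>" using le by (fastforce simp: ivd_def)
  have cl: "q v \<in> carrier (ivm I \<alpha>' \<alpha>)" if "v \<in> carrier (ivm I \<alpha>' \<beta>)" for v
    by (rule ivm_carrierI) (use ivm_D[OF that] in \<open>auto simp: q_def\<close>)
  have 1: "q \<in> rhom A (ivm I \<alpha>' \<beta>) (ivm I \<alpha>' \<alpha>)"
  proof (rule rhom_basisI[OF fd_ivm[OF ok(1)] fd_ivm[OF ok(2)]])
    show "q \<in> lin K (ivm I \<alpha>' \<beta>) (ivm I \<alpha>' \<alpha>)"
      by (rule linI) (use cl in \<open>auto simp: ivm_simps(3,4) q_def\<close>)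
    fix v i j assume v: "v \<in> carrier (ivm I \<alpha>' \<beta>)" and ij: "pv n i j"
    have qd: "q u d = (if d \<in> ivd I \<alpha>' \<alpha> then u d else \<zero>)" for u d by (simp add: q_def)
    show "q (v \<star>\<^bsub>ivm I \<alpha>' \<beta>\<^esub> b i j) = q v \<star>\<^bsub>ivm I \<alpha>' \<alpha>\<^esub> b i j"
    proof
      fix d :: "nat \<times> nat" obtain r y where d: "d = (r, y)" by (cases d)
      have "v (r, i) = \<zero>" if "(r, j) \<in> ivd I \<alpha>' \<alpha>" "(r, i) \<notin> ivd I \<alpha>' \<alpha>"
        by (rule ivm_D(2)[OF v]) (use that ij in \<open>auto simp: ivd_def pv_def\<close>)
      thus "q (v \<star>\<^bsub>ivm I \<alpha>' \<beta>\<^esub> b i j) d = (q v \<star>\<^bsub>ivm I \<alpha>' \<alpha>\<^esub> b i j) d"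
        using sub by (auto simp: d ivm_act_b[OF v] ivm_act_b[OF cl[OF v]] qd)
    qed
  qed
  have 2: "q ` carrier (ivm I \<alpha>' \<beta>) = carrier (ivm I \<alpha>' \<alpha>)"
  proof
    show "q ` carrier (ivm I \<alpha>' \<beta>) \<subseteq> carrier (ivm I \<alpha>' \<alpha>)" using cl by auto
    show "carrier (ivm I \<alpha>' \<alpha>) \<subseteq> q ` carrier (ivm I \<alpha>' \<beta>)"
    proof
      fix v assume v: "v \<in> carrier (ivm I \<alpha>' \<alpha>)"
      have "v = q v" using ivm_D(2)[OF v] by (auto simp: q_def)
      moreover have "v \<in> carrier (ivm I \<alpha>' \<beta>)" by (rule ivm_carrierI) (use ivm_D[OF v] sub in blast)+
      ultimately show "v \<in> q ` carrier (ivm I \<alpha>' \<beta>)" by (rule image_eqI)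
    qed
  qed
  have "q v = \<zero>\<^bsub>ivm I \<alpha>' \<alpha>\<^esub> \<longleftrightarrow> v \<in> carrier (ivm I \<alpha> \<beta>)" if v: "v \<in> carrier (ivm I \<alpha>' \<beta>)" for v
  proof -
  have "q v = \<zero>\<^bsub>ivm I \<alpha>' \<alpha>\<^esub> \<longleftrightarrow> (\<forall>d. d \<in> ivd I \<alpha>' \<alpha> --> v d = \<zero>)"
    by (auto simp: q_def ivm_simps(2) fun_eq_iff)
  also have "\<dots> \<longleftrightarrow> (\<forall>d. d \<notin> ivd I \<alpha> \<beta> --> v d = \<zero>)"
  proof (intro iffI allI impI)
    fix d assume h: "\<forall>d. d \<in> ivd I \<alpha>' \<alpha> --> v d = \<zero>" "d \<notin> ivd I \<alpha> \<beta>"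
    show "v d = \<zero>"
    proof (cases "d \<in> ivd I \<alpha>' \<beta>")
      case True
      hence "d \<in> ivd I \<alpha>' \<alpha>" using h(2) by (auto simp: ivd_def)
      thus ?thesis using h(1) by blast
    qed (use ivm_D(2)[OF v] in blast)
  next
    fix d assume h: "\<forall>d. d \<notin> ivd I \<alpha> \<beta> --> v d = \<zero>" "d \<in> ivd I \<alpha>' \<alpha>"
    have "d \<notin> ivd I \<alpha> \<beta>" using h(2) by (auto simp: ivd_def)
    thus "v d = \<zero>" using h(1) by blast
  qed
  also have "\<dots> \<longleftrightarrow> v \<in> carrier (ivm I \<alpha> \<beta>)" using ivm_D(1)[OF v] unfolding ivm_simps(1) by blast
  finally show "q v = \<zero>\<^bsub>ivm I \<alpha>' \<alpha>\<^esub> \<longleftrightarrow> v \<in> carrier (ivm I \<alpha> \<beta>)" .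
  qed
  with 1 2 show ?thesis by (intro bexI[of _ q]) simp_all
qed

text \<open>Let \<open>m\<close> be the largest vertex at which a given nonzero submodule does not vanish. Its elements at
  \<open>m\<close> are concentrated in the socles of the rows, hence lie in the smaller intervals.\<close>

lemma ivm_essential:
  assumes ok: "ivok I \<alpha> \<beta>" "ivok I \<alpha>' \<beta>" and le: "!!r. r \<in> I ==> \<alpha>' r \<le> \<alpha> r"
    and ne: "!!r. r \<in> I ==> \<alpha>' r < \<beta> r ==> \<alpha> r < \<beta> r"
  shows "essential A (ivm I \<alpha>' \<beta>) (carrier (ivm I \<alpha> \<beta>))"
  unfolding essential_def
proof (intro conjI allI impI)
  let ?E = "ivm I \<alpha>' \<beta>"
  note F = fd_ivm[OF ok(2)]
  show "submod A ?E (carrier (ivm I \<alpha> \<beta>))"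
    using submod_image[OF fd_ivm[OF ok(1)] F ivm_inclusion[OF ok le]] by simp
  fix V assume V: "submod A ?E V" "carrier (ivm I \<alpha> \<beta>) \<inter> V = {\<zero>\<^sub>?E}"
  note v = submodD[OF F V(1)]
  show "V = {\<zero>\<^sub>?E}"
  proof (rule ccontr)
    assume "V ~= {\<zero>\<^sub>?E}"
    then obtain w where w: "w \<in> V" "w ~= \<zero>\<^sub>?E" using v(2) by blast
    define S where "S = {y. \<exists>w\<in>V. \<exists>r. w (r, y) ~= \<zero>}"
    have Sn: "y < n" if "y \<in> S" for y
    proof -
      obtain u r where "u \<in> V" "u (r, y) ~= \<zero>" using \<open>y \<in> S\<close> by (auto simp: S_def)
      hence "(r, y) \<in> ivd I \<alpha>' \<beta>" using ivm_D(2)[OF v(1)] by blast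
      thus ?thesis using ok(2) by (auto simp: ivd_def ivok_def)
    qed
    have "S ~= {}" using w by (auto simp: S_def ivm_simps(2) fun_eq_iff)
    moreover have "finite S" by (rule finite_subset[of _ "{..<n}"]) (use Sn in auto)
    ultimately have mS: "Max S \<in> S" "!!y. y \<in> S ==> y \<le> Max S" by simp_all
    define m where "m = Max S"
    obtain u r0 where u: "u \<in> V" "u (r0, m) ~= \<zero>" using mS(1) by (auto simp: S_def m_def)
    have pm: "pv n m m" using Sn[OF mS(1)] by (simp add: pv_def m_def)
    let ?u = "u \<star>\<^sub>?E b m m"
    have uV: "?u \<in> V" using v(5)[OF b_closed u(1)] .
    have ua: "?u (r, y) = (if y = m then u (r, m) else \<zero>)" for r y
      using ivm_D(2)[OF v(1)[OF u(1)]] pm by (auto simp: ivm_act_b[OF v(1)[OF u(1)]])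
    have "?u \<in> carrier (ivm I \<alpha> \<beta>)"
    proof (rule ivm_carrierI)
      show "?u (r, x) \<in> carrier K" for r x by (rule ivm_D(1)[OF v(1)[OF uV]])
      fix r x assume n: "(r, x) \<notin> ivd I \<alpha> \<beta>"
      show "?u (r, x) = \<zero>"
      proof (rule ccontr)
        assume "?u (r, x) ~= \<zero>"
        hence x: "x = m" "u (r, m) ~= \<zero>" using ua by (auto split: if_splits)
        hence d: "(r, m) \<in> ivd I \<alpha>' \<beta>" using ivm_D(2)[OF v(1)[OF u(1)]] by blast
        hence m: "m < \<alpha> r" "\<alpha> r < \<beta> r" using n x(1) ne[of r] by (auto simp: ivd_def)
        have p1: "pv n m (Suc m)" "(r, Suc m) \<in> ivd I \<alpha>' \<beta>" using m d ok(2) by (auto simp: pv_def ivd_def ivok_def)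
        have "(u \<star>\<^sub>?E b m (Suc m)) (r, Suc m) = u (r, m)"
          using p1 by (simp add: ivm_act_b[OF v(1)[OF u(1)]])
        hence "(u \<star>\<^sub>?E b m (Suc m)) (r, Suc m) ~= \<zero>" using x(2) by simp
        hence "Suc m \<in> S" unfolding S_def using v(5)[OF b_closed u(1), of m "Suc m"] by blast
        thus False using mS(2)[of "Suc m"] by (simp add: m_def)
      qed
    qed
    hence "?u = \<zero>\<^sub>?E" using V(2) uV by blast
    hence "?u (r0, m) = \<zero>" by (simp add: ivm_simps(2))
    thus False using ua u(2) by simp
  qed
qed

text \<open>The left end of the injective hull of a row; empty rows stay empty.\<close>

definition lo :: "(nat => nat) => (nat => nat) => nat => nat" where
  "lo \<alpha> \<beta> r = (if \<alpha> r < \<beta> r then \<beta> r - 3 else \<alpha> r)"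

lemma lo_ok:
  assumes "ivok I \<alpha> \<beta>"
  shows "ivinj I (lo \<alpha> \<beta>) \<beta>" "ivok I (lo \<alpha> \<beta>) \<alpha>" "!!r. r \<in> I ==> lo \<alpha> \<beta> r \<le> \<alpha> r"
    "!!r. r \<in> I ==> lo \<alpha> \<beta> r < \<beta> r ==> \<alpha> r < \<beta> r"
  using assms by (auto simp: ivinj_def ivok_def lo_def split: if_splits)

text \<open>One step of the minimal injective resolution, for a submodule \<open>U\<close> of an injective module \<open>E\<close> that is
  isomorphic to an interval module: its hull and the cokernel are obtained row by row.\<close>

lemma hull_of_interval_module:
  fixes E :: "('k, 'a, 'v) rmodule"
  assumes ok: "ivok I \<alpha> \<beta>" and E: "injm E" and U: "essential A E U"
    and \<kappa>: "\<kappa> \<in> rhom A (E\<lparr>carrier := U\<rparr>) (ivm I \<alpha> \<beta>)" "bij_betw \<kappa> U (carrier (ivm I \<alpha> \<beta>))"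
  shows "\<exists>h\<in>rhom A E (ivm I (lo \<alpha> \<beta>) \<beta>). bij_betw h (carrier E) (carrier (ivm I (lo \<alpha> \<beta>) \<beta>))"
    "\<exists>p\<in>rhom A E (ivm I (lo \<alpha> \<beta>) \<alpha>). p ` carrier E = carrier (ivm I (lo \<alpha> \<beta>) \<alpha>) \<and> rker E (ivm I (lo \<alpha> \<beta>) \<alpha>) p = U"
proof -
  let ?F = "ivm I (lo \<alpha> \<beta>) \<beta>" and ?N = "carrier (ivm I \<alpha> \<beta>)"
  note l = lo_ok[OF ok]
  have ok2: "ivok I (lo \<alpha> \<beta>) \<beta>" using l(1) by (simp add: ivinj_def)
  note F = inj_ivm[OF l(1)] and fF = fd_ivm[OF ok2] and fE = inj_fd[OF E]
  note inc = ivm_inclusion[OF ok ok2 l(3)]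
  have ess: "essential A ?F ?N" by (rule ivm_essential[OF ok ok2 l(3,4)])
  note k = rhomD[OF \<kappa>(1)]
  have "\<kappa> \<in> rhom A (E\<lparr>carrier := U\<rparr>) (?F\<lparr>carrier := ?N\<rparr>)"
  proof (rule rhomI)
    fix x assume "x \<in> carrier (E\<lparr>carrier := U\<rparr>)"
    thus "\<kappa> x \<in> carrier (?F\<lparr>carrier := ?N\<rparr>)" using k(1) by simp
  next
    fix x y assume "x \<in> carrier (E\<lparr>carrier := U\<rparr>)" "y \<in> carrier (E\<lparr>carrier := U\<rparr>)"
    thus "\<kappa> (x \<oplus>\<^bsub>E\<lparr>carrier := U\<rparr>\<^esub> y) = \<kappa> x \<oplus>\<^bsub>?F\<lparr>carrier := ?N\<rparr>\<^esub> \<kappa> y" using k(2) by (simp add: ivm_simps(3))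
  next
    fix a x assume "x \<in> carrier (E\<lparr>carrier := U\<rparr>)" "a \<in> carrier A"
    thus "\<kappa> (x \<star>\<^bsub>E\<lparr>carrier := U\<rparr>\<^esub> a) = \<kappa> x \<star>\<^bsub>?F\<lparr>carrier := ?N\<rparr>\<^esub> a"
      using k(3)[of x a] rhomD(3)[OF inc k(1), of x a] by simp
  qed
  from hull_iso[OF E U F ess this \<kappa>(2)] obtain h where
    h: "h \<in> rhom A E ?F" "bij_betw h (carrier E) (carrier ?F)" "!!u. u \<in> U ==> h u = \<kappa> u" by blast
  show "\<exists>h\<in>rhom A E ?F. bij_betw h (carrier E) (carrier ?F)" using h by blast
  have le: "!!r. r \<in> I ==> \<alpha> r \<le> \<beta> r" using ok by (simp add: ivok_def)
  let ?C = "ivm I (lo \<alpha> \<beta>) \<alpha>"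
  from ivm_quotient[OF ok2 l(2) le] obtain q where q: "q \<in> rhom A ?F ?C" "q ` carrier ?F = carrier ?C"
    "\<forall>v\<in>carrier ?F. q v = \<zero>\<^sub>?C \<longleftrightarrow> v \<in> ?N" by blast
  have "(%x. q (h x)) ` carrier E = carrier ?C"
    using q(2) bij_betw_imp_surj_on[OF h(2)] by (metis image_image)
  moreover have "rker E ?C (%x. q (h x)) = U"
  proof -
    have Uc: "x \<in> carrier E" if "x \<in> U" for x
      using submodD(1)[OF fE _ that] U by (simp add: essential_def)
    have "q (h x) = \<zero>\<^sub>?C \<longleftrightarrow> x \<in> U" if x: "x \<in> carrier E" for x
    proof -
      have "q (h x) = \<zero>\<^sub>?C \<longleftrightarrow> h x \<in> ?N" by (rule bspec[OF q(3) rhomD(1)[OF h(1) x]])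
      also have "\<dots> \<longleftrightarrow> x \<in> U"
      proof
        assume "h x \<in> ?N"
        then obtain u where u: "u \<in> U" "h x = \<kappa> u" using bij_betw_imp_surj_on[OF \<kappa>(2)] by (metis imageE)
        hence "h x = h u" using h(3) by simp
        hence "x = u" using inj_onD[OF bij_betw_imp_inj_on[OF h(2)]] x Uc[OF u(1)] by blast
        thus "x \<in> U" using u(1) by simp
      next
        assume "x \<in> U"
        thus "h x \<in> ?N" using h(3) bij_betwE[OF \<kappa>(2)] by simp
      qed
      finally show ?thesis .
    qed
    thus ?thesis using Uc by (auto simp: rker_def)
  qed
  ultimately show "\<exists>p\<in>rhom A E ?C. p ` carrier E = carrier ?C \<and> rker E ?C p = U"
    by (intro bexI[of _ "%x. q (h x)"] conjI rhom_comp[OF h(1) q(1)])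
qed

end

context fd_algebra
begin

text \<open>The homomorphism theorem, in the form that identifies the image of a differential with a known cokernel.\<close>

lemma factor_iso:
  assumes E: "fdm E" and F: "fdm F" and N: "fdm N"
    and f: "f \<in> rhom A E F" and p: "p \<in> rhom A E N" "p ` carrier E = carrier N"
    and k: "rker E F f = rker E N p"
  shows "\<exists>\<kappa>\<in>rhom A (F\<lparr>carrier := f ` carrier E\<rparr>) N. bij_betw \<kappa> (f ` carrier E) (carrier N)"
proof -
  interpret E: Module.module K E by (rule fdD(1)[OF E])
  interpret F: Module.module K F by (rule fdD(1)[OF F])
  interpret N: Module.module K N by (rule fdD(1)[OF N])
  note f' = rhomD[OF f] and p' = rhomD[OF p(1)]
  have sub: "g (x \<ominus>\<^sub>E y) = \<zero>\<^sub>G \<longleftrightarrow> g x = g y"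
    if g: "g \<in> rhom A E G" and G: "fdm G" and xy: "x \<in> carrier E" "y \<in> carrier E"
    for g and G :: "('k, 'a, 'z) rmodule" and x y
  proof -
    interpret G: Module.module K G by (rule fdD(1)[OF G])
    have "x = (x \<ominus>\<^sub>E y) \<oplus>\<^sub>E y" using xy by (simp add: a_minus_def E.a_assoc E.l_neg)
    hence "g x = g (x \<ominus>\<^sub>E y) \<oplus>\<^sub>G g y" using rhomD(2)[OF g, of "x \<ominus>\<^sub>E y" y] xy by simp
    thus ?thesis using rhomD(1)[OF g] xy by simp
  qed
  have eq: "f x = f y \<longleftrightarrow> p x = p y" if xy: "x \<in> carrier E" "y \<in> carrier E" for x y
  proof -
    have "x \<ominus>\<^sub>E y \<in> rker E F f \<longleftrightarrow> x \<ominus>\<^sub>E y \<in> rker E N p" by (simp add: k)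
    thus ?thesis using sub[OF f F xy] sub[OF p(1) N xy] xy by (simp add: rker_def)
  qed
  define \<kappa> where "\<kappa> y = p (inv_into (carrier E) f y)" for y
  have \<kappa>: "\<kappa> (f x) = p x" if x: "x \<in> carrier E" for x
  proof -
    have "inv_into (carrier E) f (f x) \<in> carrier E" "f (inv_into (carrier E) f (f x)) = f x"
      using x by (auto intro: inv_into_into f_inv_into_f)
    thus ?thesis using eq x by (simp add: \<kappa>_def)
  qed
  have "\<kappa> \<in> rhom A (F\<lparr>carrier := f ` carrier E\<rparr>) N"
  proof (rule rhomI)
    fix u assume "u \<in> carrier (F\<lparr>carrier := f ` carrier E\<rparr>)"
    then obtain x where x: "x \<in> carrier E" "u = f x" by auto
    show "\<kappa> u \<in> carrier N" using x \<kappa> p'(1) by simp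
    fix a assume a: "a \<in> carrier A"
    have "\<kappa> (f (x \<star>\<^sub>E a)) = p (x \<star>\<^sub>E a)" by (rule \<kappa>[OF fdD(3)[OF E x(1) a]])
    thus "\<kappa> (u \<star>\<^bsub>F\<lparr>carrier := f ` carrier E\<rparr>\<^esub> a) = \<kappa> u \<star>\<^sub>N a"
      using x a \<kappa> f'(3) p'(3) by simp
  next
    fix u v assume "u \<in> carrier (F\<lparr>carrier := f ` carrier E\<rparr>)" "v \<in> carrier (F\<lparr>carrier := f ` carrier E\<rparr>)"
    then obtain x y where x: "x \<in> carrier E" "u = f x" and y: "y \<in> carrier E" "v = f y" by auto
    have "\<kappa> (f (x \<oplus>\<^sub>E y)) = p (x \<oplus>\<^sub>E y)" by (rule \<kappa>[OF E.a_closed[OF x(1) y(1)]])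
    thus "\<kappa> (u \<oplus>\<^bsub>F\<lparr>carrier := f ` carrier E\<rparr>\<^esub> v) = \<kappa> u \<oplus>\<^sub>N \<kappa> v"
      using x y \<kappa> f'(2) p'(2) by simp
  qed
  moreover have "bij_betw \<kappa> (f ` carrier E) (carrier N)"
  proof (rule bij_betw_imageI)
    show "inj_on \<kappa> (f ` carrier E)"
      by (rule inj_onI) (use \<kappa> eq in auto)
    have "\<kappa> ` f ` carrier E = p ` carrier E" unfolding image_image by (rule image_cong) (simp_all add: \<kappa>)
    thus "\<kappa> ` f ` carrier E = carrier N" using p(2) by simp
  qed
  ultimately show ?thesis by blast
qed

end

context nakayama
begin

subsection \<open>The regular module and its minimal injective resolution\<close>

text \<open>The right ideal that is the sum of the \<open>e_i A\<close> with \<open>i \<in> J\<close>.\<close>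

definition rows :: "nat set => 'a set" where
  "rows J = {a \<in> carrier A. \<forall>i j. i \<notin> J --> co a i j = \<zero>}"

definition c0 :: "'a => nat \<times> nat => 'k" where
  "c0 a = (%(r, x). co a r x)"

definition pend :: "nat => nat" where
  "pend r = min (r + 3) n"

lemma ivok_proj: "J \<subseteq> {..<n} ==> ivok J (%r. r) pend"
  by (auto simp: ivok_def pend_def finite_subset)

lemma ivd_proj: "J \<subseteq> {..<n} ==> (r, x) \<in> ivd J (%r. r) pend \<longleftrightarrow> r \<in> J \<and> pv n r x"
  by (auto simp: ivd_def pend_def pv_def)

lemma submod_rows: "submod A AA (rows J)"
proof (rule submodI[OF fd_regular])
  fix a x assume a: "a \<in> carrier A" and x: "x \<in> rows J"
  have "co (x \<otimes>\<^sub>A a) i j = \<zero>" if i: "i \<notin> J" for i j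
  proof (cases "pv n i j")
    case True
    have "(\<Oplus>l\<in>{..<n}. co x i l \<otimes> co a l j) = \<zero>"
      by (rule K.add.finprod_one_eqI) (use x a i in \<open>simp add: rows_def\<close>)
    thus ?thesis using True x a by (simp add: co_mult rows_def)
  qed (use x a in \<open>simp add: co_zero rows_def\<close>)
  thus "x \<star>\<^bsub>AA\<^esub> a \<in> rows J" using x a by (simp add: rows_def)
qed (auto simp: rows_def co_zero_elem co_add)

lemma rows_iso:
  assumes J: "J \<subseteq> {..<n}"
  shows "c0 \<in> rhom A (AA\<lparr>carrier := rows J\<rparr>) (ivm J (%r. r) pend)"
    "bij_betw c0 (rows J) (carrier (ivm J (%r. r) pend))"
proof -
  let ?N = "ivm J (%r. r) pend"
  have cl: "c0 a \<in> carrier ?N" if a: "a \<in> rows J" for a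
    by (rule ivm_carrierI) (use a in \<open>auto simp: c0_def rows_def ivd_proj[OF J] co_zero\<close>)
  show "c0 \<in> rhom A (AA\<lparr>carrier := rows J\<rparr>) ?N"
  proof (rule rhomI)
    fix a x assume "x \<in> carrier (AA\<lparr>carrier := rows J\<rparr>)" and a: "a \<in> carrier A"
    hence x: "x \<in> rows J" "x \<in> carrier A" by (simp_all add: rows_def)
    show "c0 (x \<star>\<^bsub>AA\<lparr>carrier := rows J\<rparr>\<^esub> a) = c0 x \<star>\<^sub>?N a"
    proof
      fix d :: "nat \<times> nat" obtain r y where d: "d = (r, y)" by (cases d)
      have "x \<otimes>\<^sub>A a \<in> rows J" using submodD(5)[OF fd_regular submod_rows a x(1)] by simp
      hence "co (x \<otimes>\<^sub>A a) r y = \<zero>" if "(r, y) \<notin> ivd J (%r. r) pend"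
        using that x a by (auto simp: ivd_proj[OF J] rows_def co_zero)
      thus "c0 (x \<star>\<^bsub>AA\<lparr>carrier := rows J\<rparr>\<^esub> a) d = (c0 x \<star>\<^sub>?N a) d"
        using x a by (simp add: d c0_def ivm_act ivd_proj[OF J] co_mult)
    qed
  next
    fix x y assume "x \<in> carrier (AA\<lparr>carrier := rows J\<rparr>)" "y \<in> carrier (AA\<lparr>carrier := rows J\<rparr>)"
    hence "x \<in> carrier A" "y \<in> carrier A" by (simp_all add: rows_def)
    thus "c0 (x \<oplus>\<^bsub>AA\<lparr>carrier := rows J\<rparr>\<^esub> y) = c0 x \<oplus>\<^sub>?N c0 y"
      by (simp add: c0_def ivm_simps(3) co_add fun_eq_iff)
  qed (use cl in simp)
  show "bij_betw c0 (rows J) (carrier ?N)"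
  proof (rule bij_betw_imageI)
    show "inj_on c0 (rows J)"
    proof (rule inj_onI)
      fix x y assume h: "x \<in> rows J" "y \<in> rows J" "c0 x = c0 y"
      show "x = y"
      proof (rule co_eqI)
        fix i j show "co x i j = co y i j" using fun_cong[OF h(3), of "(i, j)"] by (simp add: c0_def)
      qed (use h in \<open>simp_all add: rows_def\<close>)
    qed
    show "c0 ` rows J = carrier ?N"
    proof
      show "c0 ` rows J \<subseteq> carrier ?N" using cl by blast
      show "carrier ?N \<subseteq> c0 ` rows J"
      proof
        fix v assume v: "v \<in> carrier ?N"
        have f: "(%i j. v (i, j)) \<in> coords K n"
          using ivm_D[OF v] by (simp add: coords_def ivd_proj[OF J])
        have "v = c0 (el (%i j. v (i, j)))" by (auto simp: c0_def co_el[OF f])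
        moreover have "el (%i j. v (i, j)) \<in> rows J"
          using ivm_D[OF v] by (simp add: rows_def el_closed[OF f] co_el[OF f] ivd_proj[OF J])
        ultimately show "v \<in> c0 ` rows J" by (rule image_eqI)
      qed
    qed
  qed
qed

lemma rows_UNIV: "rows {..<n} = carrier A"
proof -
  have "co a i j = \<zero>" if "a \<in> carrier A" "i \<notin> {..<n}" for a i j
    using that by (intro co_zero) (auto simp: pv_def)
  thus ?thesis by (auto simp: rows_def)
qed

lemma regular_iso:
  "c0 \<in> rhom A AA (ivm {..<n} (%r. r) pend)"
  "bij_betw c0 (carrier A) (carrier (ivm {..<n} (%r. r) pend))"
proof -
  have e: "AA\<lparr>carrier := carrier A\<rparr> = AA"
    by (simp add: regular_rmod_def module.defs rmodule.defs)
  show "c0 \<in> rhom A AA (ivm {..<n} (%r. r) pend)"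
    using rows_iso(1)[OF subset_refl] unfolding rows_UNIV e .
  show "bij_betw c0 (carrier A) (carrier (ivm {..<n} (%r. r) pend))"
    using rows_iso(2)[of "{..<n}"] by (simp add: rows_UNIV)
qed

text \<open>The rows of the \<open>k\<close>-th cosyzygy of the regular module are the intervals
  \<open>[fst (iv k) r, snd (iv k) r)\<close>.\<close>

primrec iv :: "nat => (nat => nat) \<times> (nat => nat)" where
  "iv 0 = (%r. r, pend)"
| "iv (Suc k) = (lo (fst (iv k)) (snd (iv k)), fst (iv k))"

abbreviation "Om k \<equiv> ivm {..<n} (fst (iv k)) (snd (iv k))"

lemma iv_ok: "ivok {..<n} (fst (iv k)) (snd (iv k))"
proof (induction k)
  case (Suc k)
  thus ?case using lo_ok(2)[OF Suc] by simp
qed (simp add: ivok_proj)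

lemma fd_Om: "fdm (Om k)"
  by (rule fd_ivm[OF iv_ok])

text \<open>The image of the \<open>k\<close>-th map of a resolution, whose zeroth map is the embedding of \<open>A\<close>.\<close>

definition im where
  "im I \<epsilon> d k = (case k of 0 => \<epsilon> ` carrier A | Suc j => d j ` carrier (I j))"

context
  fixes I \<epsilon> d
  assumes R: "min_inj_resolution K A AA I \<epsilon> d"
begin

lemma res_facts:
  "injm (I k)" "essential A (I k) (im I \<epsilon> d k)" "rker (I k) (I (Suc k)) (d k) = im I \<epsilon> d k"
  "d k \<in> rhom A (I k) (I (Suc k))" "\<epsilon> \<in> rhom A AA (I 0)" "inj_on \<epsilon> (carrier A)"
  using R unfolding min_inj_resolution_def is_injective_hull_def im_def
  by (cases k; simp)+

text \<open>The image of the \<open>k\<close>-th map of the resolution is the \<open>k\<close>-th cosyzygy. By induction it is the sum of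
  intervals \<open>Om k\<close>, because hulls and cokernels of interval modules are known.\<close>

lemma im_iso: "\<exists>\<kappa>\<in>rhom A ((I k)\<lparr>carrier := im I \<epsilon> d k\<rparr>) (Om k). bij_betw \<kappa> (im I \<epsilon> d k) (carrier (Om k))"
proof (induction k)
  case 0
  note f0 = inj_fd[OF res_facts(1)[of 0]]
  interpret I0: Module.module K "I 0" by (rule fdD(1)[OF f0])
  have z: "rker AA (I 0) \<epsilon> = rker AA (Om 0) c0"
  proof -
    have "rker AA (I 0) \<epsilon> = {\<zero>\<^sub>A}"
      using rhom_inj_iff[OF fd_regular f0 res_facts(5)] res_facts(6) rhom_zero_map[OF fd_regular f0 res_facts(5)]
      by (auto simp: rker_def)
    moreover have "rker AA (Om 0) c0 = {\<zero>\<^sub>A}"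
      using rhom_inj_iff[OF fd_regular fd_Om[of 0], of c0] regular_iso bij_betw_imp_inj_on[OF regular_iso(2)]
        rhom_zero_map[OF fd_regular fd_Om[of 0], of c0]
      by (auto simp: rker_def)
    ultimately show ?thesis by simp
  qed
  from factor_iso[OF fd_regular f0 fd_Om[of 0] res_facts(5) _ _ z]
  show ?case using regular_iso bij_betw_imp_surj_on[OF regular_iso(2)] by (simp add: im_def)
next
  case (Suc k)
  then obtain \<kappa> where \<kappa>: "\<kappa> \<in> rhom A ((I k)\<lparr>carrier := im I \<epsilon> d k\<rparr>) (Om k)" "bij_betw \<kappa> (im I \<epsilon> d k) (carrier (Om k))" by blast
  from hull_of_interval_module(2)[OF iv_ok res_facts(1,2) \<kappa>] obtain p where
    p: "p \<in> rhom A (I k) (Om (Suc k))" "p ` carrier (I k) = carrier (Om (Suc k))" "rker (I k) (Om (Suc k)) p = im I \<epsilon> d k"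
    by auto
  have "rker (I k) (I (Suc k)) (d k) = rker (I k) (Om (Suc k)) p" using res_facts(3) p(3) by simp
  from factor_iso[OF inj_fd[OF res_facts(1)] inj_fd[OF res_facts(1)] fd_Om res_facts(4) p(1,2) this]
  show ?case by (simp add: im_def)
qed

lemma Om_cover:
  "\<exists>p\<in>rhom A (I k) (Om (Suc k)). p ` carrier (I k) = carrier (Om (Suc k)) \<and> rker (I k) (Om (Suc k)) p = im I \<epsilon> d k"
proof -
  obtain \<kappa> where \<kappa>: "\<kappa> \<in> rhom A ((I k)\<lparr>carrier := im I \<epsilon> d k\<rparr>) (Om k)" "bij_betw \<kappa> (im I \<epsilon> d k) (carrier (Om k))"
    using im_iso by blast
  from hull_of_interval_module(2)[OF iv_ok res_facts(1,2) \<kappa>] show ?thesis by simp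
qed

lemma term_proj:
  assumes "!!r. r < n ==> fst (iv k) r < snd (iv k) r ==> 3 \<le> snd (iv k) r"
  shows "projm (I k)"
proof -
  let ?F = "ivm {..<n} (lo (fst (iv k)) (snd (iv k))) (snd (iv k))"
  obtain \<kappa> where \<kappa>: "\<kappa> \<in> rhom A ((I k)\<lparr>carrier := im I \<epsilon> d k\<rparr>) (Om k)" "bij_betw \<kappa> (im I \<epsilon> d k) (carrier (Om k))"
    using im_iso by blast
  from hull_of_interval_module(1)[OF iv_ok res_facts(1,2) \<kappa>] obtain h where
    h: "h \<in> rhom A (I k) ?F" "bij_betw h (carrier (I k)) (carrier ?F)" by blast
  have ok: "ivok {..<n} (lo (fst (iv k)) (snd (iv k))) (snd (iv k))"
    using lo_ok(1)[OF iv_ok] by (simp add: ivinj_def)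
  have "projm ?F"
  proof (rule proj_ivm[OF ok])
    fix r assume r: "r \<in> {..<n}" "lo (fst (iv k)) (snd (iv k)) r < snd (iv k) r"
    thus "snd (iv k) r = lo (fst (iv k)) (snd (iv k)) r + 3"
      using assms[of r] lo_ok(4)[OF iv_ok r] by (simp add: lo_def)
  qed
  from proj_iso[OF this inj_fd[OF res_facts(1)] rhom_inverse[OF inj_fd[OF res_facts(1)] h] bij_betw_inv_into[OF h(2)]]
  show ?thesis .
qed

end

text \<open>In a free module, an element at vertex \<open>0\<close> killed by the path from \<open>0\<close> to \<open>2\<close> has no component
  at the trivial path, and this is the only path that ends at \<open>0\<close>.\<close>

lemma torsionless_zero_02:
  assumes E: "fdm E" "torsionless A E" and t: "t \<in> carrier E" "t \<star>\<^sub>E b 0 2 = \<zero>\<^sub>E" and n: "3 \<le> n"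
  shows "t \<star>\<^sub>E b 0 1 = \<zero>\<^sub>E"
proof (rule ccontr)
  assume "t \<star>\<^sub>E b 0 1 ~= \<zero>\<^sub>E"
  then obtain \<phi> where p: "\<phi> \<in> rhom A E AA" "\<phi> (t \<star>\<^sub>E b 0 1) ~= \<zero>\<^sub>A"
    using E fdD(3)[OF E(1) t(1) b_closed] unfolding torsionless_def by meson
  note P = rhomD[OF p(1), unfolded regular_simps]
  have c: "\<phi> t \<in> carrier A" by (rule P(1)[OF t(1)])
  have pvs: "pv n 0 2" "pv n 0 1" using n by (simp_all add: pv_def)
  have "\<phi> t \<otimes>\<^sub>A b 0 2 = \<phi> (t \<star>\<^sub>E b 0 2)" by (rule P(3)[OF t(1) b_closed, symmetric])
  also have "\<dots> = \<zero>\<^sub>A" using rhom_zero_map[OF E(1) fd_regular p(1)] by (simp add: t(2))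
  finally have "co (\<phi> t \<otimes>\<^sub>A b 0 2) 0 2 = \<zero>" by (simp add: co_zero_elem)
  hence z: "co (\<phi> t) 0 0 = \<zero>" using pvs by (simp add: co_mult_b[OF c])
  have "co (\<phi> t) i 0 = \<zero>" for i
  proof (cases "i = 0")
    case False
    thus ?thesis by (intro co_zero[OF c]) (simp add: pv_def)
  qed (simp add: z)
  hence "\<phi> t \<otimes>\<^sub>A b 0 1 = \<zero>\<^sub>A"
    by (intro co_eqI) (simp_all add: c co_mult_b[OF c] co_zero_elem)
  thus False using P(3)[OF t(1) b_closed, of 0 1] p(2) by simp
qed

lemma torsionless_zero_01:
  assumes E: "fdm E" "torsionless A E" and t: "t \<in> carrier E" "t \<star>\<^sub>E b 0 0 = t" "t \<star>\<^sub>E b 0 1 = \<zero>\<^sub>E"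
    and n: "2 \<le> n"
  shows "t = \<zero>\<^sub>E"
proof (rule ccontr)
  assume "t ~= \<zero>\<^sub>E"
  then obtain \<phi> where p: "\<phi> \<in> rhom A E AA" "\<phi> t ~= \<zero>\<^sub>A"
    using E t(1) unfolding torsionless_def by meson
  note P = rhomD[OF p(1), unfolded regular_simps]
  have c: "\<phi> t \<in> carrier A" by (rule P(1)[OF t(1)])
  have pvs: "pv n 0 0" "pv n 0 1" using n by (simp_all add: pv_def)
  have "\<phi> t \<otimes>\<^sub>A b 0 1 = \<phi> (t \<star>\<^sub>E b 0 1)" by (rule P(3)[OF t(1) b_closed, symmetric])
  also have "\<dots> = \<zero>\<^sub>A" using rhom_zero_map[OF E(1) fd_regular p(1)] t(3) by simp
  finally have "co (\<phi> t \<otimes>\<^sub>A b 0 1) 0 1 = \<zero>" by (simp add: co_zero_elem)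
  hence z: "co (\<phi> t) 0 0 = \<zero>" using pvs by (simp add: co_mult_b[OF c])
  have e: "\<phi> t = \<phi> t \<otimes>\<^sub>A b 0 0" using P(3)[OF t(1) b_closed, of 0 0] by (simp add: t(2))
  have "co (\<phi> t) i 0 = \<zero>" for i
  proof (cases "i = 0")
    case False
    thus ?thesis by (intro co_zero[OF c]) (simp add: pv_def)
  qed (simp add: z)
  hence "\<phi> t \<otimes>\<^sub>A b 0 0 = \<zero>\<^sub>A"
    by (intro co_eqI) (simp_all add: c co_mult_b[OF c] co_zero_elem)
  thus False using e p(2) by simp
qed

text \<open>An element at vertex 1 that is killed by the arrow out of it spans a simple submodule.\<close>

lemma socle_act:
  assumes f: "fdm E" and s: "s \<in> carrier E" "s \<star>\<^sub>E b 1 1 = s" "s \<star>\<^sub>E b 1 2 = \<zero>\<^sub>E"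
    and n: "3 \<le> n" and c: "c \<in> carrier A"
  shows "s \<star>\<^sub>E c = co c 1 1 \<odot>\<^sub>E s"
proof -
  interpret E: Module.module K E by (rule fdD(1)[OF f])
  have pvs: "pv n 1 2" "pv n 1 1" using n by (simp_all add: pv_def)
  have z: "co c 1 j = \<zero>" if "j ~= 1" "j ~= 2" "j ~= 3" for j
    using that by (intro co_zero[OF c]) (auto simp: pv_def)
  have "b 1 1 \<otimes>\<^sub>A c = co c 1 1 \<odot>\<^sub>A b 1 1 \<oplus>\<^sub>A (co c 1 2 \<odot>\<^sub>A b 1 2 \<oplus>\<^sub>A co c 1 3 \<odot>\<^sub>A b 1 3)"
  proof (rule co_eqI)
    fix i j assume ij: "pv n i j"
    consider "j = 1" | "j = 2" | "j = 3" | "j ~= 1" "j ~= 2" "j ~= 3" by blast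
    thus "co (b 1 1 \<otimes>\<^sub>A c) i j =
      co (co c 1 1 \<odot>\<^sub>A b 1 1 \<oplus>\<^sub>A (co c 1 2 \<odot>\<^sub>A b 1 2 \<oplus>\<^sub>A co c 1 3 \<odot>\<^sub>A b 1 3)) i j"
      using ij pvs c z[of j] by cases (simp_all add: co_b_mult co_smult co_b co_add del: One_nat_def)
  qed (use c in simp_all)
  hence "s \<star>\<^sub>E c = s \<star>\<^sub>E (co c 1 1 \<odot>\<^sub>A b 1 1 \<oplus>\<^sub>A (co c 1 2 \<odot>\<^sub>A b 1 2 \<oplus>\<^sub>A co c 1 3 \<odot>\<^sub>A b 1 3))"
    using fdD(6)[OF f s(1) b_closed c, of 1 1] s(2) by simp
  also have "\<dots> = co c 1 1 \<odot>\<^sub>E (s \<star>\<^sub>E b 1 1) \<oplus>\<^sub>E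
     (co c 1 2 \<odot>\<^sub>E (s \<star>\<^sub>E b 1 2) \<oplus>\<^sub>E co c 1 3 \<odot>\<^sub>E (s \<star>\<^sub>E b 1 3))"
    using c by (simp add: fdD(5)[OF f s(1)] fdD(8)[OF f s(1)])
  also have "s \<star>\<^sub>E b 1 3 = \<zero>\<^sub>E"
  proof (cases "pv n 2 3")
    case True
    have "s \<star>\<^sub>E b 1 2 \<star>\<^sub>E b 2 3 = s \<star>\<^sub>E b 1 3" using True pvs by (simp add: fd_bb[OF f s(1)])
    thus ?thesis using s(3) zero_ract[OF f b_closed, of 2 3] by simp
  next
    case False
    hence "\<not> pv n 1 3" by (simp add: pv_def)
    thus ?thesis by (simp add: b_zero ract_zero[OF f s(1)])
  qed
  finally show ?thesis using c s(1) by (simp only: s(2,3)) simp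
qed

text \<open>The simple module at vertex \<open>1\<close> is divisible by the arrow from \<open>0\<close> to \<open>1\<close> in every injective extension,
  by this inclusion of annihilators.\<close>

lemma socle_annihilator:
  assumes f: "fdm E" and s: "s \<in> carrier E" "s \<star>\<^sub>E b 1 1 = s" "s \<star>\<^sub>E b 1 2 = \<zero>\<^sub>E"
    and n: "3 \<le> n" and c: "c \<in> carrier A" "b 0 1 \<otimes>\<^sub>A c = \<zero>\<^sub>A"
  shows "s \<star>\<^sub>E c = \<zero>\<^sub>E"
proof -
  interpret E: Module.module K E by (rule fdD(1)[OF f])
  have "pv n 0 1" using n by (simp add: pv_def)
  hence "co c 1 1 = \<zero>"
    using arg_cong[OF c(2), of "%a. co a 0 1"] by (simp add: co_b_mult[OF c(1)] co_zero_elem)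
  thus ?thesis using socle_act[OF f s n c(1)] s(1) by simp
qed

text \<open>The injective hull \<open>[0,2)\<close> of the simple module \<open>[1,2)\<close> is not projective.\<close>

lemma not_proj_if_socle_1:
  assumes E: "injm E" and s: "s \<in> carrier E" "s \<star>\<^sub>E b 1 1 = s" "s \<star>\<^sub>E b 1 2 = \<zero>\<^sub>E" "s ~= \<zero>\<^sub>E"
    and n: "3 \<le> n"
  shows "\<not> projm E"
proof
  assume P: "projm E"
  note f = inj_fd[OF E]
  have pvs: "pv n 0 1" "pv n 1 2" using n by (simp_all add: pv_def)
  have "\<exists>y\<in>carrier E. s = y \<star>\<^sub>E b 0 1"
    by (rule inj_divide[OF E b_closed s(1)]) (rule socle_annihilator[OF f s(1-3) n])
  then obtain y where y: "y \<in> carrier E" "s = y \<star>\<^sub>E b 0 1" by blast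
  have "s \<star>\<^sub>E b 1 2 = y \<star>\<^sub>E b 0 2" using pvs by (simp add: y(2) fd_bb[OF f y(1)])
  hence "y \<star>\<^sub>E b 0 2 = \<zero>\<^sub>E" using s(3) by simp
  from torsionless_zero_02[OF f proj_torsionless[OF P] y(1) this n] show False using s(4) y(2) by simp
qed

lemma socle_1_in_interval_module:
  assumes "r < n" "fst (iv k) r = 1" "snd (iv k) r = 2"
  shows "\<exists>s\<in>carrier (Om k). s \<star>\<^bsub>Om k\<^esub> b 1 1 = s \<and> s \<star>\<^bsub>Om k\<^esub> b 1 2 = \<zero>\<^bsub>Om k\<^esub> \<and> s ~= \<zero>\<^bsub>Om k\<^esub> \<and> s (r, 1) = \<one>"
proof -
  have "snd (iv k) r \<le> n" using iv_ok[of k] assms(1) by (simp add: ivok_def)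
  hence n: "2 \<le> n" using assms(3) by simp
  define s where "s = delta K (r, 1::nat)"
  have sv: "s (q, y) = (if q = r \<and> y = 1 then \<one> else \<zero>)" for q y by (simp add: s_def delta_def)
  have s: "s \<in> carrier (Om k)" by (rule ivm_carrierI) (use assms in \<open>auto simp: sv ivd_def\<close>)
  have "s \<star>\<^bsub>Om k\<^esub> b 1 1 = s"
  proof
    fix d :: "nat \<times> nat" obtain q y where d: "d = (q, y)" by (cases d)
    show "(s \<star>\<^bsub>Om k\<^esub> b 1 1) d = s d"
      using assms n by (auto simp: d ivm_act_b[OF s] sv ivd_def pv_def)
  qed
  moreover have "s \<star>\<^bsub>Om k\<^esub> b 1 2 = \<zero>\<^bsub>Om k\<^esub>"
  proof
    fix d :: "nat \<times> nat" obtain q y where d: "d = (q, y)" by (cases d)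
    show "(s \<star>\<^bsub>Om k\<^esub> b 1 2) d = \<zero>\<^bsub>Om k\<^esub> d"
      using assms by (auto simp: d ivm_act_b[OF s] sv ivd_def ivm_simps(2))
  qed
  moreover have "s ~= \<zero>\<^bsub>Om k\<^esub>"
  proof
    assume "s = \<zero>\<^bsub>Om k\<^esub>"
    hence "s (r, 1) = \<zero>\<^bsub>Om k\<^esub> (r, 1)" by simp
    thus False by (simp add: sv ivm_simps(2))
  qed
  ultimately show ?thesis using s by (intro bexI[of _ s]) (simp_all add: sv)
qed

lemma term_not_proj:
  assumes R: "min_inj_resolution K A AA I \<epsilon> d"
    and r: "r < n" "fst (iv k) r = 1" "snd (iv k) r = 2" and n: "3 \<le> n"
  shows "\<not> projm (I k)"
proof -
  note f = res_facts[OF R]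
  note fd = inj_fd[OF f(1)]
  let ?U = "im I \<epsilon> d k"
  have sU: "submod A (I k) ?U" using f(2) by (simp add: essential_def)
  have fU: "fdm ((I k)\<lparr>carrier := ?U\<rparr>)" by (rule fd_submod[OF fd sU])
  obtain \<kappa> where \<kappa>: "\<kappa> \<in> rhom A ((I k)\<lparr>carrier := ?U\<rparr>) (Om k)" "bij_betw \<kappa> ?U (carrier (Om k))"
    using im_iso[OF R] by blast
  obtain s where s: "s \<in> carrier (Om k)" "s \<star>\<^bsub>Om k\<^esub> b 1 1 = s" "s \<star>\<^bsub>Om k\<^esub> b 1 2 = \<zero>\<^bsub>Om k\<^esub>" "s ~= \<zero>\<^bsub>Om k\<^esub>"
    using socle_1_in_interval_module[OF r] by blast
  let ?g = "inv_into ?U \<kappa>"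
  have g: "?g \<in> rhom A (Om k) ((I k)\<lparr>carrier := ?U\<rparr>)" using rhom_inverse[OF fU \<kappa>(1)] \<kappa>(2) by simp
  note G = rhomD[OF g, simplified]
  have gz: "?g \<zero>\<^bsub>Om k\<^esub> = \<zero>\<^bsub>I k\<^esub>" using rhom_zero_map[OF fd_Om fU g] by simp
  have kg: "\<kappa> (?g x) = x" if "x \<in> carrier (Om k)" for x by (rule bij_betw_inv_into_right[OF \<kappa>(2) that])
  show ?thesis
  proof (rule not_proj_if_socle_1[OF f(1) _ _ _ _ n])
    show "?g s \<in> carrier (I k)" using G(1)[OF s(1)] submodD(1)[OF fd sU] by blast
    show "?g s \<star>\<^bsub>I k\<^esub> b 1 1 = ?g s" using G(3)[OF s(1) b_closed, of 1 1] s(2) by simp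
    show "?g s \<star>\<^bsub>I k\<^esub> b 1 2 = \<zero>\<^bsub>I k\<^esub>" using G(3)[OF s(1) b_closed, of 1 2] s(3) gz by simp
    show "?g s ~= \<zero>\<^bsub>I k\<^esub>"
    proof
      assume "?g s = \<zero>\<^bsub>I k\<^esub>"
      hence "s = \<kappa> (?g \<zero>\<^bsub>Om k\<^esub>)" using kg[OF s(1)] gz by simp
      thus False using kg[of "\<zero>\<^bsub>Om k\<^esub>"] s(4) submodD(2)[OF fd_Om submod_carrier[OF fd_Om]] by simp
    qed
  qed
qed

text \<open>Rows that are injective already vanish after the first step.\<close>

lemma iv_short: "r + 3 \<le> n ==> iv (Suc k) = (\<alpha>, \<beta>) ==> \<alpha> r = r \<and> \<beta> r = r"
  by (induction k arbitrary: \<alpha> \<beta>) (auto simp: lo_def pend_def)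

text \<open>Two steps shift each of the last two rows to the left by \<open>3\<close>.\<close>

lemma iv_last:
  "3 * k + 1 \<le> n ==> fst (iv (2 * k)) (n - 1) = n - 1 - 3 * k \<and> snd (iv (2 * k)) (n - 1) = n - 3 * k"
proof (induction k)
  case (Suc k)
  hence IH: "fst (iv (2 * k)) (n - 1) = n - 1 - 3 * k" "snd (iv (2 * k)) (n - 1) = n - 3 * k" by auto
  show ?case using Suc.prems by (auto simp: IH[simplified] lo_def)
qed (auto simp: pend_def)

lemma iv_last_odd:
  "3 * k + 1 \<le> n ==> fst (iv (Suc (2 * k))) (n - 1) = n - 3 * k - 3 \<and> snd (iv (Suc (2 * k))) (n - 1) = n - 1 - 3 * k"
  using iv_last[of k] by (auto simp: lo_def)

lemma iv_penult:
  "3 * k + 2 \<le> n ==> fst (iv (2 * k)) (n - 2) = n - 2 - 3 * k \<and> snd (iv (2 * k)) (n - 2) = n - 3 * k"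
proof (induction k)
  case (Suc k)
  hence IH: "fst (iv (2 * k)) (n - 2) = n - 2 - 3 * k" "snd (iv (2 * k)) (n - 2) = n - 3 * k" by auto
  show ?case using Suc.prems by (auto simp: IH[simplified] lo_def)
qed (auto simp: pend_def)

lemma iv_penult_odd:
  "3 * k + 2 \<le> n ==> fst (iv (Suc (2 * k))) (n - 2) = n - 3 * k - 3 \<and> snd (iv (Suc (2 * k))) (n - 2) = n - 2 - 3 * k"
  using iv_penult[of k] by (auto simp: lo_def)

text \<open>From the first cosyzygy on, only the last two rows are nonzero.\<close>

lemma iv_cases:
  assumes "r < n" "fst (iv k) r < snd (iv k) r"
  shows "k = 0 \<or> r = n - 1 \<or> r = n - 2"
proof (rule ccontr)
  assume h: "\<not> ?thesis"
  then obtain j where "k = Suc j" by (cases k) auto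
  thus False using iv_short[of r j "fst (iv k)" "snd (iv k)"] assms h by auto
qed

lemma term_proj_small:
  assumes R: "min_inj_resolution K A AA I \<epsilon> d" and n: "3 \<le> n" and k: "3 * (k div 2) + (if even k then 3 else 5) \<le> n"
  shows "projm (I k)"
proof (rule term_proj[OF R])
  fix r assume r: "r < n" "fst (iv k) r < snd (iv k) r"
  show "3 \<le> snd (iv k) r"
  proof (cases "k = 0")
    case True
    thus ?thesis using r n by (simp add: pend_def)
  next
    case False
    hence rr: "r = n - 1 \<or> r = n - 2" using iv_cases[OF r] by simp
    show ?thesis
    proof (cases "even k")
      case True
      then obtain j where j: "k = 2 * j" by (elim evenE)
      hence c: "3 * j + 3 \<le> n" using k by simp
      have "snd (iv (2 * j)) r = n - 3 * j" using rr iv_last[of j] iv_penult[of j] c by auto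
      thus ?thesis using c j by simp
    next
      case False
      then obtain j where j: "k = Suc (2 * j)" by (auto elim: oddE)
      hence c: "3 * j + 5 \<le> n" using k by simp
      have "snd (iv (Suc (2 * j))) r = n - 1 - 3 * j \<or> snd (iv (Suc (2 * j))) r = n - 2 - 3 * j"
        using rr iv_last_odd[of j] iv_penult_odd[of j] c by (auto simp del: iv.simps)
      thus ?thesis using c unfolding j by linarith
    qed
  qed
qed

lemma domdim_1:
  assumes "n = 3 * m + 1" "1 \<le> m"
  shows "domdim K A = enat (2 * m - 1)"
  unfolding domdim_def
proof (rule domdim_mod_eq[OF fd_regular], intro conjI allI impI)
  fix I \<epsilon> d i assume R: "min_inj_resolution K A AA I \<epsilon> d"
  show "projm (I i)" if i: "i < 2 * m - 1"
  proof (rule term_proj_small[OF R])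
    show "3 * (i div 2) + (if even i then 3 else 5) \<le> n"
      using i assms by (auto elim!: evenE oddE)
  qed (use assms in simp)
  obtain j where m: "m = Suc j" using assms(2) by (cases m) auto
  show "\<not> projm (I (2 * m - 1))"
    by (rule term_not_proj[OF R, of "n - 2"]) (use iv_penult_odd[of j] assms(1) m in auto)
qed

lemma domdim_2:
  assumes "n = 3 * m + 2" "1 \<le> m"
  shows "domdim K A = enat (2 * m)"
  unfolding domdim_def
proof (rule domdim_mod_eq[OF fd_regular], intro conjI allI impI)
  fix I \<epsilon> d i assume R: "min_inj_resolution K A AA I \<epsilon> d"
  show "projm (I i)" if i: "i < 2 * m"
  proof (rule term_proj_small[OF R])
    show "3 * (i div 2) + (if even i then 3 else 5) \<le> n"
      using i assms by (auto elim!: evenE oddE)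
  qed (use assms in simp)
  show "\<not> projm (I (2 * m))"
    by (rule term_not_proj[OF R, of "n - 1"]) (use iv_last[of m] assms in auto)
qed

text \<open>The chosen cosyzygy is the cokernel of some minimal resolution, hence has the known intervals.\<close>

lemma cosyzygy_iso:
  assumes D: "1 \<le> D"
  shows "fdm (cosyzygy K A D AA)"
    "\<exists>c\<in>rhom A (cosyzygy K A D AA) (Om D). bij_betw c (carrier (cosyzygy K A D AA)) (carrier (Om D))"
proof -
  let ?C = "cosyzygy K A D AA"
  obtain j where j: "D = Suc j" using D by (cases D) auto
  have cs: "is_cosyzygy K A D AA C \<longleftrightarrow> fdm C \<and> (\<exists>I \<epsilon> d.
      min_inj_resolution K A AA I \<epsilon> d \<and>
      (\<exists>p\<in>rhom A (I j) C. p ` carrier (I j) = carrier C \<and> rker (I j) C p = im I \<epsilon> d j))" for C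
    unfolding is_cosyzygy_def j by (cases j) (auto simp: im_def)
  have "\<exists>C. is_cosyzygy K A D AA C"
  proof -
    obtain I \<epsilon> d where R: "min_inj_resolution K A AA I \<epsilon> d"
      using min_inj_resolution_exists[OF fd_regular] by blast
    obtain p where p: "p \<in> rhom A (I j) (Om D)" "p ` carrier (I j) = carrier (Om D)" "rker (I j) (Om D) p = im I \<epsilon> d j"
      using Om_cover[OF R, of j] j by blast
    obtain C :: "('k, 'a, nat => 'k) rmodule" and c where
      C: "fdm C" "c \<in> rhom A (Om D) C" "bij_betw c (carrier (Om D)) (carrier C)"
      using nat_copy_exists[OF fd_Om] by blast
    have "c x = \<zero>\<^sub>C \<longleftrightarrow> x = \<zero>\<^bsub>Om D\<^esub>" if "x \<in> carrier (Om D)" for x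
      using rhom_inj_iff[OF fd_Om C(1,2)] bij_betw_imp_inj_on[OF C(3)] that rhom_zero_map[OF fd_Om C(1,2)] by auto
    hence "rker (I j) C (%x. c (p x)) = im I \<epsilon> d j"
      unfolding p(3)[symmetric] rker_def using rhomD(1)[OF p(1)] by auto
    moreover have "(%x. c (p x)) ` carrier (I j) = carrier C"
      using p(2) bij_betw_imp_surj_on[OF C(3)] by (metis image_image)
    ultimately have "is_cosyzygy K A D AA C"
      unfolding cs using C(1) R rhom_comp[OF p(1) C(2)] by blast
    thus ?thesis by blast
  qed
  hence "is_cosyzygy K A D AA ?C" unfolding cosyzygy_def by (rule someI_ex)
  then obtain I \<epsilon> d p where C: "fdm ?C" and R: "min_inj_resolution K A AA I \<epsilon> d"
    and p: "p \<in> rhom A (I j) ?C" "p ` carrier (I j) = carrier ?C" "rker (I j) ?C p = im I \<epsilon> d j"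
    unfolding cs by blast
  show "fdm ?C" by (rule C)
  obtain q where q: "q \<in> rhom A (I j) (Om D)" "q ` carrier (I j) = carrier (Om D)" "rker (I j) (Om D) q = im I \<epsilon> d j"
    using Om_cover[OF R, of j] j by blast
  have "rker (I j) ?C p = rker (I j) (Om D) q" using p(3) q(3) by simp
  from factor_iso[OF inj_fd[OF res_facts(1)[OF R]] C fd_Om p(1) q(1,2) this]
  show "\<exists>c\<in>rhom A ?C (Om D). bij_betw c (carrier ?C) (carrier (Om D))"
    unfolding p(2) by simp
qed

end

context nakayama
begin

section \<open>The endomorphism algebras\<close>

subsection \<open>Homomorphisms out of and into interval summands\<close>

lemma row_single:
  "k \<in> carrier K ==> row l (%j. if j = w then k else \<zero>) = k \<odot>\<^sub>A b l w"
  by (rule co_eqI) (auto simp: row_closed co_row co_smult co_b)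

lemma row_add:
  "(!!j. g j \<in> carrier K) ==> (!!j. h j \<in> carrier K) ==> row l (%j. g j \<oplus> h j) = row l g \<oplus>\<^sub>A row l h"
  by (rule co_eqI) (simp_all add: row_closed co_row co_add)

lemma row_smult:
  "k \<in> carrier K ==> (!!j. g j \<in> carrier K) ==> row l (%j. k \<otimes> g j) = k \<odot>\<^sub>A row l g"
  by (rule co_eqI) (simp_all add: row_closed co_row co_smult)

text \<open>A functional \<open>\<psi>\<close> gives a homomorphism into the injective interval module with socle
  \<open>i\<close>, and an element \<open>u\<close> of \<open>N\<close> at the top \<open>i - 2\<close> of this interval module, killed by the paths
  that leave it, gives a homomorphism from there to \<open>N\<close>. This is the composite.\<close>

definition kap :: "('k, 'a, 'w) rmodule => 'w => ('k, 'a, 'v) rmodule => nat => ('v => 'k) => 'v => 'w" where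
  "kap N u M i \<psi> x = u \<star>\<^sub>N row (i - 2) (%y. \<psi> (x \<star>\<^sub>M b y i))"

lemma kap_rhom:
  assumes M: "fdm M" and N: "fdm N" and u: "u \<in> carrier N" and i: "i < n"
    and kill: "!!w. i < w ==> u \<star>\<^sub>N b (i - 2) w = \<zero>\<^sub>N"
    and Z: "ksub K M Z" "!!x y. x \<in> carrier M ==> x \<star>\<^sub>M b y i \<in> Z"
    and \<psi>: "\<psi> \<in> lin K (M\<lparr>carrier := Z\<rparr>) (kmod K)"
  shows "kap N u M i \<psi> \<in> rhom A M N"
proof (rule rhom_basisI[OF M N])
  interpret M: Module.module K M by (rule fdD(1)[OF M])
  interpret N: Module.module K N by (rule fdD(1)[OF N])
  have P: "\<psi> z \<in> carrier K" "\<psi> (z \<oplus>\<^sub>M z') = \<psi> z \<oplus> \<psi> z'" "k \<in> carrier K ==> \<psi> (k \<odot>\<^sub>M z) = k \<otimes> \<psi> z"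
    if "z \<in> Z" "z' \<in> Z" for z z' k
    using linD[OF \<psi>] that by simp_all
  have P0: "\<psi> \<zero>\<^sub>M = \<zero>" using P(3)[OF ksubD(2)[OF Z(1)] ksubD(2)[OF Z(1)], of "\<zero>"]
      P(1)[OF ksubD(2)[OF Z(1)] ksubD(2)[OF Z(1)]] by simp
  have gK: "\<psi> (x \<star>\<^sub>M b y i) \<in> carrier K" if "x \<in> carrier M" for x y
    by (rule P(1)[OF Z(2)[OF that] Z(2)[OF that]])
  have rc: "row (i - 2) (%y. \<psi> (x \<star>\<^sub>M b y i)) \<in> carrier A" if "x \<in> carrier M" for x
    by (rule row_closed[OF gK[OF that]])
  show "kap N u M i \<psi> \<in> lin K M N"
  proof (rule linI)
    fix x assume x: "x \<in> carrier M"
    show "kap N u M i \<psi> x \<in> carrier N" unfolding kap_def by (rule fdD(3)[OF N u rc[OF x]])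
    fix k assume k: "k \<in> carrier K"
    have "(%y. \<psi> ((k \<odot>\<^sub>M x) \<star>\<^sub>M b y i)) = (%y. k \<otimes> \<psi> (x \<star>\<^sub>M b y i))"
      by (rule ext) (simp add: smult_ract[OF M k x] P(3)[OF Z(2)[OF x] Z(2)[OF x] k])
    thus "kap N u M i \<psi> (k \<odot>\<^sub>M x) = k \<odot>\<^sub>N kap N u M i \<psi> x"
      unfolding kap_def by (simp add: row_smult[OF k gK[OF x]] fdD(8)[OF N u rc[OF x] k])
  next
    fix x x' assume x: "x \<in> carrier M" and x': "x' \<in> carrier M"
    have "(%y. \<psi> ((x \<oplus>\<^sub>M x') \<star>\<^sub>M b y i)) = (%y. \<psi> (x \<star>\<^sub>M b y i) \<oplus> \<psi> (x' \<star>\<^sub>M b y i))"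
      by (rule ext) (simp add: fdD(4)[OF M x x'] P(2)[OF Z(2)[OF x] Z(2)[OF x']])
    thus "kap N u M i \<psi> (x \<oplus>\<^sub>M x') = kap N u M i \<psi> x \<oplus>\<^sub>N kap N u M i \<psi> x'"
      unfolding kap_def by (simp add: row_add[OF gK[OF x] gK[OF x']] fdD(5)[OF N u rc[OF x] rc[OF x']])
  qed
  fix x v w assume x: "x \<in> carrier M" and vw: "pv n v w"
  let ?l = "i - 2" and ?k = "\<psi> (x \<star>\<^sub>M b v i)"
  let ?k1 = "if pv n w i then ?k else \<zero>" and ?k2 = "if pv n ?l v then ?k else \<zero>"
  have kK: "?k1 \<in> carrier K" "?k2 \<in> carrier K" using gK[OF x] by simp_all
  have "(%y. \<psi> (x \<star>\<^sub>M b v w \<star>\<^sub>M b y i)) = (%y. if y = w then ?k1 else \<zero>)"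
    by (rule ext) (use vw P0 in \<open>auto simp: fd_bb[OF M x]\<close>)
  hence 1: "kap N u M i \<psi> (x \<star>\<^sub>M b v w) = ?k1 \<odot>\<^sub>N (u \<star>\<^sub>N b ?l w)"
    unfolding kap_def by (simp only: row_single[OF kK(1)] fdD(8)[OF N u b_closed kK(1)])
  have "row ?l (%y. \<psi> (x \<star>\<^sub>M b y i)) \<otimes>\<^sub>A b v w = ?k2 \<odot>\<^sub>A b ?l w"
    unfolding row_b[OF gK[OF x]] row_single[OF kK(2), symmetric]
    by (rule arg_cong[of _ _ "row ?l"]) (use vw in auto)
  hence 2: "kap N u M i \<psi> x \<star>\<^sub>N b v w = ?k2 \<odot>\<^sub>N (u \<star>\<^sub>N b ?l w)"
    unfolding kap_def fdD(6)[OF N u rc[OF x] b_closed, symmetric] by (simp only: fdD(8)[OF N u b_closed kK(2)])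
  have uc: "u \<star>\<^sub>N b ?l w \<in> carrier N" by (rule fdD(3)[OF N u b_closed])
  show "kap N u M i \<psi> (x \<star>\<^sub>M b v w) = kap N u M i \<psi> x \<star>\<^sub>N b v w"
  proof (cases "pv n ?l w \<and> w \<le> i")
    case False
    hence "u \<star>\<^sub>N b ?l w = \<zero>\<^sub>N" using kill[of w] by (auto simp: b_zero ract_zero[OF N u])
    thus ?thesis unfolding 1 2 using kK by simp
  next
    case True
    hence "pv n w i" using i by (auto simp: pv_def)
    moreover have "pv n ?l v \<or> \<not> pv n v i" using True vw by (auto simp: pv_def)
    moreover have "?k = \<zero>" if "\<not> pv n v i" using that P0 by (simp add: b_zero ract_zero[OF M x])
    ultimately have "?k1 = ?k2" by auto
    thus ?thesis unfolding 1 2 by simp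
  qed
qed

lemma ksub_carrier: "fdm M ==> ksub K M (carrier M)"
  using submod_carrier submod_iff by blast

text \<open>If the path from \<open>i\<close> to \<open>i + 2\<close> acts nontrivially on \<open>P\<close>, then \<open>[i, i + 3)\<close> is a summand: \<open>z\<close> generates a
  copy of it, and a functional that is \<open>1\<close> at the end of this copy yields the projection \<open>p\<close>.\<close>

lemma summand_exists:
  assumes P: "fdm P" and x: "x \<in> carrier P" "x \<star>\<^sub>P b i (i + 2) ~= \<zero>\<^sub>P" and i: "i + 2 < n"
  shows "\<exists>z p. z \<in> carrier P \<and> z \<star>\<^sub>P b i i = z \<and> p \<in> rhom A P AA \<and> p z = b i i \<and>
    (\<forall>y\<in>carrier P. b i i \<otimes>\<^sub>A p y = p y)"
proof -
  have pvi: "pv n i i" "pv n i (i + 2)" using i by (simp_all add: pv_def)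
  let ?z = "x \<star>\<^sub>P b i i"
  have zc: "?z \<in> carrier P" by (rule fdD(3)[OF P x(1) b_closed])
  have zb: "?z \<star>\<^sub>P b i i = ?z" "?z \<star>\<^sub>P b i (i + 2) = x \<star>\<^sub>P b i (i + 2)"
    using pvi by (simp_all add: fd_bb[OF P x(1)])
  obtain \<psi> where \<psi>: "\<psi> \<in> lin K P (kmod K)" "\<psi> (x \<star>\<^sub>P b i (i + 2)) = \<one>"
    using functional_exists[OF fieldK fdD(1,2)[OF P] fdD(3)[OF P x(1) b_closed] x(2)] by blast
  have \<psi>0: "\<psi> \<zero>\<^sub>P = \<zero>" using lin_zero[OF fdD(1)[OF P] module_kmod[OF K.is_cring] \<psi>(1)] by simp
  define p where "p = kap AA (b i i) P (i + 2) \<psi>"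
  have pr: "p \<in> rhom A P AA" unfolding p_def
  proof (rule kap_rhom[OF P fd_regular _ i _ ksub_carrier[OF P]])
    fix w assume "i + 2 < w"
    thus "b i i \<star>\<^bsub>AA\<^esub> b (i + 2 - 2) w = \<zero>\<^bsub>AA\<^esub>" by (simp add: b_b pv_def)
  qed (simp_all add: fdD(3)[OF P] \<psi>(1))
  have pe: "p y = b i i \<otimes>\<^sub>A row i (%j. \<psi> (y \<star>\<^sub>P b j (i + 2)))" for y by (simp add: p_def kap_def)
  have "(%j. \<psi> (?z \<star>\<^sub>P b j (i + 2))) = (%j. if j = i then \<one> else \<zero>)"
    by (rule ext) (use pvi \<psi>0 \<psi>(2) in \<open>auto simp: fd_bb[OF P x(1)]\<close>)
  hence "p ?z = b i i \<otimes>\<^sub>A b i i" by (simp add: pe row_single)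
  hence "p ?z = b i i" using pvi by (simp add: b_b)
  moreover have "b i i \<otimes>\<^sub>A p y = p y" if "y \<in> carrier P" for y
  proof -
    have "row i (%j. \<psi> (y \<star>\<^sub>P b j (i + 2))) \<in> carrier A"
      by (rule row_closed) (use linD(1)[OF \<psi>(1) fdD(3)[OF P that b_closed]] in simp)
    hence "b i i \<otimes>\<^sub>A p y = (b i i \<otimes>\<^sub>A b i i) \<otimes>\<^sub>A row i (%j. \<psi> (y \<star>\<^sub>P b j (i + 2)))"
      by (simp add: pe A.m_assoc)
    thus ?thesis using pvi by (simp add: pe b_b)
  qed
  ultimately show ?thesis using zc zb(1) pr by blast
qed

lemma faithful_summand:
  assumes P: "fdm P" "faithful A P" and i: "i + 2 < n"
  shows "\<exists>z p. z \<in> carrier P \<and> z \<star>\<^sub>P b i i = z \<and> p \<in> rhom A P AA \<and> p z = b i i \<and>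
    (\<forall>y\<in>carrier P. b i i \<otimes>\<^sub>A p y = p y)"
proof -
  have "pv n i (i + 2)" using i by (simp add: pv_def)
  hence "co (b i (i + 2)) i (i + 2) ~= co \<zero>\<^sub>A i (i + 2)" by (simp add: co_b co_zero_elem)
  hence "b i (i + 2) ~= \<zero>\<^sub>A" by auto
  then obtain x where "x \<in> carrier P" "x \<star>\<^sub>P b i (i + 2) ~= \<zero>\<^sub>P"
    using P(2) b_closed unfolding faithful_def by blast
  from summand_exists[OF P(1) this i] show ?thesis .
qed

lemma pair_rhom:
  "f \<in> rhom A L P ==> g \<in> rhom A L C ==> (%w. (f w, g w)) \<in> rhom A L (rmod_sum P C)"
  by (rule rhomI) (simp_all add: rhomD)

subsection \<open>The summand that is a cosyzygy\<close>

lemma iso_pullback: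
  assumes C: "fdm C" and c: "c \<in> rhom A C (Om D)" "bij_betw c (carrier C) (carrier (Om D))"
    and s: "s \<in> carrier (Om D)"
  shows "\<exists>s'\<in>carrier C. c s' = s"
  using bij_betw_imp_surj_on[OF c(2)] s by (metis imageE)

lemma iso_eq_zero:
  assumes C: "fdm C" and c: "c \<in> rhom A C (Om D)" "bij_betw c (carrier C) (carrier (Om D))"
    and x: "x \<in> carrier C"
  shows "x = \<zero>\<^sub>C \<longleftrightarrow> c x = \<zero>\<^bsub>Om D\<^esub>"
  using rhom_inj_iff[OF C fd_Om c(1)] bij_betw_imp_inj_on[OF c(2)] x rhom_zero_map[OF C fd_Om c(1)] by auto

lemma iso_eq:
  assumes c: "bij_betw c (carrier C) (carrier (Om D))" and "x \<in> carrier C" "y \<in> carrier C" "c x = c y"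
  shows "x = y"
  using inj_onD[OF bij_betw_imp_inj_on[OF c]] assms(2-4) by blast

lemma socle_1_in_cosyzygy:
  assumes C: "fdm C" and c: "c \<in> rhom A C (Om D)" "bij_betw c (carrier C) (carrier (Om D))"
    and r: "r < n" "fst (iv D) r = 1" "snd (iv D) r = 2"
  shows "\<exists>s\<in>carrier C. s \<star>\<^sub>C b 1 1 = s \<and> s \<star>\<^sub>C b 1 2 = \<zero>\<^sub>C \<and> s ~= \<zero>\<^sub>C \<and> c s (r, 1) = \<one>"
proof -
  obtain t where t: "t \<in> carrier (Om D)" "t \<star>\<^bsub>Om D\<^esub> b 1 1 = t" "t \<star>\<^bsub>Om D\<^esub> b 1 2 = \<zero>\<^bsub>Om D\<^esub>" "t ~= \<zero>\<^bsub>Om D\<^esub>" "t (r, 1) = \<one>"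
    using socle_1_in_interval_module[OF r] by blast
  obtain s where s: "s \<in> carrier C" "c s = t" using iso_pullback[OF C c t(1)] by blast
  note sc = fdD(3)[OF C s(1) b_closed]
  have "s \<star>\<^sub>C b 1 1 = s" by (rule iso_eq[OF c(2) sc s(1)]) (simp only: rhomD(3)[OF c(1) s(1) b_closed] s(2) t(2))
  moreover have "s \<star>\<^sub>C b 1 2 = \<zero>\<^sub>C"
    unfolding iso_eq_zero[OF C c sc] by (simp only: rhomD(3)[OF c(1) s(1) b_closed] s(2) t(3))
  moreover have "s ~= \<zero>\<^sub>C" unfolding iso_eq_zero[OF C c s(1)] using s(2) t(4) by simp
  ultimately show ?thesis using s t(5) by blast
qed

subsection \<open>The case \<open>n = 3m + 1\<close>\<close>

text \<open>The cosyzygy is \<open>[1, 2) + [1, 3)\<close>; only its vanishing at vertex \<open>0\<close> and the first summand matter.\<close>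

lemma ivd_cosyzygy_1:
  assumes n: "n = 3 * m + 1" "1 \<le> m"
  shows "(r, 0) \<notin> ivd {..<n} (fst (iv (2 * m - 1))) (snd (iv (2 * m - 1)))"
    "fst (iv (2 * m - 1)) (n - 2) = 1" "snd (iv (2 * m - 1)) (n - 2) = 2"
proof -
  let ?D = "2 * m - 1"
  obtain j where j: "m = Suc j" using n(2) by (cases m) auto
  have last: "fst (iv ?D) (n - 1) = 1" and pen: "fst (iv ?D) (n - 2) = 1" "snd (iv ?D) (n - 2) = 2"
    using iv_last_odd[of j] iv_penult_odd[of j] n j by (simp_all del: iv.simps)
  show "(r, 0) \<notin> ivd {..<n} (fst (iv ?D)) (snd (iv ?D))"
  proof
    assume h: "(r, 0) \<in> ivd {..<n} (fst (iv ?D)) (snd (iv ?D))"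
    hence "r = n - 1 \<or> r = n - 2" using iv_cases[of r ?D] n by (auto simp: ivd_def)
    thus False using h last pen by (auto simp: ivd_def)
  qed
  show "fst (iv ?D) (n - 2) = 1" "snd (iv ?D) (n - 2) = 2" by (fact pen)+
qed

text \<open>\<open>\<beta>\<close> and \<open>\<rho>\<close> send the generator \<open>z1\<close> of the summand \<open>[1, 4)\<close> to the element \<open>z0 \<star> b 0 1\<close> of \<open>[0, 3)\<close> and to the
  simple submodule of \<open>C\<close>. If \<open>g \<rho> = y \<beta>\<close>, then \<open>g\<close> maps the generator \<open>s\<close> of this simple module to \<open>y (z0) \<star> b 0 1\<close>, which
  is killed by the next arrow and hence zero.\<close>

lemma domdim_End_1:
  fixes P :: "('k, 'a, 'p) rmodule" and C :: "('k, 'a, 'q) rmodule"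
  assumes n: "n = 3 * m + 1" "1 \<le> m"
    and P: "fdm P" "faithful A P" "torsionless A P"
    and C: "fdm C" and c: "c \<in> rhom A C (Om (2 * m - 1))" "bij_betw c (carrier C) (carrier (Om (2 * m - 1)))"
  shows "domdim K (End_alg A (rmod_sum P C)) = 0"
proof -
  let ?M = "rmod_sum P C" and ?D = "2 * m - 1"
  note M = fd_rmod_sum[OF P(1) C]
  interpret P: Module.module K P by (rule fdD(1)[OF P(1)])
  interpret C: Module.module K C by (rule fdD(1)[OF C])
  have n3: "3 \<le> n" "n - 2 < n" using n by simp_all
  have n3': "0 + 2 < n" "1 + 2 < n" using n by simp_all
  note n3 = n3(1) and n2 = n3(2)
  have pvs: "pv n 0 1" "pv n 1 2" "pv n 0 0" "pv n 1 1" using n3 by (simp_all add: pv_def)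
  note D = ivd_cosyzygy_1[OF n]
  obtain s where s: "s \<in> carrier C" "s \<star>\<^sub>C b 1 1 = s" "s \<star>\<^sub>C b 1 2 = \<zero>\<^sub>C" "s ~= \<zero>\<^sub>C"
    using socle_1_in_cosyzygy[OF C c n2 D(2,3)] by blast
  have C01: "y \<star>\<^sub>C b 0 1 = \<zero>\<^sub>C" if y: "y \<in> carrier C" for y
  proof -
    have cy: "c y \<in> carrier (Om ?D)" by (rule rhomD(1)[OF c(1) y])
    have "c y (r, 0) = \<zero>" for r by (rule ivm_D(2)[OF cy D(1)])
    hence "(c y \<star>\<^bsub>Om ?D\<^esub> b 0 1) (r, x) = \<zero>" for r x
      unfolding ivm_act_b[OF cy, of 0 1 r x] by simp
    hence "c y \<star>\<^bsub>Om ?D\<^esub> b 0 1 = \<zero>\<^bsub>Om ?D\<^esub>" unfolding ivm_simps(2) by (intro ext) (simp only: split_paired_all)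
    hence "c (y \<star>\<^sub>C b 0 1) = \<zero>\<^bsub>Om ?D\<^esub>" by (simp only: rhomD(3)[OF c(1) y b_closed])
    thus ?thesis using iso_eq_zero[OF C c fdD(3)[OF C y b_closed]] by blast
  qed
  obtain z0 p0 where z0: "z0 \<in> carrier P" "z0 \<star>\<^sub>P b 0 0 = z0" "p0 \<in> rhom A P AA" "p0 z0 = b 0 0"
    using faithful_summand[OF P(1,2) n3'(1)] by blast
  obtain z1 p1 where z1: "z1 \<in> carrier P" "z1 \<star>\<^sub>P b 1 1 = z1" "p1 \<in> rhom A P AA" "p1 z1 = b 1 1"
    using faithful_summand[OF P(1,2) n3'(2)] by blast
  note q1 = rhom_comp[OF fst_rhom[of P C] z1(3)]
  note P1 = rhomD[OF z1(3), unfolded regular_simps] and P0 = rhomD[OF z0(3), unfolded regular_simps]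
  let ?z = "z0 \<star>\<^sub>P b 0 1"
  have zc: "?z \<in> carrier P" by (rule fdD(3)[OF P(1) z0(1) b_closed])
  define \<beta> where "\<beta> w = (?z \<star>\<^sub>P p1 (fst w), \<zero>\<^sub>C)" for w :: "'p \<times> 'q"
  define \<rho> where "\<rho> w = (\<zero>\<^sub>P, s \<star>\<^sub>C p1 (fst w))" for w :: "'p \<times> 'q"
  have \<beta>r: "\<beta> \<in> rhom A ?M ?M" unfolding \<beta>_def
    by (rule pair_rhom[OF generator_hom[OF P(1) zc q1]]) (rule rhomI, simp_all add: zero_ract[OF C])
  have \<rho>r: "\<rho> \<in> rhom A ?M ?M" unfolding \<rho>_def
    by (rule pair_rhom[OF _ generator_hom[OF C s(1) q1]]) (rule rhomI, simp_all add: zero_ract[OF P(1)])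
  show ?thesis
  proof (rule domdim_End_0[OF M \<beta>r \<rho>r, of "(z1, \<zero>\<^sub>C)"])
    show "(z1, \<zero>\<^sub>C) \<in> carrier ?M" using z1 by simp
    show "\<rho> (z1, \<zero>\<^sub>C) ~= \<zero>\<^sub>?M" using s z1(4) by (simp add: \<rho>_def)
  next
    fix w assume w: "w \<in> carrier ?M" "\<beta> w = \<zero>\<^sub>?M"
    have wc: "fst w \<in> carrier P" using w(1) by auto
    hence pc: "p1 (fst w) \<in> carrier A" by (rule P1(1))
    have "p0 (?z \<star>\<^sub>P p1 (fst w)) = b 0 1 \<otimes>\<^sub>A p1 (fst w)"
      using pvs by (simp only: P0(3)[OF zc pc] P0(3)[OF z0(1) b_closed] z0(4) b_b) simp
    moreover have "?z \<star>\<^sub>P p1 (fst w) = \<zero>\<^sub>P" using w(2) by (simp add: \<beta>_def)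
    ultimately have "b 0 1 \<otimes>\<^sub>A p1 (fst w) = \<zero>\<^sub>A" using rhom_zero_map[OF P(1) fd_regular z0(3)] by simp
    thus "\<rho> w = \<zero>\<^sub>?M" using socle_annihilator[OF C s(1-3) n3 pc] by (simp add: \<rho>_def)
  next
    fix g y assume g: "g \<in> rhom A ?M ?M" and y: "y \<in> rhom A ?M ?M"
      and eq: "!!x. x \<in> carrier ?M ==> g (\<rho> x) = y (\<beta> x)"
    note G = rhomD[OF g] and Y = rhomD[OF y]
    let ?s = "(\<zero>\<^sub>P, s)" and ?T = "y (z0, \<zero>\<^sub>C)"
    have sc: "?s \<in> carrier ?M" using s by simp
    have tc: "?T \<in> carrier ?M" using Y(1) z0(1) by simp
    have "g ?s = y (?z, \<zero>\<^sub>C)"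
    proof -
      have "?z \<star>\<^sub>P b 1 1 = ?z" using pvs by (simp add: fd_bb[OF P(1) z0(1)])
      thus ?thesis using eq[of "(z1, \<zero>\<^sub>C)"] z1 s(2) by (simp add: \<rho>_def \<beta>_def)
    qed
    also have "\<dots> = y ((z0, \<zero>\<^sub>C) \<star>\<^sub>?M b 0 1)" by (simp add: zero_ract[OF C])
    also have "\<dots> = ?T \<star>\<^sub>?M b 0 1" by (rule Y(3)) (use z0 in simp_all)
    finally have gs: "g ?s = ?T \<star>\<^sub>?M b 0 1" .
    have "?T \<star>\<^sub>?M b 0 2 = g ?s \<star>\<^sub>?M b 1 2" using pvs by (simp add: gs fd_bb[OF M tc])
    also have "\<dots> = g (?s \<star>\<^sub>?M b 1 2)" by (rule G(3)[OF sc b_closed, symmetric])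
    also have "?s \<star>\<^sub>?M b 1 2 = \<zero>\<^sub>?M" using s(3) by (simp add: zero_ract[OF P(1)])
    also have "g \<zero>\<^sub>?M = \<zero>\<^sub>?M" by (rule rhom_zero_map[OF M M g])
    finally have T2: "?T \<star>\<^sub>?M b 0 2 = \<zero>\<^sub>?M" .
    obtain t u where tu: "?T = (t, u)" "t \<in> carrier P" "u \<in> carrier C" using tc by auto
    have "t \<star>\<^sub>P b 0 1 = \<zero>\<^sub>P"
      by (rule torsionless_zero_02[OF P(1,3) tu(2) _ n3]) (use T2 tu(1) in simp)
    hence "?T \<star>\<^sub>?M b 0 1 = \<zero>\<^sub>?M" using C01[OF tu(3)] by (simp add: tu(1))
    hence g0: "g ?s = \<zero>\<^sub>?M" using gs by simp
    show "\<forall>x\<in>carrier ?M. g (\<rho> x) = \<zero>\<^sub>?M"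
    proof
      fix x assume "x \<in> carrier ?M"
      hence pc: "p1 (fst x) \<in> carrier A" by (intro P1(1)) auto
      have "\<rho> x = ?s \<star>\<^sub>?M p1 (fst x)" using pc by (simp add: \<rho>_def zero_ract[OF P(1)])
      hence "g (\<rho> x) = g ?s \<star>\<^sub>?M p1 (fst x)" using G(3)[OF sc pc] by simp
      thus "g (\<rho> x) = \<zero>\<^sub>?M" using zero_ract[OF M pc] g0 by simp
    qed
  qed
qed

end

context nakayama
begin

subsection \<open>Diagonal idempotents\<close>

text \<open>The sum of the idempotents at the vertices in \<open>J\<close>.\<close>

definition eJ :: "nat set => 'a" where
  "eJ J = el (%i j. if i = j \<and> i \<in> J \<and> i < n then \<one> else \<zero>)"

lemma eJ_coords: "(%i j. if i = j \<and> i \<in> J \<and> i < n then \<one> else \<zero>) \<in> coords K n"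
  by (auto simp: coords_def pv_def)

lemma eJ_closed [simp, intro]: "eJ J \<in> carrier A"
  unfolding eJ_def by (rule el_closed[OF eJ_coords])

lemma co_eJ: "co (eJ J) i j = (if i = j \<and> i \<in> J \<and> i < n then \<one> else \<zero>)"
  unfolding eJ_def by (simp add: co_el[OF eJ_coords])

lemma co_eJ_mult:
  assumes "a \<in> carrier A"
  shows "co (eJ J \<otimes>\<^sub>A a) i j = (if i \<in> J then co a i j else \<zero>)"
proof (cases "pv n i j")
  case True
  hence i: "i < n" by (simp add: pv_def)
  have "(\<Oplus>l\<in>{..<n}. co (eJ J) i l \<otimes> co a l j) = co (eJ J) i i \<otimes> co a i j"
    by (rule finsum_single[OF K.abelian_monoid_axioms]) (use i assms in \<open>simp_all add: co_eJ\<close>)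
  thus ?thesis using True i assms by (simp add: co_mult co_eJ)
qed (use assms in \<open>simp add: co_zero\<close>)

lemma b_eJ: "i \<in> J ==> b y i \<otimes>\<^sub>A eJ J = b y i"
  by (rule co_eqI) (auto simp: co_b_mult co_eJ co_b pv_def)

lemma eJ_idem: "eJ J \<otimes>\<^sub>A eJ J = eJ J"
  by (rule co_eqI) (auto simp: co_eJ_mult co_eJ)

lemma eJ_one: "eJ {..<n} = \<one>\<^sub>A"
  by (rule co_eqI) (auto simp: co_eJ co_one)

lemma eJ_sum:
  assumes J: "J \<subseteq> {..<n}"
  shows "eJ J = (\<Oplus>\<^sub>A i\<in>J. b i i)"
proof (rule co_eqI)
  have fin: "finite J" using J finite_subset by blast
  fix i j
  have "co (\<Oplus>\<^sub>A l\<in>J. b l l) i j = (\<Oplus>l\<in>J. co (b l l) i j)"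
    using additive_finsum[OF A.abelian_group_axioms K.abelian_group_axioms, of "%a. co a i j" "%l. b l l" J]
    by (simp add: co_add)
  also have "\<dots> = co (eJ J) i j"
  proof (cases "i = j \<and> i \<in> J")
    case True
    have "(\<Oplus>l\<in>J. co (b l l) i j) = co (b i i) i j"
      by (rule finsum_single[OF K.abelian_monoid_axioms fin]) (use True in \<open>auto simp: co_b\<close>)
    thus ?thesis using True by (auto simp: co_b co_eJ pv_def)
  next
    case False
    have "(\<Oplus>l\<in>J. co (b l l) i j) = \<zero>"
      by (rule K.add.finprod_one_eqI) (use False in \<open>auto simp: co_b\<close>)
    thus ?thesis using False by (auto simp: co_eJ)
  qed
  finally show "co (eJ J) i j = co (\<Oplus>\<^sub>A l\<in>J. b l l) i j" by simp
qed (simp_all add: A.finsum_closed)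

lemma ract_eJ:
  assumes "fdm M" "x \<in> carrier M" "J \<subseteq> {..<n}"
  shows "x \<star>\<^sub>M eJ J = (\<Oplus>\<^sub>M i\<in>J. x \<star>\<^sub>M b i i)"
  unfolding eJ_sum[OF assms(3)] by (rule ract_finsum[OF assms(1) _ assms(2)]) simp

subsection \<open>The case \<open>n = 3m + 2\<close>\<close>

lemma ivd_cosyzygy_2:
  assumes n: "n = 3 * m + 2" "1 \<le> m"
  shows "(r, x) \<in> ivd {..<n} (fst (iv (2 * m))) (snd (iv (2 * m))) \<longleftrightarrow> r = n - 1 \<and> x = 1 \<or> r = n - 2 \<and> x < 2"
proof -
  have v: "fst (iv (2 * m)) (n - 1) = 1" "snd (iv (2 * m)) (n - 1) = 2"
    "fst (iv (2 * m)) (n - 2) = 0" "snd (iv (2 * m)) (n - 2) = 2"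
    using iv_last[of m] iv_penult[of m] n by simp_all
  have r: "r = n - 1 \<or> r = n - 2" if "(r, x) \<in> ivd {..<n} (fst (iv (2 * m))) (snd (iv (2 * m)))"
    using that iv_cases[of r "2 * m"] n(2) by (auto simp: ivd_def)
  have ne: "n - 1 ~= n - 2" "n - 1 < n" "n - 2 < n" using n by simp_all
  show ?thesis using r v ne by (auto simp: ivd_def)
qed

context
  fixes m :: nat and P :: "('k, 'a, 'p) rmodule" and C :: "('k, 'a, 'q) rmodule" and c
  assumes n: "n = 3 * m + 2" "1 \<le> m"
    and P: "fdm P" "faithful A P" "torsionless A P"
    and C: "fdm C" and c: "c \<in> rhom A C (Om (2 * m))" "bij_betw c (carrier C) (carrier (Om (2 * m)))"
begin

lemma n5: "5 \<le> n"
  using n by simp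

lemma c_eval:
  assumes y: "y \<in> carrier C"
  shows "c (y \<star>\<^sub>C b i j) (r, x) =
    (if (r = n - 1 \<and> x = 1 \<or> r = n - 2 \<and> x < 2) \<and> x = j \<and> pv n i j then c y (r, i) else \<zero>)"
  unfolding rhomD(3)[OF c(1) y b_closed] ivm_act_b[OF rhomD(1)[OF c(1) y]] ivd_cosyzygy_2[OF n] ..

lemma c_support:
  "y \<in> carrier C ==> \<not> (r = n - 1 \<and> x = 1 \<or> r = n - 2 \<and> x < 2) ==> c y (r, x) = \<zero>"
  using ivm_D(2)[OF rhomD(1)[OF c(1)]] ivd_cosyzygy_2[OF n] by blast

lemma c_zero: "y \<in> carrier C ==> (!!r x. c y (r, x) = \<zero>) ==> y = \<zero>\<^sub>C"
  unfolding iso_eq_zero[OF C c] ivm_simps(2) by (intro ext) (simp only: split_paired_all)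

text \<open>The interval \<open>[1, 2)\<close> of the cosyzygy; its generator is not in the image of the arrow from \<open>0\<close> to \<open>1\<close>.\<close>

lemma cosyzygy_bottom:
  "\<exists>s\<in>carrier C. s \<star>\<^sub>C b 1 1 = s \<and> s \<star>\<^sub>C b 1 2 = \<zero>\<^sub>C \<and> (\<forall>y\<in>carrier C. s ~= y \<star>\<^sub>C b 0 1)"
proof -
  have n1: "n - 1 < n" "fst (iv (2 * m)) (n - 1) = 1" "snd (iv (2 * m)) (n - 1) = 2"
    using iv_last[of m] n by simp_all
  obtain s where s: "s \<in> carrier C" "s \<star>\<^sub>C b 1 1 = s" "s \<star>\<^sub>C b 1 2 = \<zero>\<^sub>C" "c s (n - 1, 1) = \<one>"
    using socle_1_in_cosyzygy[OF C c n1] by blast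
  have "s ~= y \<star>\<^sub>C b 0 1" if y: "y \<in> carrier C" for y
  proof
    assume "s = y \<star>\<^sub>C b 0 1"
    hence "c (y \<star>\<^sub>C b 0 1) (n - 1, 1) = \<one>" using s(4) by simp
    moreover have "c y (n - 1, 0) = \<zero>" by (rule c_support[OF y]) (use n5 in auto)
    ultimately show False unfolding c_eval[OF y] by (simp split: if_splits)
  qed
  thus ?thesis using s by blast
qed

text \<open>The generator of the interval \<open>[0, 2)\<close> of the cosyzygy.\<close>

lemma cosyzygy_top:
  "\<exists>t\<in>carrier C. t \<star>\<^sub>C b 0 0 = t \<and> t \<star>\<^sub>C b 0 2 = \<zero>\<^sub>C \<and> t \<star>\<^sub>C b 0 1 ~= \<zero>\<^sub>C"
proof -
  have pvs: "pv n 0 0" "pv n 0 1" using n5 by (simp_all add: pv_def)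
  define v where "v = delta K (n - 2, 0 :: nat)"
  have vv: "v (r, x) = (if r = n - 2 \<and> x = 0 then \<one> else \<zero>)" for r x by (simp add: v_def delta_def)
  have "v \<in> carrier (Om (2 * m))"
    by (rule ivm_carrierI) (use ivd_cosyzygy_2[OF n] in \<open>auto simp: vv\<close>)
  then obtain t where t: "t \<in> carrier C" "c t = v" using iso_pullback[OF C c] by blast
  note tc = fdD(3)[OF C t(1) b_closed]
  have "t \<star>\<^sub>C b 0 0 = t"
  proof (rule iso_eq[OF c(2) tc t(1)], rule ext)
    fix d :: "nat \<times> nat" obtain r x where d: "d = (r, x)" by (cases d)
    show "c (t \<star>\<^sub>C b 0 0) d = c t d" unfolding d c_eval[OF t(1)] using pvs n5 by (auto simp: t(2) vv)
  qed
  moreover have "t \<star>\<^sub>C b 0 2 = \<zero>\<^sub>C" by (rule c_zero[OF tc]) (auto simp: c_eval[OF t(1)])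
  moreover have "t \<star>\<^sub>C b 0 1 ~= \<zero>\<^sub>C"
  proof
    assume "t \<star>\<^sub>C b 0 1 = \<zero>\<^sub>C"
    hence "c (t \<star>\<^sub>C b 0 1) = \<zero>\<^bsub>Om (2 * m)\<^esub>" using iso_eq_zero[OF C c tc] by blast
    hence "c (t \<star>\<^sub>C b 0 1) (n - 2, 1) = \<zero>" by (simp only: ivm_simps(2))
    thus False unfolding c_eval[OF t(1)] using pvs by (simp add: t(2) vv)
  qed
  ultimately show ?thesis using t(1) by blast
qed

lemma cosyzygy_zero_01:
  assumes u: "u \<in> carrier C" "u \<star>\<^sub>C b 0 0 = u" "u \<star>\<^sub>C b 0 1 = \<zero>\<^sub>C"
  shows "u = \<zero>\<^sub>C"
proof (rule c_zero[OF u(1)])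
  fix r x
  have pvs: "pv n 0 1" using n5 by (simp add: pv_def)
  have "c (u \<star>\<^sub>C b 0 1) = \<zero>\<^bsub>Om (2 * m)\<^esub>"
    using iso_eq_zero[OF C c fdD(3)[OF C u(1) b_closed]] u(3) by blast
  hence "c (u \<star>\<^sub>C b 0 1) (n - 2, 1) = \<zero>" by (simp only: ivm_simps(2))
  hence z: "c u (n - 2, 0) = \<zero>" unfolding c_eval[OF u(1)] using pvs by simp
  have "c u (r, x) = c (u \<star>\<^sub>C b 0 0) (r, x)" by (simp only: u(2))
  thus "c u (r, x) = \<zero>" unfolding c_eval[OF u(1)] using z by (auto split: if_splits)
qed

lemma cosyzygy_b_ge_2:
  assumes "y \<in> carrier C" "2 \<le> i"
  shows "y \<star>\<^sub>C b i i = \<zero>\<^sub>C"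
  by (rule c_zero[OF fdD(3)[OF C assms(1) b_closed]]) (use assms(2) n5 in \<open>auto simp: c_eval[OF assms(1)]\<close>)

abbreviation "PC \<equiv> rmod_sum P C"

lemma fd_PC: "fdm PC"
  by (rule fd_rmod_sum[OF P(1) C])

text \<open>No summand of \<open>M\<close> has socle at vertex \<open>0\<close>.\<close>

lemma zero_01:
  assumes w: "w \<in> carrier PC" "w \<star>\<^sub>PC b 0 0 = w" "w \<star>\<^sub>PC b 0 1 = \<zero>\<^sub>PC"
  shows "w = \<zero>\<^sub>PC"
proof -
  obtain x y where xy: "w = (x, y)" by (cases w)
  have "x = \<zero>\<^sub>P" by (rule torsionless_zero_01[OF P(1,3)]) (use w xy n5 in auto)
  moreover have "y = \<zero>\<^sub>C" by (rule cosyzygy_zero_01) (use w xy in auto)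
  ultimately show ?thesis by (simp add: xy)
qed

text \<open>\<open>\<mu>\<close> maps \<open>[1, 4)\<close> into \<open>[0, 3)\<close>, \<open>\<nu>\<close> maps \<open>[0, 3)\<close> onto the summand \<open>[0, 2)\<close> of \<open>C\<close> with generator \<open>t\<close>, and \<open>\<rho>\<close> maps \<open>[1, 4)\<close>
  onto the simple summand \<open>[1, 2)\<close> of \<open>C\<close> with generator \<open>s\<close>. The two kernels agree, since \<open>t \<star> b 0 1\<close>
  and \<open>s\<close> both span a simple module at vertex \<open>1\<close>.\<close>

lemma End_second_term:
  assumes R: "min_inj_resolution K (End_alg A PC) (regular_rmod (End_alg A PC)) I \<epsilon> d"
  shows "\<not> proj_rmod K (End_alg A PC) (I 1)"
proof -
  interpret P: Module.module K P by (rule fdD(1)[OF P(1)])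
  interpret C: Module.module K C by (rule fdD(1)[OF C])
  have n3: "3 \<le> n" "0 + 2 < n" "1 + 2 < n" using n5 by simp_all
  have pvs: "pv n 0 1" "pv n 1 2" "pv n 0 0" "pv n 1 1" using n5 by (simp_all add: pv_def)
  obtain s where s: "s \<in> carrier C" "s \<star>\<^sub>C b 1 1 = s" "s \<star>\<^sub>C b 1 2 = \<zero>\<^sub>C"
    "\<forall>y\<in>carrier C. s ~= y \<star>\<^sub>C b 0 1" using cosyzygy_bottom by blast
  obtain t where t: "t \<in> carrier C" "t \<star>\<^sub>C b 0 0 = t" "t \<star>\<^sub>C b 0 2 = \<zero>\<^sub>C" "t \<star>\<^sub>C b 0 1 ~= \<zero>\<^sub>C"
    using cosyzygy_top by blast
  obtain z0 p0 where z0: "z0 \<in> carrier P" "z0 \<star>\<^sub>P b 0 0 = z0" "p0 \<in> rhom A P AA" "p0 z0 = b 0 0"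
    "\<forall>y\<in>carrier P. b 0 0 \<otimes>\<^sub>A p0 y = p0 y"
    using faithful_summand[OF P(1,2) n3(2)] by blast
  obtain z1 p1 where z1: "z1 \<in> carrier P" "z1 \<star>\<^sub>P b 1 1 = z1" "p1 \<in> rhom A P AA" "p1 z1 = b 1 1"
    using faithful_summand[OF P(1,2) n3(3)] by blast
  note q0 = rhom_comp[OF fst_rhom[of P C] z0(3)] and q1 = rhom_comp[OF fst_rhom[of P C] z1(3)]
  note P1 = rhomD[OF z1(3), unfolded regular_simps] and P0 = rhomD[OF z0(3), unfolded regular_simps]
  let ?z = "z0 \<star>\<^sub>P b 0 1" and ?t = "t \<star>\<^sub>C b 0 1"
  have zc: "?z \<in> carrier P" by (rule fdD(3)[OF P(1) z0(1) b_closed])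
  have tc: "?t \<in> carrier C" by (rule fdD(3)[OF C t(1) b_closed])
  have tb: "?t \<star>\<^sub>C b 1 1 = ?t" "?t \<star>\<^sub>C b 1 2 = \<zero>\<^sub>C" using pvs by (simp_all add: fd_bb[OF C t(1)] t(3))
  have pz: "p0 ?z = b 0 1"
    using pvs by (simp only: P0(3)[OF z0(1) b_closed] z0(4) b_b) simp
  define \<nu> where "\<nu> w = (\<zero>\<^sub>P, t \<star>\<^sub>C p0 (fst w))" for w :: "'p \<times> 'q"
  define \<mu> where "\<mu> w = (?z \<star>\<^sub>P p1 (fst w), \<zero>\<^sub>C)" for w :: "'p \<times> 'q"
  define \<rho> where "\<rho> w = (\<zero>\<^sub>P, s \<star>\<^sub>C p1 (fst w))" for w :: "'p \<times> 'q"
  have \<mu>r: "\<mu> \<in> rhom A PC PC" unfolding \<mu>_def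
    by (rule pair_rhom[OF generator_hom[OF P(1) zc q1]]) (rule rhomI, simp_all add: zero_ract[OF C])
  have \<rho>r: "\<rho> \<in> rhom A PC PC" unfolding \<rho>_def
    by (rule pair_rhom[OF _ generator_hom[OF C s(1) q1]]) (rule rhomI, simp_all add: zero_ract[OF P(1)])
  have \<nu>r: "\<nu> \<in> rhom A PC PC" unfolding \<nu>_def
    by (rule pair_rhom[OF _ generator_hom[OF C t(1) q0]]) (rule rhomI, simp_all add: zero_ract[OF P(1)])
  have nm: "\<nu> (\<mu> w) = (\<zero>\<^sub>P, ?t \<star>\<^sub>C p1 (fst w))" if w: "w \<in> carrier PC" for w
  proof -
    have pc: "p1 (fst w) \<in> carrier A" by (rule P1(1)) (use w in auto)
    have "t \<star>\<^sub>C (b 0 1 \<otimes>\<^sub>A p1 (fst w)) = ?t \<star>\<^sub>C p1 (fst w)" by (rule fdD(6)[OF C t(1) b_closed pc])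
    thus ?thesis by (simp only: \<nu>_def \<mu>_def fst_conv P0(3)[OF zc pc] pz)
  qed
  show ?thesis
  proof (rule End_second_term_not_proj[OF fd_PC R \<nu>r \<mu>r \<rho>r])
    fix w assume w: "w \<in> carrier PC" "\<nu> (\<mu> w) = \<zero>\<^sub>PC"
    have pc: "p1 (fst w) \<in> carrier A" by (rule P1(1)) (use w in auto)
    let ?k = "co (p1 (fst w)) 1 1"
    have "?t \<star>\<^sub>C p1 (fst w) = \<zero>\<^sub>C" using w nm[OF w(1)] by simp
    hence kt: "?k \<odot>\<^sub>C ?t = \<zero>\<^sub>C" using socle_act[OF C tc tb n3(1) pc] by (simp only:)
    obtain \<phi> where \<phi>: "\<phi> \<in> lin K C (kmod K)" "\<phi> ?t = \<one>"
      using functional_exists[OF fieldK fdD(1,2)[OF C] tc t(4)] by blast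
    have "\<phi> (?k \<odot>\<^sub>C ?t) = ?k" using linD(3)[OF \<phi>(1) co_closed[OF pc] tc, of 1 1] co_closed[OF pc, of 1 1] by (simp only: \<phi>(2) kmod_simps K.r_one)
    hence k0: "?k = \<zero>" using kt lin_zero[OF fdD(1)[OF C] module_kmod[OF K.is_cring] \<phi>(1)] by (simp only: kmod_simps)
    have "s \<star>\<^sub>C p1 (fst w) = ?k \<odot>\<^sub>C s" by (rule socle_act[OF C s(1-3) n3(1) pc])
    hence "s \<star>\<^sub>C p1 (fst w) = \<zero>\<^sub>C" unfolding k0 using s(1) by simp
    thus "\<rho> w = \<zero>\<^sub>PC" by (simp add: \<rho>_def)
  next
    fix h assume h: "h \<in> rhom A PC PC"
    note H = rhomD[OF h]
    have z1c: "(z1, \<zero>\<^sub>C) \<in> carrier PC" and z0c: "(z0, \<zero>\<^sub>C) \<in> carrier PC" using z0(1) z1(1) by simp_all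
    have "h (\<mu> (z1, \<zero>\<^sub>C)) ~= \<rho> (z1, \<zero>\<^sub>C)"
    proof
      assume e: "h (\<mu> (z1, \<zero>\<^sub>C)) = \<rho> (z1, \<zero>\<^sub>C)"
      have "?z \<star>\<^sub>P b 1 1 = ?z" using pvs by (simp add: fd_bb[OF P(1) z0(1)])
      hence "\<mu> (z1, \<zero>\<^sub>C) = (z0, \<zero>\<^sub>C) \<star>\<^sub>PC b 0 1" by (simp add: \<mu>_def z1(4)[simplified] zero_ract[OF C])
      hence "h (z0, \<zero>\<^sub>C) \<star>\<^sub>PC b 0 1 = \<rho> (z1, \<zero>\<^sub>C)" using H(3)[OF z0c b_closed, of 0 1] e by simp
      hence "h (z0, \<zero>\<^sub>C) \<star>\<^sub>PC b 0 1 = (\<zero>\<^sub>P, s)" using s(2) z1(4) by (simp add: \<rho>_def)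
      moreover obtain x y where xy: "h (z0, \<zero>\<^sub>C) = (x, y)" by (cases "h (z0, \<zero>\<^sub>C)")
      moreover have "y \<in> carrier C" using H(1)[OF z0c] xy by simp
      ultimately have "s = y \<star>\<^sub>C b 0 1" "y \<in> carrier C" by simp_all
      thus False using s(4) by blast
    qed
    thus "\<exists>x\<in>carrier PC. h (\<mu> x) ~= \<rho> x" using z1c by blast
  next
    fix k assume k: "k \<in> rhom A PC PC" and k0: "!!x. x \<in> carrier PC ==> k (\<nu> (\<mu> x)) = \<zero>\<^sub>PC"
    note H = rhomD[OF k]
    let ?u = "(\<zero>\<^sub>P, t)"
    have uc: "?u \<in> carrier PC" using t(1) by simp
    have "k ?u = \<zero>\<^sub>PC"
    proof (rule zero_01[OF H(1)[OF uc]])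
      have "k ?u \<star>\<^sub>PC b 0 0 = k (?u \<star>\<^sub>PC b 0 0)" by (rule H(3)[OF uc b_closed, symmetric])
      thus "k ?u \<star>\<^sub>PC b 0 0 = k ?u" by (simp add: t(2) zero_ract[OF P(1)])
      have z1c: "(z1, \<zero>\<^sub>C) \<in> carrier PC" using z1(1) by simp
      have "?t \<star>\<^sub>C p1 z1 = ?t" by (simp only: z1(4) tb(1))
      hence nz: "\<nu> (\<mu> (z1, \<zero>\<^sub>C)) = (\<zero>\<^sub>P, ?t)" using nm[OF z1c] by simp
      have "k ?u \<star>\<^sub>PC b 0 1 = k (?u \<star>\<^sub>PC b 0 1)" by (rule H(3)[OF uc b_closed, symmetric])
      also have "?u \<star>\<^sub>PC b 0 1 = (\<zero>\<^sub>P, ?t)" by (simp add: zero_ract[OF P(1)])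
      finally show "k ?u \<star>\<^sub>PC b 0 1 = \<zero>\<^sub>PC" using k0[OF z1c] nz by simp
    qed
    show "\<forall>x\<in>carrier PC. k (\<nu> x) = \<zero>\<^sub>PC"
    proof
      fix x assume "x \<in> carrier PC"
      hence pc: "p0 (fst x) \<in> carrier A" by (intro P0(1)) auto
      have "\<nu> x = ?u \<star>\<^sub>PC p0 (fst x)" by (simp add: \<nu>_def zero_ract[OF P(1) pc])
      hence "k (\<nu> x) = k ?u \<star>\<^sub>PC p0 (fst x)" using H(3)[OF uc pc] by simp
      thus "k (\<nu> x) = \<zero>\<^sub>PC" using zero_ract[OF fd_PC pc] \<open>k ?u = \<zero>\<^sub>PC\<close> by simp
    qed
  qed
qed

text \<open>The endomorphism algebra embeds into \<open>Hom(Mf, M)\<close> for the sum \<open>f\<close> of the idempotents at the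
  vertices \<open>1, \<dots>, n - 3\<close>: the other vertices are detected by these.\<close>

lemma End_first_term:
  assumes Pinj: "injm P"
    and E: "is_injective_hull K (End_alg A PC) (regular_rmod (End_alg A PC)) E \<epsilon>"
  shows "proj_rmod K (End_alg A PC) E"
proof -
  interpret P: Module.module K P by (rule fdD(1)[OF P(1)])
  interpret C: Module.module K C by (rule fdD(1)[OF C])
  interpret M: Module.module K PC by (rule fdD(1)[OF fd_PC])
  define J where "J = {i. 1 \<le> i \<and> i + 2 < n}"
  let ?f = "eJ J" and ?Z = "{w \<in> carrier PC. w \<star>\<^sub>PC eJ J = w}"
  have J: "J \<subseteq> {..<n}" "finite J" by (auto simp: J_def intro: finite_subset[of _ "{..<n}"])
  have Jb: "i \<in> J ==> b y i \<otimes>\<^sub>A ?f = b y i" for y i by (rule b_eJ)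
  have Jpv: "pv n i i" if "i \<in> J" for i using that by (simp add: J_def pv_def)
  have inZ: "w \<star>\<^sub>PC b y i \<in> ?Z" if "w \<in> carrier PC" "i \<in> J" for w y i
    using fdD(3)[OF fd_PC that(1) b_closed] fdD(6)[OF fd_PC that(1) b_closed eJ_closed, of y i J] Jb[OF that(2)] by simp
  have kZ: "ksub K PC ?Z" unfolding ksub_def
    by (simp add: fdD(4)[OF fd_PC] zero_ract[OF P(1)] zero_ract[OF C] smult_ract[OF fd_PC])
  have sumZ: "w = (\<Oplus>\<^sub>PC i\<in>J. w \<star>\<^sub>PC b i i)" if "w \<in> carrier PC" "w \<star>\<^sub>PC ?f = w" for w
    using ract_eJ[OF fd_PC that(1) J(1)] that(2) by simp
  \<comment> \<open>projections onto the summands of \<open>P\<close> with tops \<open>i \<le> n - 3\<close>\<close>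
  define Q where "Q i zp \<longleftrightarrow> fst zp \<in> carrier P \<and> fst zp \<star>\<^sub>P b i i = fst zp \<and> snd zp \<in> rhom A P AA \<and>
     snd zp (fst zp) = b i i" for i and zp :: "'p \<times> ('p => 'a)"
  have "\<forall>i. \<exists>zp. i + 2 < n --> Q i zp"
  proof
    fix i
    show "\<exists>zp. i + 2 < n --> Q i zp"
    proof (cases "i + 2 < n")
      case True
      then obtain z p where "z \<in> carrier P \<and> z \<star>\<^sub>P b i i = z \<and> p \<in> rhom A P AA \<and> p z = b i i"
        using faithful_summand[OF P(1,2) True] by blast
      hence "Q i (z, p)" by (simp add: Q_def)
      thus ?thesis by blast
    qed simp
  qed
  then obtain zp where zp: "i + 2 < n ==> Q i (zp i)" for i using choice[of "%i zp. i + 2 < n --> Q i zp"] by blast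
  define z where "z i = fst (zp i)" for i
  define p where "p i = snd (zp i)" for i
  have z: "z i \<in> carrier P" "z i \<star>\<^sub>P b i i = z i" "p i \<in> rhom A P AA" "p i (z i) = b i i"
    if "i + 2 < n" for i using zp[OF that] by (simp_all add: Q_def z_def p_def)
  obtain t where t: "t \<in> carrier C" "t \<star>\<^sub>C b 0 0 = t" "t \<star>\<^sub>C b 0 2 = \<zero>\<^sub>C" "t \<star>\<^sub>C b 0 1 ~= \<zero>\<^sub>C"
    using cosyzygy_top by blast
  \<comment> \<open>elements spanning submodules with socle \<open>i\<close> that reach as far up as possible\<close>
  define u where "u i = (if i = 1 then (\<zero>\<^sub>P, t) else (z (i - 2), \<zero>\<^sub>C))" for i
  have Jc: "i = 1 \<or> 2 \<le> i \<and> i - 2 + 2 < n \<and> i = i - 2 + 2" if "i \<in> J" for i using that by (auto simp: J_def)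
  have uc: "u i \<in> carrier PC" if "i \<in> J" for i
    using Jc[OF that] z(1)[of "i - 2"] t(1) by (auto simp: u_def)
  have kill: "u i \<star>\<^sub>PC b (i - 2) w = \<zero>\<^sub>PC" if i: "i \<in> J" and w: "i < w" for i w
  proof (cases "pv n (i - 2) w")
    case True
    hence "i = 1" "w = 2" using w Jc[OF i] by (auto simp: pv_def)
    thus ?thesis using t(3) by (simp add: u_def zero_ract[OF P(1)])
  qed (simp add: b_zero ract_zero[OF fd_PC uc[OF i]])
  have une: "u i \<star>\<^sub>PC b (i - 2) i ~= \<zero>\<^sub>PC" if i: "i \<in> J" for i
  proof (cases "i = 1")
    case True
    thus ?thesis using t(4) by (simp add: u_def)
  next
    case False
    then obtain l where l: "i = l + 2" "l + 2 < n" using Jc[OF i] by (metis)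
    have pvl: "pv n l (l + 2)" "pv n l l" using l(2) by (simp_all add: pv_def)
    have "p l (z l \<star>\<^sub>P b l (l + 2)) = b l (l + 2)"
      using rhomD(3)[OF z(3)[OF l(2)] z(1)[OF l(2)] b_closed, of l "l + 2"] z(4)[OF l(2)] pvl by (simp add: b_b)
    moreover have "b l (l + 2) ~= \<zero>\<^sub>A"
    proof
      assume "b l (l + 2) = \<zero>\<^sub>A"
      hence "co (b l (l + 2)) l (l + 2) = \<zero>" by (simp add: co_zero_elem)
      thus False using pvl by (simp add: co_b)
    qed
    ultimately have "z l \<star>\<^sub>P b l (l + 2) ~= \<zero>\<^sub>P" using rhom_zero_map[OF P(1) fd_regular z(3)[OF l(2)]] by auto
    thus ?thesis using False by (simp add: u_def l(1))
  qed
  have "\<forall>i. \<exists>\<theta>. i \<in> J --> \<theta> \<in> lin K PC (kmod K) \<and> \<theta> (u i \<star>\<^sub>PC b (i - 2) i) = \<one>"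
    using functional_exists[OF fieldK fdD(1,2)[OF fd_PC] fdD(3)[OF fd_PC uc b_closed] une] by blast
  then obtain \<theta> where \<theta>: "\<theta> i \<in> lin K PC (kmod K)" "\<theta> i (u i \<star>\<^sub>PC b (i - 2) i) = \<one>" if "i \<in> J" for i
    using choice[of "%i \<theta>. i \<in> J --> \<theta> \<in> lin K PC (kmod K) \<and> \<theta> (u i \<star>\<^sub>PC b (i - 2) i) = \<one>"] by blast
  have psi: "\<psi> (w \<star>\<^sub>PC b y i) \<in> carrier K"
    if "\<psi> \<in> lin K (PC\<lparr>carrier := ?Z\<rparr>) (kmod K)" "w \<in> carrier PC" "i \<in> J" for \<psi> w y i
    using linD(1)[OF that(1), of "w \<star>\<^sub>PC b y i"] inZ[OF that(2,3)] by simp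
  show ?thesis
  proof (rule End_hull_proj[OF fd_PC eJ_closed eJ_idem J(2), where z = "%i. (z i, \<zero>\<^sub>C)" and p = "%i w. p i (fst w)"
        and \<theta> = "%i w. \<theta> i (w \<star>\<^sub>PC b i i)" and \<kappa> = "%i. kap PC (u i) PC i" and E = E and \<epsilon> = \<epsilon>])
    fix j assume j: "j \<in> J"
    hence j2: "j + 2 < n" by (simp add: J_def)
    show zc: "(z j, \<zero>\<^sub>C) \<in> carrier PC" using z(1)[OF j2] by simp
    have "(z j, \<zero>\<^sub>C) \<star>\<^sub>PC b j j = (z j, \<zero>\<^sub>C)" using z(2)[OF j2] by (simp add: zero_ract[OF C])
    thus "(z j, \<zero>\<^sub>C) \<star>\<^sub>PC ?f = (z j, \<zero>\<^sub>C)" using inZ[OF zc j, of j] by simp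
    show "(%w. p j (fst w)) \<in> rhom A PC AA" by (rule rhom_comp[OF fst_rhom z(3)[OF j2]])
    show "(%w. \<theta> j (w \<star>\<^sub>PC b j j)) \<in> lin K PC (kmod K)"
      by (rule lin_comp[OF ract_lin[OF fd_PC b_closed] \<theta>(1)[OF j]])
  next
    fix w assume w: "w \<in> carrier PC" "w \<star>\<^sub>PC ?f = w"
    have "(\<Oplus>\<^sub>PC j\<in>J. w \<star>\<^sub>PC p j (fst (z j, \<zero>\<^sub>C))) = (\<Oplus>\<^sub>PC j\<in>J. w \<star>\<^sub>PC b j j)"
      by (rule M.finsum_cong') (use fdD(3)[OF fd_PC w(1) b_closed] z(4) in \<open>simp_all add: J_def\<close>)
    thus "w = (\<Oplus>\<^sub>PC j\<in>J. w \<star>\<^sub>PC p j (fst (z j, \<zero>\<^sub>C)))" using sumZ[OF w] by simp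
  next
    fix g assume g: "g \<in> rhom A PC PC" and gz: "!!w. w \<in> carrier PC ==> w \<star>\<^sub>PC ?f = w ==> g w = \<zero>\<^sub>PC"
    note G = rhomD[OF g]
    have gJ: "g (w \<star>\<^sub>PC b y i) = \<zero>\<^sub>PC" if "w \<in> carrier PC" "i \<in> J" for w y i
      using inZ[OF that, of y] by (intro gz) simp_all
    have gi: "g (w \<star>\<^sub>PC b i i) = \<zero>\<^sub>PC" if w: "w \<in> carrier PC" and i: "i < n" for w i
    proof -
      have pvi: "pv n i i" using i by (simp add: pv_def)
      have wc: "w \<star>\<^sub>PC b i i \<in> carrier PC" by (rule fdD(3)[OF fd_PC w b_closed])
      consider "i \<in> J" | "i = 0" | "i \<notin> J" "i ~= 0" by blast
      thus ?thesis
      proof cases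
        case 1
        show ?thesis by (rule gJ[OF w 1])
      next
        case 2
        have "1 \<in> J" using n5 by (simp add: J_def)
        have pvs: "pv n 0 0" "pv n 0 1" using n5 by (simp_all add: pv_def)
        have w00: "w \<star>\<^sub>PC b 0 0 \<in> carrier PC" using wc 2 by simp
        have "g (w \<star>\<^sub>PC b 0 0) = \<zero>\<^sub>PC"
        proof (rule zero_01[OF G(1)[OF w00]])
          have "g (w \<star>\<^sub>PC b 0 0) \<star>\<^sub>PC b 0 0 = g (w \<star>\<^sub>PC b 0 0 \<star>\<^sub>PC b 0 0)" by (rule G(3)[OF w00 b_closed, symmetric])
          thus "g (w \<star>\<^sub>PC b 0 0) \<star>\<^sub>PC b 0 0 = g (w \<star>\<^sub>PC b 0 0)" using pvs by (simp only: fd_bb[OF fd_PC w]) simp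
          have "g (w \<star>\<^sub>PC b 0 0) \<star>\<^sub>PC b 0 1 = g (w \<star>\<^sub>PC b 0 0 \<star>\<^sub>PC b 0 1)" by (rule G(3)[OF w00 b_closed, symmetric])
          also have "\<dots> = g (w \<star>\<^sub>PC b 0 1)" using pvs by (simp only: fd_bb[OF fd_PC w]) simp
          also have "\<dots> = \<zero>\<^sub>PC" by (rule gJ[OF w \<open>1 \<in> J\<close>])
          finally show "g (w \<star>\<^sub>PC b 0 0) \<star>\<^sub>PC b 0 1 = \<zero>\<^sub>PC" .
        qed
        thus ?thesis using 2 by simp
      next
        case 3
        \<comment> \<open>at the last two vertices elements of \<open>P\<close> come from vertex \<open>n - 3\<close>, as \<open>P\<close> is injective\<close>
        hence i2: "n - 2 \<le> i" "2 \<le> i" using n5 by (auto simp: J_def)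
        obtain x y where xy: "w = (x, y)" "x \<in> carrier P" "y \<in> carrier C" using w by auto
        have "\<exists>v\<in>carrier P. x \<star>\<^sub>P b i i = v \<star>\<^sub>P b (n - 3) i"
        proof (rule inj_divide[OF Pinj b_closed fdD(3)[OF P(1) xy(2) b_closed]])
          fix a assume a: "a \<in> carrier A" "b (n - 3) i \<otimes>\<^sub>A a = \<zero>\<^sub>A"
          have "b i i \<otimes>\<^sub>A a = \<zero>\<^sub>A"
          proof (rule co_eqI)
            fix i' j assume ij: "pv n i' j"
            have "co a i j = \<zero>" if "pv n i j"
            proof -
              have "pv n (n - 3) i" "pv n (n - 3) j" using that i2 by (auto simp: pv_def)
              hence "co a i j = co (b (n - 3) i \<otimes>\<^sub>A a) (n - 3) j" by (simp add: co_b_mult[OF a(1)])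
              thus ?thesis by (simp add: a(2) co_zero_elem)
            qed
            thus "co (b i i \<otimes>\<^sub>A a) i' j = co \<zero>\<^sub>A i' j" by (simp add: co_b_mult[OF a(1)] co_zero_elem)
          qed (use a in simp_all)
          thus "x \<star>\<^sub>P b i i \<star>\<^sub>P a = \<zero>\<^sub>P"
            using fdD(6)[OF P(1) xy(2) b_closed a(1), of i i] ract_zero[OF P(1) xy(2)] by simp
        qed
        then obtain v where v: "v \<in> carrier P" "x \<star>\<^sub>P b i i = v \<star>\<^sub>P b (n - 3) i" by blast
        have vM: "(v, \<zero>\<^sub>C) \<in> carrier PC" using v by simp
        have n3J: "n - 3 \<in> J" using n5 unfolding J_def mem_Collect_eq by arith
        have pn: "pv n (n - 3) (n - 3)" "pv n (n - 3) i" using i2 i by (auto simp: pv_def)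
        have "w \<star>\<^sub>PC b i i = (v, \<zero>\<^sub>C) \<star>\<^sub>PC b (n - 3) i"
          using cosyzygy_b_ge_2[OF xy(3) i2(2)] v(2) by (simp add: xy(1) zero_ract[OF C])
        also have "\<dots> = (v, \<zero>\<^sub>C) \<star>\<^sub>PC b (n - 3) (n - 3) \<star>\<^sub>PC b (n - 3) i"
          using pn by (simp only: fd_bb[OF fd_PC vM]) simp
        finally have "g (w \<star>\<^sub>PC b i i) = g ((v, \<zero>\<^sub>C) \<star>\<^sub>PC b (n - 3) (n - 3)) \<star>\<^sub>PC b (n - 3) i"
          by (simp only: G(3)[OF fdD(3)[OF fd_PC vM b_closed] b_closed])
        thus ?thesis by (simp only: gJ[OF vM n3J] zero_ract[OF fd_PC b_closed])
      qed
    qed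
    show "\<forall>w\<in>carrier PC. g w = \<zero>\<^sub>PC"
    proof
      fix w assume w: "w \<in> carrier PC"
      have "w = (\<Oplus>\<^sub>PC i\<in>{..<n}. w \<star>\<^sub>PC b i i)"
        using ract_eJ[OF fd_PC w subset_refl] by (simp add: eJ_one fdD(7)[OF fd_PC w])
      hence "g w = (\<Oplus>\<^sub>PC i\<in>{..<n}. g (w \<star>\<^sub>PC b i i))"
        using rhom_finsum[OF fd_PC fd_PC g, of "%i. w \<star>\<^sub>PC b i i" "{..<n}"] fdD(3)[OF fd_PC w b_closed] by simp
      also have "\<dots> = \<zero>\<^sub>PC" by (rule M.add.finprod_one_eqI) (use gi[OF w] in simp)
      finally show "g w = \<zero>\<^sub>PC" .
    qed
  next
    fix j \<psi> assume j: "j \<in> J" and \<psi>: "\<psi> \<in> lin K (PC\<lparr>carrier := ?Z\<rparr>) (kmod K)"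
    show "kap PC (u j) PC j \<psi> \<in> rhom A PC PC"
    proof (rule kap_rhom[OF fd_PC fd_PC uc[OF j] _ _ kZ _ \<psi>])
      show "j < n" using j by (simp add: J_def)
    qed (use kill[OF j] inZ[OF _ j] in blast)+
    {
      fix \<psi>' x assume \<psi>': "\<psi>' \<in> lin K (PC\<lparr>carrier := ?Z\<rparr>) (kmod K)" and x: "x \<in> carrier PC"
      show "kap PC (u j) PC j (%w. \<psi> w \<oplus> \<psi>' w) x = kap PC (u j) PC j \<psi> x \<oplus>\<^sub>PC kap PC (u j) PC j \<psi>' x"
        unfolding kap_def row_add[OF psi[OF \<psi> x j] psi[OF \<psi>' x j]]
        by (rule fdD(5)[OF fd_PC uc[OF j] row_closed[OF psi[OF \<psi> x j]] row_closed[OF psi[OF \<psi>' x j]]])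
    next
      fix g x assume g: "g \<in> rhom A PC PC" and x: "x \<in> carrier PC"
      show "kap PC (u j) PC j (%w. \<psi> (g w)) x = kap PC (u j) PC j \<psi> (g x)"
        unfolding kap_def rhomD(3)[OF g x b_closed] ..
    }
  next
    fix j x and \<psi> \<psi>' :: "'p \<times> 'q => 'k" assume j: "j \<in> J" and x: "x \<in> carrier PC"
      and e: "!!w. w \<in> carrier PC ==> w \<star>\<^sub>PC ?f = w ==> \<psi> w = \<psi>' w"
    have "\<psi> (x \<star>\<^sub>PC b y j) = \<psi>' (x \<star>\<^sub>PC b y j)" for y
      by (rule e) (use inZ[OF x j, of y] in simp_all)
    thus "kap PC (u j) PC j \<psi> x = kap PC (u j) PC j \<psi>' x" by (simp only: kap_def)
  next
    fix \<psi> w assume \<psi>: "\<psi> \<in> lin K (PC\<lparr>carrier := ?Z\<rparr>) (kmod K)" and w: "w \<in> carrier PC" "w \<star>\<^sub>PC ?f = w"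
    have tk: "\<theta> j (kap PC (u j) PC j \<psi> w \<star>\<^sub>PC b j j) = \<psi> (w \<star>\<^sub>PC b j j)" if j: "j \<in> J" for j
    proof -
      note pc = psi[OF \<psi> w(1) j] and rc = row_closed[OF psi[OF \<psi> w(1) j]]
      have "pv n (j - 2) j" using Jpv[OF j] by (auto simp: pv_def)
      hence "(%y. if y = j \<and> pv n j j \<and> pv n (j - 2) j then \<psi> (w \<star>\<^sub>PC b j j) else \<zero>) =
          (%y. if y = j then \<psi> (w \<star>\<^sub>PC b j j) else \<zero>)" using Jpv[OF j] by simp
      hence r: "row (j - 2) (%y. \<psi> (w \<star>\<^sub>PC b y j)) \<otimes>\<^sub>A b j j = \<psi> (w \<star>\<^sub>PC b j j) \<odot>\<^sub>A b (j - 2) j"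
        unfolding row_b[OF pc] by (simp only: row_single[OF pc])
      have "kap PC (u j) PC j \<psi> w \<star>\<^sub>PC b j j = \<psi> (w \<star>\<^sub>PC b j j) \<odot>\<^sub>PC (u j \<star>\<^sub>PC b (j - 2) j)"
        unfolding kap_def fdD(6)[OF fd_PC uc[OF j] rc b_closed, symmetric] r
        by (rule fdD(8)[OF fd_PC uc[OF j] b_closed pc])
      thus ?thesis
        using linD(3)[OF \<theta>(1)[OF j] pc fdD(3)[OF fd_PC uc[OF j] b_closed], of j "j - 2" j] pc[of j]
        by (simp only: \<theta>(2)[OF j] kmod_simps K.r_one)
    qed
    have "(\<Oplus>j\<in>J. \<theta> j (kap PC (u j) PC j \<psi> w \<star>\<^sub>PC b j j)) = (\<Oplus>j\<in>J. \<psi> (w \<star>\<^sub>PC b j j))"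
      by (rule K.finsum_cong') (use tk psi[OF \<psi> w(1)] in simp_all)
    also have "\<dots> = \<psi> (\<Oplus>\<^bsub>PC\<lparr>carrier := ?Z\<rparr>\<^esub>j\<in>J. w \<star>\<^sub>PC b j j)"
      by (rule lin_finsum[OF module_ksub[OF fdD(1)[OF fd_PC] kZ] module_kmod[OF K.is_cring] \<psi>, unfolded finsum_kmod, symmetric])
        (use inZ[OF w(1)] in simp)
    also have "(\<Oplus>\<^bsub>PC\<lparr>carrier := ?Z\<rparr>\<^esub>j\<in>J. w \<star>\<^sub>PC b j j) = (\<Oplus>\<^sub>PC j\<in>J. w \<star>\<^sub>PC b j j)"
      by (rule finsum_ksub[OF M.abelian_group_axioms ksub_additive_subgroup[OF fdD(1)[OF fd_PC] kZ]])
        (use inZ[OF w(1)] in simp)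
    also have "\<dots> = w" by (rule sumZ[OF w, symmetric])
    finally show "(\<Oplus>j\<in>J. \<theta> j (kap PC (u j) PC j \<psi> w \<star>\<^sub>PC b j j)) = \<psi> w" .
  next
    show "is_injective_hull K (End_alg A PC) (regular_rmod (End_alg A PC)) E \<epsilon>" by (rule E)
  qed
qed

lemma domdim_End_2_le: "domdim K (End_alg A PC) \<le> 1"
proof -
  interpret B: fd_algebra K "End_alg A PC" by (rule End_fd_algebra[OF fd_PC])
  show ?thesis unfolding domdim_def
    by (rule B.domdim_mod_le_1[OF B.fd_regular]) (rule End_second_term)
qed

lemma domdim_End_2:
  assumes "injm P"
  shows "domdim K (End_alg A PC) = 1"
proof -
  interpret B: fd_algebra K "End_alg A PC" by (rule End_fd_algebra[OF fd_PC])
  show ?thesis unfolding domdim_def one_enat_def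
  proof (rule B.domdim_mod_eq[OF B.fd_regular])
    fix I \<epsilon> d assume R: "min_inj_resolution K (End_alg A PC) (regular_rmod (End_alg A PC)) I \<epsilon> d"
    have "is_injective_hull K (End_alg A PC) (regular_rmod (End_alg A PC)) (I 0) \<epsilon>"
      using R unfolding min_inj_resolution_def by (rule conjunct1)
    hence "proj_rmod K (End_alg A PC) (I 0)" by (rule End_first_term[OF assms])
    moreover have "i = 0" if "i < 1" for i :: nat using that by simp
    ultimately show "(\<forall>i<1. proj_rmod K (End_alg A PC) (I i)) \<and> \<not> proj_rmod K (End_alg A PC) (I 1)"
      using End_second_term[OF R] by blast
  qed
qed

end

end

context nakayama
begin

section \<open>The minimal faithful projective-injective module\<close>

abbreviation "rmod_rows J \<equiv> AA\<lparr>carrier := rows J\<rparr>"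

lemma fd_rows: "fdm (rmod_rows J)"
  by (rule fd_submod[OF fd_regular submod_rows])

lemma idem_rmod_eJ: "idem_rmod A (eJ J) = rmod_rows J"
proof -
  have "{eJ J \<otimes>\<^sub>A a | a. a \<in> carrier A} = rows J"
  proof (intro equalityI subsetI)
    fix x assume "x \<in> {eJ J \<otimes>\<^sub>A a | a. a \<in> carrier A}"
    thus "x \<in> rows J" by (auto simp: rows_def co_eJ_mult)
  next
    fix x assume x: "x \<in> rows J"
    hence "x = eJ J \<otimes>\<^sub>A x" by (intro co_eqI) (auto simp: rows_def co_eJ_mult)
    thus "x \<in> {eJ J \<otimes>\<^sub>A a | a. a \<in> carrier A}" using x by (auto simp: rows_def)
  qed
  thus ?thesis by (simp add: idem_rmod_def)
qed

lemma rows_proj_inj: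
  assumes J: "!!i. i \<in> J ==> i + 2 < n"
  shows "projm (rmod_rows J)" "injm (rmod_rows J)"
proof -
  let ?N = "ivm J (%r. r) pend"
  have Jn: "J \<subseteq> {..<n}" using J by force
  have p: "pend r = r + 3" if "r \<in> J" for r using J[OF that] by (simp add: pend_def)
  have N: "projm ?N" "injm ?N"
    by (rule proj_ivm[OF ivok_proj[OF Jn] p], assumption) (rule inj_ivm, use p in \<open>simp add: ivinj_def ivok_proj[OF Jn]\<close>)
  note c = rows_iso[OF Jn]
  have c': "c0 \<in> rhom A (rmod_rows J) ?N" "bij_betw c0 (carrier (rmod_rows J)) (carrier ?N)" using c by simp_all
  note i = rhom_inverse[OF fd_rows c'] bij_betw_inv_into[OF c'(2)]
  show "projm (rmod_rows J)" by (rule proj_iso[OF N(1) fd_rows i])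
  show "injm (rmod_rows J)" by (rule inj_iso[OF N(2) fd_rows i])
qed

lemma b_ne_zero: "pv n i j ==> b i j ~= \<zero>\<^sub>A"
proof
  assume "pv n i j" "b i j = \<zero>\<^sub>A"
  hence "co (b i j) i j = \<zero>" by (simp add: co_zero_elem)
  thus False using \<open>pv n i j\<close> by (simp add: co_b)
qed

lemma b_in_rows: "i \<in> J ==> b i j \<in> rows J"
  by (auto simp: rows_def co_b)

text \<open>Every nonzero path extends to the left to one that starts at most at \<open>n - 3\<close>.\<close>

lemma rows_faithful:
  assumes n: "3 \<le> n"
  shows "faithful A (rmod_rows {i. i + 2 < n})"
  unfolding faithful_def
proof (intro ballI impI)
  fix a assume a: "a \<in> carrier A" and z: "\<forall>x\<in>carrier (rmod_rows {i. i + 2 < n}). x \<star>\<^bsub>rmod_rows {i. i + 2 < n}\<^esub> a = \<zero>\<^bsub>rmod_rows {i. i + 2 < n}\<^esub>"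
  show "a = \<zero>\<^sub>A"
  proof (rule co_eqI[OF a])
    fix i j assume ij: "pv n i j"
    define l where "l = min i (n - 3)"
    have l: "l + 2 < n" "pv n l i" "pv n l j" using n ij by (auto simp: l_def pv_def)
    have "b l i \<in> rows {i. i + 2 < n}" by (rule b_in_rows) (use l in simp)
    hence "b l i \<otimes>\<^sub>A a = \<zero>\<^sub>A" using z by simp
    hence "co (b l i \<otimes>\<^sub>A a) l j = \<zero>" by (simp add: co_zero_elem)
    thus "co a i j = co \<zero>\<^sub>A i j" using l by (simp add: co_b_mult[OF a] co_zero_elem)
  qed simp
qed

text \<open>The module with top \<open>i\<close> is uniserial with socle spanned by the path from \<open>i\<close> to \<open>i + 2\<close>.\<close>

lemma socle_in_submod:
  assumes i: "i + 2 < n" and U: "submod A (rmod_rows {i}) U" and u: "u \<in> U" "u ~= \<zero>\<^sub>A"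
  shows "b i (i + 2) \<in> U"
proof -
  note S = submodD[OF fd_rows U]
  have uR: "u \<in> rows {i}" "u \<in> carrier A" using S(1)[OF u(1)] by (simp_all add: rows_def)
  have "\<exists>j. co u i j ~= \<zero>"
  proof (rule ccontr)
    assume h: "\<not> ?thesis"
    have "u = \<zero>\<^sub>A"
    proof (rule co_eqI[OF uR(2)])
      fix i' j show "co u i' j = co \<zero>\<^sub>A i' j" using h uR(1) by (cases "i' = i") (simp_all add: rows_def co_zero_elem)
    qed simp
    thus False using u(2) by simp
  qed
  then obtain j where j: "co u i j ~= \<zero>" by blast
  hence "pv n i j" using co_zero[OF uR(2)] by blast
  hence pj: "pv n j (i + 2)" "pv n i (i + 2)" using i by (auto simp: pv_def)
  obtain k where k: "k \<in> carrier K" "k \<otimes> co u i j = \<one>" using field_inverse[OF fieldK co_closed[OF uR(2)] j] by blast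
  have "k \<odot>\<^sub>A (u \<otimes>\<^sub>A b j (i + 2)) = b i (i + 2)"
  proof (rule co_eqI)
    fix i' j' show "co (k \<odot>\<^sub>A (u \<otimes>\<^sub>A b j (i + 2))) i' j' = co (b i (i + 2)) i' j'"
      using k uR pj by (auto simp: co_smult co_mult_b co_b rows_def)
  qed (use k uR in simp_all)
  moreover have "u \<otimes>\<^sub>A b j (i + 2) \<in> U" using S(5)[OF b_closed u(1), of j "i + 2"] by simp
  hence "k \<odot>\<^sub>A (u \<otimes>\<^sub>A b j (i + 2)) \<in> U"
    using U k(1) unfolding submod_iff[OF fd_rows] ksub_def by simp
  ultimately show ?thesis by simp
qed

lemma rows_indecomposable:
  assumes i: "i + 2 < n"
  shows "indecomposable A (rmod_rows {i})"
  unfolding indecomposable_def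
proof (intro conjI allI impI)
  have p: "pv n i i" "pv n i (i + 2)" using i by (simp_all add: pv_def)
  show "carrier (rmod_rows {i}) ~= {\<zero>\<^bsub>rmod_rows {i}\<^esub>}" using b_in_rows[of i "{i}" i] b_ne_zero[OF p(1)] by auto
  fix U V assume U: "submod A (rmod_rows {i}) U" and V: "submod A (rmod_rows {i}) V" and uv: "U \<inter> V = {\<zero>\<^bsub>rmod_rows {i}\<^esub>}"
  show "U = {\<zero>\<^bsub>rmod_rows {i}\<^esub>} \<or> V = {\<zero>\<^bsub>rmod_rows {i}\<^esub>}"
  proof (rule ccontr)
    assume h: "\<not> ?thesis"
    have z: "\<zero>\<^sub>A \<in> U" "\<zero>\<^sub>A \<in> V" using uv by auto
    obtain u where "u \<in> U" "u ~= \<zero>\<^sub>A" using h z by auto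
    from socle_in_submod[OF i U this] have 1: "b i (i + 2) \<in> U" .
    obtain v where "v \<in> V" "v ~= \<zero>\<^sub>A" using h z by auto
    from socle_in_submod[OF i V this] have 2: "b i (i + 2) \<in> V" .
    show False using 1 2 uv b_ne_zero[OF p(2)] by auto
  qed
qed

text \<open>A projective-injective module has a socle element at some vertex \<open>i + 2\<close>: take the largest
  vertex \<open>j\<close> at which the module does not vanish. By injectivity its elements are divisible by the
  longest path into \<open>j\<close>, and this path starts at \<open>j - 2\<close>, since for \<open>j \<le> 1\<close> an element of a
  torsionless module that survives to vertex \<open>j\<close> survives beyond it.\<close>

lemma proj_inj_long_path:
  assumes X: "projm X" "injm X" and ne: "carrier X ~= {\<zero>\<^sub>X}" and n: "3 \<le> n"
  shows "\<exists>i x. i + 2 < n \<and> x \<in> carrier X \<and> x \<star>\<^sub>X b i (i + 2) ~= \<zero>\<^sub>X"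
proof -
  note f = proj_fd[OF X(1)] and tl = proj_torsionless[OF X(1)]
  interpret X: Module.module K X by (rule fdD(1)[OF f])
  have sum: "x = (\<Oplus>\<^sub>X i\<in>{..<n}. x \<star>\<^sub>X b i i)" if "x \<in> carrier X" for x
    using ract_eJ[OF f that subset_refl] by (simp add: eJ_one fdD(7)[OF f that])
  have zeroI: "x = \<zero>\<^sub>X" if x: "x \<in> carrier X" and z: "!!i. i < n ==> x \<star>\<^sub>X b i i = \<zero>\<^sub>X" for x
    by (rule trans[OF sum[OF x]]) (rule X.add.finprod_one_eqI, use z in simp)
  define S where "S = {j. j < n \<and> (\<exists>x\<in>carrier X. x \<star>\<^sub>X b j j ~= \<zero>\<^sub>X)}"
  obtain x0 where "x0 \<in> carrier X" "x0 ~= \<zero>\<^sub>X" using ne X.zero_closed by blast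
  hence "S ~= {}" using zeroI[of x0] by (auto simp: S_def)
  moreover have fin: "finite S" by (rule finite_subset[of _ "{..<n}"]) (auto simp: S_def)
  ultimately have M: "Max S \<in> S" by simp
  define j where "j = Max S"
  have top: "x \<star>\<^sub>X b i w = \<zero>\<^sub>X" if x: "x \<in> carrier X" and w: "j < w" for x i w
  proof (cases "pv n i w")
    case True
    have "w \<notin> S" using Max_ge[OF fin, of w] w by (auto simp: j_def)
    moreover have "w < n" "pv n w w" using True by (auto simp: pv_def)
    ultimately have "x \<star>\<^sub>X b i w \<star>\<^sub>X b w w = \<zero>\<^sub>X" using fdD(3)[OF f x b_closed] by (auto simp: S_def)
    thus ?thesis using True \<open>pv n w w\<close> by (simp add: fd_bb[OF f x])
  qed (simp add: b_zero ract_zero[OF f x])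
  obtain x1 where x1: "x1 \<in> carrier X" "x1 \<star>\<^sub>X b j j ~= \<zero>\<^sub>X" and jn: "j < n" using M by (auto simp: S_def j_def)
  have pj: "pv n j j" using jn by (simp add: pv_def)
  let ?x = "x1 \<star>\<^sub>X b j j"
  have xc: "?x \<in> carrier X" by (rule fdD(3)[OF f x1(1) b_closed])
  define l where "l = j - 2"
  have pl: "pv n l j" using jn by (auto simp: l_def pv_def)
  have "\<exists>y\<in>carrier X. ?x = y \<star>\<^sub>X b l j"
  proof (rule inj_divide[OF X(2) b_closed xc])
    fix a assume a: "a \<in> carrier A" "b l j \<otimes>\<^sub>A a = \<zero>\<^sub>A"
    have "co a j j = co (b l j \<otimes>\<^sub>A a) l j" using pl by (simp add: co_b_mult[OF a(1)])
    hence a0: "co a j j = \<zero>" by (simp add: a(2) co_zero_elem)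
    show "?x \<star>\<^sub>X a = \<zero>\<^sub>X"
    proof (rule zeroI[OF fdD(3)[OF f xc a(1)]])
      fix w assume w: "w < n"
      hence pw: "pv n w w" by (simp add: pv_def)
      have e: "b j j \<otimes>\<^sub>A a \<otimes>\<^sub>A b w w = co a j w \<odot>\<^sub>A b j w"
        by (rule co_eqI) (use a(1) pj pw in \<open>auto simp: co_mult_b co_b_mult co_smult co_b\<close>)
      have "?x \<star>\<^sub>X a \<star>\<^sub>X b w w = x1 \<star>\<^sub>X (b j j \<otimes>\<^sub>A a \<otimes>\<^sub>A b w w)"
        using a(1) by (simp add: fdD(6)[OF f x1(1)])
      also have "\<dots> = co a j w \<odot>\<^sub>X (x1 \<star>\<^sub>X b j w)" unfolding e by (rule fdD(8)[OF f x1(1) b_closed co_closed[OF a(1)]])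
      also have "\<dots> = \<zero>\<^sub>X"
      proof -
        consider "w < j" | "w = j" | "j < w" by linarith
        thus ?thesis
        proof cases
          case 1
          hence "co a j w = \<zero>" by (intro co_zero[OF a(1)]) (simp add: pv_def)
          thus ?thesis using fdD(3)[OF f x1(1) b_closed] by simp
        next
          case 2
          thus ?thesis using a0 xc by simp
        next
          case 3
          thus ?thesis using top[OF x1(1)] a(1) by simp
        qed
      qed
      finally show "?x \<star>\<^sub>X a \<star>\<^sub>X b w w = \<zero>\<^sub>X" .
    qed
  qed
  then obtain y where y: "y \<in> carrier X" "?x = y \<star>\<^sub>X b l j" by blast
  have "2 \<le> j"
  proof (rule ccontr)
    assume h: "\<not> 2 \<le> j"
    have y2: "y \<star>\<^sub>X b 0 2 = \<zero>\<^sub>X" by (rule top[OF y(1)]) (use h in simp)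
    have "y \<star>\<^sub>X b 0 1 = \<zero>\<^sub>X" by (rule torsionless_zero_02[OF f tl y(1) y2 n])
    moreover have "j = 0 \<or> j = 1" "l = 0" using h by (auto simp: l_def)
    ultimately have j0: "j = 0" "l = 0" using y(2) x1(2) by auto
    have pvs: "pv n 0 0" using n by (simp add: pv_def)
    have "?x = \<zero>\<^sub>X"
    proof (rule torsionless_zero_01[OF f tl xc])
      show "?x \<star>\<^sub>X b 0 0 = ?x" using pvs by (simp add: fd_bb[OF f x1(1)] j0)
      show "?x \<star>\<^sub>X b 0 1 = \<zero>\<^sub>X" by (rule top[OF xc]) (simp add: j0)
    qed (use n in simp)
    thus False using x1(2) by simp
  qed
  hence l2: "l + 2 = j" by (simp add: l_def)
  have "y \<star>\<^sub>X b l (l + 2) ~= \<zero>\<^sub>X" unfolding l2 using y(2) x1(2) by (simp only:) simp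
  moreover have "l + 2 < n" using l2 jn by simp
  ultimately show ?thesis using y(1) by blast
qed

text \<open>By the path of length two that acts nontrivially, some \<open>[i, i + 3)\<close> is a summand.\<close>

lemma proj_inj_classification:
  fixes X :: "('k, 'a, 'x) rmodule"
  assumes ind: "indecomposable A X" and X: "projm X" "injm X" and n: "3 \<le> n"
  shows "\<exists>i. i + 2 < n \<and> rmod_iso A X (rmod_rows {i})"
proof -
  note f = proj_fd[OF X(1)]
  interpret X: Module.module K X by (rule fdD(1)[OF f])
  obtain i x where i: "i + 2 < n" and x: "x \<in> carrier X" "x \<star>\<^sub>X b i (i + 2) ~= \<zero>\<^sub>X"
    using proj_inj_long_path[OF X _ n] ind unfolding indecomposable_def by blast
  obtain z p where z: "z \<in> carrier X" "z \<star>\<^sub>X b i i = z" and p: "p \<in> rhom A X AA" "p z = b i i"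
    "\<forall>y\<in>carrier X. b i i \<otimes>\<^sub>A p y = p y" using summand_exists[OF f x i] by blast
  have pvi: "pv n i i" using i by (simp add: pv_def)
  note p' = rhomD[OF p(1), unfolded regular_simps]
  have pc: "p y \<in> rows {i}" if y: "y \<in> carrier X" for y
  proof -
    have "co (b i i \<otimes>\<^sub>A p y) i' j = \<zero>" if "i' ~= i" for i' j using that by (simp add: co_b_mult[OF p'(1)[OF y]])
    hence "co (p y) i' j = \<zero>" if "i' ~= i" for i' j using p(3) y that by simp
    thus ?thesis using p'(1)[OF y] by (simp add: rows_def)
  qed
  have pR: "p \<in> rhom A X (rmod_rows {i})" by (rule rhomI) (simp_all add: pc p')
  define q where "q a = z \<star>\<^sub>X a" for a
  have q: "q \<in> rhom A (rmod_rows {i}) X" unfolding q_def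
    by (rule rhomI) (simp_all add: fdD[OF f] z(1) rows_def)
  have pq: "p (q a) = a" if "a \<in> rows {i}" for a
  proof -
    have a: "a \<in> carrier A" using that by (simp add: rows_def)
    have "b i i \<otimes>\<^sub>A a = a"
      by (rule co_eqI) (use that a pvi in \<open>auto simp: co_b_mult rows_def\<close>)
    thus ?thesis using p'(3)[OF z(1) a] by (simp add: q_def p(2))
  qed
  note Q = rhomD[OF q]
  let ?U = "q ` carrier (rmod_rows {i})" and ?V = "rker X (rmod_rows {i}) p"
  have U: "submod A X ?U" by (rule submod_image[OF fd_rows f q])
  have V: "submod A X ?V" by (rule submod_rker[OF f fd_rows pR])
  note S = submodD[OF f U] and T = submodD[OF f V]
  have UV: "?U \<inter> ?V = {\<zero>\<^sub>X}"
  proof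
    show "?U \<inter> ?V \<subseteq> {\<zero>\<^sub>X}"
    proof
      fix y assume "y \<in> ?U \<inter> ?V"
      then obtain a where a: "a \<in> rows {i}" "y = q a" "p y = \<zero>\<^sub>A" by (auto simp: rker_def)
      hence "a = \<zero>\<^sub>A" using pq by simp
      thus "y \<in> {\<zero>\<^sub>X}" using a(2) rhom_zero_map[OF fd_rows f q] by simp
    qed
    show "{\<zero>\<^sub>X} \<subseteq> ?U \<inter> ?V" using S(2) T(2) by simp
  qed
  have sumUV: "?U <+>\<^sub>X ?V = carrier X"
  proof
    show "?U <+>\<^sub>X ?V \<subseteq> carrier X"
      unfolding set_add_def' using S(1) T(1) by (auto intro!: X.a_closed)
    show "carrier X \<subseteq> ?U <+>\<^sub>X ?V"
    proof
      fix y assume y: "y \<in> carrier X"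
      have py: "p y \<in> rows {i}" "p y \<in> carrier A" using pc[OF y] by (simp_all add: rows_def)
      have qc: "q (p y) \<in> carrier X" using Q(1) py(1) by simp
      let ?v = "y \<ominus>\<^sub>X q (p y)"
      have vc: "?v \<in> carrier X" using y qc by simp
      have e: "y = q (p y) \<oplus>\<^sub>X ?v" using y qc by (simp add: a_minus_def X.a_ac X.r_neg)
      have "p y = p (q (p y)) \<oplus>\<^sub>A p ?v" using p'(2)[OF qc vc] e by simp
      hence "p ?v = \<zero>\<^sub>A" using pq[OF py(1)] p'(1)[OF vc] py(2) A.add.l_cancel_one' by (metis)
      hence "?v \<in> ?V" using vc by (simp add: rker_def)
      moreover have "q (p y) \<in> ?U" using py(1) by simp
      ultimately show "y \<in> ?U <+>\<^sub>X ?V" unfolding set_add_def' using e by blast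
    qed
  qed
  have "?U ~= {\<zero>\<^sub>X}"
  proof
    assume h: "?U = {\<zero>\<^sub>X}"
    have "q (b i i) \<in> ?U" using b_in_rows[of i "{i}" i] by simp
    hence "z = \<zero>\<^sub>X" using h z(2) by (simp add: q_def)
    thus False using p(2) b_ne_zero[OF pvi] rhom_zero_map[OF f fd_regular p(1)] by simp
  qed
  hence V0: "?V = {\<zero>\<^sub>X}" using ind U V UV sumUV unfolding indecomposable_def by blast
  have "inj_on p (carrier X)" unfolding rhom_inj_iff[OF f fd_rows pR] using V0 by (auto simp: rker_def)
  moreover have "p ` carrier X = carrier (rmod_rows {i})"
  proof
    show "p ` carrier X \<subseteq> carrier (rmod_rows {i})" using pc by auto
    show "carrier (rmod_rows {i}) \<subseteq> p ` carrier X"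
    proof
      fix a assume a: "a \<in> carrier (rmod_rows {i})"
      hence "a = p (q a)" using pq by simp
      thus "a \<in> p ` carrier X" using Q(1)[OF a] by (rule image_eqI)
    qed
  qed
  ultimately have "rmod_iso A X (rmod_rows {i})" unfolding rmod_iso_def using pR by (auto simp: bij_betw_def)
  thus ?thesis using i by blast
qed

text \<open>Among the intervals \<open>[j, j + 3)\<close>, the path from \<open>i\<close> to \<open>i + 2\<close> acts nontrivially only on the one with \<open>j = i\<close>.\<close>

lemma rows_iso_unique:
  assumes X: "fdm X" and i: "i + 2 < n" and iso: "rmod_iso A X (rmod_rows {i})" "rmod_iso A X (rmod_rows {j})"
  shows "i = j"
proof -
  obtain f where f: "f \<in> rhom A X (rmod_rows {i})" "bij_betw f (carrier X) (carrier (rmod_rows {i}))"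
    using iso(1) unfolding rmod_iso_def by blast
  obtain g where g: "g \<in> rhom A X (rmod_rows {j})" "bij_betw g (carrier X) (carrier (rmod_rows {j}))"
    using iso(2) unfolding rmod_iso_def by blast
  have p: "pv n i i" "pv n i (i + 2)" using i by (simp_all add: pv_def)
  have "b i i \<in> f ` carrier X" using b_in_rows[of i "{i}" i] unfolding bij_betw_imp_surj_on[OF f(2)] by simp
  then obtain x where x: "b i i = f x" "x \<in> carrier X" by (rule imageE)
  have xc: "x \<star>\<^sub>X b i (i + 2) \<in> carrier X" by (rule fdD(3)[OF X x(2) b_closed])
  have "f (x \<star>\<^sub>X b i (i + 2)) = f x \<otimes>\<^sub>A b i (i + 2)" using rhomD(3)[OF f(1) x(2) b_closed, of i "i + 2"] by simp
  also have "f x = b i i" by (rule x(1)[symmetric])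
  also have "b i i \<otimes>\<^sub>A b i (i + 2) = b i (i + 2)" using p by (simp only: b_b) simp
  finally have "f (x \<star>\<^sub>X b i (i + 2)) ~= \<zero>\<^bsub>rmod_rows {i}\<^esub>" using b_ne_zero[OF p(2)] by simp
  hence "x \<star>\<^sub>X b i (i + 2) ~= \<zero>\<^sub>X" using rhom_zero_map[OF X fd_rows f(1)] by metis
  moreover have "\<forall>y\<in>carrier X. g y = \<zero>\<^bsub>rmod_rows {j}\<^esub> --> y = \<zero>\<^sub>X"
    using rhom_inj_iff[OF X fd_rows g(1)] bij_betw_imp_inj_on[OF g(2)] by blast
  ultimately have "g (x \<star>\<^sub>X b i (i + 2)) ~= \<zero>\<^bsub>rmod_rows {j}\<^esub>" using xc by blast
  hence gx: "g x \<otimes>\<^sub>A b i (i + 2) ~= \<zero>\<^sub>A" using rhomD(3)[OF g(1) x(2) b_closed, of i "i + 2"] by simp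
  have gr: "g x \<in> rows {j}" "g x \<in> carrier A" using rhomD(1)[OF g(1) x(2)] by (simp_all add: rows_def)
  show ?thesis
  proof (rule ccontr)
    assume ne: "i ~= j"
    have "g x \<otimes>\<^sub>A b i (i + 2) = \<zero>\<^sub>A"
    proof (rule co_eqI)
      fix i' j' assume "pv n i' j'"
      show "co (g x \<otimes>\<^sub>A b i (i + 2)) i' j' = co \<zero>\<^sub>A i' j'"
      proof (cases "i' = j \<and> pv n i' (i + 2) \<and> pv n i' i")
        case True
        thus ?thesis using ne by (auto simp: pv_def)
      next
        case False
        have "co (g x) i' i = \<zero>" if "pv n i' (i + 2)"
        proof (cases "i' = j")
          case True
          thus ?thesis using False that by (intro co_zero[OF gr(2)]) blast
        qed (use gr(1) in \<open>simp add: rows_def\<close>)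
        thus ?thesis by (simp add: co_mult_b[OF gr(2)] co_zero_elem)
      qed
    qed (use gr(2) in simp_all)
    thus False using gx by simp
  qed
qed

lemma eJ_minimal_faithful_projinj:
  assumes n: "3 \<le> n"
  shows "minimal_faithful_projinj K A (idem_rmod A (eJ {i. i + 2 < n}))"
proof -
  define J where "J = {i. i + 2 < n}"
  have fin: "finite J" by (rule finite_subset[of _ "{..<n}"]) (auto simp: J_def)
  have Jn: "i \<in> J ==> i + 2 < n" for i by (simp add: J_def)
  let ?M = "rmod_rows J"
  define \<U> where "\<U> = (%i. rows {i}) ` J"
  interpret M: Module.module K ?M by (rule fdD(1)[OF fd_rows])
  have upd: "?M\<lparr>carrier := U\<rparr> = AA\<lparr>carrier := U\<rparr>" for U by simp
  have rinj: "i = j" if "i \<in> J" "rows {i} = rows {j}" for i j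
  proof -
    have "pv n i i" using Jn[OF that(1)] by (simp add: pv_def)
    moreover have "b i i \<in> rows {j}" using that(2) b_in_rows[of i "{i}" i] by simp
    ultimately show ?thesis by (auto simp: rows_def co_b split: if_splits)
  qed
  have sub: "rows {i} \<subseteq> rows J" if "i \<in> J" for i using that by (auto simp: rows_def)
  have coS: "co (\<Oplus>\<^sub>?M U\<in>\<U>. f U) i j = (if i \<in> J then co (f (rows {i})) i j else \<zero>)"
    if f: "!!l. l \<in> J ==> f (rows {l}) \<in> rows {l}" for f i j
  proof -
    have fc: "f U \<in> rows J" if "U \<in> \<U>" for U using that f sub by (auto simp: \<U>_def)
    have coc: "co x i j \<in> carrier K" if "x \<in> rows J" for x using that by (simp add: rows_def)
    have coa: "co (x \<oplus>\<^sub>?M y) i j = co x i j \<oplus> co y i j" if "x \<in> rows J" "y \<in> rows J" for x y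
      using that by (simp add: rows_def co_add)
    have "co (\<Oplus>\<^sub>?M U\<in>\<U>. f U) i j = (\<Oplus> U\<in>\<U>. co (f U) i j)"
      using additive_finsum[OF M.abelian_group_axioms K.abelian_group_axioms, of "%a. co a i j" f \<U>] fc coc coa by simp
    also have "\<dots> = (if i \<in> J then co (f (rows {i})) i j else \<zero>)"
    proof (cases "i \<in> J")
      case True
      have "(\<Oplus> U\<in>\<U>. co (f U) i j) = co (f (rows {i})) i j"
      proof (rule finsum_single[OF K.abelian_monoid_axioms])
        show "finite \<U>" using fin by (simp add: \<U>_def)
        show "rows {i} \<in> \<U>" using True by (simp add: \<U>_def)
        show "co (f (rows {i})) i j \<in> carrier K" using f[OF True] by (simp add: rows_def)
        fix U assume "U \<in> \<U>" "U ~= rows {i}"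
        then obtain l where "l \<in> J" "U = rows {l}" "l ~= i" by (auto simp: \<U>_def)
        thus "co (f U) i j = \<zero>" using f[of l] by (simp add: rows_def)
      qed
      thus ?thesis using True by simp
    next
      case False
      have "(\<Oplus> U\<in>\<U>. co (f U) i j) = \<zero>"
      proof (rule K.add.finprod_one_eqI)
        fix U assume "U \<in> \<U>"
        then obtain l where l: "l \<in> J" "U = rows {l}" by (auto simp: \<U>_def)
        hence "l ~= i" using False by auto
        thus "co (f U) i j = \<zero>" using f[OF l(1)] l(2) by (simp add: rows_def)
      qed
      thus ?thesis using False by simp
    qed
    finally show ?thesis .
  qed
  have decomposition: "\<exists>!f. f \<in> (\<Pi>\<^sub>E U\<in>\<U>. U) \<and> x = (\<Oplus>\<^sub>?M U\<in>\<U>. f U)" if x: "x \<in> rows J" for x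
  proof -
    have xA: "x \<in> carrier A" using x by (simp add: rows_def)
    define g where "g i = b i i \<otimes>\<^sub>A x" for i
    have gr: "g i \<in> rows {i}" for i using xA by (auto simp: g_def rows_def co_b_mult)
    have gco: "co (g i) i j = co x i j" if "i \<in> J" for i j
    proof (cases "pv n i j")
      case True
      moreover have "pv n i i" using Jn[OF that] by (simp add: pv_def)
      ultimately show ?thesis using xA by (simp add: g_def co_b_mult)
    next
      case False
      thus ?thesis using xA gr[of i] by (simp add: co_zero rows_def)
    qed
    define f where "f = (\<lambda>U\<in>\<U>. g (THE i. i \<in> J \<and> U = rows {i}))"
    have fi: "f (rows {i}) = g i" if i: "i \<in> J" for i
    proof -
      have "(THE l. l \<in> J \<and> rows {i} = rows {l}) = i"
        by (rule the_equality) (use i rinj in auto)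
      moreover have "rows {i} \<in> \<U>" using i by (simp add: \<U>_def)
      ultimately show ?thesis by (simp add: f_def)
    qed
    have fP: "f \<in> (\<Pi>\<^sub>E U\<in>\<U>. U)"
    proof (rule PiE_I)
      fix U assume "U \<in> \<U>"
      then obtain i where "i \<in> J" "U = rows {i}" by (auto simp: \<U>_def)
      thus "f U \<in> U" using fi gr by simp
    qed (simp add: f_def)
    have Pi: "h (rows {l}) \<in> rows {l}" if "h \<in> (\<Pi>\<^sub>E U\<in>\<U>. U)" "l \<in> J" for h l
      by (rule PiE_mem[OF that(1)]) (use that(2) in \<open>simp add: \<U>_def\<close>)
    show ?thesis
    proof (rule ex1I[of _ f], intro conjI)
      show "x = (\<Oplus>\<^sub>?M U\<in>\<U>. f U)"
      proof (rule co_eqI[OF xA])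
        have "(\<Oplus>\<^sub>?M U\<in>\<U>. f U) \<in> carrier ?M"
        proof (rule M.finsum_closed, rule funcsetI)
          fix U assume "U \<in> \<U>"
          then obtain l where "l \<in> J" "U = rows {l}" by (auto simp: \<U>_def)
          thus "f U \<in> carrier ?M" using Pi[OF fP] sub by auto
        qed
        thus "(\<Oplus>\<^sub>?M U\<in>\<U>. f U) \<in> carrier A" by (simp add: rows_def)
        fix i j
        have "co (\<Oplus>\<^sub>?M U\<in>\<U>. f U) i j = (if i \<in> J then co (f (rows {i})) i j else \<zero>)"
          by (rule coS[OF Pi[OF fP]])
        also have "\<dots> = co x i j"
        proof (cases "i \<in> J")
          case True
          show ?thesis by (simp only: if_P[OF True] fi[OF True] gco[OF True])
        qed (use x in \<open>simp add: rows_def\<close>)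
        finally show "co x i j = co (\<Oplus>\<^sub>?M U\<in>\<U>. f U) i j" by (rule sym)
      qed
    next
      fix h assume h: "h \<in> (\<Pi>\<^sub>E U\<in>\<U>. U) \<and> x = (\<Oplus>\<^sub>?M U\<in>\<U>. h U)"
      have hc: "co x i j = (if i \<in> J then co (h (rows {i})) i j else \<zero>)" for i j
        using coS[OF Pi[OF conjunct1[OF h]], of i j] conjunct2[OF h] by simp
      show "h = f"
      proof (rule PiE_ext[OF conjunct1[OF h] fP])
        fix U assume "U \<in> \<U>"
        then obtain l where l: "l \<in> J" "U = rows {l}" by (auto simp: \<U>_def)
        note hl = Pi[OF conjunct1[OF h] l(1)]
        have "h (rows {l}) = g l"
        proof (rule co_eqI)
          fix i j show "co (h (rows {l})) i j = co (g l) i j"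
            using hl gr[of l] hc[of l j] gco[OF l(1), of j] l(1) by (cases "i = l") (simp_all add: rows_def)
        qed (use hl gr[of l] in \<open>simp_all add: rows_def\<close>)
        thus "h U = f U" using fi[OF l(1)] l(2) by simp
      qed
    qed (rule fP)
  qed
  have members: "submod A ?M U \<and> indecomposable A (?M\<lparr>carrier := U\<rparr>) \<and> projm (?M\<lparr>carrier := U\<rparr>) \<and> injm (?M\<lparr>carrier := U\<rparr>)"
    if U: "U \<in> \<U>" for U
  proof -
    obtain i where i: "i \<in> J" "U = rows {i}" using U by (auto simp: \<U>_def)
    have "submod A ?M U"
    proof (rule submodI[OF fd_rows])
      note S = submodD[OF fd_regular submod_rows[of "{i}"]]
      show "U \<subseteq> carrier ?M" using sub[OF i(1)] i(2) by simp
      show "\<zero>\<^sub>?M \<in> U" using S(2) i(2) by simp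
      show "x \<oplus>\<^sub>?M y \<in> U" if "x \<in> U" "y \<in> U" for x y using S(3) that i(2) by simp
      show "x \<star>\<^sub>?M a \<in> U" if "a \<in> carrier A" "x \<in> U" for a x using S(5) that i(2) by simp
    qed
    moreover have "projm (rmod_rows {i})" "injm (rmod_rows {i})"
      using rows_proj_inj[of "{i}"] Jn[OF i(1)] by simp_all
    ultimately show ?thesis unfolding upd using rows_indecomposable[OF Jn[OF i(1)]] i(2) by simp
  qed
  have occur: "\<exists>!U. U \<in> \<U> \<and> rmod_iso A X (?M\<lparr>carrier := U\<rparr>)"
    if X: "indecomposable A X" "projm X" "injm X" for X :: "('k, 'a, nat => 'k) rmodule"
  proof -
    obtain i where i: "i + 2 < n" "rmod_iso A X (rmod_rows {i})" using proj_inj_classification[OF X n] by blast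
    show ?thesis unfolding upd
    proof (rule ex1I[of _ "rows {i}"])
      show "rows {i} \<in> \<U> \<and> rmod_iso A X (rmod_rows {i})" using i by (simp add: \<U>_def J_def)
      fix U assume U: "U \<in> \<U> \<and> rmod_iso A X (AA\<lparr>carrier := U\<rparr>)"
      then obtain j where "U = rows {j}" by (auto simp: \<U>_def)
      thus "U = rows {i}" using rows_iso_unique[OF proj_fd[OF X(2)] i, of j] U by simp
    qed
  qed
  have "finite \<U>" using fin by (simp add: \<U>_def)
  moreover have "\<forall>x\<in>carrier ?M. \<exists>!f. f \<in> (\<Pi>\<^sub>E U\<in>\<U>. U) \<and> x = (\<Oplus>\<^sub>?M U\<in>\<U>. f U)"
    using decomposition by simp
  ultimately have "minimal_faithful_projinj K A ?M"
    unfolding minimal_faithful_projinj_def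
    using rows_faithful[OF n, folded J_def] rows_proj_inj[OF Jn, of J] members occur
    by (intro conjI exI[of _ \<U>] ballI allI impI) (simp_all only:)
  thus ?thesis unfolding idem_rmod_eJ J_def .
qed

text \<open>The idempotent in the definition of \<open>B_n\<close> is a choice. Only these properties of it are used.\<close>

lemma minimal_idem:
  assumes n: "3 \<le> n"
  defines "M \<equiv> idem_rmod A (minimal_projinj_idem K A)"
  shows "fdm M" "faithful A M" "torsionless A M" "injm M"
proof -
  have "\<exists>e. e \<in> carrier A \<and> e \<otimes>\<^sub>A e = e \<and> minimal_faithful_projinj K A (idem_rmod A e)"
    using eJ_minimal_faithful_projinj[OF n] eJ_idem eJ_closed by blast
  hence "minimal_faithful_projinj K A M"
    unfolding M_def minimal_projinj_idem_def by (rule someI2_ex) simp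
  hence 1: "faithful A M" "projm M" "injm M" unfolding minimal_faithful_projinj_def by simp_all
  thus "fdm M" "faithful A M" "torsionless A M" "injm M"
    by (simp_all add: proj_fd proj_torsionless)
qed

text \<open>The injective hull of \<open>A\<close> is projective, since \<open>A\<close> embeds into the projective-injective
  module whose rows are the intervals of length 3 with the same socles.\<close>

lemma hull_regular:
  assumes n: "3 \<le> n"
  defines "E \<equiv> injective_hull K A AA"
  shows "fdm E" "faithful A E" "torsionless A E"
proof -
  have "\<exists>\<epsilon>. is_injective_hull K A AA E \<epsilon>" unfolding E_def injective_hull_def
    by (rule someI_ex[OF injective_hull_exists[OF fd_regular]])
  then obtain \<epsilon> where h: "is_injective_hull K A AA E \<epsilon>" by blast
  hence e: "injm E" "\<epsilon> \<in> rhom A AA E" "inj_on \<epsilon> (carrier A)" by (simp_all add: is_injective_hull_def)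
  show f: "fdm E" by (rule inj_fd[OF e(1)])
  note \<epsilon> = rhomD[OF e(2), unfolded regular_simps]
  show "faithful A E" unfolding faithful_def
  proof (intro ballI impI)
    fix a assume a: "a \<in> carrier A" and z: "\<forall>x\<in>carrier E. x \<star>\<^sub>E a = \<zero>\<^sub>E"
    have "\<epsilon> (\<one>\<^sub>A \<otimes>\<^sub>A a) = \<epsilon> \<one>\<^sub>A \<star>\<^sub>E a" by (rule \<epsilon>(3)[OF A.one_closed a])
    hence "\<epsilon> a = \<zero>\<^sub>E" using z \<epsilon>(1)[OF A.one_closed] a by simp
    thus "a = \<zero>\<^sub>A" using rhom_inj_iff[OF fd_regular f e(2)] e(3) a by simp
  qed
  let ?N = "ivm {..<n} (%r. r) pend" and ?F = "ivm {..<n} (lo (%r. r) pend) pend"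
  have ok: "ivok {..<n} (%r. r) pend" by (rule ivok_proj) simp
  note l = lo_ok[OF ok]
  have ok2: "ivok {..<n} (lo (%r. r) pend) pend" using l(1) by (simp add: ivinj_def)
  have F: "projm ?F" by (rule proj_ivm[OF ok2]) (use n in \<open>auto simp: lo_def pend_def\<close>)
  have "c0 \<in> rhom A AA ?F"
    using rhom_comp[OF regular_iso(1) ivm_inclusion[OF ok ok2 l(3)]] by simp
  moreover have "inj_on c0 (carrier AA)" using bij_betw_imp_inj_on[OF regular_iso(2)] by simp
  ultimately have "projm E" by (rule hull_proj[OF fd_regular h inj_ivm[OF l(1)] F])
  thus "torsionless A E" by (rule proj_torsionless)
qed

end

section \<open>Coordinates on the algebra \<open>A_n\<close>\<close>

subsection \<open>Paths in the linear quiver\<close>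

lemma linear_quiver_simps:
  "verts (linear_quiver n) = {i. i < n}" "arcs (linear_quiver n) = {i. Suc i < n}"
  "tail (linear_quiver n) = (%i. i)" "head (linear_quiver n) = Suc"
  by (simp_all add: linear_quiver_def)

lemma linear_cas: "pre_digraph.cas (linear_quiver n) u p v \<longleftrightarrow> u \<le> v \<and> p = [u..<v]"
proof (induction p arbitrary: u)
  case Nil
  show ?case by (cases "u < v") (auto simp: pre_digraph.cas.simps upt_conv_Cons)
next
  case (Cons e es)
  have h: "(u \<le> v \<and> e # es = [u..<v]) \<longleftrightarrow> u < v \<and> e = u \<and> es = [Suc u..<v]"
    by (cases "u < v") (auto simp: upt_conv_Cons)
  show ?case unfolding h pre_digraph.cas.simps Cons.IH linear_quiver_simps by auto
qed

lemma paths_linear: "paths (linear_quiver n) = {(u, [u..<v]) | u v. u \<le> v \<and> v < n}"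
proof -
  have "pre_digraph.awalk (linear_quiver n) u p v \<longleftrightarrow> u \<le> v \<and> v < n \<and> p = [u..<v]" for u p v
  proof -
    have "u < n \<and> set [u..<v] \<subseteq> {i. Suc i < n} \<longleftrightarrow> v < n" if uv: "u \<le> v"
    proof (cases "u = v")
      case False
      hence m: "v - 1 \<in> set [u..<v]" and v: "Suc (v - 1) = v" using uv by auto
      show ?thesis
      proof
        assume "u < n \<and> set [u..<v] \<subseteq> {i. Suc i < n}"
        hence "Suc (v - 1) < n" using m by blast
        thus "v < n" unfolding v .
      qed (use uv in auto)
    qed simp
    thus ?thesis by (auto simp: pre_digraph.awalk_def linear_cas linear_quiver_simps)
  qed
  thus ?thesis unfolding paths_def by auto
qed

lemma awlast_upt: "u \<le> v ==> last (pre_digraph.awalk_verts (linear_quiver n) u [u..<v]) = v"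
  by (cases "u = v") (auto simp: pre_digraph.awalk_verts_conv linear_quiver_simps)

lemma path_eq: "u \<le> v ==> u' \<le> v' ==> (u, [u..<v]) = (u', [u'..<v']) \<longleftrightarrow> u = u' \<and> v = v'"
proof
  assume h: "u \<le> v" "u' \<le> v'" "(u, [u..<v]) = (u', [u'..<v'])"
  have e: "u = u'" "[u..<v] = [u'..<v']" using h(3) unfolding prod.inject by blast+
  have "length [u..<v] = length [u'..<v']" by (simp only: e(2))
  thus "u = u' \<and> v = v'" using h(1,2) e(1) by simp
qed simp

locale linear_path_algebra =
  fixes K :: "('k, 'c) ring_scheme" (structure) and n :: nat
  assumes fieldK: "field K"
begin

sublocale K: field K by (rule fieldK)

abbreviation "R \<equiv> path_algebra K (linear_quiver n)"

text \<open>The paths of length at least \<open>k\<close>; the path from \<open>u\<close> to \<open>v\<close> has the arrows \<open>u, \<dots>, v - 1\<close>.\<close>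

definition pths :: "nat => (nat \<times> nat list) set" where
  "pths k = {(u, [u..<v]) | u v. u + k \<le> v \<and> v < n}"

text \<open>The matrix entries of an element of the path algebra. The guard is needed because
  \<open>[u..<v]\<close> is the trivial path for all \<open>v \<le> u\<close>.\<close>

definition xc :: "(nat \<times> nat list => 'k) => nat => nat => 'k" where
  "xc x u v = (if u \<le> v \<and> v < n then x (u, [u..<v]) else \<zero>)"

lemma finite_pths: "finite (pths k)"
  by (rule finite_subset[of _ "(%(u, v). (u, [u..<v])) ` ({..<n} \<times> {..<n})"]) (auto simp: pths_def image_iff)

lemma R_carrier: "x \<in> carrier R \<longleftrightarrow> (\<forall>w. x w \<in> carrier K) \<and> (\<forall>w. w \<notin> pths 0 --> x w = \<zero>)"
proof -
  have p: "paths (linear_quiver n) = pths 0" by (simp add: paths_linear pths_def)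
  have f: "finite {w. x w ~= \<zero>}" if "{w. x w ~= \<zero>} \<subseteq> pths 0"
    using finite_subset[OF that finite_pths] .
  have sub: "(\<forall>w. w \<notin> pths 0 --> x w = \<zero>) \<longleftrightarrow> {w. x w ~= \<zero>} \<subseteq> pths 0" by blast
  have "x \<in> carrier R \<longleftrightarrow> x \<in> UNIV \<rightarrow> carrier K \<and> finite {w. x w ~= \<zero>} \<and> {w. x w ~= \<zero>} \<subseteq> pths 0"
    by (simp add: path_algebra_def p)
  thus ?thesis unfolding sub Pi_iff using f by blast
qed

lemma R_D: "x \<in> carrier R ==> x w \<in> carrier K" "x \<in> carrier R ==> w \<notin> pths 0 ==> x w = \<zero>"
  using R_carrier by blast+

lemma R_simps: "zero R = (%w. \<zero>)" "add R = (%x y w. x w \<oplus> y w)" "smult R = (%k x w. k \<otimes> x w)"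
  by (simp_all add: path_algebra_def)

lemma R_fun_space: "carrier R = carrier (fun_space K (pths 0))"
  by (auto simp: R_carrier fun_space_def)

lemma module_R: "Module.module K R"
  by (rule module_cong[OF module_fun_space[OF K.is_cring, of "pths 0"]])
    (simp_all add: R_fun_space R_simps fun_space_def)

lemma finite_dim_R: "finite_dim K R"
  by (rule finite_dim_cong[OF module_fun_space[OF K.is_cring] finite_dim_fun_space[OF K.is_cring finite_pths[of 0]]])
    (simp_all add: R_fun_space R_simps fun_space_def)

lemma xc_closed [simp, intro]: "x \<in> carrier R ==> xc x u v \<in> carrier K"
  by (simp add: xc_def R_carrier)

lemma xc_add: "x \<in> carrier R ==> y \<in> carrier R ==> xc (x \<oplus>\<^sub>R y) u v = xc x u v \<oplus> xc y u v"
  by (simp add: xc_def R_simps)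

lemma xc_smult: "k \<in> carrier K ==> xc (k \<odot>\<^sub>R x) u v = k \<otimes> xc x u v"
  by (simp add: xc_def R_simps)

lemma xc_zero: "xc \<zero>\<^sub>R u v = \<zero>"
  by (simp add: xc_def R_simps)

lemma xc_eqI:
  assumes "x \<in> carrier R" "y \<in> carrier R" "!!u v. u \<le> v ==> v < n ==> xc x u v = xc y u v"
  shows "x = y"
proof
  fix w
  show "x w = y w"
  proof (cases "w \<in> pths 0")
    case True
    then obtain u v where uv: "w = (u, [u..<v])" "u \<le> v" "v < n" by (auto simp: pths_def)
    thus ?thesis using assms(3)[OF uv(2,3)] by (simp add: xc_def)
  qed (simp add: R_D(2)[OF assms(1)] R_D(2)[OF assms(2)])
qed

lemma R_mult_apply: "(x \<otimes>\<^sub>R y) (u, p) = (\<Oplus>i\<in>{..length p}.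
        x (u, take i p) \<otimes> y (last (pre_digraph.awalk_verts (linear_quiver n) u (take i p)), drop i p))"
  by (simp add: path_algebra_def)

text \<open>In coordinates the path algebra is the algebra of upper triangular matrices.\<close>

lemma xc_mult:
  assumes x: "x \<in> carrier R" and y: "y \<in> carrier R"
  shows "xc (x \<otimes>\<^sub>R y) u v = (\<Oplus>l\<in>{..<n}. xc x u l \<otimes> xc y l v)"
proof (cases "u \<le> v \<and> v < n")
  case False
  have "(\<Oplus>l\<in>{..<n}. xc x u l \<otimes> xc y l v) = \<zero>"
  proof (rule K.add.finprod_one_eqI)
    fix l
    have "xc x u l = \<zero> \<or> xc y l v = \<zero>" using False by (auto simp: xc_def)
    thus "xc x u l \<otimes> xc y l v = \<zero>" using x y by auto
  qed
  thus ?thesis using False by (auto simp: xc_def)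
next
  case True
  let ?g = "%l. xc x u l \<otimes> xc y l v"
  have gK: "?g l \<in> carrier K" for l using x y by simp
  have "xc (x \<otimes>\<^sub>R y) u v = (\<Oplus>i\<in>{..v - u}. ?g (u + i))"
    unfolding xc_def[of "x \<otimes>\<^sub>R y"] R_mult_apply
  proof (simp add: True, rule K.finsum_cong')
    fix i assume i: "i \<in> {..v - u}"
    hence "u + i \<le> v" using True by auto
    thus "x (u, take i [u..<v]) \<otimes> y (last (pre_digraph.awalk_verts (linear_quiver n) u (take i [u..<v])), [u + i..<v]) = ?g (u + i)"
      using True by (simp add: take_upt awlast_upt xc_def)
  qed (use gK in auto)
  also have "\<dots> = (\<Oplus>l\<in>(%i. u + i) ` {..v - u}. ?g l)"
    by (rule K.finsum_reindex[symmetric]) (use gK in auto)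
  also have "\<dots> = (\<Oplus>l\<in>{..<n}. ?g l)"
  proof (rule K.add.finprod_mono_neutral_cong_left)
    show "(%i. u + i) ` {..v - u} \<subseteq> {..<n}" using True by auto
    fix l assume l: "l \<in> {..<n} - (%i. u + i) ` {..v - u}"
    have "l \<in> (%i. u + i) ` {..v - u}" if "u \<le> l" "l \<le> v"
      by (rule image_eqI[of _ _ "l - u"]) (use that in auto)
    hence "\<not> (u \<le> l \<and> l \<le> v)" using l by blast
    thus "?g l = \<zero>" using x y by (auto simp: xc_def R_carrier)
  qed (use gK in auto)
  finally show ?thesis .
qed

lemma R_mult_closed:
  assumes x: "x \<in> carrier R" and y: "y \<in> carrier R"
  shows "x \<otimes>\<^sub>R y \<in> carrier R"
  unfolding R_carrier
proof (intro conjI allI impI)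
  have xK: "x w \<in> carrier K" and yK: "y w \<in> carrier K" for w by (rule R_D(1)[OF x], rule R_D(1)[OF y])
  fix w :: "nat \<times> nat list" obtain u p where w: "w = (u, p)" by (cases w)
  show "(x \<otimes>\<^sub>R y) w \<in> carrier K" unfolding w R_mult_apply
    by (rule K.finsum_closed) (use xK yK in simp)
  assume wn: "w \<notin> pths 0"
  show "(x \<otimes>\<^sub>R y) w = \<zero>" unfolding w R_mult_apply
  proof (rule K.add.finprod_one_eqI)
    fix i
    let ?a = "last (pre_digraph.awalk_verts (linear_quiver n) u (take i p))"
    have "x (u, take i p) = \<zero> \<or> y (?a, drop i p) = \<zero>"
    proof (rule ccontr)
      assume h: "\<not> ?thesis"
      have "(u, take i p) \<in> pths 0" using h x unfolding R_carrier by blast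
      then obtain a where a: "take i p = [u..<a]" "u \<le> a" by (auto simp: pths_def)
      have "(?a, drop i p) \<in> pths 0" using h y unfolding R_carrier by blast
      hence "(a, drop i p) \<in> pths 0" using a by (simp add: awlast_upt)
      then obtain v where v: "drop i p = [a..<v]" "a \<le> v" "v < n" by (auto simp: pths_def)
      have "p = [u..<a] @ [a..<v]" using append_take_drop_id[of i p] a(1) v(1) by simp
      also have "\<dots> = [u..<v]" using upt_add_eq_append[OF a(2), of "v - a"] v(2) by simp
      finally have "(u, p) \<in> pths 0" using a(2) v by (auto simp: pths_def)
      thus False using wn w by simp
    qed
    thus "x (u, take i p) \<otimes> y (?a, drop i p) = \<zero>" using xK yK by auto
  qed
qed

lemma R_one: "\<one>\<^sub>R \<in> carrier R" "xc \<one>\<^sub>R u v = (if u = v \<and> v < n then \<one> else \<zero>)"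
proof -
  have o: "\<one>\<^sub>R (u, p) = (if u < n \<and> p = [] then \<one> else \<zero>)" for u p
    by (simp add: path_algebra_def linear_quiver_simps)
  have "(u, []) \<in> pths 0" if "u < n" for u
    unfolding pths_def using that by (intro CollectI exI[of _ u]) simp
  thus "\<one>\<^sub>R \<in> carrier R" unfolding R_carrier by (auto simp: o)
  show "xc \<one>\<^sub>R u v = (if u = v \<and> v < n then \<one> else \<zero>)" by (auto simp: xc_def o)
qed

lemma ring_R: "ring R"
proof -
  interpret R: Module.module K R by (rule module_R)
  show ?thesis
  proof (rule ringI)
    show "abelian_group R" by (rule R.abelian_group_axioms)
    show "Group.monoid R"
    proof (rule monoidI)
      fix x y z assume xyz: "x \<in> carrier R" "y \<in> carrier R" "z \<in> carrier R"
      note c = R_mult_closed[OF xyz(1,2)] R_mult_closed[OF xyz(2,3)]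
      show "x \<otimes>\<^sub>R y \<otimes>\<^sub>R z = x \<otimes>\<^sub>R (y \<otimes>\<^sub>R z)"
      proof (rule xc_eqI)
        fix u v
        have "xc (x \<otimes>\<^sub>R y \<otimes>\<^sub>R z) u v = (\<Oplus>l\<in>{..<n}. (\<Oplus>k\<in>{..<n}. xc x u k \<otimes> xc y k l) \<otimes> xc z l v)"
          by (simp add: xc_mult c xyz)
        also have "\<dots> = (\<Oplus>l\<in>{..<n}. \<Oplus>k\<in>{..<n}. xc x u k \<otimes> (xc y k l \<otimes> xc z l v))"
          by (rule K.finsum_cong') (simp_all add: K.finsum_ldistr xyz K.m_assoc)
        also have "\<dots> = (\<Oplus>k\<in>{..<n}. \<Oplus>l\<in>{..<n}. xc x u k \<otimes> (xc y k l \<otimes> xc z l v))"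
          by (rule finsum_swap[OF K.abelian_monoid_axioms]) (simp_all add: xyz)
        also have "\<dots> = (\<Oplus>k\<in>{..<n}. xc x u k \<otimes> (\<Oplus>l\<in>{..<n}. xc y k l \<otimes> xc z l v))"
          by (rule K.finsum_cong') (simp_all add: K.finsum_rdistr xyz)
        also have "\<dots> = xc (x \<otimes>\<^sub>R (y \<otimes>\<^sub>R z)) u v" by (simp add: xc_mult c xyz)
        finally show "xc (x \<otimes>\<^sub>R y \<otimes>\<^sub>R z) u v = xc (x \<otimes>\<^sub>R (y \<otimes>\<^sub>R z)) u v" .
      qed (simp_all add: R_mult_closed c xyz)
    next
      fix x assume x: "x \<in> carrier R"
      show "\<one>\<^sub>R \<otimes>\<^sub>R x = x"
      proof (rule xc_eqI)
        fix u v assume uv: "u \<le> v" "v < n"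
        have "(\<Oplus>l\<in>{..<n}. xc \<one>\<^sub>R u l \<otimes> xc x l v) = xc \<one>\<^sub>R u u \<otimes> xc x u v"
          by (rule finsum_single[OF K.abelian_monoid_axioms]) (use x uv in \<open>auto simp: R_one(2)\<close>)
        thus "xc (\<one>\<^sub>R \<otimes>\<^sub>R x) u v = xc x u v" using x uv by (simp add: xc_mult R_one)
      qed (simp_all add: x R_one R_mult_closed)
      show "x \<otimes>\<^sub>R \<one>\<^sub>R = x"
      proof (rule xc_eqI)
        fix u v assume uv: "u \<le> v" "v < n"
        have "(\<Oplus>l\<in>{..<n}. xc x u l \<otimes> xc \<one>\<^sub>R l v) = xc x u v \<otimes> xc \<one>\<^sub>R v v"
          by (rule finsum_single[OF K.abelian_monoid_axioms]) (use x uv in \<open>auto simp: R_one(2)\<close>)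
        thus "xc (x \<otimes>\<^sub>R \<one>\<^sub>R) u v = xc x u v" using x uv by (simp add: xc_mult R_one)
      qed (simp_all add: x R_one R_mult_closed)
    qed (simp_all add: R_one R_mult_closed)
  next
    fix x y z assume xyz: "x \<in> carrier R" "y \<in> carrier R" "z \<in> carrier R"
    note c = R_mult_closed[OF xyz(1,3)] R_mult_closed[OF xyz(2,3)] R_mult_closed[OF xyz(3,1)] R_mult_closed[OF xyz(3,2)]
    show "(x \<oplus>\<^sub>R y) \<otimes>\<^sub>R z = x \<otimes>\<^sub>R z \<oplus>\<^sub>R y \<otimes>\<^sub>R z"
      by (rule xc_eqI) (simp_all add: xyz c R_mult_closed xc_add xc_mult K.l_distr K.finsum_addf)
    show "z \<otimes>\<^sub>R (x \<oplus>\<^sub>R y) = z \<otimes>\<^sub>R x \<oplus>\<^sub>R z \<otimes>\<^sub>R y"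
      by (rule xc_eqI) (simp_all add: xyz c R_mult_closed xc_add xc_mult K.r_distr K.finsum_addf)
  qed
qed

sublocale R: ring R by (rule ring_R)
sublocale RM: Module.module K R by (rule module_R)

lemma R_smult_mult:
  assumes k: "k \<in> carrier K" and x: "x \<in> carrier R" and y: "y \<in> carrier R"
  shows "(k \<odot>\<^sub>R x) \<otimes>\<^sub>R y = k \<odot>\<^sub>R (x \<otimes>\<^sub>R y)" "x \<otimes>\<^sub>R (k \<odot>\<^sub>R y) = k \<odot>\<^sub>R (x \<otimes>\<^sub>R y)"
proof -
  have e: "k \<otimes> (\<Oplus>l\<in>{..<n}. xc x u l \<otimes> xc y l v) = (\<Oplus>l\<in>{..<n}. k \<otimes> (xc x u l \<otimes> xc y l v))" for u v
    by (rule K.finsum_rdistr) (simp_all add: k x y)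
  show "(k \<odot>\<^sub>R x) \<otimes>\<^sub>R y = k \<odot>\<^sub>R (x \<otimes>\<^sub>R y)"
    by (rule xc_eqI) (simp_all add: k x y xc_mult xc_smult e K.m_assoc)
  show "x \<otimes>\<^sub>R (k \<odot>\<^sub>R y) = k \<odot>\<^sub>R (x \<otimes>\<^sub>R y)"
    by (rule xc_eqI) (simp_all add: k x y xc_mult xc_smult e K.m_lcomm)
qed

subsection \<open>Powers of the arrow ideal\<close>

text \<open>The span of the paths of length at least \<open>k\<close>, which turns out to be the \<open>k\<close>-th power of the arrow ideal.\<close>

definition F :: "nat => (nat \<times> nat list => 'k) set" where
  "F k = {x \<in> carrier R. \<forall>u v. v < u + k --> xc x u v = \<zero>}"

lemma F_0: "F 0 = carrier R"
  by (auto simp: F_def xc_def)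

lemma F_mult:
  assumes x: "x \<in> F k" and y: "y \<in> F l"
  shows "x \<otimes>\<^sub>R y \<in> F (k + l)"
proof -
  have c: "x \<in> carrier R" "y \<in> carrier R" using x y by (simp_all add: F_def)
  have "xc (x \<otimes>\<^sub>R y) u v = \<zero>" if v: "v < u + (k + l)" for u v
    unfolding xc_mult[OF c]
  proof (rule K.add.finprod_one_eqI)
    fix j
    have "j < u + k \<or> v < j + l" using v by linarith
    hence "xc x u j = \<zero> \<or> xc y j v = \<zero>" using x y by (auto simp: F_def)
    thus "xc x u j \<otimes> xc y j v = \<zero>" using c by auto
  qed
  thus ?thesis using c by (simp add: F_def)
qed

lemma F_ideal: "ideal (F k) R"
proof (rule idealI[OF ring_R])
  have "ksub K R (F k)" unfolding ksub_def by (auto simp: F_def xc_add xc_smult xc_zero)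
  thus "subgroup (F k) (add_monoid R)"
    by (intro additive_subgroup.a_subgroup ksub_additive_subgroup[OF module_R])
  fix a x assume "a \<in> F k" "x \<in> carrier R"
  thus "x \<otimes>\<^sub>R a \<in> F k" "a \<otimes>\<^sub>R x \<in> F k"
    using F_mult[of x 0 a k] F_mult[of a k x 0] by (simp_all add: F_0)
qed

definition dl :: "nat => nat => nat \<times> nat list => 'k" where
  "dl u v = delta K (u, [u..<v])"

lemma dl_closed: "u \<le> v ==> v < n ==> dl u v \<in> carrier R"
  unfolding R_fun_space dl_def by (rule delta_in_fun_space[OF K.is_cring]) (auto simp: pths_def)

lemma xc_dl:
  assumes "u \<le> v" "v < n"
  shows "xc (dl u v) u' v' = (if u' = u \<and> v' = v then \<one> else \<zero>)"
proof (cases "u' \<le> v' \<and> v' < n")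
  case True
  thus ?thesis using path_eq[of u' v' u v] assms by (simp add: xc_def dl_def delta_def)
qed (use assms in \<open>auto simp: xc_def\<close>)

lemma dl_F: "u + k \<le> v ==> v < n ==> dl u v \<in> F k"
  using dl_closed[of u v] xc_dl[of u v] by (simp add: F_def)

lemma dl_mult:
  assumes ul: "u \<le> l" and lv: "l \<le> v" and v: "v < n"
  shows "dl u l \<otimes>\<^sub>R dl l v = dl u v"
proof -
  note c = dl_closed[OF ul le_less_trans[OF lv v]] dl_closed[OF lv v] dl_closed[OF le_trans[OF ul lv] v]
  note e = xc_dl[OF ul le_less_trans[OF lv v]] xc_dl[OF lv v] xc_dl[OF le_trans[OF ul lv] v]
  show ?thesis
  proof (rule xc_eqI[OF R.m_closed[OF c(1,2)] c(3)])
    fix u' v'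
    have "(\<Oplus>j\<in>{..<n}. xc (dl u l) u' j \<otimes> xc (dl l v) j v') = xc (dl u l) u' l \<otimes> xc (dl l v) l v'"
      by (rule finsum_single[OF K.abelian_monoid_axioms]) (use lv v in \<open>auto simp: e\<close>)
    thus "xc (dl u l \<otimes>\<^sub>R dl l v) u' v' = xc (dl u v) u' v'" by (simp add: xc_mult c e)
  qed
qed

text \<open>An ideal is a subspace, so it contains the span of the paths in it.\<close>

lemma F_subset_ideal:
  assumes T: "ideal T R" and d: "!!u v. u + k \<le> v ==> v < n ==> dl u v \<in> T"
  shows "F k \<subseteq> T"
proof -
  interpret T: ideal T R by (rule T)
  let ?S = "fun_space K (pths k)"
  have SR: "carrier ?S \<subseteq> carrier R" by (auto simp: R_fun_space fun_space_def pths_def)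
  have "ksub K ?S (T \<inter> carrier ?S)"
    unfolding ksub_def
  proof (intro conjI ballI)
    show "\<zero>\<^sub>?S \<in> T \<inter> carrier ?S" using T.zero_closed by (simp add: R_simps fun_space_def)
    fix x y assume xy: "x \<in> T \<inter> carrier ?S" "y \<in> T \<inter> carrier ?S"
    hence "x \<oplus>\<^sub>R y \<in> T" by (simp add: T.a_closed)
    thus "x \<oplus>\<^sub>?S y \<in> T \<inter> carrier ?S" using xy by (simp add: R_simps fun_space_def)
  next
    fix c x assume c: "c \<in> carrier K" and x: "x \<in> T \<inter> carrier ?S"
    hence xR: "x \<in> carrier R" using SR by blast
    have "(c \<odot>\<^sub>R \<one>\<^sub>R) \<otimes>\<^sub>R x \<in> T" using c x by (intro T.I_l_closed) simp_all
    hence "c \<odot>\<^sub>R x \<in> T" using c xR by (simp add: R_smult_mult)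
    thus "c \<odot>\<^sub>?S x \<in> T \<inter> carrier ?S" using c x by (simp add: R_simps fun_space_def)
  qed simp
  moreover have "delta K w \<in> T \<inter> carrier ?S" if w: "w \<in> pths k" for w
  proof -
    obtain u v where "w = (u, [u..<v])" "u + k \<le> v" "v < n" using w by (auto simp: pths_def)
    thus ?thesis using d[of u v] delta_in_fun_space[OF K.is_cring w] by (simp add: dl_def)
  qed
  ultimately have ST: "carrier ?S \<subseteq> T \<inter> carrier ?S"
    by (rule fun_space_sub[OF K.is_cring finite_pths])
  show ?thesis
  proof
    fix x assume x: "x \<in> F k"
    hence xR: "x \<in> carrier R" by (simp add: F_def)
    have "x w = \<zero>" if w: "w \<notin> pths k" for w
    proof (cases "w \<in> pths 0")
      case True
      then obtain u v where uv: "w = (u, [u..<v])" "u \<le> v" "v < n" by (auto simp: pths_def)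
      have "v < u + k"
      proof (rule ccontr)
        assume "\<not> v < u + k"
        hence "w \<in> pths k" unfolding pths_def using uv by (intro CollectI exI[of _ u] exI[of _ v]) simp
        thus False using w by simp
      qed
      hence "xc x u v = \<zero>" using x by (simp add: F_def)
      thus ?thesis using uv by (simp add: xc_def)
    qed (simp add: R_D(2)[OF xR])
    hence "x \<in> carrier ?S" using xR by (simp add: R_carrier fun_space_def)
    thus "x \<in> T" using ST by blast
  qed
qed

lemma arrow_ideal_F: "arrow_ideal K (linear_quiver n) = F 1"
proof
  let ?S = "arrow_elem K (linear_quiver n) ` arcs (linear_quiver n)"
  have a: "arrow_elem K (linear_quiver n) i = dl i (Suc i)" if "Suc i < n" for i
    using that by (simp add: arrow_elem_def dl_def delta_def linear_quiver_simps)
  have aF: "?S \<subseteq> F 1"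
  proof
    fix x assume "x \<in> ?S"
    then obtain i where i: "Suc i < n" "x = dl i (Suc i)" using a by (auto simp: linear_quiver_simps)
    thus "x \<in> F 1" using dl_F[of i 1 "Suc i"] by simp
  qed
  thus "arrow_ideal K (linear_quiver n) \<subseteq> F 1"
    unfolding arrow_ideal_def by (rule R.genideal_minimal[OF F_ideal])
  have Sc: "?S \<subseteq> carrier R" using aF by (auto simp: F_def)
  interpret J: ideal "Idl\<^bsub>R\<^esub> ?S" R by (rule R.genideal_ideal[OF Sc])
  show "F 1 \<subseteq> arrow_ideal K (linear_quiver n)"
    unfolding arrow_ideal_def
  proof (rule F_subset_ideal[OF J.ideal_axioms])
    fix u v assume uv: "u + 1 \<le> v" "v < n"
    have "dl u (Suc u) \<in> ?S" using a[of u] uv by (intro image_eqI[of _ _ u]) (simp_all add: linear_quiver_simps)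
    hence "dl u (Suc u) \<in> Idl\<^bsub>R\<^esub> ?S" using R.genideal_self[OF Sc] by blast
    hence "dl u (Suc u) \<otimes>\<^sub>R dl (Suc u) v \<in> Idl\<^bsub>R\<^esub> ?S" by (rule J.I_r_closed) (use uv in \<open>simp add: dl_closed\<close>)
    thus "dl u v \<in> Idl\<^bsub>R\<^esub> ?S" using dl_mult[of u "Suc u" v] uv by simp
  qed
qed

text \<open>A path of length at least \<open>k + 1\<close> is a path of length at least \<open>k\<close> followed by an arrow.\<close>

lemma F_prod: "F k \<cdot>\<^sub>R F 1 = F (k + 1)"
proof
  interpret Fk: ideal "F (k + 1)" R by (rule F_ideal)
  show "F k \<cdot>\<^sub>R F 1 \<subseteq> F (k + 1)"
  proof
    fix x assume "x \<in> F k \<cdot>\<^sub>R F 1"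
    thus "x \<in> F (k + 1)"
      by (induction rule: ideal_prod.induct) (rule F_mult Fk.a_closed; assumption)+
  qed
  show "F (k + 1) \<subseteq> F k \<cdot>\<^sub>R F 1"
  proof (rule F_subset_ideal[OF R.ideal_prod_is_ideal[OF F_ideal F_ideal]])
    fix u v assume uv: "u + (k + 1) \<le> v" "v < n"
    have "dl u (v - 1) \<in> F k" by (rule dl_F) (use uv in auto)
    moreover have "dl (v - 1) v \<in> F 1" by (rule dl_F) (use uv in auto)
    ultimately have "dl u (v - 1) \<otimes>\<^sub>R dl (v - 1) v \<in> F k \<cdot>\<^sub>R F 1" by (rule ideal_prod.prod)
    thus "dl u v \<in> F k \<cdot>\<^sub>R F 1" using dl_mult[of u "v - 1" v] uv by simp
  qed
qed

subsection \<open>The quotient by paths of length three\<close>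

abbreviation "A \<equiv> A_alg K n"

lemma A_eq: "A = quot_algebra R (F 3)"
proof -
  have "F 1 \<cdot>\<^sub>R F 1 \<cdot>\<^sub>R F 1 = F 3" using F_prod[of 1] F_prod[of 2] by (simp add: numeral_eq_Suc)
  thus ?thesis by (simp add: A_alg_def Let_def arrow_ideal_F)
qed

sublocale I: ideal "F 3" R by (rule F_ideal)

abbreviation cs :: "(nat \<times> nat list => 'k) => (nat \<times> nat list => 'k) set" where
  "cs x \<equiv> F 3 +>\<^sub>R x"

lemma A_carrier: "carrier A = cs ` carrier R"
  unfolding A_eq by (auto simp: quot_algebra_def ring.defs FactRing_simps)

lemma cs_closed: "x \<in> carrier R ==> cs x \<in> carrier A"
  unfolding A_carrier by (rule imageI)

lemma cs_eq: "x \<in> carrier R ==> y \<in> carrier R ==> cs x = cs y \<longleftrightarrow> (\<forall>u v. v < u + 3 --> xc x u v = xc y u v)"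
proof -
  assume xy: "x \<in> carrier R" "y \<in> carrier R"
  have x': "xc x u v = xc (x \<ominus>\<^sub>R y) u v \<oplus> xc y u v" for u v
  proof -
    have "x = (x \<ominus>\<^sub>R y) \<oplus>\<^sub>R y" using xy by (simp add: a_minus_def R.a_assoc R.l_neg)
    thus ?thesis using xc_add[of "x \<ominus>\<^sub>R y" y u v] xy by simp
  qed
  have e0: "xc (x \<ominus>\<^sub>R y) u v = \<zero> \<longleftrightarrow> xc x u v = xc y u v" for u v
  proof
    let ?d = "xc (x \<ominus>\<^sub>R y) u v" and ?b = "xc y u v"
    have c: "?d \<in> carrier K" "?b \<in> carrier K" using xy by simp_all
    show "xc x u v = ?b" if "?d = \<zero>" using x'[of u v] c that by simp
    assume "xc x u v = ?b"
    hence e: "?d \<oplus> ?b = ?b" using x'[of u v] by simp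
    have "?d = (?d \<oplus> ?b) \<oplus> \<ominus> ?b" using c by (simp add: K.a_assoc K.r_neg)
    thus "?d = \<zero>" unfolding e using c by (simp add: K.r_neg)
  qed
  have "x \<ominus>\<^sub>R y \<in> F 3 \<longleftrightarrow> (\<forall>u v. v < u + 3 --> xc x u v = xc y u v)"
    unfolding F_def mem_Collect_eq e0 using xy by simp
  thus ?thesis using R.quotient_eq_iff_same_a_r_cos[OF F_ideal xy] by simp
qed

lemma A_ops:
  assumes "x \<in> carrier R"
  shows "y \<in> carrier R ==> cs x \<oplus>\<^sub>A cs y = cs (x \<oplus>\<^sub>R y)" "y \<in> carrier R ==> cs x \<otimes>\<^sub>A cs y = cs (x \<otimes>\<^sub>R y)"
    "k \<in> carrier K ==> k \<odot>\<^sub>A cs x = cs (k \<odot>\<^sub>R x)"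
proof -
  show "y \<in> carrier R ==> cs x \<oplus>\<^sub>A cs y = cs (x \<oplus>\<^sub>R y)"
    unfolding A_eq by (simp add: quot_algebra_def ring.defs FactRing_def I.a_rcos_sum assms)
  show "y \<in> carrier R ==> cs x \<otimes>\<^sub>A cs y = cs (x \<otimes>\<^sub>R y)"
    unfolding A_eq by (simp add: quot_algebra_def ring.defs FactRing_def I.rcoset_mult_add assms)
  assume k: "k \<in> carrier K"
  have e: "cs (k \<odot>\<^sub>R y) = cs (k \<odot>\<^sub>R x)" if y: "y \<in> cs x" for y
  proof -
    have yR: "y \<in> carrier R" using y I.a_rcosets_carrier[OF R.a_rcosetsI[OF I.a_subset assms]] by blast
    have "cs x = cs y" by (rule R.a_repr_independence[OF y assms I.a_subgroup])
    thus ?thesis using cs_eq[OF assms yR] cs_eq[of "k \<odot>\<^sub>R y" "k \<odot>\<^sub>R x"] k yR assms by (simp add: xc_smult)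
  qed
  have "k \<odot>\<^sub>A cs x = (\<Union>y\<in>cs x. cs (k \<odot>\<^sub>R y))"
    unfolding A_eq by (simp add: quot_algebra_def ring.defs module.defs)
  also have "\<dots> = cs (k \<odot>\<^sub>R x)" using e I.a_rcos_self[OF assms] by blast
  finally show "k \<odot>\<^sub>A cs x = cs (k \<odot>\<^sub>R x)" .
qed

lemma A_zero_one: "\<zero>\<^sub>A = cs \<zero>\<^sub>R" "\<one>\<^sub>A = cs \<one>\<^sub>R"
  unfolding A_eq using R.a_coset_add_zero[OF I.a_subset]
  by (simp_all add: quot_algebra_def ring.defs FactRing_def)

lemma A_rep: "X \<in> carrier A ==> (!!x. X = cs x ==> x \<in> carrier R ==> thesis) ==> thesis"
  unfolding A_carrier by (erule imageE)

lemma module_A: "Module.module K A"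
  by (rule module_intro[OF K.is_cring])
    ((elim A_rep)?, simp add: A_zero_one A_ops cs_closed RM.smult_l_distr RM.smult_r_distr RM.smult_assoc1 R.a_ac)+

lemma ring_A: "ring A"
proof -
  interpret A: Module.module K A by (rule module_A)
  show ?thesis
  proof (rule ringI)
    show "abelian_group A" by (rule A.abelian_group_axioms)
    show "Group.monoid A"
      by (rule monoidI) ((elim A_rep)?, simp add: A_zero_one A_ops cs_closed R.m_assoc)+
  qed (elim A_rep, simp add: A_ops R.l_distr R.r_distr)+
qed

lemma fd_algebra_A: "fd_algebra K A"
proof (rule fd_algebra.intro[OF fieldK ring_A module_A])
  show "finite_dim K A"
  proof (rule finite_dim_image[OF module_R module_A _ _ finite_dim_R])
    show "cs \<in> lin K R A" by (rule linI) (simp_all add: A_ops cs_closed)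
    show "cs ` carrier R = carrier A" by (rule A_carrier[symmetric])
  qed
qed (elim A_rep, simp add: A_ops R_smult_mult)+

text \<open>The coordinates of a coset are those of any representative at paths of length at most two.\<close>

definition co :: "(nat \<times> nat list => 'k) set => nat => nat => 'k" where
  "co X i j = (if pv n i j then xc (SOME x. x \<in> carrier R \<and> X = cs x) i j else \<zero>)"

lemma co_cs:
  assumes x: "x \<in> carrier R"
  shows "co (cs x) i j = (if pv n i j then xc x i j else \<zero>)"
proof -
  let ?y = "SOME y. y \<in> carrier R \<and> cs x = cs y"
  have "?y \<in> carrier R \<and> cs x = cs ?y" by (rule someI[of _ x]) (simp add: x)
  hence "\<forall>u v. v < u + 3 --> xc x u v = xc ?y u v" using cs_eq[OF x] by blast
  hence "xc ?y i j = xc x i j" if "pv n i j" using that by (simp add: pv_def)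
  thus ?thesis by (simp add: co_def)
qed

lemma nakayama_A: "nakayama K A n co"
proof (intro nakayama.intro fd_algebra_A nakayama_axioms.intro)
  show "bij_betw co (carrier A) (coords K n)"
  proof (rule bij_betw_imageI)
    show "inj_on co (carrier A)"
    proof (rule inj_onI, elim A_rep)
      fix X Y x y assume h: "co X = co Y" "X = cs x" "x \<in> carrier R" "Y = cs y" "y \<in> carrier R"
      have "xc x u v = xc y u v" if "v < u + 3" for u v
      proof (cases "pv n u v")
        case True
        thus ?thesis using fun_cong[OF fun_cong[OF h(1)], of u v] co_cs[OF h(3)] co_cs[OF h(5)] h(2,4) by simp
      next
        case False
        hence "\<not> (u \<le> v \<and> v < n)" using that by (auto simp: pv_def)
        thus ?thesis by (auto simp: xc_def)
      qed
      thus "X = Y" using cs_eq[OF h(3,5)] h(2,4) by simp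
    qed
    show "co ` carrier A = coords K n"
    proof
      show "co ` carrier A \<subseteq> coords K n"
      proof
        fix f assume "f \<in> co ` carrier A"
        then obtain x where "x \<in> carrier R" "f = co (cs x)" unfolding A_carrier by auto
        thus "f \<in> coords K n" by (simp add: coords_def co_cs)
      qed
      show "coords K n \<subseteq> co ` carrier A"
      proof
        fix f assume f: "f \<in> coords K n"
        define x where "x w = (if w \<in> pths 0 then f (fst w) (fst w + length (snd w)) else \<zero>)" for w
        have xR: "x \<in> carrier R" using f by (simp add: R_carrier x_def coords_def)
        have "xc x u v = f u v" if "pv n u v" for u v
          using that by (auto simp: xc_def x_def pths_def pv_def)
        hence "f = co (cs x)" using f by (intro ext) (simp add: co_cs[OF xR] coords_def)
        thus "f \<in> co ` carrier A" using cs_closed[OF xR] by (rule image_eqI)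
      qed
    qed
  qed
next
  fix X Y i j assume "X \<in> carrier A" "Y \<in> carrier A"
  then obtain x y where xy: "X = cs x" "x \<in> carrier R" "Y = cs y" "y \<in> carrier R" by (elim A_rep) blast
  show "co (X \<oplus>\<^sub>A Y) i j = co X i j \<oplus> co Y i j" using xy by (simp add: A_ops co_cs xc_add)
  assume ij: "pv n i j"
  have "(\<Oplus>l\<in>{..<n}. xc x i l \<otimes> xc y l j) = (\<Oplus>l\<in>{..<n}. co X i l \<otimes> co Y l j)"
  proof (rule K.finsum_cong')
    fix l
    show "xc x i l \<otimes> xc y l j = co X i l \<otimes> co Y l j"
    proof (cases "i \<le> l \<and> l \<le> j")
      case True
      hence "pv n i l" "pv n l j" using ij by (auto simp: pv_def)
      thus ?thesis using xy by (simp add: co_cs)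
    next
      case False
      hence "xc x i l = \<zero> \<or> xc y l j = \<zero>" "co X i l = \<zero> \<or> co Y l j = \<zero>"
        using xy by (auto simp: xc_def co_cs pv_def)
      thus ?thesis using xy by (auto simp: co_cs)
    qed
  qed (use xy in \<open>auto simp: co_cs\<close>)
  thus "co (X \<otimes>\<^sub>A Y) i j = (\<Oplus>l\<in>{..<n}. co X i l \<otimes> co Y l j)"
    using xy ij by (simp add: A_ops co_cs xc_mult)
next
  fix k X i j assume k: "k \<in> carrier K" and "X \<in> carrier A"
  then obtain x where "X = cs x" "x \<in> carrier R" by (elim A_rep) blast
  thus "co (k \<odot>\<^sub>A X) i j = k \<otimes> co X i j" using k by (simp add: A_ops co_cs xc_smult)
next
  fix i j show "co \<one>\<^sub>A i j = (if i = j \<and> i < n then \<one> else \<zero>)"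
    by (auto simp: A_zero_one(2) co_cs R_one pv_def)
qed

end

section \<open>The algebras \<open>B_n\<close>\<close>

theorem proposition2p6:
  fixes K :: "('k, 'c) ring_scheme" and m :: nat
  assumes "field K" and "m \<ge> 1"
  shows "domdim K (B_alg K (3 * m + 1)) = 0 \<and>
         domdim K (B_alg K (3 * m + 2)) = 1 \<and>
         (\<forall>n \<in> {3 * m + 1, 3 * m + 2}.
            1 \<le> domdim K (A_alg K n) \<and> domdim K (A_alg K n) \<noteq> \<infinity> \<and>
            \<not> property_star K (A_alg K n))"
proof -
  define n1 where "n1 = 3 * m + 1"
  define n2 where "n2 = 3 * m + 2"
  interpret L1: linear_path_algebra K n1 by (rule linear_path_algebra.intro[OF assms(1)])
  interpret L2: linear_path_algebra K n2 by (rule linear_path_algebra.intro[OF assms(1)])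
  interpret A1: nakayama K "A_alg K n1" n1 L1.co by (rule L1.nakayama_A)
  interpret A2: nakayama K "A_alg K n2" n2 L2.co by (rule L2.nakayama_A)
  have n: "3 \<le> n1" "3 \<le> n2" "1 \<le> 2 * m - 1" "1 \<le> 2 * m" using assms(2) by (simp_all add: n1_def n2_def)
  have d1: "domdim K (A_alg K n1) = enat (2 * m - 1)" by (rule A1.domdim_1[OF n1_def assms(2)])
  have d2: "domdim K (A_alg K n2) = enat (2 * m)" by (rule A2.domdim_2[OF n2_def assms(2)])
  note C1 = A1.cosyzygy_iso[OF n(3)] and C2 = A2.cosyzygy_iso[OF n(4)]
  have E1: "domdim K (End_alg (A_alg K n1) (rmod_sum P (cosyzygy K (A_alg K n1) (2 * m - 1) (regular_rmod (A_alg K n1))))) = 0"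
    if "fd_rmodule K (A_alg K n1) P" "faithful (A_alg K n1) P" "torsionless (A_alg K n1) P"
    for P :: "('k, (nat \<times> nat list => 'k) set, 'p) rmodule"
    using A1.domdim_End_1[OF n1_def assms(2) that C1(1)] C1(2) by blast
  have E2: "domdim K (End_alg (A_alg K n2) (rmod_sum P (cosyzygy K (A_alg K n2) (2 * m) (regular_rmod (A_alg K n2))))) \<le> 1"
    "inj_rmod K (A_alg K n2) P ==>
     domdim K (End_alg (A_alg K n2) (rmod_sum P (cosyzygy K (A_alg K n2) (2 * m) (regular_rmod (A_alg K n2))))) = 1"
    if "fd_rmodule K (A_alg K n2) P" "faithful (A_alg K n2) P" "torsionless (A_alg K n2) P"
    for P :: "('k, (nat \<times> nat list => 'k) set, 'p) rmodule"
    using A2.domdim_End_2_le[OF n2_def assms(2) that C2(1)] A2.domdim_End_2[OF n2_def assms(2) that C2(1)] C2(2) by blast+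
  have B1: "domdim K (B_alg K n1) = 0"
    unfolding B_alg_def Let_def d1 the_enat.simps by (rule E1) (rule A1.minimal_idem[OF n(1)])+
  have B2: "domdim K (B_alg K n2) = 1"
    unfolding B_alg_def Let_def d2 the_enat.simps by (rule E2) (rule A2.minimal_idem[OF n(2)])+
  have S1: "\<not> property_star K (A_alg K n1)"
    unfolding property_star_def d1
    using E1[OF A1.hull_regular[OF n(1)]] by (auto simp: zero_enat_def)
  have S2: "\<not> property_star K (A_alg K n2)"
    unfolding property_star_def d2
    using E2(1)[OF A2.hull_regular[OF n(2)]] n(4) by (auto simp: one_enat_def)
  show ?thesis unfolding n1_def[symmetric] n2_def[symmetric]
    using B1 B2 S1 S2 d1 d2 n by (auto simp: one_enat_def)
qed

end
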